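(* Let $H$ be a finite-dimensional pointed Hopf algebra over a field $k$ such that $H_{\mathrm{ab}}=k[\bar G]$ is a group algebra, with $\bar G=G(H_{\mathrm{ab}})$. Let $n=\dim H$ and $\ell=\mathrm{card}\,G(H)$. Define integers $d,r$ as follows: if $\bar G$ is trivial, $d=r=0$; otherwise write the primary decomposition $\bar G\cong \mathbb{Z}/p_1^{e_1}\times\cdots\times\mathbb{Z}/p_r^{e_r}$ ($r\ge1$, $p_i$ primes, $e_i\ge1$) and set $d=p_1^{e_1}+\cdots+p_r^{e_r}$. Then there exist elements $u_1,\dots,u_n\in S(t_H)$ such that each of $u_1,\dots,u_\ell$ is a monomial of degree $\le d-r+1$ in the variables $t_g$ ($g\in G(H)$), each of $u_{\ell+1},\dots,u_n$ is a product of at most two elements of the form $t_x$ ($x\in H$), $u_1,\dots,u_\ell$ are invertible in $\mathrm{Frac}\,S(t_H)$, and $$\mathcal{B}_H=k[u_1^{\pm1},\dots,u_\ell^{\pm1},u_{\ell+1},\dots,u_n],$$ the subalgebra of $\mathrm{Frac}\,S(t_H)$ generated by $u_1^{\pm1},\dots,u_\ell^{\pm1},u_{\ell+1},\dots,u_n$.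
   Context: A Hopf algebra is pointed if every simple subcoalgebra is one-dimensional; $G(\cdot)$ denotes group-like elements; $H_{\mathrm{ab}}$ is the largest commutative Hopf algebra quotient of $H$. Sweedler notation $\Delta(x)=x_1\otimes x_2$. Let $t_H=\{t_x: x\in H\}$ be a copy of the vector space $H$ ($x\mapsto t_x$ linear isomorphism), $S(t_H)$ its symmetric algebra, and $x\mapsto t^{-1}_x$ the unique linear map from $H$ to $\mathrm{Frac}\,S(t_H)$ with $t_{x_1}t^{-1}_{x_2}=t^{-1}_{x_1}t_{x_2}=\varepsilon(x)1$. The generic base algebra $\mathcal{B}_H$ is the subalgebra of $\mathrm{Frac}\,S(t_H)$ generated by all $\sigma(x,y)=t_{x_1}t_{y_1}t^{-1}_{x_2y_2}$ and $\sigma^{-1}(x,y)=t_{x_1y_1}t^{-1}_{x_2}t^{-1}_{y_2}$, $x,y\in H$. *)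

theory Defs
  imports "HOL-Library.Poly_Mapping" "HOL-Computational_Algebra.Fraction_Field"
    "HOL-Computational_Algebra.Primes"
    "HOL-Algebra.Elementary_Groups" "HOL-Algebra.Product_Groups"
begin

text \<open>A finite-dimensional Hopf algebra H over a field k of dimension n is given by
  structure constants with respect to a basis e_0, ..., e_(n-1).  Elements of H are
  coordinate functions nat => k vanishing at indices >= n; elements of H (x) H are
  functions nat => nat => k vanishing outside {..<n} x {..<n}.\<close>

record 'k hopf_data =
  hdim :: nat
  hm :: "nat \<Rightarrow> nat \<Rightarrow> nat \<Rightarrow> 'k"   \<comment> \<open>e_i e_j = sum_l hm i j l e_l\<close>
  hu :: "nat \<Rightarrow> 'k"                  \<comment> \<open>1 = sum_l hu l e_l\<close>
  hc :: "nat \<Rightarrow> nat \<Rightarrow> nat \<Rightarrow> 'k"   \<comment> \<open>Delta e_i = sum_(a,b) hc i a b e_a (x) e_b\<close>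
  he :: "nat \<Rightarrow> 'k"                  \<comment> \<open>epsilon e_i\<close>
  hs :: "nat \<Rightarrow> nat \<Rightarrow> 'k"           \<comment> \<open>S e_a = sum_l hs a l e_l\<close>

definition vecs :: "nat \<Rightarrow> (nat \<Rightarrow> 'k::field) set" where
  "vecs n = {x. \<forall>i\<ge>n. x i = 0}"

definition tens :: "nat \<Rightarrow> (nat \<Rightarrow> nat \<Rightarrow> 'k::field) set" where
  "tens n = {t. \<forall>i j. (n \<le> i \<or> n \<le> j) \<longrightarrow> t i j = 0}"

definition bas :: "nat \<Rightarrow> nat \<Rightarrow> 'k::field" where
  "bas i = (\<lambda>j. if j = i then 1 else 0)"

definition tensor :: "(nat \<Rightarrow> 'k::field) \<Rightarrow> (nat \<Rightarrow> 'k) \<Rightarrow> nat \<Rightarrow> nat \<Rightarrow> 'k" where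
  "tensor x y = (\<lambda>a b. x a * y b)"

definition mulv :: "'k::field hopf_data \<Rightarrow> (nat \<Rightarrow> 'k) \<Rightarrow> (nat \<Rightarrow> 'k) \<Rightarrow> nat \<Rightarrow> 'k" where
  "mulv H x y = (\<lambda>l. \<Sum>i<hdim H. \<Sum>j<hdim H. x i * y j * hm H i j l)"

definition unitv :: "'k::field hopf_data \<Rightarrow> nat \<Rightarrow> 'k" where
  "unitv H = hu H"

definition comulv :: "'k::field hopf_data \<Rightarrow> (nat \<Rightarrow> 'k) \<Rightarrow> nat \<Rightarrow> nat \<Rightarrow> 'k" where
  "comulv H x = (\<lambda>a b. \<Sum>i<hdim H. x i * hc H i a b)"

definition counitv :: "'k::field hopf_data \<Rightarrow> (nat \<Rightarrow> 'k) \<Rightarrow> 'k" where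
  "counitv H x = (\<Sum>i<hdim H. x i * he H i)"

definition antipv :: "'k::field hopf_data \<Rightarrow> (nat \<Rightarrow> 'k) \<Rightarrow> nat \<Rightarrow> 'k" where
  "antipv H x = (\<lambda>l. \<Sum>a<hdim H. x a * hs H a l)"

definition hopf_algebra :: "'k::field hopf_data \<Rightarrow> bool" where
  "hopf_algebra H \<longleftrightarrow> (let n = hdim H; V = vecs n in
     \<comment> \<open>the structure maps take values in H, resp. H (x) H\<close>
     (\<forall>x\<in>V. \<forall>y\<in>V. mulv H x y \<in> V) \<and> unitv H \<in> V \<and>
     (\<forall>x\<in>V. comulv H x \<in> tens n) \<and> (\<forall>x\<in>V. antipv H x \<in> V) \<and>
     \<comment> \<open>associative unital algebra\<close>
     (\<forall>x\<in>V. \<forall>y\<in>V. \<forall>z\<in>V. mulv H (mulv H x y) z = mulv H x (mulv H y z)) \<and>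
     (\<forall>x\<in>V. mulv H (unitv H) x = x \<and> mulv H x (unitv H) = x) \<and>
     \<comment> \<open>coassociative counital coalgebra\<close>
     (\<forall>x\<in>V. \<forall>a b c. (\<Sum>l<n. comulv H x l c * comulv H (bas l) a b)
                    = (\<Sum>l<n. comulv H x a l * comulv H (bas l) b c)) \<and>
     (\<forall>x\<in>V. \<forall>b. (\<Sum>a<n. counitv H (bas a) * comulv H x a b) = x b) \<and>
     (\<forall>x\<in>V. \<forall>a. (\<Sum>b<n. comulv H x a b * counitv H (bas b)) = x a) \<and>
     \<comment> \<open>Delta and epsilon are algebra maps\<close>
     (\<forall>x\<in>V. \<forall>y\<in>V. \<forall>a b. comulv H (mulv H x y) a b =
        (\<Sum>a1<n. \<Sum>b1<n. \<Sum>a2<n. \<Sum>b2<n. comulv H x a1 b1 * comulv H y a2 b2 *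
            mulv H (bas a1) (bas a2) a * mulv H (bas b1) (bas b2) b)) \<and>
     comulv H (unitv H) = tensor (unitv H) (unitv H) \<and>
     (\<forall>x\<in>V. \<forall>y\<in>V. counitv H (mulv H x y) = counitv H x * counitv H y) \<and>
     counitv H (unitv H) = 1 \<and>
     \<comment> \<open>antipode\<close>
     (\<forall>x\<in>V. \<forall>p. (\<Sum>a<n. \<Sum>b<n. comulv H x a b * mulv H (antipv H (bas a)) (bas b) p)
                  = counitv H x * unitv H p) \<and>
     (\<forall>x\<in>V. \<forall>p. (\<Sum>a<n. \<Sum>b<n. comulv H x a b * mulv H (bas a) (antipv H (bas b)) p)
                  = counitv H x * unitv H p))"

definition subspace_of :: "nat \<Rightarrow> (nat \<Rightarrow> 'k::field) set \<Rightarrow> bool" where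
  "subspace_of n C \<longleftrightarrow> C \<subseteq> vecs n \<and> (\<lambda>_. 0) \<in> C \<and>
     (\<forall>x\<in>C. \<forall>y\<in>C. (\<lambda>i. x i + y i) \<in> C) \<and> (\<forall>c. \<forall>x\<in>C. (\<lambda>i. c * x i) \<in> C)"

definition lspan :: "(nat \<Rightarrow> 'k::field) set \<Rightarrow> (nat \<Rightarrow> 'k) set" where
  "lspan A = {(\<lambda>i. \<Sum>(c, v)\<leftarrow>ps. c * v i) | ps. \<forall>(c, v)\<in>set ps. v \<in> A}"

definition tspan :: "(nat \<Rightarrow> 'k::field) set \<Rightarrow> (nat \<Rightarrow> 'k) set \<Rightarrow> (nat \<Rightarrow> nat \<Rightarrow> 'k) set" where
  "tspan A B = {(\<lambda>i j. \<Sum>(a, b)\<leftarrow>ps. a i * b j) | ps. \<forall>(a, b)\<in>set ps. a \<in> A \<and> b \<in> B}"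

definition grouplikes :: "'k::field hopf_data \<Rightarrow> (nat \<Rightarrow> 'k) set" where
  "grouplikes H = {g \<in> vecs (hdim H). g \<noteq> (\<lambda>_. 0) \<and> comulv H g = tensor g g}"

definition subcoalgebra :: "'k::field hopf_data \<Rightarrow> (nat \<Rightarrow> 'k) set \<Rightarrow> bool" where
  "subcoalgebra H C \<longleftrightarrow> subspace_of (hdim H) C \<and> (\<forall>x\<in>C. comulv H x \<in> tspan C C)"

definition simple_subcoalgebra :: "'k::field hopf_data \<Rightarrow> (nat \<Rightarrow> 'k) set \<Rightarrow> bool" where
  "simple_subcoalgebra H C \<longleftrightarrow> subcoalgebra H C \<and> C \<noteq> {(\<lambda>_. 0)} \<and>
     (\<forall>D. subcoalgebra H D \<and> D \<subseteq> C \<longrightarrow> D = {(\<lambda>_. 0)} \<or> D = C)"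

definition pointed :: "'k::field hopf_data \<Rightarrow> bool" where
  "pointed H \<longleftrightarrow> (\<forall>C. simple_subcoalgebra H C \<longrightarrow>
      (\<exists>v. v \<noteq> (\<lambda>_. 0) \<and> C = {(\<lambda>i. c * v i) | c. True}))"

definition hopf_ideal :: "'k::field hopf_data \<Rightarrow> (nat \<Rightarrow> 'k) set \<Rightarrow> bool" where
  "hopf_ideal H I \<longleftrightarrow> subspace_of (hdim H) I \<and>
     (\<forall>x\<in>vecs (hdim H). \<forall>y\<in>I. mulv H x y \<in> I \<and> mulv H y x \<in> I) \<and>
     (\<forall>x\<in>I. comulv H x \<in> {(\<lambda>i j. s i j + t i j) | s t. s \<in> tspan I (vecs (hdim H)) \<and> t \<in> tspan (vecs (hdim H)) I}) \<and>
     (\<forall>x\<in>I. counitv H x = 0) \<and> (\<forall>x\<in>I. antipv H x \<in> I)"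

definition comm_quotient :: "'k::field hopf_data \<Rightarrow> (nat \<Rightarrow> 'k) set \<Rightarrow> bool" where
  "comm_quotient H I \<longleftrightarrow> (\<forall>x\<in>vecs (hdim H). \<forall>y\<in>vecs (hdim H). (\<lambda>i. mulv H x y i - mulv H y x i) \<in> I)"

text \<open>The kernel of H -> H_ab: the smallest Hopf ideal with commutative quotient
  (so that H/J is the largest commutative Hopf algebra quotient).\<close>
definition ab_ideal :: "'k::field hopf_data \<Rightarrow> (nat \<Rightarrow> 'k) set" where
  "ab_ideal H = (THE J. hopf_ideal H J \<and> comm_quotient H J \<and>
       (\<forall>I. hopf_ideal H I \<and> comm_quotient H I \<longrightarrow> J \<subseteq> I))"

definition grouplike_mod :: "'k::field hopf_data \<Rightarrow> (nat \<Rightarrow> 'k) set \<Rightarrow> (nat \<Rightarrow> 'k) \<Rightarrow> bool" where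
  "grouplike_mod H J x \<longleftrightarrow> x \<in> vecs (hdim H) \<and> x \<notin> J \<and>
     (\<lambda>i j. comulv H x i j - tensor x x i j) \<in> {(\<lambda>i j. s i j + t i j) | s t. s \<in> tspan J (vecs (hdim H)) \<and> t \<in> tspan (vecs (hdim H)) J}"

definition cls :: "'k::field hopf_data \<Rightarrow> (nat \<Rightarrow> 'k) set \<Rightarrow> (nat \<Rightarrow> 'k) \<Rightarrow> (nat \<Rightarrow> 'k) set" where
  "cls H J x = {y \<in> vecs (hdim H). (\<lambda>i. x i - y i) \<in> J}"

text \<open>H_ab = k[Gbar] is a group algebra: H_ab is spanned by its group-likes.\<close>
definition ab_is_group_algebra :: "'k::field hopf_data \<Rightarrow> bool" where
  "ab_is_group_algebra H \<longleftrightarrow> (\<forall>h\<in>vecs (hdim H).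
     \<exists>v\<in>lspan {x. grouplike_mod H (ab_ideal H) x}. (\<lambda>i. h i - v i) \<in> ab_ideal H)"

definition Gbar :: "'k::field hopf_data \<Rightarrow> (nat \<Rightarrow> 'k) set monoid" where
  "Gbar H = \<lparr>carrier = cls H (ab_ideal H) ` {x. grouplike_mod H (ab_ideal H) x},
     monoid.mult = (\<lambda>A B. cls H (ab_ideal H) (mulv H (SOME x. x \<in> A) (SOME y. y \<in> B))),
     one = cls H (ab_ideal H) (unitv H)\<rparr>"

type_synonym 'k mpoly = "(nat \<Rightarrow>\<^sub>0 nat) \<Rightarrow>\<^sub>0 'k"

text \<open>t_x = sum_i x_i T_i, where T_i = t_(e_i) are the polynomial variables.\<close>
definition tvar :: "'k::field hopf_data \<Rightarrow> (nat \<Rightarrow> 'k) \<Rightarrow> 'k mpoly" where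
  "tvar H x = (\<Sum>i<hdim H. Poly_Mapping.single (Poly_Mapping.single i 1) (x i))"

definition emb :: "'k::field mpoly \<Rightarrow> 'k mpoly fract" where
  "emb p = Fraction_Field.Fract p 1"

definition kc :: "'k::field \<Rightarrow> 'k mpoly fract" where
  "kc c = Fraction_Field.Fract (Poly_Mapping.single 0 c) 1"

text \<open>Linear maps H -> Frac S(t_H) given by their values w on the basis.\<close>
definition linv :: "'k::field hopf_data \<Rightarrow> (nat \<Rightarrow> 'k mpoly fract) \<Rightarrow> (nat \<Rightarrow> 'k) \<Rightarrow> 'k mpoly fract" where
  "linv H w x = (\<Sum>l<hdim H. kc (x l) * w l)"

definition is_tinv :: "'k::field hopf_data \<Rightarrow> (nat \<Rightarrow> 'k mpoly fract) \<Rightarrow> bool" where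
  "is_tinv H w \<longleftrightarrow> (\<forall>i\<ge>hdim H. w i = 0) \<and>
     (\<forall>x\<in>vecs (hdim H).
        (\<Sum>a<hdim H. \<Sum>b<hdim H. kc (comulv H x a b) * emb (tvar H (bas a)) * linv H w (bas b))
          = kc (counitv H x) \<and>
        (\<Sum>a<hdim H. \<Sum>b<hdim H. kc (comulv H x a b) * linv H w (bas a) * emb (tvar H (bas b)))
          = kc (counitv H x))"

definition tinv :: "'k::field hopf_data \<Rightarrow> (nat \<Rightarrow> 'k) \<Rightarrow> 'k mpoly fract" where
  "tinv H = linv H (THE w. is_tinv H w)"

definition sigma :: "'k::field hopf_data \<Rightarrow> (nat \<Rightarrow> 'k) \<Rightarrow> (nat \<Rightarrow> 'k) \<Rightarrow> 'k mpoly fract" where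
  "sigma H x y = (\<Sum>a<hdim H. \<Sum>b<hdim H. \<Sum>a'<hdim H. \<Sum>b'<hdim H.
      kc (comulv H x a b * comulv H y a' b') * emb (tvar H (bas a) * tvar H (bas a'))
        * tinv H (mulv H (bas b) (bas b')))"

definition sigma_inv :: "'k::field hopf_data \<Rightarrow> (nat \<Rightarrow> 'k) \<Rightarrow> (nat \<Rightarrow> 'k) \<Rightarrow> 'k mpoly fract" where
  "sigma_inv H x y = (\<Sum>a<hdim H. \<Sum>b<hdim H. \<Sum>a'<hdim H. \<Sum>b'<hdim H.
      kc (comulv H x a b * comulv H y a' b') * emb (tvar H (mulv H (bas a) (bas a')))
        * tinv H (bas b) * tinv H (bas b'))"

inductive_set alg_gen :: "'k::field mpoly fract set \<Rightarrow> 'k mpoly fract set"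
  for S :: "'k mpoly fract set" where
  scal: "kc c \<in> alg_gen S"
| gen: "s \<in> S \<Longrightarrow> s \<in> alg_gen S"
| add: "a \<in> alg_gen S \<Longrightarrow> b \<in> alg_gen S \<Longrightarrow> a + b \<in> alg_gen S"
| mult: "a \<in> alg_gen S \<Longrightarrow> b \<in> alg_gen S \<Longrightarrow> a * b \<in> alg_gen S"

definition base_alg :: "'k::field hopf_data \<Rightarrow> 'k mpoly fract set" where
  "base_alg H = alg_gen ({sigma H x y | x y. x \<in> vecs (hdim H) \<and> y \<in> vecs (hdim H)}
                       \<union> {sigma_inv H x y | x y. x \<in> vecs (hdim H) \<and> y \<in> vecs (hdim H)})"

definition grouplike_monomial :: "'k::field hopf_data \<Rightarrow> nat \<Rightarrow> 'k mpoly \<Rightarrow> bool" where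
  "grouplike_monomial H D u \<longleftrightarrow> (\<exists>f :: (nat \<Rightarrow> 'k) \<Rightarrow> nat.
     (\<Sum>g\<in>grouplikes H. f g) \<le> D \<and> u = (\<Prod>g\<in>grouplikes H. tvar H g ^ f g))"

definition prod_le_two :: "'k::field hopf_data \<Rightarrow> 'k mpoly \<Rightarrow> bool" where
  "prod_le_two H u \<longleftrightarrow> (\<exists>xs. length xs \<le> 2 \<and> set xs \<subseteq> vecs (hdim H) \<and>
     u = prod_list (map (tvar H) xs))"

end

theory Submission
  imports Defs "HOL.Vector_Spaces" "HOL-Library.Function_Algebras" "HOL-Algebra.FiniteProduct"
begin

text \<open>
  Projecting the second tensor factor of the comultiplication to the group algebra of \<open>\<Gamma> = Gbar H\<close>
  grades H, hence \<open>S(t\<^sub>H)\<close> and its homogeneous fractions, by \<open>\<Gamma>\<close>. Since H is pointed, \<open>t\<^sup>-\<^sup>1\<close> only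
  involves inverses of the \<open>t\<^sub>g\<close>, so that \<open>\<sigma>\<close> and its convolution inverse are homogeneous of degree one.

  Conversely \<open>t\<^sub>x\<close> lies in the base algebra B for every x of degree one. The cocycle relations
  show that the B-module A spanned by the variables is a finite B-algebra containing all \<open>t\<^sup>-\<^sup>1\<^sub>x\<close>, and that
  \<open>x \<mapsto> t\<^sup>-\<^sup>1\<^sub>x\<^sub>1 \<otimes> t\<^sub>x\<^sub>2\<close> is an algebra map from H to \<open>A \<otimes>\<^sub>B A\<close>. It therefore kills the commutator ideal, whence
  \<open>1 \<otimes> t\<^sub>x = t\<^sub>x \<otimes> 1\<close> for x of degree one. The B-algebra generated by the degree-one part of A is thus an
  epimorphic finite extension of B, and it equals B by Nakayama's lemma.

  Choose a homogeneous basis of H extending the group-likes and lifts \<open>g\<^sub>j\<close> of the standard generators of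
  \<open>\<Gamma>\<close>. Multiplying each basis variable by a monomial (or a single group-like variable) of inverse degree,
  and replacing \<open>t\<close> at \<open>g\<^sub>j\<close> by its \<open>q\<^sub>j\<close>-th power, one obtains elements of degree one that generate all
  elements of degree one.
\<close>

text \<open>The base algebra is given only by generators, so it has to be caught from both sides.
  From above, one containment result serves twice: a family of subsets indexed by the degree group
  which is closed under sums and products and contains the scalars, the variables and the inverses
  of the \<open>t_g\<close> in the right degrees has the base algebra in its neutral component.
  Homogeneous fractions form such a family, and so do the monomial multiples of the algebra
  generated by the proposed \<open>u_i\<close>. From below, no tensor product over the base algebra
  is formed: its elements are tested by maps on A that are additive and linear only modulo an ideal
  I, and equations become congruences modulo IA. The generators of the degree-one part are removed
  one at a time, I being the annihilator of the last one modulo the others. Pointedness enters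
  through an induction that enlarges a left coideal X by one vector v with \<Delta>(v) in g
  \<otimes> v + H \<otimes> X. In the degree bound, d - r is the largest total of reduced exponents,
  the sum of all q_j - 1, and the extra 1 counts the variable being compensated.\<close>

section \<open>Coalgebras given by structure constants, and convolution\<close>

locale coalg =
  fixes I :: "'i set" and d :: "'i \<Rightarrow> 'i \<Rightarrow> 'i \<Rightarrow> 'k::field" and e :: "'i \<Rightarrow> 'k"
  assumes fin: "finite I"
    and coassoc: "\<lbrakk>i \<in> I; a \<in> I; b \<in> I; c \<in> I\<rbrakk>
      \<Longrightarrow> (\<Sum>l\<in>I. d i l c * d l a b) = (\<Sum>l\<in>I. d i a l * d l b c)"
    and counit_l: "\<lbrakk>i \<in> I; b \<in> I\<rbrakk> \<Longrightarrow> (\<Sum>a\<in>I. e a * d i a b) = (if b = i then 1 else 0)"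
    and counit_r: "\<lbrakk>i \<in> I; a \<in> I\<rbrakk> \<Longrightarrow> (\<Sum>b\<in>I. d i a b * e b) = (if a = i then 1 else 0)"

text \<open>No unit is part of the structure: \<open>mulv H\<close> is used on all functions on
  \<open>nat\<close>, where \<open>unitv H\<close> is an identity only on
  \<open>vecs (hdim H)\<close>. The convolution lemmas therefore ask separately that
  \<open>u\<close> acts trivially on the values concerned.\<close>

locale kalgebra = vector_space sc for sc :: "'k::field \<Rightarrow> 'r::ab_group_add \<Rightarrow> 'r" +
  fixes m :: "'r \<Rightarrow> 'r \<Rightarrow> 'r"
  assumes m_add_l: "m (x + y) z = m x z + m y z"
    and m_add_r: "m z (x + y) = m z x + m z y"
    and m_sc_l: "m (sc c x) y = sc c (m x y)"
    and m_sc_r: "m x (sc c y) = sc c (m x y)"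
    and m_assoc: "m (m x y) z = m x (m y z)"
begin

lemma m_zero_l [simp]: "m 0 z = 0"
  using m_add_l[of 0 0 z] by simp

lemma m_zero_r [simp]: "m z 0 = 0"
  using m_add_r[of z 0 0] by simp

lemma m_sum_l: "m (\<Sum>i\<in>A. f i) z = (\<Sum>i\<in>A. m (f i) z)"
  by (induction A rule: infinite_finite_induct) (auto simp: m_add_l)

lemma m_sum_r: "m z (\<Sum>i\<in>A. f i) = (\<Sum>i\<in>A. m z (f i))"
  by (induction A rule: infinite_finite_induct) (auto simp: m_add_r)

end

locale coalg_alg = coalg I d e + kalgebra sc m
  for I :: "'i set" and d and e :: "'i \<Rightarrow> 'k::field" and sc :: "'k \<Rightarrow> 'r::ab_group_add \<Rightarrow> 'r" and m
begin

definition conv :: "('i \<Rightarrow> 'r) \<Rightarrow> ('i \<Rightarrow> 'r) \<Rightarrow> 'i \<Rightarrow> 'r" where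
  "conv f g i = (\<Sum>a\<in>I. \<Sum>b\<in>I. sc (d i a b) (m (f a) (g b)))"

lemma conv_cong:
  "(\<And>a. a \<in> I \<Longrightarrow> f a = f' a) \<Longrightarrow> (\<And>a. a \<in> I \<Longrightarrow> g a = g' a) \<Longrightarrow> conv f g i = conv f' g' i"
  unfolding conv_def by (intro sum.cong refl) auto

lemma conv_assoc:
  assumes i: "i \<in> I"
  shows "conv (conv f g) h i = conv f (conv g h) i"
proof -
  have "conv (conv f g) h i
      = (\<Sum>l\<in>I. \<Sum>c\<in>I. \<Sum>a\<in>I. \<Sum>b\<in>I. sc (d i l c * d l a b) (m (f a) (m (g b) (h c))))"
    unfolding conv_def by (simp add: m_sum_l m_sc_l scale_sum_right m_assoc)
  also have "\<dots> = (\<Sum>c\<in>I. \<Sum>l\<in>I. \<Sum>a\<in>I. \<Sum>b\<in>I. sc (d i l c * d l a b) (m (f a) (m (g b) (h c))))"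
    by (rule sum.swap)
  also have "\<dots> = (\<Sum>c\<in>I. \<Sum>a\<in>I. \<Sum>b\<in>I. \<Sum>l\<in>I. sc (d i l c * d l a b) (m (f a) (m (g b) (h c))))"
    by (rule sum.cong[OF refl], subst sum.swap, rule sum.cong[OF refl], subst sum.swap, rule refl)
  also have "\<dots> = (\<Sum>c\<in>I. \<Sum>a\<in>I. \<Sum>b\<in>I. sc (\<Sum>l\<in>I. d i l c * d l a b) (m (f a) (m (g b) (h c))))"
    by (simp add: scale_sum_left)
  also have "\<dots> = (\<Sum>c\<in>I. \<Sum>a\<in>I. \<Sum>b\<in>I. sc (\<Sum>l\<in>I. d i a l * d l b c) (m (f a) (m (g b) (h c))))"
    by (intro sum.cong refl) (simp add: coassoc i)
  also have "\<dots> = (\<Sum>c\<in>I. \<Sum>a\<in>I. \<Sum>b\<in>I. \<Sum>l\<in>I. sc (d i a l * d l b c) (m (f a) (m (g b) (h c))))"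
    by (simp add: scale_sum_left)
  also have "\<dots> = (\<Sum>a\<in>I. \<Sum>c\<in>I. \<Sum>b\<in>I. \<Sum>l\<in>I. sc (d i a l * d l b c) (m (f a) (m (g b) (h c))))"
    by (rule sum.swap)
  also have "\<dots> = (\<Sum>a\<in>I. \<Sum>c\<in>I. \<Sum>l\<in>I. \<Sum>b\<in>I. sc (d i a l * d l b c) (m (f a) (m (g b) (h c))))"
    by (rule sum.cong[OF refl], rule sum.cong[OF refl], rule sum.swap)
  also have "\<dots> = (\<Sum>a\<in>I. \<Sum>l\<in>I. \<Sum>c\<in>I. \<Sum>b\<in>I. sc (d i a l * d l b c) (m (f a) (m (g b) (h c))))"
    by (rule sum.cong[OF refl], rule sum.swap)
  also have "\<dots> = (\<Sum>a\<in>I. \<Sum>l\<in>I. \<Sum>b\<in>I. \<Sum>c\<in>I. sc (d i a l * d l b c) (m (f a) (m (g b) (h c))))"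
    by (rule sum.cong[OF refl], rule sum.cong[OF refl], rule sum.swap)
  also have "\<dots> = conv f (conv g h) i"
    unfolding conv_def by (simp add: m_sum_r m_sc_r scale_sum_right)
  finally show ?thesis .
qed

lemma conv_unit_l:
  assumes i: "i \<in> I" and u: "\<And>a. a \<in> I \<Longrightarrow> m u (f a) = f a"
  shows "conv (\<lambda>a. sc (e a) u) f i = f i"
proof -
  have "conv (\<lambda>a. sc (e a) u) f i = (\<Sum>a\<in>I. \<Sum>b\<in>I. sc (e a * d i a b) (f b))"
    unfolding conv_def by (intro sum.cong refl) (simp add: m_sc_l u mult.commute)
  also have "\<dots> = (\<Sum>b\<in>I. sc (\<Sum>a\<in>I. e a * d i a b) (f b))"
    by (subst sum.swap) (simp add: scale_sum_left)
  also have "\<dots> = (\<Sum>b\<in>I. if b = i then f b else 0)"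
    by (intro sum.cong refl) (simp add: counit_l i)
  finally show ?thesis using i fin by simp
qed

lemma conv_unit_r:
  assumes i: "i \<in> I" and u: "\<And>a. a \<in> I \<Longrightarrow> m (f a) u = f a"
  shows "conv f (\<lambda>a. sc (e a) u) i = f i"
proof -
  have "conv f (\<lambda>a. sc (e a) u) i = (\<Sum>a\<in>I. \<Sum>b\<in>I. sc (d i a b * e b) (f a))"
    unfolding conv_def by (intro sum.cong refl) (simp add: m_sc_r u)
  also have "\<dots> = (\<Sum>a\<in>I. sc (\<Sum>b\<in>I. d i a b * e b) (f a))"
    by (simp add: scale_sum_left)
  also have "\<dots> = (\<Sum>a\<in>I. if a = i then f a else 0)"
    by (intro sum.cong refl) (simp add: counit_r i)
  finally show ?thesis using i fin by simp
qed

text \<open>The convolution of \<open>f\<close>, \<open>g\<close> and \<open>h\<close> can be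
  bracketed in two ways, so a left and a right inverse of the same \<open>g\<close> agree. It is
  used for the antipode and for the convolution inverse of t.\<close>

lemma conv_inverse_unique:
  assumes fg: "\<And>i. i \<in> I \<Longrightarrow> conv f g i = sc (e i) u"
    and gh: "\<And>i. i \<in> I \<Longrightarrow> conv g h i = sc (e i) u"
    and uf: "\<And>i. i \<in> I \<Longrightarrow> m (f i) u = f i" and uh: "\<And>i. i \<in> I \<Longrightarrow> m u (h i) = h i"
    and i: "i \<in> I"
  shows "f i = h i"
proof -
  have "f i = conv f (\<lambda>a. sc (e a) u) i" using conv_unit_r[OF i, of f u] uf by simp
  also have "\<dots> = conv f (conv g h) i" by (rule conv_cong) (simp_all add: gh)
  also have "\<dots> = conv (conv f g) h i" by (simp add: conv_assoc i)
  also have "\<dots> = conv (\<lambda>a. sc (e a) u) h i" by (rule conv_cong) (simp_all add: fg)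
  also have "\<dots> = h i" using conv_unit_l[OF i, of u h] uh by simp
  finally show ?thesis .
qed

end

text \<open>The tensor square gives bilinear maps on H, such as \<sigma>, a convolution algebra of
  their own. Every sum over pairs factors, which reduces the axioms to those of the two
  factors.\<close>

lemma coalg_tensor:
  assumes "coalg I d e"
  shows "coalg (I \<times> I) (\<lambda>p q r. d (fst p) (fst q) (fst r) * d (snd p) (snd q) (snd r))
           (\<lambda>p. e (fst p) * e (snd p))"
proof -
  interpret coalg I d e by fact
  have prod: "(\<Sum>p\<in>I \<times> I. f (fst p) * g (snd p)) = sum f I * sum g I" for f g :: "_ \<Rightarrow> 'b"
    by (simp add: sum_product sum.cartesian_product split_beta)
  show ?thesis
  proof
    show "finite (I \<times> I)" using fin by simp
  next
    fix i a b c assume "i \<in> I \<times> I" "a \<in> I \<times> I" "b \<in> I \<times> I" "c \<in> I \<times> I"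
    then show "(\<Sum>l\<in>I \<times> I. d (fst i) (fst l) (fst c) * d (snd i) (snd l) (snd c) *
          (d (fst l) (fst a) (fst b) * d (snd l) (snd a) (snd b))) =
        (\<Sum>l\<in>I \<times> I. d (fst i) (fst a) (fst l) * d (snd i) (snd a) (snd l) *
          (d (fst l) (fst b) (fst c) * d (snd l) (snd b) (snd c)))"
      using prod[of "\<lambda>l. d (fst i) l (fst c) * d l (fst a) (fst b)"
          "\<lambda>l. d (snd i) l (snd c) * d l (snd a) (snd b)"]
        prod[of "\<lambda>l. d (fst i) (fst a) l * d l (fst b) (fst c)"
          "\<lambda>l. d (snd i) (snd a) l * d l (snd b) (snd c)"]
        coassoc[of "fst i" "fst a" "fst b" "fst c"] coassoc[of "snd i" "snd a" "snd b" "snd c"]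
      by (simp add: ac_simps mem_Times_iff)
  next
    fix i b assume "i \<in> I \<times> I" "b \<in> I \<times> I"
    then show "(\<Sum>a\<in>I \<times> I. e (fst a) * e (snd a) *
        (d (fst i) (fst a) (fst b) * d (snd i) (snd a) (snd b))) = (if b = i then 1 else 0)"
      using prod[of "\<lambda>a. e a * d (fst i) a (fst b)" "\<lambda>a. e a * d (snd i) a (snd b)"]
        counit_l[of "fst i" "fst b"] counit_l[of "snd i" "snd b"]
      by (simp add: ac_simps mem_Times_iff prod_eq_iff)
  next
    fix i a assume "i \<in> I \<times> I" "a \<in> I \<times> I"
    then show "(\<Sum>b\<in>I \<times> I. d (fst i) (fst a) (fst b) * d (snd i) (snd a) (snd b) *
        (e (fst b) * e (snd b))) = (if a = i then 1 else 0)"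
      using prod[of "\<lambda>b. d (fst i) (fst a) b * e b" "\<lambda>b. d (snd i) (snd a) b * e b"]
        counit_r[of "fst i" "fst a"] counit_r[of "snd i" "snd a"]
      by (simp add: ac_simps mem_Times_iff prod_eq_iff)
  qed
qed

section \<open>Polynomials and scalars inside the fraction field\<close>

lemma emb_0 [simp]: "emb 0 = 0" and emb_1 [simp]: "emb 1 = 1"
  by (simp_all add: emb_def Zero_fract_def One_fract_def)

lemma emb_add: "emb (p + q) = emb p + emb q" and emb_mult: "emb (p * q) = emb p * emb q"
  by (simp_all add: emb_def)

lemma emb_sum: "emb (sum f A) = (\<Sum>i\<in>A. emb (f i))"
  by (induction A rule: infinite_finite_induct) (auto simp: emb_add)

lemma emb_prod: "emb (prod f A) = (\<Prod>i\<in>A. emb (f i))"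
  by (induction A rule: infinite_finite_induct) (auto simp: emb_mult)

lemma emb_power: "emb (p ^ k) = emb p ^ k"
  by (induction k) (auto simp: emb_mult)

lemma emb_eq_iff [simp]: "emb p = emb q \<longleftrightarrow> p = q"
  by (simp add: emb_def eq_fract)

lemma emb_eq_0_iff [simp]: "emb p = 0 \<longleftrightarrow> p = 0"
  using emb_eq_iff[of p 0] by (simp del: emb_eq_iff)

lemma kc_eq_emb: "kc c = emb (Poly_Mapping.single 0 c)"
  by (simp add: kc_def emb_def)

lemma kc_0 [simp]: "kc 0 = 0" and kc_1 [simp]: "kc 1 = 1"
  by (simp_all add: kc_eq_emb)

lemma kc_add: "kc (a + b) = kc a + kc b" and kc_mult: "kc (a * b) = kc a * kc b"
  by (simp_all add: kc_eq_emb single_add emb_add mult_single flip: emb_mult)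

lemma kc_uminus: "kc (- a) = - kc a"
  using kc_add[of a "- a"] by (simp add: eq_neg_iff_add_eq_0 add.commute)

lemma kc_diff: "kc (a - b) = kc a - kc b"
  using kc_add[of a "- b"] by (simp add: kc_uminus)

lemma kc_sum: "kc (sum f A) = (\<Sum>i\<in>A. kc (f i))"
  by (induction A rule: infinite_finite_induct) (auto simp: kc_add)

definition scF :: "'k::field \<Rightarrow> 'k mpoly fract \<Rightarrow> 'k mpoly fract" where
  "scF c z = kc c * z"

definition scV :: "'k::field \<Rightarrow> (nat \<Rightarrow> 'k) \<Rightarrow> nat \<Rightarrow> 'k" where
  "scV c x = (\<lambda>i. c * x i)"

lemma scV_apply [simp]: "scV c x i = c * x i"
  by (simp add: scV_def)

lemma kalgebra_F: "kalgebra scF (*)"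
  by unfold_locales (auto simp: scF_def algebra_simps kc_add kc_mult)

interpretation vs: vector_space "scV :: 'k::field \<Rightarrow> _"
  by unfold_locales (auto simp: algebra_simps fun_eq_iff)

text \<open>\<open>hopf_algebra\<close> gives associativity on \<open>vecs (hdim H)\<close> only.
  The product reads just the first \<open>hdim H\<close> coordinates of its arguments, so truncating
  them by \<open>r\<close> transfers the law to all functions.\<close>

lemma kalgebra_mulv:
  assumes "hopf_algebra H"
  shows "kalgebra scV (mulv H)"
proof -
  define r :: "(nat \<Rightarrow> 'a) \<Rightarrow> nat \<Rightarrow> 'a" where "r x = (\<lambda>i. if i < hdim H then x i else 0)" for x
  have r: "r x \<in> vecs (hdim H)" for x by (auto simp: r_def vecs_def)
  have mr: "mulv H (r x) y = mulv H x y" "mulv H x (r y) = mulv H x y" for x y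
    unfolding mulv_def r_def by (intro ext sum.cong refl; simp)+
  have as: "\<forall>x\<in>vecs (hdim H). \<forall>y\<in>vecs (hdim H). \<forall>z\<in>vecs (hdim H).
      mulv H (mulv H x y) z = mulv H x (mulv H y z)"
    using assms unfolding hopf_algebra_def Let_def by (elim conjE)

  show ?thesis
  proof
    show "mulv H (mulv H x y) z = mulv H x (mulv H y z)" for x y z
      using as[rule_format, OF r r r, of x y z] by (simp add: mr)
    show "mulv H x (scV c y) = scV c (mulv H x y)" for c x y
      by (simp add: mulv_def fun_eq_iff sum_distrib_left mult.left_commute mult.assoc)
  qed (simp_all add: mulv_def fun_eq_iff distrib_left distrib_right sum.distrib sum_distrib_left mult.assoc)
qed

lemma sum_swap4:
  "(\<Sum>p\<in>P. \<Sum>q\<in>Q. \<Sum>l\<in>L. \<Sum>r\<in>R. F p q l r) = (\<Sum>l\<in>L. \<Sum>r\<in>R. \<Sum>p\<in>P. \<Sum>q\<in>Q. F p q l r)"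
proof -
  have "(\<Sum>p\<in>P. \<Sum>q\<in>Q. \<Sum>l\<in>L. \<Sum>r\<in>R. F p q l r) = (\<Sum>p\<in>P. \<Sum>l\<in>L. \<Sum>q\<in>Q. \<Sum>r\<in>R. F p q l r)"
    by (rule sum.cong[OF refl], rule sum.swap)
  also have "\<dots> = (\<Sum>l\<in>L. \<Sum>p\<in>P. \<Sum>q\<in>Q. \<Sum>r\<in>R. F p q l r)"
    by (rule sum.swap)
  also have "\<dots> = (\<Sum>l\<in>L. \<Sum>p\<in>P. \<Sum>r\<in>R. \<Sum>q\<in>Q. F p q l r)"
    by (rule sum.cong[OF refl], rule sum.cong[OF refl], rule sum.swap)
  also have "\<dots> = (\<Sum>l\<in>L. \<Sum>r\<in>R. \<Sum>p\<in>P. \<Sum>q\<in>Q. F p q l r)"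
    by (rule sum.cong[OF refl], rule sum.swap)
  finally show ?thesis .
qed

lemma sum_pairs2:
  "(\<Sum>p\<in>A \<times> B. \<Sum>q\<in>C \<times> D. F p q) = (\<Sum>a\<in>A. \<Sum>c\<in>C. \<Sum>b\<in>B. \<Sum>d\<in>D. F (a, b) (c, d))"
proof -
  have "(\<Sum>p\<in>A \<times> B. \<Sum>q\<in>C \<times> D. F p q) = (\<Sum>a\<in>A. \<Sum>b\<in>B. \<Sum>q\<in>C \<times> D. F (a, b) q)"
    by (subst sum.cartesian_product) (simp add: split_beta)
  also have "\<dots> = (\<Sum>a\<in>A. \<Sum>b\<in>B. \<Sum>c\<in>C. \<Sum>d\<in>D. F (a, b) (c, d))"
    by (intro sum.cong refl) (subst sum.cartesian_product, simp add: split_beta)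
  also have "\<dots> = (\<Sum>a\<in>A. \<Sum>c\<in>C. \<Sum>b\<in>B. \<Sum>d\<in>D. F (a, b) (c, d))"
    by (rule sum.cong[OF refl], rule sum.swap)
  finally show ?thesis .
qed

lemma bas_apply: "bas i j = (if j = i then 1 else 0)"
  by (simp add: bas_def)

lemma sum_bas_l: "(\<Sum>i<m. bas k i * f i) = (if k < m then f k else (0::'k::field))"
  by (simp add: bas_def if_distrib[of "\<lambda>z. z * _"] sum.delta cong: if_cong)

lemma sum_bas_r: "(\<Sum>i<m. f i * bas k i) = (if k < m then f k else (0::'k::field))"
  using sum_bas_l[of k f m] by (simp add: mult.commute)

lemma sum_bas_idx: "(\<Sum>k<m. f k * bas k i) = (if i < m then f i else (0::'k::field))"
  by (simp add: bas_def if_distrib[of "\<lambda>z. _ * z"] sum.delta' cong: if_cong)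

lemma sum_fun_apply: "(\<Sum>i\<in>A. f i) x = (\<Sum>i\<in>A. f i x)" for f :: "_ \<Rightarrow> _ \<Rightarrow> 'b::comm_monoid_add"
  by (induction A rule: infinite_finite_induct) auto

lemma bas_in_vecs [simp]: "i < m \<Longrightarrow> bas i \<in> vecs m"
  by (auto simp: bas_def vecs_def)

lemma zero_in_vecs [simp]: "0 \<in> vecs m" by (simp add: vecs_def)

lemma add_in_vecs: "x \<in> vecs m \<Longrightarrow> y \<in> vecs m \<Longrightarrow> x + y \<in> vecs m"
  by (simp add: vecs_def)

lemma diff_in_vecs: "x \<in> vecs m \<Longrightarrow> y \<in> vecs m \<Longrightarrow> x - y \<in> vecs m"
  by (simp add: vecs_def)

lemma scV_in_vecs: "x \<in> vecs m \<Longrightarrow> scV c x \<in> vecs m"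
  by (simp add: vecs_def)

lemma sum_in_vecs: "(\<And>i. i \<in> A \<Longrightarrow> f i \<in> vecs m) \<Longrightarrow> sum f A \<in> vecs m"
  by (induction A rule: infinite_finite_induct) (auto simp: add_in_vecs)

lemma vecs_expand: "x \<in> vecs m \<Longrightarrow> x = (\<Sum>i<m. scV (x i) (bas i))"
  by (rule ext) (auto simp: sum_fun_apply sum_bas_idx vecs_def)

lemma subspace_of_iff: "subspace_of m C \<longleftrightarrow> C \<subseteq> vecs m \<and> vs.subspace C"
  unfolding subspace_of_def vs.subspace_def
  by (simp add: plus_fun_def zero_fun_def scV_def)

lemma subspace_of_zero: "subspace_of m C \<Longrightarrow> 0 \<in> C"
  by (simp add: subspace_of_iff vs.subspace_0)

lemma subspace_of_add: "subspace_of m C \<Longrightarrow> x \<in> C \<Longrightarrow> y \<in> C \<Longrightarrow> x + y \<in> C"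
  by (simp add: subspace_of_iff vs.subspace_add)

lemma subspace_of_diff: "subspace_of m C \<Longrightarrow> x \<in> C \<Longrightarrow> y \<in> C \<Longrightarrow> x - y \<in> C"
  by (simp add: subspace_of_iff vs.subspace_diff)

lemma subspace_of_scale: "subspace_of m C \<Longrightarrow> x \<in> C \<Longrightarrow> scV c x \<in> C"
  by (simp add: subspace_of_iff vs.subspace_scale)

lemma subspace_of_sum: "subspace_of m C \<Longrightarrow> (\<And>i. i \<in> A \<Longrightarrow> f i \<in> C) \<Longrightarrow> sum f A \<in> C"
  by (simp add: subspace_of_iff vs.subspace_sum)

lemma subspace_of_subset: "subspace_of m C \<Longrightarrow> x \<in> C \<Longrightarrow> x \<in> vecs m"
  by (auto simp: subspace_of_iff)

lemma subspace_of_vecs: "subspace_of m (vecs m)"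
  by (auto simp: subspace_of_def vecs_def)

subsection \<open>The convolution algebras of a Hopf algebra\<close>

locale hopf =
  fixes H :: "'k::field hopf_data"
  assumes hopf: "hopf_algebra H"
begin

abbreviation "N \<equiv> hdim H"
abbreviation V :: "(nat \<Rightarrow> 'k) set" where "V \<equiv> vecs (hdim H)"

lemma mulv_bas: "i < N \<Longrightarrow> j < N \<Longrightarrow> mulv H (bas i) (bas j) = hm H i j"
  by (rule ext) (simp add: mulv_def mult.assoc sum_bas_l flip: sum_distrib_left)

lemma comulv_bas: "i < N \<Longrightarrow> comulv H (bas i) = hc H i"
  by (intro ext) (simp add: comulv_def sum_bas_l)

lemma counitv_bas: "i < N \<Longrightarrow> counitv H (bas i) = he H i"
  by (simp add: counitv_def sum_bas_l)

lemma antipv_bas: "i < N \<Longrightarrow> antipv H (bas i) = hs H i"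
  by (rule ext) (simp add: antipv_def sum_bas_l)

lemma axioms:
  shows mulv_V0: "\<forall>x\<in>V. \<forall>y\<in>V. mulv H x y \<in> V" and unitv_V: "unitv H \<in> V"
    and comulv_tens: "\<forall>x\<in>V. comulv H x \<in> tens N" and antipv_V: "\<forall>x\<in>V. antipv H x \<in> V"
    and unit_laws: "\<forall>x\<in>V. mulv H (unitv H) x = x \<and> mulv H x (unitv H) = x"
    and coassoc_V: "\<forall>x\<in>V. \<forall>a b c. (\<Sum>l<N. comulv H x l c * comulv H (bas l) a b)
                    = (\<Sum>l<N. comulv H x a l * comulv H (bas l) b c)"
    and counit_V1: "\<forall>x\<in>V. \<forall>b. (\<Sum>a<N. counitv H (bas a) * comulv H x a b) = x b"
    and counit_V2: "\<forall>x\<in>V. \<forall>a. (\<Sum>b<N. comulv H x a b * counitv H (bas b)) = x a"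
    and comulv_mulv_V: "\<forall>x\<in>V. \<forall>y\<in>V. \<forall>a b. comulv H (mulv H x y) a b =
        (\<Sum>a1<N. \<Sum>b1<N. \<Sum>a2<N. \<Sum>b2<N. comulv H x a1 b1 * comulv H y a2 b2 *
            mulv H (bas a1) (bas a2) a * mulv H (bas b1) (bas b2) b)"
    and comulv_unit: "comulv H (unitv H) = tensor (unitv H) (unitv H)"
    and counitv_mulv: "\<forall>x\<in>V. \<forall>y\<in>V. counitv H (mulv H x y) = counitv H x * counitv H y"
    and counitv_unit: "counitv H (unitv H) = 1"
    and antip_V1: "\<forall>x\<in>V. \<forall>p. (\<Sum>a<N. \<Sum>b<N. comulv H x a b * mulv H (antipv H (bas a)) (bas b) p)
                  = counitv H x * unitv H p"
    and antip_V2: "\<forall>x\<in>V. \<forall>p. (\<Sum>a<N. \<Sum>b<N. comulv H x a b * mulv H (bas a) (antipv H (bas b)) p)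
                  = counitv H x * unitv H p"
  using hopf unfolding hopf_algebra_def Let_def by - (elim conjE, assumption)+

sublocale mul: kalgebra scV "mulv H"
  by (rule kalgebra_mulv[OF hopf])

lemma hm_V: "i < N \<Longrightarrow> j < N \<Longrightarrow> hm H i j \<in> V"
  using mulv_V0 mulv_bas by (metis bas_in_vecs)

lemma hc_out: "i < N \<Longrightarrow> N \<le> a \<or> N \<le> b \<Longrightarrow> hc H i a b = 0"
  using comulv_tens[rule_format, of "bas i"] by (auto simp: comulv_bas tens_def)

lemma comulv_out: "N \<le> a \<or> N \<le> b \<Longrightarrow> comulv H x a b = 0"
  unfolding comulv_def by (rule sum.neutral) (auto simp: hc_out)

lemma row_V: "comulv H x a \<in> V"
  unfolding vecs_def by (simp add: comulv_out)

lemma hs_V: "i < N \<Longrightarrow> hs H i \<in> V"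
  using antipv_V antipv_bas by (metis bas_in_vecs)

lemma mulv_V: "mulv H x y \<in> V"
proof -
  have "mulv H x y = (\<Sum>i<N. \<Sum>j<N. scV (x i * y j) (hm H i j))"
    by (rule ext) (simp add: mulv_def sum_fun_apply)
  then show ?thesis by (auto intro!: sum_in_vecs scV_in_vecs hm_V)
qed

lemma mulv_unit_l: "x \<in> V \<Longrightarrow> mulv H (unitv H) x = x"
  and mulv_unit_r: "x \<in> V \<Longrightarrow> mulv H x (unitv H) = x"
  using unit_laws by auto

lemma comulv_add: "comulv H (x + y) = comulv H x + comulv H y"
  by (intro ext) (simp add: comulv_def distrib_right sum.distrib)

lemma comulv_diff: "comulv H (x - y) = comulv H x - comulv H y"
  by (intro ext) (simp add: comulv_def left_diff_distrib sum_subtractf)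

lemma comulv_scale: "comulv H (scV c x) a b = c * comulv H x a b"
  by (simp add: comulv_def sum_distrib_left mult.assoc)

lemma comulv_zero: "comulv H 0 a b = 0"
  by (simp add: comulv_def)

lemma comulv_sum: "comulv H (\<Sum>i\<in>A. f i) a b = (\<Sum>i\<in>A. comulv H (f i) a b)"
  unfolding comulv_def sum_fun_apply sum_distrib_right by (rule sum.swap)

lemma counitv_add: "counitv H (x + y) = counitv H x + counitv H y"
  by (simp add: counitv_def distrib_right sum.distrib)

lemma counitv_scale: "counitv H (scV c x) = c * counitv H x"
  by (simp add: counitv_def sum_distrib_left mult.assoc)

lemma counitv_diff: "counitv H (x - y) = counitv H x - counitv H y"
  by (simp add: counitv_def left_diff_distrib sum_subtractf)

lemma counitv_zero [simp]: "counitv H 0 = 0"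
  by (simp add: counitv_def)

lemma counitv_sum: "counitv H (\<Sum>i\<in>A. f i) = (\<Sum>i\<in>A. counitv H (f i))"
  unfolding counitv_def sum_fun_apply sum_distrib_right by (rule sum.swap)

lemma antipv_eq_sum: "antipv H x = (\<Sum>a<N. scV (x a) (hs H a))"
  by (rule ext) (simp add: antipv_def sum_fun_apply)

lemma antipv_add: "antipv H (x + y) = antipv H x + antipv H y"
  by (intro ext) (simp add: antipv_def distrib_right sum.distrib)

lemma antipv_diff: "antipv H (x - y) = antipv H x - antipv H y"
  by (intro ext) (simp add: antipv_def left_diff_distrib sum_subtractf)

lemma antipv_scale: "antipv H (scV c x) = scV c (antipv H x)"
  by (intro ext) (simp add: antipv_def sum_distrib_left mult.assoc)

lemma antipv_zero [simp]: "antipv H 0 = 0"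
  by (intro ext) (simp add: antipv_def)

lemma antipv_sum: "antipv H (\<Sum>i\<in>A. f i) = (\<Sum>i\<in>A. antipv H (f i))"
  unfolding antipv_def fun_eq_iff sum_fun_apply sum_distrib_right by (intro allI sum.swap)

lemma hc_coassoc:
  "i < N \<Longrightarrow> (\<Sum>l<N. hc H i l c * hc H l a b) = (\<Sum>l<N. hc H i a l * hc H l b c)"
  using coassoc_V[rule_format, of "bas i" c a b] by (simp add: comulv_bas)

lemma hc_counit_l: "i < N \<Longrightarrow> (\<Sum>a<N. he H a * hc H i a b) = (if b = i then 1 else 0)"
  using counit_V1[rule_format, of "bas i" b] by (simp add: comulv_bas counitv_bas bas_apply)

lemma hc_counit_r: "i < N \<Longrightarrow> (\<Sum>b<N. hc H i a b * he H b) = (if a = i then 1 else 0)"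
  using counit_V2[rule_format, of "bas i" a] by (simp add: comulv_bas counitv_bas bas_apply)

lemma coalg_H: "coalg {..<N} (hc H) (he H)"
  by unfold_locales (simp_all add: hc_coassoc hc_counit_l hc_counit_r)

abbreviation "hc2 \<equiv> \<lambda>p q r. hc H (fst p) (fst q) (fst r) * hc H (snd p) (snd q) (snd r)"
abbreviation "he2 \<equiv> \<lambda>p. he H (fst p) * he H (snd p)"

sublocale CF: coalg_alg "{..<N}" "hc H" "he H" scF "(*)"
  by (intro coalg_alg.intro coalg_H kalgebra_F)

sublocale CF2: coalg_alg "{..<N} \<times> {..<N}" hc2 he2 scF "(*)"
  by (intro coalg_alg.intro coalg_tensor[OF coalg_H] kalgebra_F)

sublocale CH2: coalg_alg "{..<N} \<times> {..<N}" hc2 he2 scV "mulv H"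
  by (intro coalg_alg.intro coalg_tensor[OF coalg_H] kalgebra_mulv hopf)

lemma hm_hc:
  assumes "i < N" "j < N"
  shows "(\<Sum>l<N. hm H i j l * hc H l a b) = (\<Sum>a1<N. \<Sum>b1<N. \<Sum>a2<N. \<Sum>b2<N.
    hc H i a1 b1 * hc H j a2 b2 * hm H a1 a2 a * hm H b1 b2 b)"
  using comulv_mulv_V[rule_format, of "bas i" "bas j" a b] assms
  by (simp add: comulv_bas mulv_bas) (simp add: comulv_def)

text \<open>Precomposition with the multiplication of H is multiplicative for convolution, because the
  comultiplication of H is an algebra map.\<close>

lemma conv_pullback:
  assumes K: "kalgebra sc m" and ij: "i < N" "j < N"
  shows "(\<Sum>l<N. sc (hm H i j l) (\<Sum>a<N. \<Sum>b<N. sc (hc H l a b) (m (f a) (g b))))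
    = (\<Sum>p\<in>{..<N} \<times> {..<N}. \<Sum>q\<in>{..<N} \<times> {..<N}. sc (hc2 (i, j) p q)
        (m (\<Sum>l<N. sc (hm H (fst p) (snd p) l) (f l)) (\<Sum>l<N. sc (hm H (fst q) (snd q) l) (g l))))"
proof -
  interpret K: kalgebra sc m by fact
  have "(\<Sum>p\<in>{..<N} \<times> {..<N}. \<Sum>q\<in>{..<N} \<times> {..<N}. sc (hc2 (i, j) p q)
        (m (\<Sum>l<N. sc (hm H (fst p) (snd p) l) (f l)) (\<Sum>l<N. sc (hm H (fst q) (snd q) l) (g l))))
    = (\<Sum>p\<in>{..<N} \<times> {..<N}. \<Sum>q\<in>{..<N} \<times> {..<N}. \<Sum>b<N. \<Sum>a<N.
        sc (hc2 (i, j) p q * hm H (fst p) (snd p) a * hm H (fst q) (snd q) b) (m (f a) (g b)))"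
    by (simp add: K.m_sum_l K.m_sum_r K.m_sc_l K.m_sc_r K.scale_sum_right ac_simps)
  also have "\<dots> = (\<Sum>b<N. \<Sum>a<N. \<Sum>p\<in>{..<N} \<times> {..<N}. \<Sum>q\<in>{..<N} \<times> {..<N}.
        sc (hc2 (i, j) p q * hm H (fst p) (snd p) a * hm H (fst q) (snd q) b) (m (f a) (g b)))"
    by (rule sum_swap4)
  also have "\<dots> = (\<Sum>b<N. \<Sum>a<N. sc (\<Sum>p\<in>{..<N} \<times> {..<N}. \<Sum>q\<in>{..<N} \<times> {..<N}.
        hc2 (i, j) p q * hm H (fst p) (snd p) a * hm H (fst q) (snd q) b) (m (f a) (g b)))"
    by (simp only: K.scale_sum_left)
  also have "\<dots> = (\<Sum>b<N. \<Sum>a<N. sc (\<Sum>l<N. hm H i j l * hc H l a b) (m (f a) (g b)))"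
    by (intro sum.cong refl arg_cong2[where f = sc]) (simp add: hm_hc[OF ij] sum_pairs2)
  also have "\<dots> = (\<Sum>b<N. \<Sum>a<N. \<Sum>l<N. sc (hm H i j l * hc H l a b) (m (f a) (g b)))"
    by (simp only: K.scale_sum_left)
  also have "\<dots> = (\<Sum>a<N. \<Sum>b<N. \<Sum>l<N. sc (hm H i j l * hc H l a b) (m (f a) (g b)))"
    by (rule sum.swap)
  also have "\<dots> = (\<Sum>a<N. \<Sum>l<N. \<Sum>b<N. sc (hm H i j l * hc H l a b) (m (f a) (g b)))"
    by (rule sum.cong[OF refl], rule sum.swap)
  also have "\<dots> = (\<Sum>l<N. \<Sum>a<N. \<Sum>b<N. sc (hm H i j l * hc H l a b) (m (f a) (g b)))"
    by (rule sum.swap)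
  also have "\<dots> = (\<Sum>l<N. sc (hm H i j l) (\<Sum>a<N. \<Sum>b<N. sc (hc H l a b) (m (f a) (g b))))"
    by (simp add: K.scale_sum_right)
  finally show ?thesis by simp
qed

lemma hm_he: "i < N \<Longrightarrow> j < N \<Longrightarrow> (\<Sum>l<N. hm H i j l * he H l) = he H i * he H j"
  using counitv_mulv[rule_format, of "bas i" "bas j"]
  by (simp add: mulv_bas counitv_bas) (simp add: counitv_def)

lemma hs_left: "i < N \<Longrightarrow> (\<Sum>a<N. \<Sum>b<N. scV (hc H i a b) (mulv H (hs H a) (bas b))) = scV (he H i) (unitv H)"
  using antip_V1[rule_format, of "bas i"]
  by (intro ext) (simp add: comulv_bas antipv_bas counitv_bas sum_fun_apply)

lemma hs_right: "i < N \<Longrightarrow> (\<Sum>a<N. \<Sum>b<N. scV (hc H i a b) (mulv H (bas a) (hs H b))) = scV (he H i) (unitv H)"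
  using antip_V2[rule_format, of "bas i"]
  by (intro ext) (simp add: comulv_bas antipv_bas counitv_bas sum_fun_apply)

text \<open>In the convolution algebra of maps from H \<otimes> H to H, \<open>?f\<close> (antipode
  after multiplication) is a left inverse and \<open>?h\<close> (product of antipodes in reversed
  order) a right inverse of the multiplication \<open>?g\<close>; hence they agree.\<close>

lemma antipv_mulv_bas:
  assumes ij: "i < N" "j < N"
  shows "antipv H (hm H i j) = mulv H (hs H j) (hs H i)"
proof -
  let ?f = "\<lambda>p. antipv H (hm H (fst p) (snd p))"
  let ?g = "\<lambda>p. hm H (fst p) (snd p)"
  let ?h = "\<lambda>p. mulv H (hs H (snd p)) (hs H (fst p))"
  have "?f (i, j) = ?h (i, j)"
  proof (rule CH2.conv_inverse_unique[where u = "unitv H" and g = ?g])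
    fix p assume "p \<in> {..<N} \<times> {..<N}"
    then obtain i j where p: "p = (i, j)" and ij: "i < N" "j < N" by auto
    have f: "?f q = (\<Sum>l<N. scV (hm H (fst q) (snd q) l) (hs H l))" for q
      by (simp add: antipv_eq_sum)
    have g: "?g q = (\<Sum>l<N. scV (hm H (fst q) (snd q) l) (bas l))" if "q \<in> {..<N} \<times> {..<N}" for q
      using vecs_expand[OF hm_V, of "fst q" "snd q"] that by (simp add: mem_Times_iff)
    have "CH2.conv ?f ?g p = (\<Sum>p\<in>{..<N} \<times> {..<N}. \<Sum>q\<in>{..<N} \<times> {..<N}. scV (hc2 (i, j) p q)
        (mulv H (\<Sum>l<N. scV (hm H (fst p) (snd p) l) (hs H l)) (\<Sum>l<N. scV (hm H (fst q) (snd q) l) (bas l))))"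
      unfolding CH2.conv_def p by (intro sum.cong refl arg_cong2[where f = scV] arg_cong2[where f = "mulv H"] f g)
    also have "\<dots> = (\<Sum>l<N. scV (hm H i j l) (\<Sum>a<N. \<Sum>b<N. scV (hc H l a b) (mulv H (hs H a) (bas b))))"
      by (rule conv_pullback[OF kalgebra_mulv[OF hopf] ij, symmetric])
    also have "\<dots> = (\<Sum>l<N. scV (hm H i j l * he H l) (unitv H))"
      by (intro sum.cong refl) (simp add: hs_left)
    also have "\<dots> = scV (he H i * he H j) (unitv H)"
      by (simp only: vs.scale_sum_left[symmetric] hm_he[OF ij])
    finally show "CH2.conv ?f ?g p = scV (he2 p) (unitv H)" by (simp add: p)
    have "CH2.conv ?g ?h p = (\<Sum>a<N. \<Sum>b<N. \<Sum>a'<N. \<Sum>b'<N.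
        scV (hc H i a b * hc H j a' b') (mulv H (hm H a a') (mulv H (hs H b') (hs H b))))"
      unfolding CH2.conv_def p by (simp add: sum_pairs2)
    also have "\<dots> = (\<Sum>a<N. \<Sum>b<N. \<Sum>a'<N. \<Sum>b'<N. scV (hc H i a b) (mulv H (bas a)
        (mulv H (scV (hc H j a' b') (mulv H (bas a') (hs H b'))) (hs H b))))"
      by (intro sum.cong refl) (simp add: mul.m_assoc mul.m_sc_l mul.m_sc_r flip: mulv_bas)
    also have "\<dots> = (\<Sum>a<N. \<Sum>b<N. scV (hc H i a b) (mulv H (bas a)
        (mulv H (\<Sum>a'<N. \<Sum>b'<N. scV (hc H j a' b') (mulv H (bas a') (hs H b'))) (hs H b))))"
      by (simp add: mul.m_sum_l mul.m_sum_r vs.scale_sum_right)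
    also have "\<dots> = (\<Sum>a<N. \<Sum>b<N. scV (hc H i a b * he H j) (mulv H (bas a) (hs H b)))"
      by (intro sum.cong refl) (simp add: hs_right ij mul.m_sc_l mul.m_sc_r mulv_unit_l hs_V)
    also have "\<dots> = scV (he H j) (\<Sum>a<N. \<Sum>b<N. scV (hc H i a b) (mulv H (bas a) (hs H b)))"
      by (simp add: vs.scale_sum_right mult.commute)
    also have "\<dots> = scV (he2 p) (unitv H)" by (simp add: hs_right ij p mult.commute)
    finally show "CH2.conv ?g ?h p = scV (he2 p) (unitv H)" .
    show "mulv H (?f p) (unitv H) = ?f p" using p ij by (simp add: mulv_unit_r hm_V antipv_V)
    show "mulv H (unitv H) (?h p) = ?h p" by (simp add: mulv_unit_l mulv_V)
  qed (use ij in auto)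
  then show ?thesis by simp
qed

lemma mulv_expand: "mulv H x y = (\<Sum>i<N. \<Sum>j<N. scV (x i * y j) (hm H i j))"
  by (rule ext) (simp add: mulv_def sum_fun_apply)

lemma antipv_mulv: "antipv H (mulv H x y) = mulv H (antipv H y) (antipv H x)"
proof -
  have "antipv H (mulv H x y) = (\<Sum>i<N. \<Sum>j<N. scV (x i * y j) (mulv H (hs H j) (hs H i)))"
    by (simp add: mulv_expand antipv_sum antipv_scale antipv_mulv_bas[unfolded mulv_expand])
  also have "\<dots> = (\<Sum>j<N. \<Sum>i<N. scV (x i * y j) (mulv H (hs H j) (hs H i)))"
    by (rule sum.swap)
  also have "\<dots> = mulv H (antipv H y) (antipv H x)"
    by (simp add: antipv_eq_sum mul.m_sum_l mul.m_sum_r mul.m_sc_l mul.m_sc_r mult.commute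
        vs.scale_sum_right)
       (rule sum.swap)
  finally show ?thesis .
qed

end

subsection \<open>Linear algebra in coordinate spaces\<close>

definition dotp :: "nat \<Rightarrow> (nat \<Rightarrow> 'k::field) \<Rightarrow> (nat \<Rightarrow> 'k) \<Rightarrow> 'k" where
  "dotp m \<phi> x = (\<Sum>i<m. \<phi> i * x i)"

lemma dotp_add: "dotp m \<phi> (x + y) = dotp m \<phi> x + dotp m \<phi> y"
  by (simp add: dotp_def distrib_left sum.distrib)

lemma dotp_diff: "dotp m \<phi> (x - y) = dotp m \<phi> x - dotp m \<phi> y"
  by (simp add: dotp_def right_diff_distrib sum_subtractf)

lemma dotp_scale: "dotp m \<phi> (scV c x) = c * dotp m \<phi> x"
  by (simp add: dotp_def sum_distrib_left mult.left_commute)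

lemma dotp_zero [simp]: "dotp m \<phi> 0 = 0"
  by (simp add: dotp_def)

lemma dotp_sum: "dotp m \<phi> (\<Sum>i\<in>A. f i) = (\<Sum>i\<in>A. dotp m \<phi> (f i))"
  unfolding dotp_def sum_fun_apply sum_distrib_left by (rule sum.swap)

lemma dotp_bas: "i < m \<Longrightarrow> dotp m \<phi> (bas i) = \<phi> i"
  by (simp add: dotp_def sum_bas_r)

lemma vector_space_field: "vector_space ((*) :: 'k::field \<Rightarrow> 'k \<Rightarrow> 'k)"
  by unfold_locales (auto simp: algebra_simps)

lemma functional_extend:
  fixes B :: "(nat \<Rightarrow> 'k::field) set"
  assumes "vs.independent B" "B \<subseteq> vecs m"
  shows "\<exists>\<phi>. \<forall>b\<in>B. dotp m \<phi> b = g b"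
proof -
  interpret vp: vector_space_pair "scV :: 'k \<Rightarrow> _" "(*)"
    by (intro vector_space_pair.intro vector_space_field vs.vector_space_axioms)
  obtain f where f: "Vector_Spaces.linear scV (*) f" "\<forall>b\<in>B. f b = g b"
    using vp.linear_independent_extend[OF assms(1)] by blast
  have "dotp m (\<lambda>i. f (bas i)) b = g b" if "b \<in> B" for b
  proof -
    have "g b = f (\<Sum>i<m. scV (b i) (bas i))"
      using that assms(2) f(2) vecs_expand[of b m] by auto
    also have "\<dots> = dotp m (\<lambda>i. f (bas i)) b"
      by (simp add: vp.linear_sum[OF f(1)] vp.linear_scale[OF f(1)] dotp_def mult.commute)
    finally show ?thesis by simp
  qed
  then show ?thesis by blast
qed

lemma separating_functional:
  assumes X: "subspace_of m X" and v: "v \<in> vecs m" "v \<notin> X"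
  shows "\<exists>\<phi>. (\<forall>x\<in>X. dotp m \<phi> x = 0) \<and> dotp m \<phi> v = 1"
proof -
  obtain B where B: "B \<subseteq> X" "vs.independent B" "X \<subseteq> vs.span B"
    using vs.maximal_independent_subset[of X] by blast
  have "vs.span B = X"
    using B X by (meson subspace_of_iff vs.span_minimal subset_antisym)
  then have "vs.independent (insert v B)" using v B by (simp add: vs.independent_insertI)
  moreover have "insert v B \<subseteq> vecs m" using v B X by (auto simp: subspace_of_iff)
  ultimately obtain \<phi> where \<phi>: "\<forall>b\<in>insert v B. dotp m \<phi> b = (if b = v then 1 else 0)"
    using functional_extend[of "insert v B" m "\<lambda>b. if b = v then 1 else 0"] by blast
  have "v \<notin> B" using v B by blast
  have "vs.subspace {x. dotp m \<phi> x = 0}"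
    by (auto simp: vs.subspace_def dotp_add dotp_scale)
  moreover have "B \<subseteq> {x. dotp m \<phi> x = 0}" using \<phi> \<open>v \<notin> B\<close> by auto
  ultimately have "vs.span B \<subseteq> {x. dotp m \<phi> x = 0}" by (rule vs.span_minimal[rotated])
  then show ?thesis using \<phi> \<open>vs.span B = X\<close> by auto
qed

lemma vecs_span_bas: "vecs m = vs.span (bas ` {..<m})"
proof (rule subset_antisym)
  show "vecs m \<subseteq> vs.span (bas ` {..<m})"
  proof
    fix x assume "x \<in> vecs m"
    then have "x = (\<Sum>i<m. scV (x i) (bas i))" by (rule vecs_expand)
    also have "\<dots> \<in> vs.span (bas ` {..<m})"
      by (intro vs.span_sum vs.span_scale vs.span_base) auto
    finally show "x \<in> vs.span (bas ` {..<m})" .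
  qed
  show "vs.span (bas ` {..<m}) \<subseteq> vecs m"
    by (rule vs.span_minimal) (use subspace_of_vecs in \<open>auto simp: subspace_of_iff\<close>)
qed

lemma independent_finite:
  assumes "vs.independent B" "B \<subseteq> vecs m"
  shows "finite B" "card B \<le> m"
proof -
  have "finite B \<and> card B \<le> card (bas ` {..<m} :: (nat \<Rightarrow> 'a) set)"
    by (rule vs.independent_span_bound) (use assms vecs_span_bas in auto)
  moreover have "card (bas ` {..<m} :: (nat \<Rightarrow> 'a) set) \<le> m"
    using card_image_le[of "{..<m}" "bas :: nat \<Rightarrow> nat \<Rightarrow> 'a"] by simp
  ultimately show "finite B" "card B \<le> m" by auto
qed

lemma basis_card:
  assumes "vs.independent B" "B \<subseteq> vecs m" "vecs m \<subseteq> vs.span B"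
  shows "card B = m"
proof -
  let ?C = "bas ` {..<m} :: (nat \<Rightarrow> 'a) set"
  have inj: "inj_on (bas :: nat \<Rightarrow> nat \<Rightarrow> 'a) {..<m}"
    by (rule inj_onI) (metis bas_apply zero_neq_one)
  have "m \<le> card B"
  proof -
    have "vs.independent ?C"
    proof (rule vs.independent_if_scalars_zero)
      fix f :: "(nat \<Rightarrow> 'a) \<Rightarrow> 'a" and x
      assume *: "(\<Sum>x\<in>?C. scV (f x) x) = 0" and "x \<in> ?C"
      then obtain k where k: "x = bas k" "k < m" by auto
      have "(\<Sum>x\<in>?C. scV (f x) x) = (\<Sum>i<m. scV (f (bas i)) (bas i))"
        by (subst sum.reindex[OF inj]) simp
      then have "(\<Sum>i<m. scV (f (bas i)) (bas i)) k = 0" using * by simp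
      then show "f x = 0" using k by (simp add: sum_fun_apply sum_bas_idx)
    qed simp
    then have "card ?C \<le> card B"
      using vs.independent_span_bound[of B ?C] independent_finite[OF assms(1,2)] assms(3)
      by (meson bas_in_vecs image_subsetI lessThan_iff order_trans)
    then show ?thesis using card_image[OF inj] by simp
  qed
  then show ?thesis using independent_finite[OF assms(1,2)] by simp
qed

text \<open>The number of leading positions is the dimension of a subspace; it makes inclusion of
  subspaces well-founded.\<close>

definition pivots :: "(nat \<Rightarrow> 'k::field) set \<Rightarrow> nat set" where
  "pivots X = {j. \<exists>x\<in>X. x j \<noteq> 0 \<and> (\<forall>i<j. x i = 0)}"

definition sdim :: "(nat \<Rightarrow> 'k::field) set \<Rightarrow> nat" where
  "sdim X = card (pivots X)"

lemma pivots_bounded: "X \<subseteq> vecs m \<Longrightarrow> pivots X \<subseteq> {..<m}"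
  by (force simp: pivots_def vecs_def not_less[symmetric])

text \<open>Gaussian elimination: subtracting a multiple of an element of \<open>X\<close> with the
  same leading position moves the first nonzero coordinate of y to the right, until nothing is left.
  The induction runs over the number k of positions that may still be nonzero.\<close>

lemma subspace_eq_if_pivots_eq:
  assumes X: "subspace_of m X" and Y: "subspace_of m Y" and "X \<subseteq> Y" "pivots X = pivots Y"
  shows "X = Y"
proof -
  have "y \<in> Y \<Longrightarrow> \<forall>i<m - k. y i = 0 \<Longrightarrow> y \<in> X" for k y
  proof (induction k arbitrary: y)
    case 0
    then have "y = 0" using subspace_of_subset[OF Y, of y] by (intro ext) (auto simp: vecs_def not_le[symmetric])
    then show ?case using subspace_of_zero[OF X] by (simp only:)
  next
    case (Suc k)
    show ?case
    \<comment> \<open>Equality means k \<ge> m: the subtraction is truncated and the vanishing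
      hypothesis is empty in both forms.\<close>
    proof (cases "m - k = m - Suc k")
      case True
      then show ?thesis using Suc by metis
    next
      case False
      define j where "j = m - Suc k"
      have j: "m - k = Suc j" using False by (auto simp: j_def)
      show ?thesis
      proof (cases "y j = 0")
        case True
        then show ?thesis using Suc.IH[of y] Suc.prems j by (auto simp: j_def less_Suc_eq)
      next
        case False
        then have "j \<in> pivots Y" using Suc.prems by (auto simp: pivots_def j_def)
        then have "j \<in> pivots X" using assms(4) by simp
        then obtain x where x: "x \<in> X" "x j \<noteq> 0" "\<forall>i<j. x i = 0"
          by (auto simp: pivots_def)
        define z where "z = y - scV (y j / x j) x"
        have "z \<in> Y" unfolding z_def
          using x assms(3) Suc.prems(1) by (intro subspace_of_diff[OF Y] subspace_of_scale[OF Y]) auto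
        moreover have "\<forall>i<m - k. z i = 0"
          using x Suc.prems(2) j by (auto simp: z_def j_def less_Suc_eq)
        ultimately have "z \<in> X" by (rule Suc.IH)
        then have "z + scV (y j / x j) x \<in> X"
          using x by (intro subspace_of_add[OF X] subspace_of_scale[OF X])
        then show ?thesis by (simp add: z_def)
      qed
    qed
  qed
  from this[of _ m] show ?thesis using \<open>X \<subseteq> Y\<close> by auto
qed

lemma sdim_less:
  assumes "subspace_of m X" "subspace_of m Y" "X \<subset> Y"
  shows "sdim X < sdim Y"
proof -
  have "pivots X \<subseteq> pivots Y" using assms(3) by (auto simp: pivots_def)
  moreover have "pivots X \<noteq> pivots Y" using subspace_eq_if_pivots_eq assms by blast
  moreover have "finite (pivots Y)"
    using pivots_bounded[of Y m] assms(2) finite_subset by (auto simp: subspace_of_iff)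
  ultimately show ?thesis unfolding sdim_def by (intro psubset_card_mono) auto
qed

lemma sdim_le: "subspace_of m X \<Longrightarrow> sdim X \<le> m"
  unfolding sdim_def subspace_of_iff
  using card_mono[OF _ pivots_bounded[of X m]] by simp

subsection \<open>Tensors vanishing modulo a subspace\<close>

text \<open>This is J \<otimes> H + H \<otimes> J, for a subspace J the kernel of the map to the
  tensor square of H / J. The shape is that of \<open>hopf_ideal\<close> and
  \<open>grouplike_mod\<close>, so that both unfold to membership in it.\<close>

definition TS :: "nat \<Rightarrow> (nat \<Rightarrow> 'k::field) set \<Rightarrow> (nat \<Rightarrow> nat \<Rightarrow> 'k) set" where
  "TS m J = {(\<lambda>i j. s i j + t i j) | s t. s \<in> tspan J (vecs m) \<and> t \<in> tspan (vecs m) J}"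

lemma tspan_zero: "0 \<in> tspan A B"
  unfolding tspan_def by (rule CollectI, rule exI[of _ "[]"]) (auto simp: zero_fun_def)

lemma tspan_add:
  assumes "s \<in> tspan A B" "t \<in> tspan A B" shows "s + t \<in> tspan A B"
proof -
  obtain ps qs where "s = (\<lambda>i j. \<Sum>(a, b)\<leftarrow>ps. a i * b j)" "\<forall>(a, b)\<in>set ps. a \<in> A \<and> b \<in> B"
     "t = (\<lambda>i j. \<Sum>(a, b)\<leftarrow>qs. a i * b j)" "\<forall>(a, b)\<in>set qs. a \<in> A \<and> b \<in> B"
    using assms unfolding tspan_def by blast
  then show ?thesis unfolding tspan_def
    by (intro CollectI exI[of _ "ps @ qs"]) (auto simp: plus_fun_def)
qed

lemma tspan_pure: "a \<in> A \<Longrightarrow> b \<in> B \<Longrightarrow> tensor a b \<in> tspan A B"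
  unfolding tspan_def tensor_def by (rule CollectI, rule exI[of _ "[(a, b)]"]) auto

lemma tspan_sum: "(\<And>i. i \<in> I \<Longrightarrow> f i \<in> tspan A B) \<Longrightarrow> sum f I \<in> tspan A B"
  by (induction I rule: infinite_finite_induct) (auto simp: tspan_zero tspan_add)

lemma tspan_induct [consumes 1, case_names zero add pure]:
  assumes "T \<in> tspan A B" and z: "P 0" and add: "\<And>S T. P S \<Longrightarrow> P T \<Longrightarrow> P (S + T)"
    and pure: "\<And>a b. a \<in> A \<Longrightarrow> b \<in> B \<Longrightarrow> P (tensor a b)"
  shows "P T"
proof -
  have "\<forall>(a, b)\<in>set ps. a \<in> A \<and> b \<in> B \<Longrightarrow> P (\<lambda>i j. \<Sum>(a, b)\<leftarrow>ps. a i * b j)" for ps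
  proof (induction ps)
    case Nil
    then show ?case using z by (simp add: zero_fun_def)
  next
    case (Cons p ps)
    obtain a b where p: "p = (a, b)" by force
    have "P (tensor a b + (\<lambda>i j. \<Sum>(a, b)\<leftarrow>ps. a i * b j))"
      using Cons p by (intro add pure) auto
    then show ?case by (simp add: p tensor_def plus_fun_def)
  qed
  then show ?thesis using assms(1) unfolding tspan_def by blast
qed

lemma TS_I: "s \<in> tspan J (vecs m) \<Longrightarrow> t \<in> tspan (vecs m) J \<Longrightarrow> s + t \<in> TS m J"
  unfolding TS_def plus_fun_def by blast

lemma TS_left: "x \<in> J \<Longrightarrow> y \<in> vecs m \<Longrightarrow> tensor x y \<in> TS m J"
  using TS_I[OF tspan_pure tspan_zero, of x J y m] by (simp only: add_0_right)

lemma TS_right: "x \<in> vecs m \<Longrightarrow> y \<in> J \<Longrightarrow> tensor x y \<in> TS m J"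
  by (metis TS_I tspan_zero tspan_pure add_0_left)

lemma TS_zero: "0 \<in> TS m J"
  by (metis TS_I tspan_zero add_0_left)

lemma TS_add:
  assumes "S \<in> TS m J" "T \<in> TS m J" shows "S + T \<in> TS m J"
proof -
  obtain s t s' t' where *: "S = (\<lambda>i j. s i j + t i j)" "T = (\<lambda>i j. s' i j + t' i j)"
    "s \<in> tspan J (vecs m)" "t \<in> tspan (vecs m) J" "s' \<in> tspan J (vecs m)" "t' \<in> tspan (vecs m) J"
    using assms unfolding TS_def by blast
  then have "S + T = (\<lambda>i j. (s + s') i j + (t + t') i j)" by (intro ext) (simp add: algebra_simps)
  then show ?thesis unfolding TS_def using * tspan_add by blast
qed

lemma TS_sum: "(\<And>i. i \<in> I \<Longrightarrow> f i \<in> TS m J) \<Longrightarrow> sum f I \<in> TS m J"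
  by (induction I rule: infinite_finite_induct) (auto simp: TS_zero TS_add)

lemma TS_induct [consumes 1, case_names zero add left right]:
  assumes "T \<in> TS m J" and z: "P 0" and add: "\<And>S T. P S \<Longrightarrow> P T \<Longrightarrow> P (S + T)"
    and left: "\<And>a b. a \<in> J \<Longrightarrow> b \<in> vecs m \<Longrightarrow> P (tensor a b)"
    and right: "\<And>a b. a \<in> vecs m \<Longrightarrow> b \<in> J \<Longrightarrow> P (tensor a b)"
  shows "P T"
proof -
  obtain s t where *: "T = (\<lambda>i j. s i j + t i j)" "s \<in> tspan J (vecs m)" "t \<in> tspan (vecs m) J"
    using assms(1) unfolding TS_def by blast
  have "P s" using *(2) by (rule tspan_induct[OF _ z add left])
  moreover have "P t" using *(3) by (rule tspan_induct[OF _ z add right])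
  ultimately have "P (s + t)" by (rule add)
  then show ?thesis using * by (simp add: plus_fun_def)
qed

lemma tensor_scale: "(\<lambda>i j. c * tensor x y i j) = tensor (scV c x) y"
  by (simp add: tensor_def mult.assoc)

lemma TS_scale:
  assumes "subspace_of m J" "T \<in> TS m J" shows "(\<lambda>i j. c * T i j) \<in> TS m J"
  using assms(2)
proof (induction rule: TS_induct)
  case zero
  then show ?case using TS_zero by (simp add: zero_fun_def)
next
  case (add S T)
  then show ?case using TS_add[OF add] by (simp add: plus_fun_def distrib_left)
next
  case (left a b)
  then show ?case unfolding tensor_scale using assms(1) by (intro TS_left subspace_of_scale)
next
  case (right a b)
  then show ?case unfolding tensor_scale by (intro TS_right scV_in_vecs)
qed

text \<open>Functionals vanishing on J descend to H / J, so their product kills the kernel of the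
  quotient map on tensors. Identities in the quotient are turned into scalar identities in this
  way.\<close>

lemma TS_functional:
  assumes T: "T \<in> TS m J" and "\<And>x. x \<in> J \<Longrightarrow> dotp m \<phi> x = 0" "\<And>x. x \<in> J \<Longrightarrow> dotp m \<psi> x = 0"
  shows "(\<Sum>a<m. \<Sum>b<m. \<phi> a * \<psi> b * T a b) = 0"
proof -
  have pure: "(\<Sum>a<m. \<Sum>b<m. \<phi> a * \<psi> b * tensor x y a b) = dotp m \<phi> x * dotp m \<psi> y" for x y
    unfolding dotp_def tensor_def sum_product by (simp add: ac_simps)
  show ?thesis using T
    by (induction rule: TS_induct) (simp_all add: pure assms distrib_left sum.distrib)
qed

subsection \<open>The commutator ideal\<close>

definition two_sided_ideal :: "'k::field hopf_data \<Rightarrow> (nat \<Rightarrow> 'k) set \<Rightarrow> bool" where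
  "two_sided_ideal H K \<longleftrightarrow> subspace_of (hdim H) K \<and>
     (\<forall>x\<in>vecs (hdim H). \<forall>y\<in>K. mulv H x y \<in> K \<and> mulv H y x \<in> K)"

text \<open>The intersection form yields an induction principle: a property holds on the whole ideal
  as soon as the vectors having it form a two-sided ideal that contains all commutators.\<close>

definition commutator_ideal :: "'k::field hopf_data \<Rightarrow> (nat \<Rightarrow> 'k) set" where
  "commutator_ideal H = \<Inter>{K. two_sided_ideal H K \<and> comm_quotient H K}"

context hopf
begin

abbreviation "CI \<equiv> commutator_ideal H"

text \<open>The multiplication of the algebra H \<otimes> H.\<close>

definition tmul :: "(nat \<Rightarrow> nat \<Rightarrow> 'k) \<Rightarrow> (nat \<Rightarrow> nat \<Rightarrow> 'k) \<Rightarrow> nat \<Rightarrow> nat \<Rightarrow> 'k" where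
  "tmul S T = (\<lambda>a b. \<Sum>a1<N. \<Sum>b1<N. \<Sum>a2<N. \<Sum>b2<N. S a1 b1 * T a2 b2 * hm H a1 a2 a * hm H b1 b2 b)"

lemma comulv_mulv: "x \<in> V \<Longrightarrow> y \<in> V \<Longrightarrow> comulv H (mulv H x y) = tmul (comulv H x) (comulv H y)"
  using comulv_mulv_V by (intro ext) (simp add: tmul_def mulv_bas)

lemma mulv_bas_l: "i < N \<Longrightarrow> mulv H (bas i) x l = (\<Sum>j<N. x j * hm H i j l)"
  by (simp add: mulv_def mult.assoc sum_bas_l flip: sum_distrib_left)

lemma mulv_bas_r: "i < N \<Longrightarrow> mulv H x (bas i) l = (\<Sum>j<N. x j * hm H j i l)"
  unfolding mulv_def mult.assoc sum_distrib_left[symmetric] sum_bas_l by simp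

lemma tmul_pure_r: "tmul S (tensor x y)
    = (\<Sum>a1<N. \<Sum>b1<N. tensor (scV (S a1 b1) (mulv H (bas a1) x)) (mulv H (bas b1) y))"
  unfolding tmul_def
  by (intro ext) (simp add: sum_fun_apply tensor_def mulv_bas_l sum_product sum_distrib_left ac_simps)

lemma tmul_pure_l: "tmul (tensor x y) S
    = (\<Sum>a1<N. \<Sum>b1<N. tensor (scV (S a1 b1) (mulv H x (bas a1))) (mulv H y (bas b1)))"
proof -
  have "tmul (tensor x y) S a b = (\<Sum>a1<N. \<Sum>b1<N. \<Sum>a2<N. \<Sum>b2<N.
      x a2 * y b2 * S a1 b1 * hm H a2 a1 a * hm H b2 b1 b)" for a b
    unfolding tmul_def tensor_def by (rule sum_swap4)
  then show ?thesis
    by (intro ext) (simp add: sum_fun_apply tensor_def mulv_bas_r sum_product sum_distrib_left ac_simps)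
qed

lemma tmul_add_r: "tmul S (T + T') = tmul S T + tmul S T'"
  unfolding tmul_def by (intro ext) (simp add: distrib_left distrib_right sum.distrib)

lemma tmul_add_l: "tmul (T + T') S = tmul T S + tmul T' S"
  unfolding tmul_def by (intro ext) (simp add: distrib_left distrib_right sum.distrib)

lemma tmul_zero: "tmul S 0 = 0" "tmul 0 S = 0"
  unfolding tmul_def by (intro ext, simp)+

text \<open>By additivity \<open>T\<close> may be taken to be a pure tensor. Expanding
  \<open>S\<close> in the basis then multiplies each leg by basis vectors, and the leg lying in J
  stays there.\<close>

lemma TS_tmul:
  assumes J: "two_sided_ideal H J" and T: "T \<in> TS N J"
  shows "tmul S T \<in> TS N J" "tmul T S \<in> TS N J"
proof -
  have JV: "subspace_of N J" and ml: "\<And>x y. x \<in> V \<Longrightarrow> y \<in> J \<Longrightarrow> mulv H x y \<in> J"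
    and mr: "\<And>x y. x \<in> V \<Longrightarrow> y \<in> J \<Longrightarrow> mulv H y x \<in> J"
    using J by (auto simp: two_sided_ideal_def)
  show "tmul S T \<in> TS N J" using T
  proof (induction rule: TS_induct)
    case (left a b)
    then show ?case unfolding tmul_pure_r
      by (intro TS_sum TS_left subspace_of_scale[OF JV] ml mulv_V) auto
  next
    case (right a b)
    then show ?case unfolding tmul_pure_r
      by (intro TS_sum TS_right scV_in_vecs ml mulv_V) auto
  qed (simp_all only: tmul_zero tmul_add_r TS_zero TS_add)
  show "tmul T S \<in> TS N J" using T
  proof (induction rule: TS_induct)
    case (left a b)
    then show ?case unfolding tmul_pure_l
      by (intro TS_sum TS_left subspace_of_scale[OF JV] mr mulv_V) auto
  next
    case (right a b)
    then show ?case unfolding tmul_pure_l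
      by (intro TS_sum TS_right scV_in_vecs mr mulv_V) auto
  qed (simp_all only: tmul_zero tmul_add_l TS_zero TS_add)
qed

lemma CI_least: "two_sided_ideal H K \<Longrightarrow> comm_quotient H K \<Longrightarrow> CI \<subseteq> K"
  unfolding commutator_ideal_def by blast

lemma comm_quotient_iff:
  "comm_quotient H K \<longleftrightarrow> (\<forall>x\<in>V. \<forall>y\<in>V. mulv H x y - mulv H y x \<in> K)"
  by (simp add: comm_quotient_def fun_diff_def)

lemma two_sided_V: "two_sided_ideal H V"
  by (auto simp: two_sided_ideal_def subspace_of_vecs mulv_V)

lemma two_sidedI:
  assumes "K \<subseteq> V" "0 \<in> K" "\<And>x y. x \<in> K \<Longrightarrow> y \<in> K \<Longrightarrow> x + y \<in> K" "\<And>c x. x \<in> K \<Longrightarrow> scV c x \<in> K"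
    "\<And>x y. x \<in> V \<Longrightarrow> y \<in> K \<Longrightarrow> mulv H x y \<in> K" "\<And>x y. x \<in> V \<Longrightarrow> y \<in> K \<Longrightarrow> mulv H y x \<in> K"
  shows "two_sided_ideal H K"
  unfolding two_sided_ideal_def subspace_of_iff vs.subspace_def by (intro conjI ballI allI assms)

lemma two_sided_CI: "two_sided_ideal H CI"
proof (rule two_sidedI)
  show "CI \<subseteq> V"
    using CI_least[OF two_sided_V] by (simp add: comm_quotient_iff diff_in_vecs mulv_V)
  have S: "subspace_of N K" if "two_sided_ideal H K" for K
    using that by (simp add: two_sided_ideal_def)
  fix x y c
  show "0 \<in> CI" unfolding commutator_ideal_def using subspace_of_zero[OF S] by blast
  assume x: "x \<in> CI"
  show "scV c x \<in> CI" using x subspace_of_scale[OF S] unfolding commutator_ideal_def by blast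
  show "x + y \<in> CI" if "y \<in> CI"
    using x that subspace_of_add[OF S] unfolding commutator_ideal_def by blast
  show "mulv H y x \<in> CI" "mulv H x y \<in> CI" if "y \<in> V" using x that
    by (simp_all add: commutator_ideal_def two_sided_ideal_def)
qed

lemma comm_CI: "comm_quotient H CI"
  unfolding commutator_ideal_def comm_quotient_def by blast

text \<open>The vectors whose comultiplication vanishes modulo the commutator ideal form a two-sided
  ideal, because \<Delta> is an algebra map. They include all commutators, because a tensor product
  of commutative algebras is commutative.\<close>

lemma comulv_CI:
  assumes "x \<in> CI" shows "comulv H x \<in> TS N CI"
proof -
  have JV: "subspace_of N CI" using two_sided_CI by (simp add: two_sided_ideal_def)
  let ?K = "{x \<in> V. comulv H x \<in> TS N CI}"
  have "two_sided_ideal H ?K"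
  proof (rule two_sidedI)
    have "comulv H 0 = 0" by (intro ext) (simp add: comulv_zero)
    then show "0 \<in> ?K" using TS_zero[of N CI] zero_in_vecs[of N] by (simp only: mem_Collect_eq)
    show "scV c x \<in> ?K" if "x \<in> ?K" for c x
      using that TS_scale[OF JV, of "comulv H x" c]
      by (simp add: scV_in_vecs) (simp add: comulv_scale[abs_def] fun_eq_iff comulv_scale)
    show "mulv H x y \<in> ?K" if "x \<in> V" "y \<in> ?K" for x y
      using that TS_tmul[OF two_sided_CI] by (simp add: comulv_mulv mulv_V)
    show "mulv H y x \<in> ?K" if "x \<in> V" "y \<in> ?K" for x y
      using that TS_tmul[OF two_sided_CI] by (simp add: comulv_mulv mulv_V)
  qed (auto simp: comulv_add TS_add add_in_vecs)
  moreover have "comm_quotient H ?K"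
    unfolding comm_quotient_iff
  proof (intro ballI CollectI conjI)
    fix x y assume xy: "x \<in> V" "y \<in> V"
    show "mulv H x y - mulv H y x \<in> V" by (simp add: diff_in_vecs mulv_V)
    let ?D = "\<lambda>a1 a2 b1 b2. comulv H x a1 b1 * comulv H y a2 b2"
    have "tmul (comulv H y) (comulv H x) a b = (\<Sum>a1<N. \<Sum>b1<N. \<Sum>a2<N. \<Sum>b2<N.
        ?D a1 a2 b1 b2 * hm H a2 a1 a * hm H b2 b1 b)" for a b
      unfolding tmul_def by (subst sum_swap4) (simp add: mult.commute)
    \<comment> \<open>With a \<otimes> b from \<Delta>(x) and c \<otimes> d from \<Delta>(y), the
      summand ac \<otimes> bd - ca \<otimes> db is written as [a,c] \<otimes> bd + ca \<otimes>
      [b,d], which has a commutator in one leg of each term.\<close>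
    then have "comulv H (mulv H x y - mulv H y x) = (\<Sum>a1<N. \<Sum>b1<N. \<Sum>a2<N. \<Sum>b2<N.
        tensor (scV (?D a1 a2 b1 b2) (mulv H (bas a1) (bas a2) - mulv H (bas a2) (bas a1))) (mulv H (bas b1) (bas b2))
      + tensor (scV (?D a1 a2 b1 b2) (mulv H (bas a2) (bas a1))) (mulv H (bas b1) (bas b2) - mulv H (bas b2) (bas b1)))"
      unfolding comulv_diff comulv_mulv[OF xy] comulv_mulv[OF xy(2,1)]
      by (intro ext) (simp add: sum_fun_apply tmul_def tensor_def mulv_bas algebra_simps
          flip: sum_subtractf sum.distrib)
    also have "\<dots> \<in> TS N CI"
      using comm_CI unfolding comm_quotient_iff
      by (intro TS_sum TS_add TS_left TS_right subspace_of_scale[OF JV] scV_in_vecs mulv_V) auto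
    finally show "comulv H (mulv H x y - mulv H y x) \<in> TS N CI" .
  qed
  ultimately show ?thesis using CI_least assms by blast
qed

lemma counitv_CI:
  assumes "x \<in> CI" shows "counitv H x = 0"
proof -
  let ?K = "{x \<in> V. counitv H x = 0}"
  have "two_sided_ideal H ?K"
    by (rule two_sidedI) (auto simp: counitv_add add_in_vecs scV_in_vecs counitv_scale counitv_mulv mulv_V)
  moreover have "comm_quotient H ?K"
    unfolding comm_quotient_iff by (auto simp: diff_in_vecs mulv_V counitv_diff counitv_mulv)
  ultimately show ?thesis using CI_least assms by blast
qed

lemma antipv_CI:
  assumes "x \<in> CI" shows "antipv H x \<in> CI"
proof -
  have JV: "subspace_of N CI" and J: "\<And>x y. x \<in> V \<Longrightarrow> y \<in> CI \<Longrightarrow> mulv H x y \<in> CI"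
    "\<And>x y. x \<in> V \<Longrightarrow> y \<in> CI \<Longrightarrow> mulv H y x \<in> CI"
    using two_sided_CI by (auto simp: two_sided_ideal_def)
  let ?K = "{x \<in> V. antipv H x \<in> CI}"
  have "two_sided_ideal H ?K"
    by (rule two_sidedI)
      (auto simp: antipv_add add_in_vecs scV_in_vecs antipv_scale antipv_mulv mulv_V
        subspace_of_zero[OF JV] subspace_of_add[OF JV] subspace_of_scale[OF JV] antipv_V J)
  moreover have "comm_quotient H ?K"
    using comm_CI unfolding comm_quotient_iff
    by (auto simp: diff_in_vecs mulv_V antipv_diff antipv_mulv antipv_V)
  ultimately show ?thesis using CI_least assms by blast
qed

text \<open>The ideal generated by the commutators turns out to be a Hopf ideal, hence it is least
  among the Hopf ideals with commutative quotient. It replaces the definite description from here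
  on.\<close>

lemma ab_ideal_eq: "ab_ideal H = CI"
proof -
  have h: "hopf_ideal H CI"
    using two_sided_CI comulv_CI counitv_CI antipv_CI
    unfolding hopf_ideal_def two_sided_ideal_def TS_def by blast
  have least: "CI \<subseteq> I" if "hopf_ideal H I" "comm_quotient H I" for I
    by (rule CI_least) (use that in \<open>auto simp: hopf_ideal_def two_sided_ideal_def\<close>)
  show ?thesis unfolding ab_ideal_def
  proof (rule the_equality)
    show "hopf_ideal H CI \<and> comm_quotient H CI \<and> (\<forall>I. hopf_ideal H I \<and> comm_quotient H I \<longrightarrow> CI \<subseteq> I)"
      using h comm_CI least by blast
  next
    fix J assume "hopf_ideal H J \<and> comm_quotient H J \<and> (\<forall>I. hopf_ideal H I \<and> comm_quotient H I \<longrightarrow> J \<subseteq> I)"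
    then show "J = CI" using h comm_CI least by (meson subset_antisym)
  qed
qed

end

section \<open>Dual bases and tensors supported on a subspace\<close>

lemma dual_basis:
  fixes B :: "(nat \<Rightarrow> 'k::field) set"
  assumes B: "vs.independent B" "B \<subseteq> vecs m"
  obtains \<psi> where "\<And>b b'. b \<in> B \<Longrightarrow> b' \<in> B \<Longrightarrow> dotp m (\<psi> b) b' = (if b' = b then 1 else 0)"
    and "\<And>x. x \<in> vs.span B \<Longrightarrow> x = (\<Sum>b\<in>B. scV (dotp m (\<psi> b) x) b)"
proof -
  have "\<forall>b. \<exists>\<phi>. \<forall>b'\<in>B. dotp m \<phi> b' = (if b' = b then 1 else 0)"
    by (intro allI functional_extend[OF B])
  then obtain \<psi> where \<psi>: "\<And>b b'. b' \<in> B \<Longrightarrow> dotp m (\<psi> b) b' = (if b' = b then 1 else 0)"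
    by metis
  have fin: "finite B" using independent_finite[OF B] by simp
  have "x = (\<Sum>b\<in>B. scV (dotp m (\<psi> b) x) b)" if x: "x \<in> vs.span B" for x
  proof -
    obtain u where u: "x = (\<Sum>b\<in>B. scV (u b) b)" using x vs.span_finite[OF fin] by auto
    have "dotp m (\<psi> b) x = u b" if "b \<in> B" for b
    proof -
      have "dotp m (\<psi> b) x = (\<Sum>b'\<in>B. if b' = b then u b' else 0)"
        unfolding u dotp_sum dotp_scale by (rule sum.cong) (auto simp: \<psi>)
      then show ?thesis using fin that by simp
    qed
    then have "(\<Sum>b\<in>B. scV (dotp m (\<psi> b) x) b) = (\<Sum>b\<in>B. scV (u b) b)"
      by (intro sum.cong refl) (simp only:)
    then show ?thesis using u by (simp only:)
  qed
  then show ?thesis using that \<psi> by blast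
qed

text \<open>Over a field, D \<otimes> H and H \<otimes> D meet in D \<otimes> D. Expanding the rows
  in a basis of \<open>D\<close> leaves coefficient vectors that are linear combinations of the
  columns, hence lie in \<open>D\<close> as well.\<close>

lemma tspan_if_rows_cols:
  fixes T :: "nat \<Rightarrow> nat \<Rightarrow> 'k::field"
  assumes D: "subspace_of m D" and rows: "\<And>a. T a \<in> D" and cols: "\<And>b. (\<lambda>a. T a b) \<in> D"
  shows "T \<in> tspan D D"
proof -
  obtain B where B: "B \<subseteq> D" "vs.independent B" "D \<subseteq> vs.span B"
    using vs.maximal_independent_subset[of D] by blast
  have BV: "B \<subseteq> vecs m" using B D by (auto simp: subspace_of_iff)
  obtain \<psi> where \<psi>: "\<And>x. x \<in> vs.span B \<Longrightarrow> x = (\<Sum>b\<in>B. scV (dotp m (\<psi> b) x) b)"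
    using dual_basis[OF B(2) BV] by metis
  have "T = (\<Sum>b\<in>B. tensor (\<lambda>a. dotp m (\<psi> b) (T a)) b)"
  proof (intro ext)
    fix a c
    have "T a = (\<Sum>b\<in>B. scV (dotp m (\<psi> b) (T a)) b)" using \<psi>[of "T a"] rows B(3) by blast
    from fun_cong[OF this, of c] show "T a c = (\<Sum>b\<in>B. tensor (\<lambda>a. dotp m (\<psi> b) (T a)) b) a c"
      by (simp add: sum_fun_apply tensor_def)
  qed
  also have "\<dots> \<in> tspan D D"
  proof (intro tspan_sum tspan_pure)
    fix b assume "b \<in> B"
    then show "b \<in> D" using B by blast
    have "(\<lambda>a. dotp m (\<psi> b) (T a)) = (\<Sum>j<m. scV (\<psi> b j) (\<lambda>a. T a j))"
      by (rule ext) (simp add: dotp_def sum_fun_apply)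
    also have "\<dots> \<in> D" by (intro subspace_of_sum[OF D] subspace_of_scale[OF D] cols)
    finally show "(\<lambda>a. dotp m (\<psi> b) (T a)) \<in> D" .
  qed
  finally show ?thesis .
qed

lemma tspan_subspace_pure:
  assumes "T \<in> tspan {scV c w | c. True} {scV c w | c. True}"
  shows "\<exists>c. T = (\<lambda>i j. c * w i * w j)"
  using assms
proof (induction rule: tspan_induct)
  case zero
  show ?case by (rule exI[of _ 0]) (simp add: fun_eq_iff)
next
  case (add S T)
  then obtain c d where "S = (\<lambda>i j. c * w i * w j)" "T = (\<lambda>i j. d * w i * w j)" by blast
  then have "S + T = (\<lambda>i j. (c + d) * w i * w j)" by (simp add: fun_eq_iff algebra_simps)
  then show ?case by blast
next
  case (pure a b)
  then obtain c d where "a = scV c w" "b = scV d w" by blast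
  then have "tensor a b = (\<lambda>i j. (c * d) * w i * w j)" by (simp add: fun_eq_iff tensor_def algebra_simps)
  then show ?case by blast
qed

context hopf
begin

subsection \<open>Left coideals of a pointed Hopf algebra\<close>

abbreviation "GL \<equiv> grouplikes H"

lemma comulv_row:
  assumes "x \<in> V"
  shows "comulv H (comulv H x a) b c = (\<Sum>l<N. comulv H x l c * hc H l a b)"
proof -
  have "comulv H (comulv H x a) b c = (\<Sum>l<N. comulv H x a l * hc H l b c)"
    unfolding comulv_def[of H "comulv H x a"] ..
  also have "\<dots> = (\<Sum>l<N. comulv H x l c * hc H l a b)"
    using coassoc_V assms by (simp add: comulv_bas)
  finally show ?thesis .
qed

lemma counitv_dotp: "counitv H x = dotp N (he H) x"
  by (simp add: counitv_def dotp_def mult.commute)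

lemma counit_left: "x \<in> V \<Longrightarrow> (\<Sum>a<N. he H a * comulv H x a b) = x b"
  using counit_V1 by (simp add: counitv_bas)

lemma counit_right: "x \<in> V \<Longrightarrow> (\<Sum>b<N. comulv H x a b * he H b) = x a"
  using counit_V2 by (simp add: counitv_bas)

lemma grouplikeD:
  assumes "g \<in> GL"
  shows "g \<in> V" "g \<noteq> 0" "comulv H g a b = g a * g b" "counitv H g = 1"
proof -
  show 1: "g \<in> V" "g \<noteq> 0" and 2: "comulv H g a b = g a * g b" for a b
    using assms by (auto simp: grouplikes_def tensor_def zero_fun_def)
  obtain b where b: "g b \<noteq> 0" using 1(2) by (auto simp: fun_eq_iff)
  have "counitv H g * g b = (\<Sum>a<N. he H a * comulv H g a b)"
    by (simp add: 2 counitv_def sum_distrib_left sum_distrib_right ac_simps)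
  also have "\<dots> = g b" by (rule counit_left[OF 1(1)])
  finally have "counitv H g * g b = g b" .
  then show "counitv H g = 1" using b by simp
qed

text \<open>The product of the dual algebra of H, that is (\<phi> \<otimes> \<psi>)\<Delta>,
  evaluated on the basis.\<close>

definition fconv :: "(nat \<Rightarrow> 'k) \<Rightarrow> (nat \<Rightarrow> 'k) \<Rightarrow> nat \<Rightarrow> 'k" where
  "fconv \<phi> \<psi> i = (\<Sum>a<N. \<Sum>b<N. hc H i a b * \<phi> a * \<psi> b)"

lemma dotp_fconv: "dotp N (fconv \<phi> \<psi>) x = (\<Sum>a<N. \<Sum>b<N. \<phi> a * \<psi> b * comulv H x a b)"
proof -
  have "dotp N (fconv \<phi> \<psi>) x = (\<Sum>i<N. \<Sum>a<N. \<Sum>b<N. \<phi> a * \<psi> b * (x i * hc H i a b))"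
    unfolding dotp_def fconv_def by (simp add: sum_distrib_left sum_distrib_right ac_simps)
  also have "\<dots> = (\<Sum>a<N. \<Sum>b<N. \<Sum>i<N. \<phi> a * \<psi> b * (x i * hc H i a b))"
    by (subst sum.swap, rule sum.cong[OF refl], rule sum.swap)
  finally show ?thesis by (simp add: comulv_def sum_distrib_left)
qed

lemma dotp_fconv_grouplike:
  "g \<in> GL \<Longrightarrow> dotp N (fconv \<phi> \<psi>) g = dotp N \<phi> g * dotp N \<psi> g"
  unfolding dotp_fconv by (simp add: grouplikeD dotp_def sum_product ac_simps)

text \<open>The map sending x to (\<phi> \<otimes> id)\<Delta>(x). It makes H a right module over
  its dual algebra, which is why \<open>act_act\<close> reverses the order of the
  functionals.\<close>

definition act :: "(nat \<Rightarrow> 'k) \<Rightarrow> (nat \<Rightarrow> 'k) \<Rightarrow> nat \<Rightarrow> 'k" where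
  "act \<phi> x = (\<Sum>a<N. scV (\<phi> a) (comulv H x a))"

lemma act_apply: "act \<phi> x b = (\<Sum>a<N. \<phi> a * comulv H x a b)"
  by (simp add: act_def sum_fun_apply)

lemma act_add: "act \<phi> (x + y) = act \<phi> x + act \<phi> y"
  by (rule ext) (simp add: act_apply comulv_add distrib_left sum.distrib)

lemma act_diff: "act \<phi> (x - y) = act \<phi> x - act \<phi> y"
  by (rule ext) (simp add: act_apply comulv_diff right_diff_distrib sum_subtractf)

lemma act_scale: "act \<phi> (scV c x) = scV c (act \<phi> x)"
  by (rule ext) (simp add: act_apply comulv_scale sum_distrib_left ac_simps)

lemma act_add_left: "act (\<phi> + \<psi>) x = act \<phi> x + act \<psi> x"
  by (rule ext) (simp add: act_apply distrib_right sum.distrib)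

lemma act_diff_left: "act (\<phi> - \<psi>) x = act \<phi> x - act \<psi> x"
  by (rule ext) (simp add: act_apply left_diff_distrib sum_subtractf)

lemma act_zero [simp]: "act \<phi> 0 = 0"
  by (rule ext) (simp add: act_apply comulv_zero)

lemma act_he: "x \<in> V \<Longrightarrow> act (he H) x = x"
  by (rule ext) (simp add: act_apply counit_left)

lemma act_act:
  assumes x: "x \<in> V"
  shows "act \<phi> (act \<psi> x) = act (fconv \<psi> \<phi>) x"
proof
  fix c
  have "act \<phi> (act \<psi> x) c = (\<Sum>b<N. \<Sum>a<N. \<Sum>l<N. \<phi> b * (\<psi> a * (comulv H x l c * hc H l a b)))"
    unfolding act_apply act_def[of \<psi>] comulv_sum comulv_scale comulv_row[OF x]
    by (simp add: sum_distrib_left)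
  also have "\<dots> = (\<Sum>a<N. \<Sum>b<N. \<Sum>l<N. \<phi> b * (\<psi> a * (comulv H x l c * hc H l a b)))"
    by (rule sum.swap)
  also have "\<dots> = (\<Sum>a<N. \<Sum>l<N. \<Sum>b<N. \<phi> b * (\<psi> a * (comulv H x l c * hc H l a b)))"
    by (rule sum.cong[OF refl], rule sum.swap)
  also have "\<dots> = (\<Sum>l<N. \<Sum>a<N. \<Sum>b<N. \<phi> b * (\<psi> a * (comulv H x l c * hc H l a b)))"
    by (rule sum.swap)
  also have "\<dots> = act (fconv \<psi> \<phi>) x c"
    unfolding act_apply fconv_def sum_distrib_right by (intro sum.cong refl) (simp add: ac_simps)
  finally show "act \<phi> (act \<psi> x) c = act (fconv \<psi> \<phi>) x c" .
qed

lemma dotp_act: "x \<in> V \<Longrightarrow> dotp N \<phi> (act \<psi> x) = dotp N (fconv \<psi> \<phi>) x"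
  unfolding dotp_fconv dotp_def[of N \<phi>] act_apply
  by (subst sum.swap) (simp add: sum_distrib_left ac_simps)

text \<open>\<open>comulv H x a\<close> is the slice of \<Delta>(x) at the a-th coordinate of the
  first factor, so the condition says that \<Delta>(X) lies in H \<otimes> X. Equivalently X is a
  submodule for \<open>act\<close>.\<close>

definition lcoideal :: "(nat \<Rightarrow> 'k) set \<Rightarrow> bool" where
  "lcoideal X \<longleftrightarrow> subspace_of N X \<and> (\<forall>x\<in>X. \<forall>a. comulv H x a \<in> X)"

lemma act_closed: "lcoideal X \<Longrightarrow> x \<in> X \<Longrightarrow> act \<phi> x \<in> X"
  unfolding act_def lcoideal_def by (auto intro!: subspace_of_sum subspace_of_scale)

lemma row_eq_act: "a < N \<Longrightarrow> comulv H x a = act (bas a) x"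
  by (rule ext) (simp add: act_apply sum_bas_l)

lemma row_out: "N \<le> a \<Longrightarrow> comulv H x a = 0"
  by (rule ext) (simp add: comulv_out)

lemma lcoidealI:
  assumes X: "subspace_of N X" and "\<And>\<phi> x. x \<in> X \<Longrightarrow> act \<phi> x \<in> X"
  shows "lcoideal X"
  unfolding lcoideal_def
proof (intro conjI ballI allI)
  fix x a assume "x \<in> X"
  then show "comulv H x a \<in> X"
    using assms(2)[of x "bas a"] subspace_of_zero[OF X]
    by (cases "a < N") (simp_all only: row_eq_act row_out not_less)
qed fact

text \<open>A nonzero subcoalgebra of least dimension inside \<open>D\<close> is simple, hence a
  line by pointedness. A spanning vector w satisfies \<Delta>(w) = c w \<otimes> w; the counit
  forces c to be nonzero, and c w is then group-like.\<close>

lemma simple_subcoalgebra_grouplike: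
  assumes p: "pointed H" and D: "subcoalgebra H D" "D \<noteq> {0}"
  shows "\<exists>g\<in>GL. g \<in> D"
proof -
  let ?P = "\<lambda>E. subcoalgebra H E \<and> E \<noteq> {0} \<and> E \<subseteq> D"
  obtain E where E: "?P E" and least: "\<And>E'. ?P E' \<Longrightarrow> sdim E \<le> sdim E'"
    using ex_has_least_nat[of ?P D sdim] D by blast
  have sub: "subspace_of N E'" if "subcoalgebra H E'" for E' using that by (simp add: subcoalgebra_def)
  have "E' = {0} \<or> E' = E" if "subcoalgebra H E'" "E' \<subseteq> E" for E'
    using that least[of E'] E sdim_less[OF sub sub, of E' E] by (metis not_less order_trans psubsetI)
  then have "simple_subcoalgebra H E"
    unfolding simple_subcoalgebra_def using E by (simp add: zero_fun_def)
  then obtain w where w: "w \<noteq> 0" "E = {scV c w | c. True}"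
    using p unfolding pointed_def scV_def zero_fun_def by blast
  have wE: "w \<in> E" using w(2) by (auto intro: exI[of _ 1])
  then have wV: "w \<in> V" using sub E subspace_of_subset by blast
  have "comulv H w \<in> tspan E E" using E wE by (simp add: subcoalgebra_def)
  then obtain c where c: "comulv H w = (\<lambda>i j. c * w i * w j)"
    using tspan_subspace_pure[of "comulv H w" w] w(2) by auto
  have "c \<noteq> 0"
  proof
    assume "c = 0"
    then have "w b = 0" for b using counit_left[OF wV, of b] by (simp add: c)
    then show False using w by auto
  qed
  have "scV c w \<in> GL" unfolding grouplikes_def
  proof (intro CollectI conjI)
    show "scV c w \<in> V" using wV by (rule scV_in_vecs)
    show "scV c w \<noteq> (\<lambda>_. 0)" using w(1) \<open>c \<noteq> 0\<close> by (auto simp: fun_eq_iff)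
    show "comulv H (scV c w) = tensor (scV c w) (scV c w)"
      by (intro ext) (simp add: comulv_scale c tensor_def)
  qed
  moreover have "scV c w \<in> D" using E w(2) by blast
  ultimately show ?thesis by blast
qed

text \<open>The coefficient coalgebra of the simple comodule Y / X contains a group-like g. The ideal of
  functionals vanishing at g cannot act on Y / X transitively, since otherwise one of these
  functionals would act as the identity and hence agree with the counit at g.\<close>

lemma coideal_step:
  assumes p: "pointed H" and X: "lcoideal X" "X \<noteq> V"
  shows "\<exists>v\<in>V - X. \<exists>g\<in>GL. \<forall>a. comulv H v a - scV (g a) v \<in> X"
proof -
  have XV: "subspace_of N X" using X by (simp add: lcoideal_def)
  \<comment> \<open>\<open>Y\<close> will be a left coideal of least dimension strictly above
    \<open>X\<close>, which makes Y / X a simple comodule.\<close>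
  let ?P = "\<lambda>Y. lcoideal Y \<and> X \<subset> Y"
  have "lcoideal V" by (auto simp: lcoideal_def subspace_of_vecs row_V)
  moreover have "X \<subset> V" using X XV by (auto simp: subspace_of_iff)
  ultimately obtain Y where Y: "lcoideal Y" "X \<subset> Y" and least: "\<And>Z. ?P Z \<Longrightarrow> sdim Y \<le> sdim Z"
    using ex_has_least_nat[of ?P V sdim] by blast
  have YV: "subspace_of N Y" using Y by (simp add: lcoideal_def)
  have YinV: "y \<in> Y \<Longrightarrow> y \<in> V" for y using YV subspace_of_subset by blast
  have Ymin: "Z = Y" if "lcoideal Z" "X \<subset> Z" "Z \<subseteq> Y" for Z
    using that least[of Z] sdim_less[of N Z Y] YV by (auto simp: lcoideal_def)
  \<comment> \<open>The elements (id \<otimes> \<phi>)\<Delta>(v), for v in Y and \<phi> zero on X,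
    are the matrix coefficients of Y / X; their span \<open>D\<close> is the coefficient
    coalgebra.\<close>
  let ?gen = "{(\<lambda>a. dotp N \<phi> (comulv H v a)) | v \<phi>. v \<in> Y \<and> (\<forall>x\<in>X. dotp N \<phi> x = 0)}"
  define D where "D = vs.span ?gen"
  have gen_V: "?gen \<subseteq> V"
    by (auto simp: vecs_def row_out)
  have DV: "subspace_of N D"
    unfolding subspace_of_iff D_def
    using gen_V vs.span_minimal[OF gen_V] subspace_of_vecs[of N] by (auto simp: subspace_of_iff)
  have key: "comulv H (\<lambda>a. dotp N \<phi> (comulv H v a)) a b = dotp N \<phi> (comulv H (comulv H v a) b)"
    if "v \<in> Y" for v \<phi> a b
  proof -
    have "comulv H (\<lambda>a. dotp N \<phi> (comulv H v a)) a b = (\<Sum>i<N. \<Sum>j<N. \<phi> j * (comulv H v i j * hc H i a b))"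
      by (subst comulv_def) (simp add: dotp_def sum_distrib_left sum_distrib_right ac_simps)
    also have "\<dots> = (\<Sum>j<N. \<Sum>i<N. \<phi> j * (comulv H v i j * hc H i a b))" by (rule sum.swap)
    also have "\<dots> = dotp N \<phi> (comulv H (comulv H v a) b)"
      unfolding dotp_def comulv_row[OF YinV[OF that]] by (simp add: sum_distrib_left)
    finally show ?thesis .
  qed
  have rows: "comulv H d a \<in> D" if "d \<in> D" for d a
  proof -
    have "vs.subspace {d. comulv H d a \<in> D}"
    proof -
      have "comulv H 0 a = 0" "comulv H (x + y) a = comulv H x a + comulv H y a"
        "comulv H (scV c x) a = scV c (comulv H x a)" for x y c
        by (rule ext, simp add: comulv_zero comulv_add comulv_scale)+
      then show ?thesis unfolding vs.subspace_def D_def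
        by (auto simp only: vs.span_zero vs.span_add vs.span_scale mem_Collect_eq)
    qed
    moreover have "?gen \<subseteq> {d. comulv H d a \<in> D}"
    proof clarify
      fix v \<phi> assume v: "v \<in> Y" and \<phi>: "\<forall>x\<in>X. dotp N \<phi> x = 0"
      have "comulv H (\<lambda>a. dotp N \<phi> (comulv H v a)) a = (\<lambda>b. dotp N \<phi> (comulv H (comulv H v a) b))"
        using key[OF v] by blast
      moreover have "comulv H v a \<in> Y" using Y v by (auto simp: lcoideal_def)
      ultimately show "comulv H (\<lambda>a. dotp N \<phi> (comulv H v a)) a \<in> D"
        unfolding D_def using \<phi> by (auto intro!: vs.span_base)
    qed
    ultimately have "D \<subseteq> {d. comulv H d a \<in> D}" unfolding D_def by (rule vs.span_minimal[rotated])
    then show ?thesis using that by blast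
  qed
  have cols: "(\<lambda>a. comulv H d a b) \<in> D" if "d \<in> D" for d b
  proof -
    have "vs.subspace {d. (\<lambda>a. comulv H d a b) \<in> D}"
    proof -
      have "(\<lambda>a. comulv H 0 a b) = 0" "(\<lambda>a. comulv H (x + y) a b) = (\<lambda>a. comulv H x a b) + (\<lambda>a. comulv H y a b)"
        "(\<lambda>a. comulv H (scV c x) a b) = scV c (\<lambda>a. comulv H x a b)" for x y c
        by (rule ext, simp add: comulv_zero comulv_add comulv_scale)+
      then show ?thesis unfolding vs.subspace_def D_def
        by (auto simp only: vs.span_zero vs.span_add vs.span_scale mem_Collect_eq)
    qed
    moreover have "?gen \<subseteq> {d. (\<lambda>a. comulv H d a b) \<in> D}"
    proof clarify
      fix v \<phi> assume v: "v \<in> Y" and \<phi>: "\<forall>x\<in>X. dotp N \<phi> x = 0"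
      \<comment> \<open>A column of the comultiplication of a coefficient is again a coefficient of
        the same v: \<open>\<phi>'\<close> is \<phi> applied to the b-th slice, and it kills X
        because X is a left coideal.\<close>
      define \<phi>' where "\<phi>' l = dotp N \<phi> (hc H l b)" for l
      have d: "dotp N \<phi>' x = dotp N \<phi> (comulv H x b)" for x
      proof -
        have "dotp N \<phi>' x = (\<Sum>l<N. \<Sum>j<N. \<phi> j * (x l * hc H l b j))"
          unfolding dotp_def \<phi>'_def by (simp add: sum_distrib_left sum_distrib_right ac_simps)
        also have "\<dots> = (\<Sum>j<N. \<Sum>l<N. \<phi> j * (x l * hc H l b j))" by (rule sum.swap)
        finally show ?thesis by (simp add: dotp_def comulv_def sum_distrib_left)
      qed
      then have "\<forall>x\<in>X. dotp N \<phi>' x = 0" using \<phi> X by (auto simp: lcoideal_def)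
      moreover have "(\<lambda>a. comulv H (\<lambda>a. dotp N \<phi> (comulv H v a)) a b) = (\<lambda>a. dotp N \<phi>' (comulv H v a))"
        unfolding key[OF v] d ..
      ultimately show "(\<lambda>a. comulv H (\<lambda>a. dotp N \<phi> (comulv H v a)) a b) \<in> D"
        unfolding D_def using v by (auto intro!: vs.span_base)
    qed
    ultimately have "D \<subseteq> {d. (\<lambda>a. comulv H d a b) \<in> D}" unfolding D_def by (rule vs.span_minimal[rotated])
    then show ?thesis using that by blast
  qed
  have subD: "subcoalgebra H D"
    unfolding subcoalgebra_def using DV tspan_if_rows_cols[OF DV] rows cols by blast
  have "D \<noteq> {0}"
  proof
    assume D0: "D = {0}"
    obtain v where v: "v \<in> Y" "v \<notin> X" using Y by blast
    obtain \<phi> where \<phi>: "\<forall>x\<in>X. dotp N \<phi> x = 0" "dotp N \<phi> v = 1"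
      using separating_functional[OF XV YinV[OF v(1)] v(2)] by blast
    have "(\<lambda>a. dotp N \<phi> (comulv H v a)) \<in> D" unfolding D_def using v \<phi> by (auto intro!: vs.span_base)
    then have z: "dotp N \<phi> (comulv H v a) = 0" for a using D0 by (metis singletonD zero_fun_apply)
    have "dotp N \<phi> v = dotp N \<phi> (act (he H) v)" by (simp add: act_he YinV v)
    also have "\<dots> = 0" unfolding act_def dotp_sum dotp_scale by (simp add: z)
    finally show False using \<phi> by simp
  qed
  then obtain g where g: "g \<in> GL" "g \<in> D" using simple_subcoalgebra_grouplike[OF p subD] by blast
  \<comment> \<open>A functional that acts as zero on Y / X kills every matrix coefficient, hence
    all of \<open>D\<close> and the group-like g in it.\<close>
  have ann: "dotp N \<phi> g = 0" if "\<And>y. y \<in> Y \<Longrightarrow> act \<phi> y \<in> X" for \<phi>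
  proof -
    have "vs.subspace {d. dotp N \<phi> d = 0}" by (auto simp: vs.subspace_def dotp_add dotp_scale)
    moreover have "?gen \<subseteq> {d. dotp N \<phi> d = 0}"
    proof clarify
      fix v \<psi> assume v: "v \<in> Y" and \<psi>: "\<forall>x\<in>X. dotp N \<psi> x = 0"
      have "dotp N \<phi> (\<lambda>a. dotp N \<psi> (comulv H v a)) = dotp N \<psi> (act \<phi> v)"
        unfolding act_def dotp_sum dotp_scale by (simp add: dotp_def[of N \<phi>])
      also have "\<dots> = 0" using \<psi> that v by blast
      finally show "dotp N \<phi> (\<lambda>a. dotp N \<psi> (comulv H v a)) = 0" .
    qed
    ultimately have "D \<subseteq> {d. dotp N \<phi> d = 0}" unfolding D_def by (rule vs.span_minimal[rotated])
    then show ?thesis using g by blast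
  qed
  \<comment> \<open>The kernel of evaluation at g. Evaluation at a group-like is multiplicative, so
    this is an ideal of the dual algebra.\<close>
  define Q where "Q = {\<phi>. dotp N \<phi> g = 0}"
  have dl: "dotp N (\<phi> + \<psi>) g = dotp N \<phi> g + dotp N \<psi> g" "dotp N (\<phi> - \<psi>) g = dotp N \<phi> g - dotp N \<psi> g" for \<phi> \<psi>
    by (simp_all add: dotp_def algebra_simps sum.distrib sum_subtractf)
  have "\<exists>v\<in>Y - X. \<forall>\<phi>\<in>Q. act \<phi> v \<in> X"
  proof (rule ccontr)
    assume neg: "\<not> ?thesis"
    \<comment> \<open>By \<open>neg\<close>, some element of Q moves w outside X. So Q w + X is a
      left coideal strictly between X and Y or equal to Y; by minimality it is Y and contains w
      itself.\<close>
    have fix1: "\<exists>\<phi>\<in>Q. act \<phi> w - w \<in> X" if w: "w \<in> Y" "w \<notin> X" for w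
    proof -
      define Z where "Z = {act \<phi> w + x | \<phi> x. \<phi> \<in> Q \<and> x \<in> X}"
      have Q0: "0 \<in> Q" by (simp add: Q_def dotp_def)
      have Qs: "scV c \<phi> \<in> Q" if "\<phi> \<in> Q" for c \<phi>
        using that by (simp add: Q_def dotp_def mult.assoc flip: sum_distrib_left)
      have as: "act (scV c \<phi>) w = scV c (act \<phi> w)" for c \<phi>
        by (rule ext) (simp add: act_apply sum_distrib_left mult.assoc)
      have a0: "act 0 w = 0" by (rule ext) (simp add: act_apply)
      have ZY: "Z \<subseteq> Y" unfolding Z_def
        using Y w act_closed[OF Y(1)] subspace_of_add[OF YV] by blast
      have "vs.subspace Z"
        unfolding vs.subspace_def
      proof (intro conjI ballI allI)
        show "0 \<in> Z" unfolding Z_def using Q0 a0 subspace_of_zero[OF XV] by (metis (mono_tags, lifting) CollectI add_0_left)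
      next
        fix z z' assume "z \<in> Z" "z' \<in> Z"
        then obtain \<phi> x \<phi>' x' where *: "z = act \<phi> w + x" "z' = act \<phi>' w + x'" "\<phi> \<in> Q" "\<phi>' \<in> Q" "x \<in> X" "x' \<in> X"
          unfolding Z_def by blast
        have "z + z' = act (\<phi> + \<phi>') w + (x + x')" unfolding * act_add_left by (simp only: ac_simps)
        moreover have "\<phi> + \<phi>' \<in> Q" using * by (simp add: Q_def dl)
        ultimately show "z + z' \<in> Z" unfolding Z_def using * subspace_of_add[OF XV] by blast
      next
        fix c z assume "z \<in> Z"
        then obtain \<phi> x where *: "z = act \<phi> w + x" "\<phi> \<in> Q" "x \<in> X" unfolding Z_def by blast
        then have "scV c z = act (scV c \<phi>) w + scV c x" by (simp only: as vs.scale_right_distrib)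
        then show "scV c z \<in> Z" unfolding Z_def using * Qs subspace_of_scale[OF XV] by blast
      qed
      then have ZV: "subspace_of N Z" using ZY YV by (auto simp: subspace_of_iff)
      have "lcoideal Z"
      proof (rule lcoidealI[OF ZV])
        fix \<psi> z assume "z \<in> Z"
        then obtain \<phi> x where *: "z = act \<phi> w + x" "\<phi> \<in> Q" "x \<in> X" unfolding Z_def by blast
        have "act \<psi> z = act (fconv \<phi> \<psi>) w + act \<psi> x"
          unfolding * act_add act_act[OF YinV[OF w(1)]] ..
        moreover have "fconv \<phi> \<psi> \<in> Q" using * g by (simp add: Q_def dotp_fconv_grouplike)
        ultimately show "act \<psi> z \<in> Z" unfolding Z_def using act_closed[OF X(1) *(3)] by blast
      qed
      moreover have "X \<subseteq> Z"
      proof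
        fix x assume "x \<in> X"
        moreover have "x = act 0 w + x" by (simp only: a0 add_0_left)
        ultimately show "x \<in> Z" unfolding Z_def using Q0 by blast
      qed
      moreover obtain \<phi> where \<phi>: "\<phi> \<in> Q" "act \<phi> w \<notin> X" using neg w by blast
      moreover have "act \<phi> w \<in> Z"
      proof -
        have "act \<phi> w = act \<phi> w + 0" by (simp only: add_0_right)
        then show ?thesis unfolding Z_def using \<phi>(1) subspace_of_zero[OF XV] by blast
      qed
      ultimately have "Z = Y" using Ymin ZY by blast
      then obtain \<phi> x where *: "w = act \<phi> w + x" "\<phi> \<in> Q" "x \<in> X" using w unfolding Z_def by blast
      then have "act \<phi> w - w = 0 - x" by (metis add_diff_cancel_left' diff_0 minus_diff_eq)
      then show ?thesis using * subspace_of_diff[OF XV subspace_of_zero[OF XV]] by metis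
    qed
    define K where "K \<phi> = {w \<in> Y. w - act \<phi> w \<in> X}" for \<phi>
    have KV: "subspace_of N (K \<phi>)" for \<phi>
    proof -
      have "vs.subspace (K \<phi>)"
        unfolding vs.subspace_def K_def
      proof (intro conjI ballI allI CollectI; (elim CollectE conjE)?)
        show "0 - act \<phi> 0 \<in> X" using subspace_of_zero[OF XV] by (simp only: act_zero diff_self)
        fix x y c assume *: "x \<in> Y" "x - act \<phi> x \<in> X"
        have "scV c x - act \<phi> (scV c x) = scV c (x - act \<phi> x)"
          by (simp only: act_scale vs.scale_right_diff_distrib)
        then show "scV c x - act \<phi> (scV c x) \<in> X" using * subspace_of_scale[OF XV] by metis
        assume **: "y \<in> Y" "y - act \<phi> y \<in> X"
        have "x + y - act \<phi> (x + y) = (x - act \<phi> x) + (y - act \<phi> y)"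
          by (simp only: act_add algebra_simps)
        then show "x + y - act \<phi> (x + y) \<in> X" using * ** subspace_of_add[OF XV] by metis
      qed (use subspace_of_zero[OF YV] subspace_of_add[OF YV] subspace_of_scale[OF YV] in auto)
      then show ?thesis using YV by (auto simp: subspace_of_iff K_def)
    qed
    \<comment> \<open>Single vectors can be fixed modulo X; to fix all of Y at once, take \<phi> in
      Q with the largest possible space \<open>K \<phi>\<close> of fixed vectors.\<close>
    obtain \<phi> where \<phi>: "\<phi> \<in> Q" and max: "\<And>\<psi>. \<psi> \<in> Q \<Longrightarrow> sdim (K \<psi>) \<le> sdim (K \<phi>)"
    proof -
      have "\<exists>x. x \<in> Q \<and> (\<forall>y. y \<in> Q \<longrightarrow> sdim (K y) \<le> sdim (K x))"
      proof (rule ex_has_greatest_nat[where b = "Suc N"])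
        show "0 \<in> Q" by (simp add: Q_def dotp_def)
        show "\<forall>y. y \<in> Q \<longrightarrow> sdim (K y) < Suc N" using sdim_le[OF KV] le_imp_less_Suc by blast
      qed
      then show ?thesis using that by blast
    qed
    have "K \<phi> = Y"
    proof (rule ccontr)
      assume "K \<phi> \<noteq> Y"
      then obtain v where v: "v \<in> Y" "v \<notin> K \<phi>" unfolding K_def by blast
      define w where "w = v - act \<phi> v"
      have w: "w \<in> Y" "w \<notin> X"
        using v act_closed[OF Y(1)] subspace_of_diff[OF YV] by (auto simp: w_def K_def)
      obtain \<mu> where \<mu>: "\<mu> \<in> Q" "act \<mu> w - w \<in> X" using fix1[OF w] by blast
      \<comment> \<open>In the dual algebra, 1 - \<psi> is the product of 1 - \<phi> and 1 - \<mu>.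
        Hence \<psi> fixes modulo X whatever \<phi> fixes, and also v, because \<mu> fixes w = v -
        \<phi> v.\<close>
      define \<psi> where "\<psi> = \<phi> + \<mu> - fconv \<phi> \<mu>"
      have "\<psi> \<in> Q" using \<phi> \<mu> g by (simp add: \<psi>_def Q_def dl dotp_fconv_grouplike)
      have comp: "y - act \<psi> y = (y - act \<phi> y) - act \<mu> (y - act \<phi> y)" if "y \<in> Y" for y
        unfolding \<psi>_def act_diff_left act_add_left act_diff act_act[OF YinV[OF that]]
        by (simp only: algebra_simps)
      have "K \<phi> \<subseteq> K \<psi>"
      proof
        fix y assume "y \<in> K \<phi>"
        then have y: "y \<in> Y" "y - act \<phi> y \<in> X" by (simp_all only: K_def mem_Collect_eq)
        then have "y - act \<psi> y \<in> X"
          using subspace_of_diff[OF XV y(2) act_closed[OF X(1) y(2)]] comp[OF y(1)] by metis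
        then show "y \<in> K \<psi>" using y by (simp only: K_def mem_Collect_eq)
      qed
      moreover have "v \<in> K \<psi>"
      proof -
        have "w - act \<mu> w = 0 - (act \<mu> w - w)" by simp
        then have "w - act \<mu> w \<in> X" using \<mu>(2) subspace_of_diff[OF XV subspace_of_zero[OF XV]] by metis
        then show ?thesis using comp[OF v(1)] v(1) by (simp only: K_def w_def mem_Collect_eq)
      qed
      ultimately have "K \<phi> \<subset> K \<psi>" using v by blast
      then show False using sdim_less[OF KV KV] max[OF \<open>\<psi> \<in> Q\<close>] by (simp add: not_le[symmetric])
    qed
    \<comment> \<open>The counit minus \<phi> acts as zero on Y / X, so it has to vanish at g; but
      its value there is 1 - 0.\<close>
    have "dotp N (he H - \<phi>) g = 0"
    proof (rule ann)
      fix y assume "y \<in> Y"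
      then have "y - act \<phi> y \<in> X" using \<open>K \<phi> = Y\<close> K_def by blast
      then show "act (he H - \<phi>) y \<in> X" by (simp only: act_diff_left act_he YinV \<open>y \<in> Y\<close>)
    qed
    then show False using \<phi> grouplikeD(4)[OF g(1)] by (simp add: dl Q_def flip: counitv_dotp)
  qed
  then obtain v where v: "v \<in> Y" "v \<notin> X" "\<And>\<phi>. \<phi> \<in> Q \<Longrightarrow> act \<phi> v \<in> X" by blast
  have "comulv H v a - scV (g a) v \<in> X" for a
  proof (cases "a < N")
    case True
    \<comment> \<open>The a-th coordinate functional and \<open>g a\<close> times the counit take
      the same value at g. Their difference acts on v as
      \<open>comulv H v a - scV (g a) v\<close>.\<close>
    have "bas a - scV (g a) (he H) \<in> Q"
    proof -
      have "dotp N (scV (g a) (he H)) g = g a * dotp N (he H) g"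
        by (simp add: dotp_def sum_distrib_left mult.assoc)
      then have "dotp N (scV (g a) (he H)) g = g a"
        using grouplikeD(4)[OF g(1)] by (simp add: counitv_dotp)
      moreover have "dotp N (bas a) g = g a" using True by (simp add: dotp_def sum_bas_l)
      ultimately show ?thesis by (simp add: Q_def dl)
    qed
    then have "act (bas a - scV (g a) (he H)) v \<in> X" by (rule v(3))
    moreover have "act (scV (g a) (he H)) v = scV (g a) (act (he H) v)"
      by (rule ext) (simp add: act_apply sum_distrib_left mult.assoc)
    ultimately show ?thesis
      by (simp only: act_diff_left act_he YinV v(1) row_eq_act True)
  next
    case False
    then have "g a = 0" using grouplikeD(1)[OF g(1)] by (simp add: vecs_def)
    then show ?thesis using False subspace_of_zero[OF XV]
      by (simp only: row_out not_less vs.scale_zero_left diff_self)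
  qed
  then show ?thesis using v g YinV by blast
qed

text \<open>Among the left coideals satisfying \<open>P\<close>, one of greatest dimension must be
  all of \<open>V\<close>, since otherwise \<open>coideal_step\<close> enlarges it by a line. The
  hypothesis on v says that \<Delta>(v) lies in g \<otimes> v + H \<otimes> X, so a convolution
  product at v equals its value for g times the unknown at v, up to terms known on X.\<close>

lemma coideal_induct:
  assumes p: "pointed H" and zero: "P {0}"
    and step: "\<And>X v g. \<lbrakk>lcoideal X; P X; v \<in> V; v \<notin> X; g \<in> GL; \<And>a. comulv H v a - scV (g a) v \<in> X\<rbrakk>
      \<Longrightarrow> P {x + scV c v | x c. x \<in> X}"
  shows "P V"
proof -
  let ?P = "\<lambda>X. lcoideal X \<and> P X"
  have l0: "lcoideal {0}"
    by (rule lcoidealI) (auto simp only: subspace_of_iff vs.subspace_single_0 zero_in_vecs act_zero singleton_iff insert_subset empty_subsetI)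
  have "\<exists>X. ?P X \<and> (\<forall>Y. ?P Y \<longrightarrow> sdim Y \<le> sdim X)"
  proof (rule ex_has_greatest_nat[where b = "Suc N"])
    show "?P {0}" using zero l0 by blast
    show "\<forall>Y. ?P Y \<longrightarrow> sdim Y < Suc N"
      using sdim_le[of N] le_imp_less_Suc unfolding lcoideal_def by blast
  qed
  then obtain X where X: "lcoideal X" "P X" and max: "\<And>Y. ?P Y \<Longrightarrow> sdim Y \<le> sdim X" by blast
  have XV: "subspace_of N X" using X by (simp add: lcoideal_def)
  have "X = V"
  proof (rule ccontr)
    assume "X \<noteq> V"
    then obtain v g where v: "v \<in> V" "v \<notin> X" "g \<in> GL" "\<And>a. comulv H v a - scV (g a) v \<in> X"
      using coideal_step[OF p X(1)] by blast
    define Y where "Y = {x + scV c v | x c. x \<in> X}"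
    have "vs.subspace Y"
      unfolding vs.subspace_def
    proof (intro conjI ballI allI)
      show "0 \<in> Y" unfolding Y_def using subspace_of_zero[OF XV]
        by (intro CollectI exI[of _ 0] conjI) (simp_all only: vs.scale_zero_left add_0)
    next
      fix y y' assume "y \<in> Y" "y' \<in> Y"
      then obtain x c x' c' where *: "y = x + scV c v" "y' = x' + scV c' v" "x \<in> X" "x' \<in> X"
        unfolding Y_def by blast
      have "y + y' = (x + x') + scV (c + c') v" unfolding * vs.scale_left_distrib by (simp only: ac_simps)
      then show "y + y' \<in> Y" unfolding Y_def using * subspace_of_add[OF XV] by blast
    next
      fix d y assume "y \<in> Y"
      then obtain x c where *: "y = x + scV c v" "x \<in> X" unfolding Y_def by blast
      have "scV d y = scV d x + scV (d * c) v" unfolding * by (simp only: vs.scale_right_distrib vs.scale_scale)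
      then show "scV d y \<in> Y" unfolding Y_def using * subspace_of_scale[OF XV] by blast
    qed
    moreover have "Y \<subseteq> V" unfolding Y_def using v(1) subspace_of_subset[OF XV]
      by (auto intro!: add_in_vecs scV_in_vecs)
    ultimately have YV: "subspace_of N Y" by (simp add: subspace_of_iff)
    have XY: "X \<subset> Y"
    proof
      show "X \<subseteq> Y"
      proof
        fix x assume "x \<in> X"
        moreover have "x = x + scV 0 v" by (simp only: vs.scale_zero_left add_0_right)
        ultimately show "x \<in> Y" unfolding Y_def by blast
      qed
      have "v \<in> Y" unfolding Y_def using subspace_of_zero[OF XV]
        by (intro CollectI exI[of _ 0] exI[of _ 1] conjI) (simp_all only: vs.scale_one add_0)
      then show "X \<noteq> Y" using v(2) by blast
    qed
    have "comulv H y a \<in> Y" if y: "y \<in> Y" for y a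
    proof -
      obtain x c where *: "y = x + scV c v" "x \<in> X" using y unfolding Y_def by blast
      have "comulv H y a = (comulv H x a + scV c (comulv H v a - scV (g a) v)) + scV (c * g a) v"
        by (rule ext) (simp add: * comulv_add comulv_scale algebra_simps)
      moreover have "comulv H x a + scV c (comulv H v a - scV (g a) v) \<in> X"
        using * X v(4) by (intro subspace_of_add[OF XV] subspace_of_scale[OF XV]) (auto simp: lcoideal_def)
      ultimately show ?thesis unfolding Y_def by blast
    qed
    then have "?P Y" using YV step[OF X v] by (simp add: lcoideal_def Y_def)
    then show False using max sdim_less[OF XV YV XY] by (simp add: not_le[symmetric])
  qed
  then show ?thesis using X by simp
qed

end

lemma dotp_tensor:
  "(\<Sum>a<m. \<Sum>b<m. \<phi> a * \<psi> b * tensor x y a b) = dotp m \<phi> x * dotp m \<psi> y"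
  unfolding dotp_def tensor_def sum_product by (intro sum.cong refl) (simp add: ac_simps)

context hopf
begin

subsection \<open>Functionals dual to the group-like elements of a quotient\<close>

lemma grouplike_mod_iff: "grouplike_mod H J x \<longleftrightarrow> x \<in> V \<and> x \<notin> J \<and> comulv H x - tensor x x \<in> TS N J"
  unfolding grouplike_mod_def TS_def by (simp add: fun_diff_def)

text \<open>A basis of J is extended inside J together with the elements that are group-like modulo
  J; \<open>Y\<close> consists of the new basis vectors and \<open>\<phi>\<close> of their dual
  functionals. These are orthogonal idempotents under convolution, since this can be tested on
  \<open>Y\<close>, where \<Delta>(y) is y \<otimes> y modulo \<open>TS\<close>.\<close>

lemma grouplike_mod_dual:
  assumes J: "subspace_of N J" and Jc: "\<And>x. x \<in> J \<Longrightarrow> comulv H x \<in> TS N J"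
  obtains Y \<phi> where "finite Y" "Y \<subseteq> {x. grouplike_mod H J x}" "vs.independent Y"
    and "\<And>y y'. y \<in> Y \<Longrightarrow> y' \<in> Y \<Longrightarrow> dotp N (\<phi> y) y' = (if y' = y then 1 else 0)"
    and "\<And>y x. y \<in> Y \<Longrightarrow> x \<in> J \<Longrightarrow> dotp N (\<phi> y) x = 0"
    and "\<And>x. x \<in> vs.span ({x. grouplike_mod H J x} \<union> J) \<Longrightarrow>
      x - (\<Sum>y\<in>Y. scV (dotp N (\<phi> y) x) y) \<in> J"
    and "\<And>x y y'. x \<in> vs.span ({x. grouplike_mod H J x} \<union> J) \<Longrightarrow> y \<in> Y \<Longrightarrow> y' \<in> Y \<Longrightarrow>
      dotp N (fconv (\<phi> y) (\<phi> y')) x = (if y = y' then dotp N (\<phi> y) x else 0)"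
    and "\<And>z. grouplike_mod H J z \<Longrightarrow>
      \<exists>y\<in>Y. (\<forall>y'\<in>Y. dotp N (\<phi> y') z = (if y' = y then 1 else 0)) \<and> z - y \<in> J"
proof -
  let ?G = "{x. grouplike_mod H J x}"
  obtain BJ where BJ: "BJ \<subseteq> J" "vs.independent BJ" "J \<subseteq> vs.span BJ"
    using vs.maximal_independent_subset[of J] by blast
  obtain B where B: "BJ \<subseteq> B" "B \<subseteq> BJ \<union> ?G" "vs.independent B" "BJ \<union> ?G \<subseteq> vs.span B"
    using vs.maximal_independent_subset_extend[of BJ "BJ \<union> ?G"] BJ(2) by blast
  have BV: "B \<subseteq> V" using B(2) BJ(1) J by (auto simp: subspace_of_iff grouplike_mod_iff)
  have finB: "finite B" using independent_finite[OF B(3) BV] by simp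
  obtain \<psi> where \<psi>: "\<And>b b'. b \<in> B \<Longrightarrow> b' \<in> B \<Longrightarrow> dotp N (\<psi> b) b' = (if b' = b then 1 else 0)"
    and ex: "\<And>x. x \<in> vs.span B \<Longrightarrow> x = (\<Sum>b\<in>B. scV (dotp N (\<psi> b) x) b)"
    by (rule dual_basis[OF B(3) BV that])
  define Y where "Y = B - BJ"
  have spanJ: "vs.span BJ = J" using BJ J by (meson subspace_of_iff vs.span_minimal subset_antisym)
  have YG: "Y \<subseteq> ?G" using B(2) by (auto simp: Y_def)
  have vanish: "dotp N (\<psi> y) x = 0" if "y \<in> Y" "x \<in> J" for x y
  proof -
    have "vs.subspace {x. dotp N (\<psi> y) x = 0}" by (auto simp: vs.subspace_def dotp_add dotp_scale)
    moreover have "BJ \<subseteq> {x. dotp N (\<psi> y) x = 0}" using \<psi> that(1) B(1) by (auto simp: Y_def)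
    ultimately have "vs.span BJ \<subseteq> {x. dotp N (\<psi> y) x = 0}" by (rule vs.span_minimal[rotated])
    then show ?thesis using that spanJ by blast
  qed
  have spanB: "vs.span (?G \<union> J) \<subseteq> vs.span B"
    using B(4) B(1) spanJ by (intro vs.span_minimal) (auto intro: vs.span_mono[THEN subsetD])
  have modJ: "x - (\<Sum>y\<in>Y. scV (dotp N (\<psi> y) x) y) \<in> J" if "x \<in> vs.span (?G \<union> J)" for x
  proof -
    define S R where "S = (\<Sum>b\<in>Y. scV (dotp N (\<psi> b) x) b)" and "R = (\<Sum>b\<in>BJ. scV (dotp N (\<psi> b) x) b)"
    have "Y \<union> BJ = B" using B(1) by (auto simp: Y_def)
    then have "x = (\<Sum>b\<in>Y \<union> BJ. scV (dotp N (\<psi> b) x) b)"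
      using ex[of x] that spanB by (metis subsetD)
    also have "\<dots> = S + R"
      unfolding S_def R_def using finB B(1) by (intro sum.union_disjoint) (auto simp: Y_def finite_subset)
    finally have "x - S = R" by (metis add_diff_cancel_left')
    moreover have "R \<in> J"
      unfolding R_def using BJ(1) by (intro subspace_of_sum[OF J] subspace_of_scale[OF J]) auto
    ultimately show ?thesis by (simp only: S_def)
  qed
  have pairG: "dotp N (fconv (\<psi> y) (\<psi> y')) z = dotp N (\<psi> y) z * dotp N (\<psi> y') z"
    if y: "y \<in> Y" "y' \<in> Y" and z: "z \<in> ?G" for y y' z
  proof -
    have "(\<Sum>a<N. \<Sum>b<N. \<psi> y a * \<psi> y' b * (comulv H z - tensor z z) a b) = 0"
    proof (rule TS_functional)
      show "comulv H z - tensor z z \<in> TS N J" using z by (simp only: mem_Collect_eq grouplike_mod_iff)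
    qed (use y vanish in auto)
    then have "dotp N (fconv (\<psi> y) (\<psi> y')) z = (\<Sum>a<N. \<Sum>b<N. \<psi> y a * \<psi> y' b * tensor z z a b)"
      unfolding dotp_fconv by (simp add: right_diff_distrib sum_subtractf)
    then show ?thesis by (simp only: dotp_tensor)
  qed
  have pair: "dotp N (fconv (\<psi> y) (\<psi> y')) x = (if y = y' then dotp N (\<psi> y) x else 0)"
    if x: "x \<in> vs.span (?G \<union> J)" and y: "y \<in> Y" "y' \<in> Y" for x y y'
  proof -
    define j where "j = x - (\<Sum>w\<in>Y. scV (dotp N (\<psi> w) x) w)"
    have "j \<in> J" using modJ[OF x] by (simp only: j_def)
    then have j0: "dotp N (fconv (\<psi> y) (\<psi> y')) j = 0"
      unfolding dotp_fconv by (rule TS_functional[OF Jc]) (use y vanish in auto)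
    have xe: "dotp N F x = dotp N F j + (\<Sum>w\<in>Y. dotp N (\<psi> w) x * dotp N F w)" for F
    proof -
      have "dotp N F (j + (\<Sum>w\<in>Y. scV (dotp N (\<psi> w) x) w))
          = dotp N F j + (\<Sum>w\<in>Y. dotp N (\<psi> w) x * dotp N F w)"
        by (simp only: dotp_add dotp_sum dotp_scale)
      then show ?thesis by (simp only: j_def diff_add_cancel)
    qed
    have "dotp N (fconv (\<psi> y) (\<psi> y')) x
        = (\<Sum>w\<in>Y. dotp N (\<psi> w) x * dotp N (fconv (\<psi> y) (\<psi> y')) w)"
      using xe[of "fconv (\<psi> y) (\<psi> y')"] j0 by (simp only: add_0_left)
    also have "\<dots> = (\<Sum>w\<in>Y. if w = y then (if y = y' then dotp N (\<psi> y) x else 0) else 0)"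
      using y YG by (intro sum.cong refl) (auto simp: pairG subset_iff \<psi> Y_def)
    also have "\<dots> = (if y = y' then dotp N (\<psi> y) x else 0)"
      using y finB by (simp add: Y_def)
    finally show ?thesis .
  qed
  have cl: "\<exists>y\<in>Y. (\<forall>y'\<in>Y. dotp N (\<psi> y') z = (if y' = y then 1 else 0)) \<and> z - y \<in> J"
    if z: "grouplike_mod H J z" for z
  proof -
    have zs: "z \<in> vs.span (?G \<union> J)" using z by (intro vs.span_base) auto
    \<comment> \<open>Dedekind's argument: the coordinates of z are orthogonal idempotents of the
      field, so at most one is nonzero and that one is 1. They cannot all vanish, as z is not in
      J.\<close>
    have cc: "dotp N (\<psi> y) z * dotp N (\<psi> y') z = (if y = y' then dotp N (\<psi> y) z else 0)"
      if "y \<in> Y" "y' \<in> Y" for y y'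
      using pairG[OF that] pair[OF zs that] z by simp
    have "\<exists>y\<in>Y. dotp N (\<psi> y) z \<noteq> 0"
    proof (rule ccontr)
      assume "\<not> ?thesis"
      then have "(\<Sum>y\<in>Y. scV (dotp N (\<psi> y) z) y) = 0"
        by (intro sum.neutral ballI) (metis vs.scale_zero_left)
      then have "z \<in> J" using modJ[OF zs] by (metis diff_zero)
      then show False using z by (simp add: grouplike_mod_iff)
    qed
    then obtain y where y: "y \<in> Y" "dotp N (\<psi> y) z \<noteq> 0" by blast
    have one: "dotp N (\<psi> y') z = (if y' = y then 1 else 0)" if "y' \<in> Y" for y'
      using cc[OF y(1) that] y(2) by (auto split: if_splits)
    have "(\<Sum>w\<in>Y. scV (dotp N (\<psi> w) z) w) = (\<Sum>w\<in>Y. if w = y then w else 0)"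
      by (intro sum.cong refl) (metis one vs.scale_one vs.scale_zero_left)
    then have "(\<Sum>w\<in>Y. scV (dotp N (\<psi> w) z) w) = y"
      using y finB sum.delta[of Y y "\<lambda>w. w"] by (metis (no_types, lifting) Y_def finite_Diff sum.cong)
    then show ?thesis using y(1) one modJ[OF zs] by metis
  qed
  show ?thesis
  proof (rule that[of Y \<psi>])
    show "finite Y" using finB by (simp add: Y_def)
    show "vs.independent Y" using B(3) by (rule vs.independent_mono) (auto simp: Y_def)
    show "dotp N (\<psi> y) y' = (if y' = y then 1 else 0)" if "y \<in> Y" "y' \<in> Y" for y y'
      using \<psi> that by (auto simp: Y_def)
  qed (fact YG vanish modJ pair cl)+
qed

text \<open>The case J = 0: each group-like differs by zero from a member of the independent set
  \<open>Y\<close>.\<close>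

lemma grouplikes_independent: "vs.independent GL"
proof -
  have J: "subspace_of N {0}" by (simp add: subspace_of_iff)
  have Jc: "comulv H x \<in> TS N {0}" if "x \<in> {0}" for x
  proof -
    have "comulv H x = 0" using that by (intro ext) (simp add: comulv_zero)
    then show ?thesis using TS_zero by metis
  qed
  obtain Y where Y: "vs.independent Y" "\<And>z. grouplike_mod H {0} z \<Longrightarrow> \<exists>y\<in>Y. z - y \<in> {0}"
    by (rule grouplike_mod_dual[OF J Jc]) (assumption, rule that, assumption, blast)
  have "GL \<subseteq> Y"
  proof
    fix g assume g: "g \<in> GL"
    have "comulv H g - tensor g g = 0" by (intro ext) (simp add: grouplikeD[OF g] tensor_def)
    then have "grouplike_mod H {0} g"
      unfolding grouplike_mod_iff using grouplikeD[OF g] TS_zero[of N "{0}"] by (metis singletonD)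
    then obtain y where "y \<in> Y" "g - y \<in> {0}" using Y(2) by blast
    then show "g \<in> Y" by (metis eq_iff_diff_eq_0 singletonD)
  qed
  then show ?thesis using Y(1) vs.independent_mono by blast
qed

lemma CI_subspace: "subspace_of N CI"
  using two_sided_CI by (simp add: two_sided_ideal_def)

lemma CI_mul: "x \<in> V \<Longrightarrow> y \<in> CI \<Longrightarrow> mulv H x y \<in> CI" "x \<in> V \<Longrightarrow> y \<in> CI \<Longrightarrow> mulv H y x \<in> CI"
  using two_sided_CI by (auto simp: two_sided_ideal_def)

lemma mulv_diff_l: "mulv H (x - y) z = mulv H x z - mulv H y z"
  using mul.m_add_l[of "x - y" y z] by (metis add_diff_cancel_right' diff_add_cancel)

lemma mulv_diff_r: "mulv H z (x - y) = mulv H z x - mulv H z y"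
  using mul.m_add_r[of z "x - y" y] by (metis add_diff_cancel_right' diff_add_cancel)

lemma mulv_cong_CI:
  assumes "x \<in> V" "y \<in> V" "x' \<in> V" "y' \<in> V" "x - x' \<in> CI" "y - y' \<in> CI"
  shows "mulv H x y - mulv H x' y' \<in> CI"
proof -
  have "mulv H x y - mulv H x' y' = mulv H (x - x') y + mulv H x' (y - y')"
    by (simp only: mulv_diff_l mulv_diff_r) (simp only: algebra_simps)
  then show ?thesis using CI_mul assms subspace_of_add[OF CI_subspace] by metis
qed

text \<open>Choose \<phi> zero on \<open>CI\<close> with \<phi>(x) = 1. Then \<epsilon> \<otimes>
  \<phi> takes the value \<phi>(x) on \<Delta>(x) and \<epsilon>(x) \<phi>(x) on x \<otimes> x, and
  it cannot see the difference of these tensors.\<close>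

lemma grouplike_mod_counit:
  assumes "grouplike_mod H CI x" shows "counitv H x = 1"
proof -
  have x: "x \<in> V" "x \<notin> CI" "comulv H x - tensor x x \<in> TS N CI"
    using assms by (auto simp: grouplike_mod_iff)
  obtain \<phi> where \<phi>: "\<forall>z\<in>CI. dotp N \<phi> z = 0" "dotp N \<phi> x = 1"
    using separating_functional[OF CI_subspace x(1,2)] by blast
  have "(\<Sum>a<N. \<Sum>b<N. he H a * \<phi> b * (comulv H x - tensor x x) a b) = 0"
    by (rule TS_functional[OF x(3)]) (use \<phi>(1) counitv_CI in \<open>auto simp: counitv_dotp\<close>)
  then have "(\<Sum>a<N. \<Sum>b<N. he H a * \<phi> b * comulv H x a b) = (\<Sum>a<N. \<Sum>b<N. he H a * \<phi> b * tensor x x a b)"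
    by (simp add: right_diff_distrib sum_subtractf)
  also have "\<dots> = counitv H x * dotp N \<phi> x"
    unfolding counitv_dotp dotp_def tensor_def sum_product by (simp add: ac_simps)
  also have "(\<Sum>a<N. \<Sum>b<N. he H a * \<phi> b * comulv H x a b) = dotp N \<phi> (act (he H) x)"
    unfolding dotp_act[OF x(1)] dotp_fconv ..
  finally show ?thesis using \<phi>(2) by (simp add: act_he x(1))
qed

lemma tmul_tensor: "tmul (tensor x x) (tensor y y) = tensor (mulv H x y) (mulv H x y)"
proof (intro ext)
  fix a b
  have "tensor (mulv H x y) (mulv H x y) a b
      = (\<Sum>a1<N. \<Sum>b1<N. (\<Sum>a2<N. x a1 * y a2 * hm H a1 a2 a) * (\<Sum>b2<N. x b1 * y b2 * hm H b1 b2 b))"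
    unfolding tensor_def mulv_def sum_product[of "\<lambda>i. \<Sum>j<N. x i * y j * hm H i j a"] ..
  also have "\<dots> = tmul (tensor x x) (tensor y y) a b"
    unfolding tmul_def tensor_def sum_product by (intro sum.cong refl) (simp add: ac_simps)
  finally show "tmul (tensor x x) (tensor y y) a b = tensor (mulv H x y) (mulv H x y) a b" by simp
qed

lemma grouplike_mod_mulv:
  assumes x: "grouplike_mod H CI x" and y: "grouplike_mod H CI y"
  shows "grouplike_mod H CI (mulv H x y)"
  unfolding grouplike_mod_iff
proof (intro conjI)
  have V: "x \<in> V" "y \<in> V" using x y by (auto simp: grouplike_mod_iff)
  show "mulv H x y \<in> V" by (rule mulv_V)
  show "mulv H x y \<notin> CI"
    using counitv_CI[of "mulv H x y"] V grouplike_mod_counit[OF x] grouplike_mod_counit[OF y]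
    by (auto simp: counitv_mulv)
  define Dx Dy where "Dx = comulv H x - tensor x x" and "Dy = comulv H y - tensor y y"
  have D: "Dx \<in> TS N CI" "Dy \<in> TS N CI" using x y by (auto simp: grouplike_mod_iff Dx_def Dy_def)
  have "comulv H (mulv H x y) = tmul (Dx + tensor x x) (Dy + tensor y y)"
    unfolding comulv_mulv[OF V] by (simp only: Dx_def Dy_def diff_add_cancel)
  also have "\<dots> = tmul Dx (Dy + tensor y y) + (tmul (tensor x x) Dy + tensor (mulv H x y) (mulv H x y))"
    by (simp only: tmul_add_l tmul_add_r[of "tensor x x"] tmul_tensor)
  finally have "comulv H (mulv H x y) - tensor (mulv H x y) (mulv H x y)
      = tmul Dx (Dy + tensor y y) + tmul (tensor x x) Dy"
    by (simp only: add.assoc[symmetric] add_diff_cancel_right')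
  then show "comulv H (mulv H x y) - tensor (mulv H x y) (mulv H x y) \<in> TS N CI"
    using TS_add TS_tmul[OF two_sided_CI] D by metis
qed

text \<open>\<open>f \<gamma>\<close> reads off, modulo \<open>CI\<close>, the coefficient of the
  group-like labelled \<gamma> by the given isomorphism. The properties are those of the coordinates
  on a group algebra: counit, orthogonality, product, common kernel and nonvanishing.\<close>

lemma grading_exists:
  assumes ab: "ab_is_group_algebra H" and iso: "Gbar H \<cong> \<Gamma>" and \<Gamma>: "group \<Gamma>"
  obtains f :: "'c \<Rightarrow> nat \<Rightarrow> 'k" where "finite (carrier \<Gamma>)"
    and "\<And>x. x \<in> V \<Longrightarrow> (\<Sum>\<gamma>\<in>carrier \<Gamma>. dotp N (f \<gamma>) x) = counitv H x"
    and "\<And>x \<gamma> \<delta>. x \<in> V \<Longrightarrow> \<gamma> \<in> carrier \<Gamma> \<Longrightarrow> \<delta> \<in> carrier \<Gamma> \<Longrightarrow>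
      dotp N (fconv (f \<gamma>) (f \<delta>)) x = (if \<gamma> = \<delta> then dotp N (f \<gamma>) x else 0)"
    and "\<And>x y \<gamma>. x \<in> V \<Longrightarrow> y \<in> V \<Longrightarrow> \<gamma> \<in> carrier \<Gamma> \<Longrightarrow> dotp N (f \<gamma>) (mulv H x y)
      = (\<Sum>\<alpha>\<in>carrier \<Gamma>. \<Sum>\<beta>\<in>carrier \<Gamma>. if \<alpha> \<otimes>\<^bsub>\<Gamma>\<^esub> \<beta> = \<gamma> then dotp N (f \<alpha>) x * dotp N (f \<beta>) y else 0)"
    and "\<And>x. x \<in> V \<Longrightarrow> \<forall>\<gamma>\<in>carrier \<Gamma>. dotp N (f \<gamma>) x = 0 \<Longrightarrow> x \<in> CI"
    and "\<And>\<gamma>. \<gamma> \<in> carrier \<Gamma> \<Longrightarrow> \<exists>x\<in>V. dotp N (f \<gamma>) x \<noteq> 0"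
proof -
  let ?G = "{x. grouplike_mod H CI x}"
  obtain Y \<phi> where finY: "finite Y" and YG: "Y \<subseteq> ?G" and "vs.independent Y"
    and dual: "\<And>y y'. y \<in> Y \<Longrightarrow> y' \<in> Y \<Longrightarrow> dotp N (\<phi> y) y' = (if y' = y then 1 else 0)"
    and van: "\<And>y x. y \<in> Y \<Longrightarrow> x \<in> CI \<Longrightarrow> dotp N (\<phi> y) x = 0"
    and modJ: "\<And>x. x \<in> vs.span (?G \<union> CI) \<Longrightarrow> x - (\<Sum>y\<in>Y. scV (dotp N (\<phi> y) x) y) \<in> CI"
    and pair: "\<And>x y y'. x \<in> vs.span (?G \<union> CI) \<Longrightarrow> y \<in> Y \<Longrightarrow> y' \<in> Y \<Longrightarrow>
      dotp N (fconv (\<phi> y) (\<phi> y')) x = (if y = y' then dotp N (\<phi> y) x else 0)"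
    and cl: "\<And>z. grouplike_mod H CI z \<Longrightarrow>
      \<exists>y\<in>Y. (\<forall>y'\<in>Y. dotp N (\<phi> y') z = (if y' = y then 1 else 0)) \<and> z - y \<in> CI"
    by (rule grouplike_mod_dual[OF CI_subspace comulv_CI that])
  have lspan: "lspan A \<subseteq> vs.span A" for A :: "(nat \<Rightarrow> 'k) set"
  proof
    fix v assume "v \<in> lspan A"
    then obtain ps where ps: "v = (\<lambda>i. \<Sum>(c, v)\<leftarrow>ps. c * v i)" "\<forall>(c, v)\<in>set ps. v \<in> A"
      unfolding lspan_def by blast
    have "(\<lambda>i. \<Sum>(c, v)\<leftarrow>ps. c * v i) \<in> vs.span A" using ps(2)
    proof (induction ps)
      case Nil
      have "(\<lambda>i. \<Sum>(c, v)\<leftarrow>[]. c * v i) = (0 :: nat \<Rightarrow> 'k)" by (rule ext) simp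
      then show ?case using vs.span_zero[of A] by (simp only:)
    next
      case (Cons p ps)
      obtain c w where p: "p = (c, w)" by force
      have "scV c w + (\<lambda>i. \<Sum>(c, v)\<leftarrow>ps. c * v i) \<in> vs.span A"
      proof (intro vs.span_add vs.span_scale)
        show "w \<in> vs.span A" by (rule vs.span_base) (use Cons.prems p in simp)
        show "(\<lambda>i. \<Sum>(c, v)\<leftarrow>ps. c * v i) \<in> vs.span A" by (rule Cons.IH) (use Cons.prems in simp)
      qed
      moreover have "(\<lambda>i. \<Sum>(c, v)\<leftarrow>p # ps. c * v i) = scV c w + (\<lambda>i. \<Sum>(c, v)\<leftarrow>ps. c * v i)"
        by (rule ext) (simp add: p)
      ultimately show ?case by (simp only:)
    qed
    then show "v \<in> vs.span A" using ps(1) by (simp only:)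
  qed
  have span: "x \<in> vs.span (?G \<union> CI)" if "x \<in> V" for x
  proof -
    have "\<exists>v\<in>lspan ?G. x - v \<in> CI"
      using ab that by (simp only: ab_is_group_algebra_def ab_ideal_eq fun_diff_def)
    then obtain v where v: "v \<in> lspan ?G" "x - v \<in> CI" by (elim bexE)
    have "v \<in> vs.span (?G \<union> CI)"
      by (rule vs.span_mono[THEN subsetD, OF Un_upper1]) (rule lspan[THEN subsetD, OF v(1)])
    moreover have "x - v \<in> vs.span (?G \<union> CI)" by (rule vs.span_base) (rule UnI2[OF v(2)])
    ultimately have "v + (x - v) \<in> vs.span (?G \<union> CI)" by (rule vs.span_add)
    then show ?thesis by (simp only: add_diff_eq add_diff_cancel_left')
  qed
  have YV: "y \<in> V" if "y \<in> Y" for y using that YG by (auto simp: grouplike_mod_iff)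
  let ?c = "cls H CI"
  have cls_eqI: "?c x = ?c y" if "x - y \<in> CI" for x y
  proof -
    have "x - w \<in> CI \<longleftrightarrow> y - w \<in> CI" for w
    proof
      assume "x - w \<in> CI"
      then have "(x - w) - (x - y) \<in> CI" using that by (rule subspace_of_diff[OF CI_subspace])
      moreover have "(x - w) - (x - y) = y - w" by (simp only: algebra_simps add_diff_cancel_left')
      ultimately show "y - w \<in> CI" by (simp only:)
    next
      assume "y - w \<in> CI"
      with that have "(x - y) + (y - w) \<in> CI" by (rule subspace_of_add[OF CI_subspace])
      moreover have "(x - y) + (y - w) = x - w" by (simp only: add_diff_eq diff_add_cancel)
      ultimately show "x - w \<in> CI" by (simp only:)
    qed
    then show ?thesis unfolding cls_def fun_diff_def by (simp only:)
  qed
  have cls_self: "x \<in> ?c x" if "x \<in> V" for x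
    using that subspace_of_zero[OF CI_subspace] by (simp add: cls_def zero_fun_def)
  have cls_mem: "z \<in> V \<and> x - z \<in> CI" if "z \<in> ?c x" for x z
    using that by (simp add: cls_def fun_diff_def)
  obtain h where h: "h \<in> iso (Gbar H) \<Gamma>" using iso by (auto simp: is_iso_def)
  have hh: "h \<in> hom (Gbar H) \<Gamma>" using h by (simp add: iso_def)
  have carr: "carrier (Gbar H) = ?c ` ?G" by (simp add: Gbar_def ab_ideal_eq)
  \<comment> \<open>\<open>Gbar\<close> multiplies arbitrarily chosen representatives; the class of
    the product does not depend on them because \<open>CI\<close> is an ideal.\<close>
  have multG: "?c x \<otimes>\<^bsub>Gbar H\<^esub> ?c y = ?c (mulv H x y)" if "x \<in> V" "y \<in> V" for x y
  proof -
    let ?x = "SOME z. z \<in> ?c x" and ?y = "SOME z. z \<in> ?c y"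
    have "?x \<in> ?c x" by (rule someI[of "\<lambda>z. z \<in> ?c x" x, OF cls_self[OF that(1)]])
    note x = cls_mem[OF this]
    have "?y \<in> ?c y" by (rule someI[of "\<lambda>z. z \<in> ?c y" y, OF cls_self[OF that(2)]])
    note y = cls_mem[OF this]
    have "mulv H x y - mulv H ?x ?y \<in> CI"
      using mulv_cong_CI[OF that] x y by blast
    then have "?c (mulv H x y) = ?c (mulv H ?x ?y)" by (rule cls_eqI)
    then show ?thesis by (simp add: Gbar_def ab_ideal_eq)
  qed
  define k where "k y = h (?c y)" for y
  have hb: "bij_betw h (?c ` ?G) (carrier \<Gamma>)" using h by (simp add: iso_def carr)
  have "inj_on ?c Y"
  proof (rule inj_onI)
    fix y y' assume y: "y \<in> Y" "y' \<in> Y" "?c y = ?c y'"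
    then have "y - y' \<in> CI" using cls_self[OF YV[OF y(2)]] cls_mem by blast
    then have "dotp N (\<phi> y) (y - y') = 0" using van y by blast
    then have "dotp N (\<phi> y) y - dotp N (\<phi> y) y' = 0" using dotp_diff by metis
    then show "y = y'" using y dual by (auto split: if_splits)
  qed
  moreover have "?c ` Y = ?c ` ?G"
  proof
    show "?c ` Y \<subseteq> ?c ` ?G" using YG by (rule image_mono)
    show "?c ` ?G \<subseteq> ?c ` Y" using cl cls_eqI by blast
  qed
  ultimately have "bij_betw ?c Y (?c ` ?G)" by (simp add: bij_betw_def)
  from bij_betw_trans[OF this hb] have kb: "bij_betw k Y (carrier \<Gamma>)"
    by (simp add: k_def[abs_def] comp_def)
  define r where "r = the_inv_into Y k"
  have r: "r \<gamma> \<in> Y" "k (r \<gamma>) = \<gamma>" if "\<gamma> \<in> carrier \<Gamma>" for \<gamma>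
    using that the_inv_into_into[OF kb[THEN bij_betw_imp_inj_on] _ subset_refl]
      f_the_inv_into_f[OF kb[THEN bij_betw_imp_inj_on]] bij_betw_imp_surj_on[OF kb]
    unfolding r_def by metis+
  have rk: "r (k y) = y" if "y \<in> Y" for y
    unfolding r_def by (rule the_inv_into_f_f[OF bij_betw_imp_inj_on[OF kb] that])
  have kc: "k y \<in> carrier \<Gamma>" if "y \<in> Y" for y using that kb by (auto simp: bij_betw_def)
  define f where "f \<gamma> = \<phi> (r \<gamma>)" for \<gamma>
  have mulY: "dotp N (\<phi> w) (mulv H y y') = (if k y \<otimes>\<^bsub>\<Gamma>\<^esub> k y' = k w then 1 else 0)"
    if y: "y \<in> Y" "y' \<in> Y" and w: "w \<in> Y" for w y y'
  proof -
    have "grouplike_mod H CI (mulv H y y')" using y YG by (auto intro: grouplike_mod_mulv)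
    then obtain z where z: "z \<in> Y" "\<And>w. w \<in> Y \<Longrightarrow> dotp N (\<phi> w) (mulv H y y') = (if w = z then 1 else 0)"
        "mulv H y y' - z \<in> CI" using cl by blast
    have "?c y \<in> carrier (Gbar H)" "?c y' \<in> carrier (Gbar H)" unfolding carr using y YG by blast+
    then have "k y \<otimes>\<^bsub>\<Gamma>\<^esub> k y' = h (?c y \<otimes>\<^bsub>Gbar H\<^esub> ?c y')"
      unfolding k_def using hom_mult[OF hh] by metis
    also have "\<dots> = k z" unfolding k_def multG[OF YV[OF y(1)] YV[OF y(2)]] using cls_eqI[OF z(3)] by simp
    finally have "k y \<otimes>\<^bsub>\<Gamma>\<^esub> k y' = k w \<longleftrightarrow> w = z"
      using kb w z(1) unfolding bij_betw_def by (metis inj_onD)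
    then show ?thesis using z(2)[OF w] by simp
  qed
  have sumY: "(\<Sum>\<gamma>\<in>carrier \<Gamma>. F (r \<gamma>) \<gamma>) = (\<Sum>y\<in>Y. F y (k y))" for F :: "_ \<Rightarrow> _ \<Rightarrow> 'k"
  proof -
    have "(\<Sum>\<gamma>\<in>carrier \<Gamma>. F (r \<gamma>) \<gamma>) = (\<Sum>y\<in>Y. F (r (k y)) (k y))"
      by (rule sum.reindex_bij_betw[OF kb, symmetric])
    also have "\<dots> = (\<Sum>y\<in>Y. F y (k y))" by (intro sum.cong refl) (simp only: rk)
    finally show ?thesis .
  qed
  show ?thesis
  proof (rule that[of f])
    show "finite (carrier \<Gamma>)" using kb finY bij_betw_finite by blast
  next
    fix x assume x: "x \<in> V"
    define j where "j = x - (\<Sum>y\<in>Y. scV (dotp N (\<phi> y) x) y)"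
    have "j \<in> CI" using modJ[OF span[OF x]] by (simp only: j_def)
    moreover have "x = j + (\<Sum>y\<in>Y. scV (dotp N (\<phi> y) x) y)" by (simp only: j_def diff_add_cancel)
    ultimately have "counitv H x = (\<Sum>y\<in>Y. dotp N (\<phi> y) x * counitv H y)"
      by (metis (no_types, lifting) counitv_CI counitv_add counitv_scale counitv_sum add_0_left sum.cong)
    also have "\<dots> = (\<Sum>y\<in>Y. dotp N (\<phi> y) x)"
      using YG by (intro sum.cong refl) (auto simp: grouplike_mod_counit subset_iff)
    also have "\<dots> = (\<Sum>\<gamma>\<in>carrier \<Gamma>. dotp N (f \<gamma>) x)"
      unfolding f_def by (simp add: sumY[of "\<lambda>y \<gamma>. dotp N (\<phi> y) x"])
    finally show "(\<Sum>\<gamma>\<in>carrier \<Gamma>. dotp N (f \<gamma>) x) = counitv H x" by simp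
  next
    fix x \<gamma> \<delta> assume "x \<in> V" and g: "\<gamma> \<in> carrier \<Gamma>" "\<delta> \<in> carrier \<Gamma>"
    then show "dotp N (fconv (f \<gamma>) (f \<delta>)) x = (if \<gamma> = \<delta> then dotp N (f \<gamma>) x else 0)"
      unfolding f_def using pair[OF span r(1) r(1), of x \<gamma> \<delta>] r(2) by (metis (full_types))
  next
    fix x y \<gamma> assume x: "x \<in> V" and y: "y \<in> V" and g: "\<gamma> \<in> carrier \<Gamma>"
    define x' y' where "x' = (\<Sum>w\<in>Y. scV (dotp N (\<phi> w) x) w)" and "y' = (\<Sum>w\<in>Y. scV (dotp N (\<phi> w) y) w)"
    have "x' \<in> V" "y' \<in> V" unfolding x'_def y'_def using YV by (auto intro!: sum_in_vecs scV_in_vecs)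
    then have "mulv H x y - mulv H x' y' \<in> CI"
      using x y modJ[OF span[OF x]] modJ[OF span[OF y]] by (intro mulv_cong_CI) (simp_all only: x'_def y'_def)
    then have "dotp N (f \<gamma>) (mulv H x y) = dotp N (f \<gamma>) (mulv H x' y')"
      using van[OF r(1)[OF g]] by (metis dotp_diff eq_iff_diff_eq_0 f_def)
    also have "mulv H x' y' = (\<Sum>w'\<in>Y. \<Sum>w\<in>Y. scV (dotp N (\<phi> w') y * dotp N (\<phi> w) x) (mulv H w w'))"
      unfolding x'_def y'_def by (simp only: mul.m_sum_r mul.m_sum_l mul.m_sc_l mul.m_sc_r vs.scale_sum_right vs.scale_scale)
    also have "dotp N (f \<gamma>) \<dots> = (\<Sum>w'\<in>Y. \<Sum>w\<in>Y. if k w \<otimes>\<^bsub>\<Gamma>\<^esub> k w' = \<gamma> then dotp N (\<phi> w) x * dotp N (\<phi> w') y else 0)"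
      unfolding dotp_sum dotp_scale f_def using mulY[OF _ _ r(1)[OF g]] r(2)[OF g]
      by (intro sum.cong refl) (simp add: mult.commute)
    also have "\<dots> = (\<Sum>w\<in>Y. \<Sum>w'\<in>Y. if k w \<otimes>\<^bsub>\<Gamma>\<^esub> k w' = \<gamma> then dotp N (\<phi> w) x * dotp N (\<phi> w') y else 0)"
      by (rule sum.swap)
    also have "\<dots> = (\<Sum>w\<in>Y. \<Sum>\<beta>\<in>carrier \<Gamma>. if k w \<otimes>\<^bsub>\<Gamma>\<^esub> \<beta> = \<gamma> then dotp N (\<phi> w) x * dotp N (\<phi> (r \<beta>)) y else 0)"
      using sumY[of "\<lambda>w' \<beta>. if k w \<otimes>\<^bsub>\<Gamma>\<^esub> \<beta> = \<gamma> then dotp N (\<phi> w) x * dotp N (\<phi> w') y else 0" for w]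
      by (intro sum.cong refl) simp
    also have "\<dots> = (\<Sum>\<alpha>\<in>carrier \<Gamma>. \<Sum>\<beta>\<in>carrier \<Gamma>. if \<alpha> \<otimes>\<^bsub>\<Gamma>\<^esub> \<beta> = \<gamma> then dotp N (\<phi> (r \<alpha>)) x * dotp N (\<phi> (r \<beta>)) y else 0)"
      using sumY[of "\<lambda>w \<alpha>. \<Sum>\<beta>\<in>carrier \<Gamma>. if \<alpha> \<otimes>\<^bsub>\<Gamma>\<^esub> \<beta> = \<gamma> then dotp N (\<phi> w) x * dotp N (\<phi> (r \<beta>)) y else 0"]
      by simp
    finally show "dotp N (f \<gamma>) (mulv H x y)
      = (\<Sum>\<alpha>\<in>carrier \<Gamma>. \<Sum>\<beta>\<in>carrier \<Gamma>. if \<alpha> \<otimes>\<^bsub>\<Gamma>\<^esub> \<beta> = \<gamma> then dotp N (f \<alpha>) x * dotp N (f \<beta>) y else 0)"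
      unfolding f_def .
  next
    fix x assume x: "x \<in> V" and z: "\<forall>\<gamma>\<in>carrier \<Gamma>. dotp N (f \<gamma>) x = 0"
    have "dotp N (\<phi> y) x = 0" if "y \<in> Y" for y
      using z kc[OF that] rk[OF that] by (metis f_def)
    then have "(\<Sum>y\<in>Y. scV (dotp N (\<phi> y) x) y) = 0"
      by (intro sum.neutral ballI) (metis vs.scale_zero_left)
    then show "x \<in> CI" using modJ[OF span[OF x]] by (metis diff_zero)
  next
    fix \<gamma> assume "\<gamma> \<in> carrier \<Gamma>"
    then show "\<exists>x\<in>V. dotp N (f \<gamma>) x \<noteq> 0"
      using r YV dual by (intro bexI[of _ "r \<gamma>"]) (auto simp: f_def)
  qed
qed

end

context coalg_alg
begin

lemma conv_sum_l: "conv (\<lambda>i. \<Sum>k\<in>K. F k i) g i = (\<Sum>k\<in>K. conv (F k) g i)"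
  unfolding conv_def m_sum_l scale_sum_right
  by (rule trans[OF sum.cong[OF refl sum.swap] sum.swap])

lemma conv_sum_r: "conv g (\<lambda>i. \<Sum>k\<in>K. F k i) i = (\<Sum>k\<in>K. conv g (F k) i)"
  unfolding conv_def m_sum_r scale_sum_right
  by (rule trans[OF sum.cong[OF refl sum.swap] sum.swap])

end

lemma single_eq_kc: "emb (Poly_Mapping.single \<mu> c) = kc c * emb (Poly_Mapping.single \<mu> 1)"
  by (simp add: kc_eq_emb mult_single flip: emb_mult)

context hopf
begin

subsection \<open>Linear maps to the fraction field\<close>

lemma linv_add: "linv H w (x + y) = linv H w x + linv H w y"
  by (simp add: linv_def kc_add distrib_right sum.distrib)

lemma linv_diff: "linv H w (x - y) = linv H w x - linv H w y"
  by (simp add: linv_def kc_diff left_diff_distrib sum_subtractf)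

lemma linv_scale: "linv H w (scV c x) = kc c * linv H w x"
  by (simp add: linv_def kc_mult sum_distrib_left mult.assoc)

lemma linv_zero [simp]: "linv H w 0 = 0"
  by (simp add: linv_def)

lemma linv_sum: "linv H w (\<Sum>i\<in>A. g i) = (\<Sum>i\<in>A. linv H w (g i))"
  unfolding linv_def sum_fun_apply kc_sum sum_distrib_right by (rule sum.swap)

lemma linv_bas: "i < N \<Longrightarrow> linv H w (bas i) = w i"
  by (simp add: linv_def bas_apply if_distrib[of kc] if_distrib[of "\<lambda>z. z * _"] cong: if_cong)

lemma linv_kc: "linv H (\<lambda>i. kc (\<phi> i)) x = kc (dotp N \<phi> x)"
  by (simp add: linv_def dotp_def kc_sum kc_mult mult.commute)

lemma linv_cong: "(\<And>i. i < N \<Longrightarrow> w i = w' i) \<Longrightarrow> linv H w x = linv H w' x"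
  by (simp add: linv_def)

definition tv :: "nat \<Rightarrow> 'k mpoly fract" where
  "tv i = emb (tvar H (bas i))"

lemma tvar_bas: "i < N \<Longrightarrow> tvar H (bas i) = Poly_Mapping.single (Poly_Mapping.single i 1) 1"
  by (simp add: tvar_def bas_apply if_distrib[of "Poly_Mapping.single _"] cong: if_cong)

lemma emb_tvar: "emb (tvar H x) = linv H tv x"
  unfolding linv_def tvar_def[of H x] emb_sum
  by (intro sum.cong refl) (simp add: tv_def tvar_bas single_eq_kc[of _ "x _"])

lemma lookup_tvar: "i < N \<Longrightarrow> Poly_Mapping.lookup (tvar H x) (Poly_Mapping.single i 1) = x i"
proof -
  assume i: "i < N"
  have "Poly_Mapping.lookup (tvar H x) (Poly_Mapping.single i 1) = (\<Sum>j<N. if j = i then x j else 0)"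
    unfolding tvar_def lookup_sum
    by (intro sum.cong refl) (auto simp: lookup_single when_def dest: arg_cong[of _ _ "\<lambda>p. Poly_Mapping.lookup p i"])
  then show ?thesis using i by simp
qed

lemma tvar_nonzero: "x \<in> V \<Longrightarrow> x \<noteq> 0 \<Longrightarrow> tvar H x \<noteq> 0"
proof
  assume "x \<in> V" "x \<noteq> 0" "tvar H x = 0"
  then have "x i = 0" for i using lookup_tvar[of i x] by (cases "i < N") (auto simp: vecs_def)
  then show False using \<open>x \<noteq> 0\<close> by auto
qed

lemma t_grouplike_nonzero: "g \<in> GL \<Longrightarrow> linv H tv g \<noteq> 0"
  unfolding emb_tvar[symmetric] emb_eq_0_iff using tvar_nonzero grouplikeD by blast

abbreviation conv1 (infixl "\<star>" 70) where "conv1 \<equiv> CF.conv"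
abbreviation conv2 (infixl "\<star>\<star>" 70) where "conv2 \<equiv> CF2.conv"

lemma conv1_eq: "(f \<star> g) i = (\<Sum>a<N. \<Sum>b<N. kc (hc H i a b) * (f a * g b))"
  by (simp add: CF.conv_def scF_def)

lemma linv_conv: "linv H (f \<star> g) x = (\<Sum>a<N. f a * linv H g (comulv H x a))"
proof -
  have "linv H (f \<star> g) x = (\<Sum>i<N. \<Sum>a<N. \<Sum>b<N. f a * (kc (x i * hc H i a b) * g b))"
    unfolding linv_def conv1_eq by (simp add: sum_distrib_left kc_mult ac_simps)
  also have "\<dots> = (\<Sum>a<N. \<Sum>b<N. \<Sum>i<N. f a * (kc (x i * hc H i a b) * g b))"
    by (subst sum.swap, rule sum.cong[OF refl], rule sum.swap)
  also have "\<dots> = (\<Sum>a<N. f a * linv H g (comulv H x a))"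
    unfolding linv_def comulv_def by (simp add: kc_sum sum_distrib_left sum_distrib_right)
  finally show ?thesis .
qed

text \<open>The pullback of a linear map on H along the multiplication, as a function of pairs of
  basis indices.\<close>

definition mus :: "(nat \<Rightarrow> 'k mpoly fract) \<Rightarrow> nat \<times> nat \<Rightarrow> 'k mpoly fract" where
  "mus f p = linv H f (hm H (fst p) (snd p))"

lemma mus_conv:
  assumes "p \<in> {..<N} \<times> {..<N}" shows "mus (f \<star> g) p = (mus f \<star>\<star> mus g) p"
proof -
  obtain i j where p: "p = (i, j)" "i < N" "j < N" using assms by auto
  show ?thesis using conv_pullback[OF kalgebra_F p(2,3), of f g]
    unfolding mus_def linv_def CF2.conv_def CF.conv_def p(1) scF_def by simp
qed

lemma conv2_pure:
  "((\<lambda>p. f (fst p) * f' (snd p)) \<star>\<star> (\<lambda>p. g (fst p) * g' (snd p))) (i, j) = (f \<star> g) i * (f' \<star> g') j"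
proof -
  have "(f \<star> g) i * (f' \<star> g') j = (\<Sum>a<N. \<Sum>c<N. \<Sum>b<N. \<Sum>d<N.
      kc (hc H i a c) * (f a * g c) * (kc (hc H j b d) * (f' b * g' d)))"
    unfolding conv1_eq by (simp only: sum_distrib_right) (simp only: sum_distrib_left)
  also have "\<dots> = ((\<lambda>p. f (fst p) * f' (snd p)) \<star>\<star> (\<lambda>p. g (fst p) * g' (snd p))) (i, j)"
    unfolding CF2.conv_def sum_pairs2 scF_def by (intro sum.cong refl) (simp add: kc_mult ac_simps)
  finally show ?thesis by simp
qed

lemma linv_mulv: "linv H f (mulv H x y) = (\<Sum>i<N. \<Sum>j<N. kc (x i * y j) * mus f (i, j))"
  unfolding mulv_expand linv_sum linv_scale mus_def by simp

lemma is_tinv_iff: "is_tinv H w \<longleftrightarrow> (\<forall>i\<ge>N. w i = 0) \<and>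
    (\<forall>i<N. (tv \<star> w) i = kc (he H i) \<and> (w \<star> tv) i = kc (he H i))"
proof -
  have 1: "(\<Sum>a<N. \<Sum>b<N. kc (comulv H x a b) * emb (tvar H (bas a)) * linv H w (bas b)) = linv H (tv \<star> w) x" for x
    unfolding linv_conv unfolding tv_def by (intro sum.cong refl) (simp add: linv_bas linv_def[of H w "comulv H x _"] sum_distrib_left ac_simps)
  have 2: "(\<Sum>a<N. \<Sum>b<N. kc (comulv H x a b) * linv H w (bas a) * emb (tvar H (bas b))) = linv H (w \<star> tv) x" for x
    unfolding linv_conv by (intro sum.cong refl) (simp add: linv_bas linv_def[of H tv] tv_def sum_distrib_left ac_simps)
  have 3: "(\<forall>x\<in>V. linv H F x = kc (counitv H x)) \<longleftrightarrow> (\<forall>i<N. F i = kc (he H i))" for F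
  proof
    assume *: "\<forall>x\<in>V. linv H F x = kc (counitv H x)"
    show "\<forall>i<N. F i = kc (he H i)"
    proof (intro allI impI)
      fix i assume "i < N"
      then show "F i = kc (he H i)" using *[rule_format, of "bas i"] by (simp add: linv_bas counitv_bas)
    qed
  next
    assume "\<forall>i<N. F i = kc (he H i)"
    then have "linv H F x = linv H (\<lambda>i. kc (he H i)) x" for x by (intro linv_cong) simp
    then show "\<forall>x\<in>V. linv H F x = kc (counitv H x)" by (simp add: linv_kc counitv_dotp)
  qed
  show ?thesis unfolding is_tinv_def 1 2 ball_conj_distrib 3 by blast
qed

lemma conv_unit_left: "i < N \<Longrightarrow> ((\<lambda>i. kc (he H i)) \<star> f) i = f i"
  using CF.conv_unit_l[of i 1 f] by (simp add: scF_def)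

lemma conv_unit_right: "i < N \<Longrightarrow> (f \<star> (\<lambda>i. kc (he H i))) i = f i"
  using CF.conv_unit_r[of i f 1] by (simp add: scF_def)

end

section \<open>The convolution inverse of t and the cocycle\<close>

locale pointed_hopf = hopf H for H :: "'k::field hopf_data" +
  assumes pointed: "pointed H"
begin

lemma linv_row:
  assumes "\<And>a. comulv H v a - scV (g a) v \<in> X"
  shows "linv H w (comulv H v a) = kc (g a) * linv H w v + linv H w (comulv H v a - scV (g a) v)"
  unfolding linv_diff linv_scale by simp

text \<open>A solution \<open>w\<close> on X is corrected by a multiple of a functional
  \<open>\<xi>\<close> that vanishes on X and is 1 at v. The values on X do not change, while the
  value at v changes by c times \<open>t_g\<close>, which is nonzero in the fraction field; this
  determines c.\<close>

lemma right_inverse_exists: "\<exists>w. \<forall>i<N. (tv \<star> w) i = kc (he H i)"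
proof -
  have "\<exists>w. \<forall>x\<in>V. linv H (tv \<star> w) x = kc (counitv H x)"
  proof (rule coideal_induct[OF pointed])
    show "\<exists>w. \<forall>x\<in>{0}. linv H (tv \<star> w) x = kc (counitv H x)" by simp
  next
    fix X v g
    assume X: "lcoideal X" and IH: "\<exists>w. \<forall>x\<in>X. linv H (tv \<star> w) x = kc (counitv H x)"
      and v: "v \<in> V" "v \<notin> X" and g: "g \<in> GL" and d: "\<And>a. comulv H v a - scV (g a) v \<in> X"
    have XV: "subspace_of N X" using X by (simp add: lcoideal_def)
    obtain w where w: "\<And>x. x \<in> X \<Longrightarrow> linv H (tv \<star> w) x = kc (counitv H x)" using IH by blast
    obtain \<xi> where \<xi>: "\<And>x. x \<in> X \<Longrightarrow> dotp N \<xi> x = 0" "dotp N \<xi> v = 1"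
      using separating_functional[OF XV v] by blast
    define c where "c = (kc (counitv H v) - linv H (tv \<star> w) v) / linv H tv g"
    define w' where "w' i = w i + c * kc (\<xi> i)" for i
    have w': "linv H (tv \<star> w') x = linv H (tv \<star> w) x + c * (\<Sum>a<N. tv a * kc (dotp N \<xi> (comulv H x a)))" for x
    proof -
      have "linv H w' z = linv H w z + c * kc (dotp N \<xi> z)" for z
        unfolding linv_def dotp_def w'_def kc_sum kc_mult
        by (simp add: distrib_left sum.distrib sum_distrib_left ac_simps)
      then show ?thesis unfolding linv_conv by (simp add: distrib_left sum.distrib sum_distrib_left ac_simps)
    qed
    have onX: "linv H (tv \<star> w') x = kc (counitv H x)" if "x \<in> X" for x
      unfolding w' using w[OF that] that X \<xi>(1) by (simp add: lcoideal_def)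
    have "dotp N \<xi> (comulv H v a) = g a" for a
      using \<xi>(1)[OF d[of a]] \<xi>(2) by (simp only: dotp_diff dotp_scale) simp
    then have "(\<Sum>a<N. tv a * kc (dotp N \<xi> (comulv H v a))) = linv H tv g"
      by (simp add: linv_def mult.commute)
    then have onv: "linv H (tv \<star> w') v = kc (counitv H v)"
      unfolding w' c_def using t_grouplike_nonzero[OF g] by simp
    show "\<exists>w. \<forall>x\<in>{x + scV c v |x c. x \<in> X}. linv H (tv \<star> w) x = kc (counitv H x)"
    proof (intro exI[of _ w'] ballI)
      fix y assume "y \<in> {x + scV c v |x c. x \<in> X}"
      then obtain x c where y: "y = x + scV c v" "x \<in> X" by blast
      show "linv H (tv \<star> w') y = kc (counitv H y)"
        unfolding y(1) linv_add linv_scale counitv_add counitv_scale kc_add kc_mult onX[OF y(2)] onv ..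
    qed
  qed
  then obtain w where "\<forall>x\<in>V. linv H (tv \<star> w) x = kc (counitv H x)" by blast
  then have "(tv \<star> w) i = kc (he H i)" if "i < N" for i
    using that linv_bas[OF that, of "tv \<star> w"] counitv_bas[OF that] by (metis bas_in_vecs)
  then show ?thesis by blast
qed

text \<open>If z already vanishes on X, the convolution of t with z at v reduces to
  \<open>t_g\<close> times z(v), and \<open>t_g\<close> is nonzero.\<close>

lemma tv_conv_cancel:
  assumes "\<And>i. i < N \<Longrightarrow> (tv \<star> z) i = 0" "i < N"
  shows "z i = 0"
proof -
  have zero: "linv H (tv \<star> z) x = 0" for x using assms(1) by (simp add: linv_def)
  have "\<forall>x\<in>V. linv H z x = 0"
  proof (rule coideal_induct[OF pointed])
    fix X v g
    assume IH: "\<forall>x\<in>X. linv H z x = 0" and g: "g \<in> GL" and d: "\<And>a. comulv H v a - scV (g a) v \<in> X"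
    have "linv H z (comulv H v a - scV (g a) v) = 0" for a using IH d by blast
    then have "linv H z (comulv H v a) = kc (g a) * linv H z v" for a
      using linv_row[OF d, of z a] by (simp only: add_0_right)
    then have "linv H (tv \<star> z) v = linv H tv g * linv H z v"
      unfolding linv_conv linv_def[of H tv] by (simp add: sum_distrib_left sum_distrib_right ac_simps)
    then have "linv H z v = 0" using zero t_grouplike_nonzero[OF g] by simp
    then show "\<forall>x\<in>{x + scV c v |x c. x \<in> X}. linv H z x = 0"
      using IH by (auto simp only: mem_Collect_eq linv_add linv_scale mult_zero_right add_0)
  qed (use linv_zero in blast)
  then show ?thesis using linv_bas[OF assms(2), of z] assms(2) by (metis bas_in_vecs)
qed

text \<open>For a right inverse w, convolving t with w \<star> t - \<epsilon> gives t - t = 0 by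
  associativity; cancelling t shows that w is a left inverse too.\<close>

lemma is_tinv_unique_exists: "\<exists>!w. is_tinv H w"
proof -
  obtain w where w: "\<And>i. i < N \<Longrightarrow> (tv \<star> w) i = kc (he H i)" using right_inverse_exists by blast
  have wt: "(w \<star> tv) i = kc (he H i)" if i: "i < N" for i
  proof -
    have "(tv \<star> (\<lambda>i. (w \<star> tv) i - kc (he H i))) j = 0" if j: "j < N" for j
    proof -
      have "(tv \<star> (\<lambda>i. (w \<star> tv) i - kc (he H i))) j = (tv \<star> (w \<star> tv)) j - (tv \<star> (\<lambda>i. kc (he H i))) j"
        unfolding conv1_eq by (simp add: right_diff_distrib sum_subtractf)
      also have "(tv \<star> (w \<star> tv)) j = ((tv \<star> w) \<star> tv) j" using CF.conv_assoc j by simp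
      also have "\<dots> = ((\<lambda>i. kc (he H i)) \<star> tv) j" by (rule CF.conv_cong) (simp_all add: w)
      finally show ?thesis using conv_unit_left[OF j, of tv] conv_unit_right[OF j, of tv] by simp
    qed
    then show ?thesis using tv_conv_cancel[of "\<lambda>i. (w \<star> tv) i - kc (he H i)" i] i by simp
  qed
  \<comment> \<open>\<open>is_tinv\<close> prescribes the value 0 at all indices from the dimension
    on, which the convolution equations do not see.\<close>
  define w' where "w' i = (if i < N then w i else 0)" for i
  have "(tv \<star> w') i = (tv \<star> w) i" "(w' \<star> tv) i = (w \<star> tv) i" for i
    by (rule CF.conv_cong; simp add: w'_def)+
  then have ex: "is_tinv H w'" unfolding is_tinv_iff using w wt by (simp add: w'_def)
  moreover have "u = w'" if "is_tinv H u" for u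
  proof
    fix i show "u i = w' i"
    proof (cases "i < N")
      case True
      then show ?thesis using ex that unfolding is_tinv_iff
        by - (rule CF.conv_inverse_unique[where g = tv and u = 1], simp_all add: scF_def)
    next
      case False
      then show ?thesis using ex that unfolding is_tinv_iff by simp
    qed
  qed
  ultimately show ?thesis by blast
qed

definition ti :: "nat \<Rightarrow> 'k mpoly fract" where
  "ti = (THE w. is_tinv H w)"

lemma tinv_eq: "tinv H x = linv H ti x"
  by (simp add: tinv_def ti_def)

lemma is_tinv_ti: "is_tinv H ti"
  unfolding ti_def by (rule theI'[OF is_tinv_unique_exists])

lemma tv_ti: "i < N \<Longrightarrow> (tv \<star> ti) i = kc (he H i)" and ti_tv: "i < N \<Longrightarrow> (ti \<star> tv) i = kc (he H i)"
  using is_tinv_ti by (auto simp: is_tinv_iff)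

abbreviation tt :: "nat \<times> nat \<Rightarrow> 'k mpoly fract" where "tt \<equiv> \<lambda>p. tv (fst p) * tv (snd p)"
abbreviation titi :: "nat \<times> nat \<Rightarrow> 'k mpoly fract" where "titi \<equiv> \<lambda>p. ti (fst p) * ti (snd p)"

text \<open>On basis pairs, \<sigma> is the convolution over H \<otimes> H of t \<otimes> t with the
  pullback of \<open>ti\<close> along the multiplication. In \<open>sgi\<close> the inverses of the
  two factors appear in reversed order.\<close>

definition sg :: "nat \<times> nat \<Rightarrow> 'k mpoly fract" where "sg = tt \<star>\<star> mus ti"
definition sgi :: "nat \<times> nat \<Rightarrow> 'k mpoly fract" where "sgi = mus tv \<star>\<star> titi"

lemma comulv_pair_expand:
  "(\<Sum>a<N. \<Sum>b<N. \<Sum>a'<N. \<Sum>b'<N. kc (comulv H x a b * comulv H y a' b') * G a b a' b')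
    = (\<Sum>i<N. \<Sum>j<N. kc (x i * y j) * (\<Sum>a<N. \<Sum>b<N. \<Sum>a'<N. \<Sum>b'<N. kc (hc H i a b * hc H j a' b') * G a b a' b'))"
proof -
  have e: "kc (comulv H x a b * comulv H y a' b')
      = (\<Sum>i<N. \<Sum>j<N. kc (x i * y j) * kc (hc H i a b * hc H j a' b'))" for a b a' b'
    unfolding comulv_def sum_product kc_sum by (intro sum.cong refl) (simp add: kc_mult ac_simps)
  let ?F = "\<lambda>a b a' b' i j. kc (x i * y j) * (kc (hc H i a b * hc H j a' b') * G a b a' b')"
  have "(\<Sum>a<N. \<Sum>b<N. \<Sum>a'<N. \<Sum>b'<N. kc (comulv H x a b * comulv H y a' b') * G a b a' b')
      = (\<Sum>a<N. \<Sum>b<N. \<Sum>a'<N. \<Sum>b'<N. \<Sum>i<N. \<Sum>j<N. ?F a b a' b' i j)"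
    unfolding e sum_distrib_right by (simp only: mult.assoc)
  also have "\<dots> = (\<Sum>a<N. \<Sum>b<N. \<Sum>i<N. \<Sum>j<N. \<Sum>a'<N. \<Sum>b'<N. ?F a b a' b' i j)"
    by (rule sum.cong[OF refl], rule sum.cong[OF refl], rule sum_swap4)
  also have "\<dots> = (\<Sum>i<N. \<Sum>j<N. \<Sum>a<N. \<Sum>b<N. \<Sum>a'<N. \<Sum>b'<N. ?F a b a' b' i j)"
    by (rule sum_swap4)
  finally show ?thesis by (simp only: sum_distrib_left)
qed

lemma sigma_eq: "sigma H x y = (\<Sum>i<N. \<Sum>j<N. kc (x i * y j) * sg (i, j))"
proof -
  have "sigma H x y = (\<Sum>a<N. \<Sum>b<N. \<Sum>a'<N. \<Sum>b'<N. kc (comulv H x a b * comulv H y a' b') *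
      (tt (a, a') * mus ti (b, b')))"
    unfolding sigma_def by (intro sum.cong refl) (simp add: emb_mult tv_def tinv_eq mus_def mulv_bas mult.assoc)
  also have "\<dots> = (\<Sum>i<N. \<Sum>j<N. kc (x i * y j) * sg (i, j))"
    unfolding comulv_pair_expand sg_def CF2.conv_def sum_pairs2 scF_def by simp
  finally show ?thesis .
qed

lemma sigma_inv_eq: "sigma_inv H x y = (\<Sum>i<N. \<Sum>j<N. kc (x i * y j) * sgi (i, j))"
proof -
  have "sigma_inv H x y = (\<Sum>a<N. \<Sum>b<N. \<Sum>a'<N. \<Sum>b'<N. kc (comulv H x a b * comulv H y a' b') *
      (mus tv (a, a') * titi (b, b')))"
    unfolding sigma_inv_def
    by (intro sum.cong refl) (simp add: emb_tvar tinv_eq linv_bas mus_def mulv_bas mult.assoc)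
  also have "\<dots> = (\<Sum>i<N. \<Sum>j<N. kc (x i * y j) * sgi (i, j))"
    unfolding comulv_pair_expand sgi_def CF2.conv_def sum_pairs2 scF_def by simp
  finally show ?thesis .
qed

end

text \<open>The functionals f form the dual basis of the group-likes of the abelianization of H, so that
  \<open>x \<mapsto> \<Sum>\<gamma>. f \<gamma> x \<cdot> \<gamma>\<close> is the projection of H onto the group algebra of \<open>\<Gamma>\<close>.\<close>

locale graded_hopf = pointed_hopf H for H :: "'k::field hopf_data" +
  fixes \<Gamma> :: "('c, 'd) monoid_scheme" and f :: "'c \<Rightarrow> nat \<Rightarrow> 'k"
  assumes \<Gamma>: "comm_group \<Gamma>" and fin_\<Gamma>: "finite (carrier \<Gamma>)"
    and f_counit: "\<And>x. x \<in> V \<Longrightarrow> (\<Sum>\<gamma>\<in>carrier \<Gamma>. dotp N (f \<gamma>) x) = counitv H x"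
    and f_orth: "\<And>x \<gamma> \<delta>. x \<in> V \<Longrightarrow> \<gamma> \<in> carrier \<Gamma> \<Longrightarrow> \<delta> \<in> carrier \<Gamma> \<Longrightarrow>
      dotp N (fconv (f \<gamma>) (f \<delta>)) x = (if \<gamma> = \<delta> then dotp N (f \<gamma>) x else 0)"
    and f_mulv: "\<And>x y \<gamma>. x \<in> V \<Longrightarrow> y \<in> V \<Longrightarrow> \<gamma> \<in> carrier \<Gamma> \<Longrightarrow> dotp N (f \<gamma>) (mulv H x y)
      = (\<Sum>\<alpha>\<in>carrier \<Gamma>. \<Sum>\<beta>\<in>carrier \<Gamma>. if \<alpha> \<otimes>\<^bsub>\<Gamma>\<^esub> \<beta> = \<gamma> then dotp N (f \<alpha>) x * dotp N (f \<beta>) y else 0)"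
    and f_kernel: "\<And>x. x \<in> V \<Longrightarrow> \<forall>\<gamma>\<in>carrier \<Gamma>. dotp N (f \<gamma>) x = 0 \<Longrightarrow> x \<in> CI"
    and f_nonzero: "\<And>\<gamma>. \<gamma> \<in> carrier \<Gamma> \<Longrightarrow> \<exists>x\<in>V. dotp N (f \<gamma>) x \<noteq> 0"
begin

sublocale GG: comm_group \<Gamma> by (rule \<Gamma>)

abbreviation "C \<equiv> carrier \<Gamma>"

subsection \<open>Degrees of group-like elements\<close>

text \<open>The values of the \<open>f \<gamma>\<close> at g are orthogonal idempotents of the field
  with sum 1, so exactly one of them is 1.\<close>

lemma degree_exists:
  assumes g: "g \<in> GL"
  shows "\<exists>\<gamma>\<in>C. \<forall>\<delta>\<in>C. dotp N (f \<delta>) g = (if \<delta> = \<gamma> then 1 else 0)"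
proof -
  have o: "dotp N (f \<gamma>) g * dotp N (f \<delta>) g = (if \<gamma> = \<delta> then dotp N (f \<gamma>) g else 0)" if "\<gamma> \<in> C" "\<delta> \<in> C" for \<gamma> \<delta>
    using f_orth[OF grouplikeD(1)[OF g] that] dotp_fconv_grouplike[OF g] by simp
  have one: "(\<Sum>\<gamma>\<in>C. dotp N (f \<gamma>) g) = 1"
    using f_counit[OF grouplikeD(1)[OF g]] grouplikeD(4)[OF g] by (rule trans)
  have "\<exists>\<gamma>\<in>C. dotp N (f \<gamma>) g \<noteq> 0"
  proof (rule ccontr)
    assume "\<not> ?thesis"
    then have "(\<Sum>\<gamma>\<in>C. dotp N (f \<gamma>) g) = 0" by (intro sum.neutral) blast
    then show False using one by simp
  qed
  then obtain \<gamma> where \<gamma>: "\<gamma> \<in> C" "dotp N (f \<gamma>) g \<noteq> 0" by blast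
  have "dotp N (f \<delta>) g = (if \<delta> = \<gamma> then 1 else 0)" if "\<delta> \<in> C" for \<delta>
  proof (cases "\<delta> = \<gamma>")
    case True
    have "dotp N (f \<gamma>) g * dotp N (f \<gamma>) g = dotp N (f \<gamma>) g" using o[OF \<gamma>(1) \<gamma>(1)] by simp
    then show ?thesis using \<gamma>(2) True mult_cancel_left2 by metis
  next
    case False
    then have "dotp N (f \<gamma>) g * dotp N (f \<delta>) g = 0" using o[OF \<gamma>(1) that] by (metis (full_types))
    then show ?thesis using \<gamma>(2) False by (metis mult_eq_0_iff)
  qed
  then show ?thesis using \<gamma>(1) by blast
qed

definition deg :: "(nat \<Rightarrow> 'k) \<Rightarrow> 'c" where
  "deg g = (SOME \<gamma>. \<gamma> \<in> C \<and> (\<forall>\<delta>\<in>C. dotp N (f \<delta>) g = (if \<delta> = \<gamma> then 1 else 0)))"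

lemma deg:
  assumes "g \<in> GL"
  shows "deg g \<in> C" "\<And>\<delta>. \<delta> \<in> C \<Longrightarrow> dotp N (f \<delta>) g = (if \<delta> = deg g then 1 else 0)"
  using someI_ex[of "\<lambda>\<gamma>. \<gamma> \<in> C \<and> (\<forall>\<delta>\<in>C. dotp N (f \<delta>) g = (if \<delta> = \<gamma> then 1 else 0))"]
    degree_exists[OF assms] unfolding deg_def by blast+

lemma deg_eqI: "g \<in> GL \<Longrightarrow> \<gamma> \<in> C \<Longrightarrow> dotp N (f \<gamma>) g \<noteq> 0 \<Longrightarrow> deg g = \<gamma>"
  using deg(2) by metis

text \<open>Group-likes of the abelianization lift to H. If none of degree \<gamma> existed,
  idempotency would give f_\<gamma>(v) = f_\<gamma>(g) f_\<gamma>(v) = 0 at each step of the coideal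
  induction, and \<open>f \<gamma>\<close> would vanish on all of H.\<close>

lemma deg_surj:
  assumes \<gamma>: "\<gamma> \<in> C"
  shows "\<exists>g\<in>GL. deg g = \<gamma>"
proof -
  have "(\<exists>x\<in>V. dotp N (f \<gamma>) x \<noteq> 0) \<longrightarrow> (\<exists>g\<in>GL. deg g = \<gamma>)"
  proof (rule coideal_induct[OF pointed])
    show "(\<exists>x\<in>{0}. dotp N (f \<gamma>) x \<noteq> 0) \<longrightarrow> (\<exists>g\<in>GL. deg g = \<gamma>)" using dotp_zero by blast
  next
    fix X v g
    assume X: "lcoideal X" and IH: "(\<exists>x\<in>X. dotp N (f \<gamma>) x \<noteq> 0) \<longrightarrow> (\<exists>g\<in>GL. deg g = \<gamma>)"
      and v: "v \<in> V" "v \<notin> X" and g: "g \<in> GL" and d: "\<And>a. comulv H v a - scV (g a) v \<in> X"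
    show "(\<exists>x\<in>{x + scV c v |x c. x \<in> X}. dotp N (f \<gamma>) x \<noteq> 0) \<longrightarrow> (\<exists>g\<in>GL. deg g = \<gamma>)"
    proof (rule impI, rule ccontr)
      assume ne: "\<not> (\<exists>g\<in>GL. deg g = \<gamma>)"
      then have zX: "\<And>x. x \<in> X \<Longrightarrow> dotp N (f \<gamma>) x = 0" using IH by blast
      have "dotp N (f \<gamma>) (comulv H v a) = g a * dotp N (f \<gamma>) v" for a
        using zX[OF d[of a]] by (simp only: dotp_diff dotp_scale) simp
      then have "(\<Sum>a<N. f \<gamma> a * (g a * dotp N (f \<gamma>) v)) = dotp N (fconv (f \<gamma>) (f \<gamma>)) v"
        unfolding dotp_fconv by (simp add: dotp_def mult.assoc flip: sum_distrib_left)
      also have "\<dots> = dotp N (f \<gamma>) v" using f_orth[OF v(1) \<gamma> \<gamma>] by simp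
      finally have "dotp N (f \<gamma>) g * dotp N (f \<gamma>) v = dotp N (f \<gamma>) v"
        by (simp add: dotp_def[of N "f \<gamma>" g] sum_distrib_right mult.assoc)
      moreover have "dotp N (f \<gamma>) g = 0" using ne deg_eqI[OF g \<gamma>] g by blast
      ultimately have "dotp N (f \<gamma>) v = 0" by simp
      moreover assume "\<exists>x\<in>{x + scV c v |x c. x \<in> X}. dotp N (f \<gamma>) x \<noteq> 0"
      ultimately show False
        using zX by (auto simp only: mem_Collect_eq dotp_add dotp_scale mult_zero_right add_0)
    qed
  qed
  then show ?thesis using f_nonzero[OF \<gamma>] by blast
qed

text \<open>\<open>f \<gamma>\<close> as an element of the convolution algebra with values in the
  fraction field. Convolving t on the right with it sends x to t_{x_1} f_\<gamma>(x_2), the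
  component of degree \<gamma>.\<close>

abbreviation E :: "'c \<Rightarrow> nat \<Rightarrow> 'k mpoly fract" where "E \<gamma> \<equiv> \<lambda>i. kc (f \<gamma> i)"

lemma E_conv:
  assumes "\<gamma> \<in> C" "\<delta> \<in> C" "i < N"
  shows "(E \<gamma> \<star> E \<delta>) i = (if \<gamma> = \<delta> then E \<gamma> i else 0)"
proof -
  have "(E \<gamma> \<star> E \<delta>) i = kc (fconv (f \<gamma>) (f \<delta>) i)"
    unfolding conv1_eq fconv_def by (simp add: kc_sum kc_mult mult.assoc)
  also have "fconv (f \<gamma>) (f \<delta>) i = (if \<gamma> = \<delta> then f \<gamma> i else 0)"
    using f_orth[of "bas i" \<gamma> \<delta>] assms by (simp add: dotp_bas)
  finally show ?thesis by simp
qed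

lemma E_sum: "i < N \<Longrightarrow> (\<Sum>\<gamma>\<in>C. E \<gamma> i) = kc (he H i)"
  using f_counit[of "bas i"] by (simp add: dotp_bas counitv_bas flip: kc_sum)

lemma mus_E:
  assumes "\<gamma> \<in> C" "i < N" "j < N"
  shows "mus (E \<gamma>) (i, j) = (\<Sum>\<alpha>\<in>C. \<Sum>\<beta>\<in>C. if \<alpha> \<otimes>\<^bsub>\<Gamma>\<^esub> \<beta> = \<gamma> then E \<alpha> i * E \<beta> j else 0)"
proof -
  have "mus (E \<gamma>) (i, j) = kc (dotp N (f \<gamma>) (mulv H (bas i) (bas j)))"
    using assms by (simp add: mus_def linv_kc mulv_bas)
  also have "\<dots> = kc (\<Sum>\<alpha>\<in>C. \<Sum>\<beta>\<in>C. if \<alpha> \<otimes>\<^bsub>\<Gamma>\<^esub> \<beta> = \<gamma> then f \<alpha> i * f \<beta> j else 0)"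
    using assms by (subst f_mulv) (auto simp: dotp_bas intro!: arg_cong[of _ _ kc] sum.cong)
  finally show ?thesis by (simp add: kc_sum kc_mult if_distrib[of kc] cong: if_cong)
qed

text \<open>The unit of convolution, written as the sum of the idempotents
  \<open>E \<gamma>\<close>, is inserted between the factors, and each idempotent is doubled so that
  one copy can be attached to either side.\<close>

lemma conv_split:
  assumes i: "i < N"
  shows "(w \<star> w') i = (\<Sum>\<gamma>\<in>C. ((w \<star> E \<gamma>) \<star> (E \<gamma> \<star> w')) i)"
proof -
  have unit: "((\<lambda>i. \<Sum>\<gamma>\<in>C. E \<gamma> i) \<star> w') a = w' a" if "a < N" for a
  proof -
    have "((\<lambda>i. \<Sum>\<gamma>\<in>C. E \<gamma> i) \<star> w') a = ((\<lambda>i. kc (he H i)) \<star> w') a"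
      by (rule CF.conv_cong) (simp_all only: E_sum lessThan_iff)
    then show ?thesis by (simp only: conv_unit_left[OF that])
  qed
  have "(w \<star> w') i = (w \<star> ((\<lambda>i. \<Sum>\<gamma>\<in>C. E \<gamma> i) \<star> w')) i"
    by (rule CF.conv_cong) (simp_all only: unit lessThan_iff)
  also have "\<dots> = (\<Sum>\<gamma>\<in>C. (w \<star> (E \<gamma> \<star> w')) i)"
    unfolding CF.conv_sum_l[abs_def] CF.conv_sum_r ..
  also have "\<dots> = (\<Sum>\<gamma>\<in>C. ((w \<star> E \<gamma>) \<star> (E \<gamma> \<star> w')) i)"
  proof (rule sum.cong[OF refl])
    fix \<gamma> assume \<gamma>: "\<gamma> \<in> C"
    have "(w \<star> (E \<gamma> \<star> w')) i = (w \<star> ((E \<gamma> \<star> E \<gamma>) \<star> w')) i"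
      by (rule CF.conv_cong, rule refl, rule CF.conv_cong, simp add: E_conv \<gamma>, rule refl)
    also have "\<dots> = (w \<star> (E \<gamma> \<star> (E \<gamma> \<star> w'))) i"
      by (rule CF.conv_cong, rule refl, rule CF.conv_assoc)
    finally show "(w \<star> (E \<gamma> \<star> w')) i = ((w \<star> E \<gamma>) \<star> (E \<gamma> \<star> w')) i" using i by (simp add: CF.conv_assoc)
  qed
  finally show ?thesis .
qed

abbreviation E2 :: "'c \<Rightarrow> 'c \<Rightarrow> nat \<times> nat \<Rightarrow> 'k mpoly fract" where
  "E2 \<alpha> \<beta> \<equiv> \<lambda>p. E \<alpha> (fst p) * E \<beta> (snd p)"

lemma E2_conv:
  assumes "\<alpha> \<in> C" "\<beta> \<in> C" "\<gamma> \<in> C" "\<delta> \<in> C" "p \<in> {..<N} \<times> {..<N}"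
  shows "(E2 \<alpha> \<beta> \<star>\<star> E2 \<gamma> \<delta>) p = (if \<alpha> = \<gamma> \<and> \<beta> = \<delta> then E2 \<alpha> \<beta> p else 0)"
  using assms conv2_pure[of "E \<alpha>" "E \<beta>" "E \<gamma>" "E \<delta>" "fst p" "snd p"] by (auto simp: E_conv mem_Times_iff)

lemma E2_sum:
  assumes "p \<in> {..<N} \<times> {..<N}"
  shows "(\<Sum>q\<in>C \<times> C. E2 (fst q) (snd q) p) = kc (he2 p)"
proof -
  have "(\<Sum>q\<in>C \<times> C. E2 (fst q) (snd q) p) = (\<Sum>\<alpha>\<in>C. E \<alpha> (fst p)) * (\<Sum>\<beta>\<in>C. E \<beta> (snd p))"
    by (simp add: sum_product sum.cartesian_product split_beta)
  also have "\<dots> = kc (he2 p)" using assms by (simp add: E_sum mem_Times_iff kc_mult)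
  finally show ?thesis .
qed

lemma mus_E2:
  assumes "\<gamma> \<in> C" "p \<in> {..<N} \<times> {..<N}"
  shows "mus (E \<gamma>) p = (\<Sum>q\<in>C \<times> C. if fst q \<otimes>\<^bsub>\<Gamma>\<^esub> snd q = \<gamma> then E2 (fst q) (snd q) p else 0)"
  using assms mus_E[of \<gamma> "fst p" "snd p"] by (simp add: mem_Times_iff sum.cartesian_product split_beta)

text \<open>The pullback of \<open>E\<close> at the product of \<alpha> and \<beta> along the
  multiplication is the sum of all \<open>E2\<close> over pairs with that product. These are
  orthogonal idempotents, and \<open>E2 \<alpha> \<beta>\<close> is one of them.\<close>

lemma E2_mus_E_l:
  assumes ab: "\<alpha> \<in> C" "\<beta> \<in> C" and p: "p \<in> {..<N} \<times> {..<N}"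
  shows "(E2 \<alpha> \<beta> \<star>\<star> mus (E (\<alpha> \<otimes>\<^bsub>\<Gamma>\<^esub> \<beta>))) p = E2 \<alpha> \<beta> p"
    "(mus (E (\<alpha> \<otimes>\<^bsub>\<Gamma>\<^esub> \<beta>)) \<star>\<star> E2 \<alpha> \<beta>) p = E2 \<alpha> \<beta> p"
proof -
  let ?P = "\<lambda>q. fst q \<otimes>\<^bsub>\<Gamma>\<^esub> snd q = \<alpha> \<otimes>\<^bsub>\<Gamma>\<^esub> \<beta>"
  let ?S = "{q \<in> C \<times> C. ?P q}"
  have m: "mus (E (\<alpha> \<otimes>\<^bsub>\<Gamma>\<^esub> \<beta>)) p = (\<Sum>q\<in>?S. E2 (fst q) (snd q) p)" if "p \<in> {..<N} \<times> {..<N}" for p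
    using mus_E2[OF GG.m_closed[OF ab] that] fin_\<Gamma> by (simp add: sum.If_cases Int_def)
  have fS: "finite ?S" "(\<alpha>, \<beta>) \<in> ?S" using fin_\<Gamma> ab by auto
  have "(E2 \<alpha> \<beta> \<star>\<star> mus (E (\<alpha> \<otimes>\<^bsub>\<Gamma>\<^esub> \<beta>))) p = (E2 \<alpha> \<beta> \<star>\<star> (\<lambda>p. \<Sum>q\<in>?S. E2 (fst q) (snd q) p)) p"
    by (rule CF2.conv_cong) (simp_all add: m)
  also have "\<dots> = (\<Sum>q\<in>?S. if q = (\<alpha>, \<beta>) then E2 \<alpha> \<beta> p else 0)"
    unfolding CF2.conv_sum_r using ab p by (intro sum.cong refl) (auto simp: E2_conv prod_eq_iff)
  also have "\<dots> = E2 \<alpha> \<beta> p" using fS by (simp add: sum.delta)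
  finally show "(E2 \<alpha> \<beta> \<star>\<star> mus (E (\<alpha> \<otimes>\<^bsub>\<Gamma>\<^esub> \<beta>))) p = E2 \<alpha> \<beta> p" .
  have "(mus (E (\<alpha> \<otimes>\<^bsub>\<Gamma>\<^esub> \<beta>)) \<star>\<star> E2 \<alpha> \<beta>) p = ((\<lambda>p. \<Sum>q\<in>?S. E2 (fst q) (snd q) p) \<star>\<star> E2 \<alpha> \<beta>) p"
    by (rule CF2.conv_cong) (simp_all add: m)
  also have "\<dots> = (\<Sum>q\<in>?S. if q = (\<alpha>, \<beta>) then E2 \<alpha> \<beta> p else 0)"
    unfolding CF2.conv_sum_l using ab p by (intro sum.cong refl) (auto simp: E2_conv prod_eq_iff)
  also have "\<dots> = E2 \<alpha> \<beta> p" using fS by (simp add: sum.delta)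
  finally show "(mus (E (\<alpha> \<otimes>\<^bsub>\<Gamma>\<^esub> \<beta>)) \<star>\<star> E2 \<alpha> \<beta>) p = E2 \<alpha> \<beta> p" .
qed

lemma conv2_split:
  assumes p: "p \<in> {..<N} \<times> {..<N}"
  shows "(w \<star>\<star> w') p = (\<Sum>q\<in>C \<times> C. ((w \<star>\<star> E2 (fst q) (snd q)) \<star>\<star> (E2 (fst q) (snd q) \<star>\<star> w')) p)"
proof -
  have unit: "((\<lambda>p. \<Sum>q\<in>C \<times> C. E2 (fst q) (snd q) p) \<star>\<star> w') a = w' a" if "a \<in> {..<N} \<times> {..<N}" for a
  proof -
    have "((\<lambda>p. \<Sum>q\<in>C \<times> C. E2 (fst q) (snd q) p) \<star>\<star> w') a = ((\<lambda>p. scF (he2 p) 1) \<star>\<star> w') a"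
      by (rule CF2.conv_cong) (simp_all only: E2_sum scF_def mult_1_right)
    also have "\<dots> = w' a" by (rule CF2.conv_unit_l[OF that]) simp
    finally show ?thesis .
  qed
  have "(w \<star>\<star> w') p = (w \<star>\<star> ((\<lambda>p. \<Sum>q\<in>C \<times> C. E2 (fst q) (snd q) p) \<star>\<star> w')) p"
    by (rule CF2.conv_cong) (simp_all only: unit)
  also have "\<dots> = (\<Sum>q\<in>C \<times> C. (w \<star>\<star> (E2 (fst q) (snd q) \<star>\<star> w')) p)"
    unfolding CF2.conv_sum_l[abs_def] CF2.conv_sum_r ..
  also have "\<dots> = (\<Sum>q\<in>C \<times> C. ((w \<star>\<star> E2 (fst q) (snd q)) \<star>\<star> (E2 (fst q) (snd q) \<star>\<star> w')) p)"
  proof (rule sum.cong[OF refl])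
    fix q assume "q \<in> C \<times> C"
    then have q: "fst q \<in> C" "snd q \<in> C" by auto
    let ?E = "E2 (fst q) (snd q)"
    have "(w \<star>\<star> (?E \<star>\<star> w')) p = (w \<star>\<star> ((?E \<star>\<star> ?E) \<star>\<star> w')) p"
      by (rule CF2.conv_cong, rule refl, rule CF2.conv_cong, simp add: E2_conv q, rule refl)
    also have "\<dots> = (w \<star>\<star> (?E \<star>\<star> (?E \<star>\<star> w'))) p"
      by (rule CF2.conv_cong, rule refl, rule CF2.conv_assoc)
    finally show "(w \<star>\<star> (?E \<star>\<star> w')) p = ((w \<star>\<star> ?E) \<star>\<star> (?E \<star>\<star> w')) p" using p by (simp only: CF2.conv_assoc)
  qed
  finally show ?thesis .
qed

subsection \<open>Graded families\<close>

text \<open>Only closure conditions are imposed, neither directness nor a form for the denominators.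
  This admits the homogeneous fractions as well as the family built from the proposed
  generators.\<close>

definition graded_family :: "('c \<Rightarrow> 'k mpoly fract set) \<Rightarrow> bool" where
  "graded_family A \<longleftrightarrow> (\<forall>\<gamma>\<in>C. 0 \<in> A \<gamma> \<and> (\<forall>z\<in>A \<gamma>. \<forall>z'\<in>A \<gamma>. z + z' \<in> A \<gamma>)) \<and>
    (\<forall>\<gamma>\<in>C. \<forall>\<delta>\<in>C. \<forall>z\<in>A \<gamma>. \<forall>z'\<in>A \<delta>. z * z' \<in> A (\<gamma> \<otimes>\<^bsub>\<Gamma>\<^esub> \<delta>)) \<and>
    (\<forall>c. kc c \<in> A \<one>\<^bsub>\<Gamma>\<^esub>) \<and> (\<forall>\<gamma>\<in>C. \<forall>i<N. (tv \<star> E \<gamma>) i \<in> A \<gamma>) \<and>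
    (\<forall>g\<in>GL. inverse (linv H tv g) \<in> A (inv\<^bsub>\<Gamma>\<^esub> (deg g)))"

context
  fixes A assumes A: "graded_family A"
begin

lemma gf_0: "\<gamma> \<in> C \<Longrightarrow> 0 \<in> A \<gamma>"
  and gf_add: "\<gamma> \<in> C \<Longrightarrow> z \<in> A \<gamma> \<Longrightarrow> z' \<in> A \<gamma> \<Longrightarrow> z + z' \<in> A \<gamma>"
  and gf_mult: "\<gamma> \<in> C \<Longrightarrow> \<delta> \<in> C \<Longrightarrow> z \<in> A \<gamma> \<Longrightarrow> z' \<in> A \<delta> \<Longrightarrow> z * z' \<in> A (\<gamma> \<otimes>\<^bsub>\<Gamma>\<^esub> \<delta>)"
  and gf_kc: "kc c \<in> A \<one>\<^bsub>\<Gamma>\<^esub>"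
  and gf_tv: "\<gamma> \<in> C \<Longrightarrow> i < N \<Longrightarrow> (tv \<star> E \<gamma>) i \<in> A \<gamma>"
  and gf_tinv: "g \<in> GL \<Longrightarrow> inverse (linv H tv g) \<in> A (inv\<^bsub>\<Gamma>\<^esub> (deg g))"
  using A unfolding graded_family_def by blast+

lemma gf_scale: "\<gamma> \<in> C \<Longrightarrow> z \<in> A \<gamma> \<Longrightarrow> kc c * z \<in> A \<gamma>"
  using gf_mult[OF GG.one_closed _ gf_kc, of \<gamma> z c] by simp

lemma gf_sum: "\<gamma> \<in> C \<Longrightarrow> (\<And>i. i \<in> S \<Longrightarrow> F i \<in> A \<gamma>) \<Longrightarrow> sum F S \<in> A \<gamma>"
  by (induction S rule: infinite_finite_induct) (auto simp: gf_0 gf_add)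

lemma gf_minus: "\<gamma> \<in> C \<Longrightarrow> z \<in> A \<gamma> \<Longrightarrow> z' \<in> A \<gamma> \<Longrightarrow> z - z' \<in> A \<gamma>"
  using gf_add[of \<gamma> z "kc (-1) * z'"] gf_scale[of \<gamma> z' "-1"] by (simp add: kc_uminus)

lemma gf_linv: "\<gamma> \<in> C \<Longrightarrow> (\<And>i. i < N \<Longrightarrow> w i \<in> A \<gamma>) \<Longrightarrow> linv H w x \<in> A \<gamma>"
  unfolding linv_def by (auto intro!: gf_sum gf_scale)

lemma gf_inv_mult: "\<gamma> \<in> C \<Longrightarrow> z \<in> A \<gamma> \<Longrightarrow> z' \<in> A (inv\<^bsub>\<Gamma>\<^esub> \<gamma>) \<Longrightarrow> z * z' \<in> A \<one>\<^bsub>\<Gamma>\<^esub>"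
  using gf_mult[of \<gamma> "inv\<^bsub>\<Gamma>\<^esub> \<gamma>" z z'] by simp

text \<open>At the new vector v there are two cases. If \<gamma> is not the degree of g, then
  f_\<gamma>(g) = 0 and the value is determined by values on X. If it is, the equation \<epsilon>(v)
  = (t \<star> t^-1)(v), split into degrees, contains the unknown exactly once, multiplied by
  \<open>t_g\<close>; solving for it costs the inverse of \<open>t_g\<close>, which the family
  provides.\<close>

lemma gf_ti_V:
  "\<forall>x\<in>V. \<forall>\<gamma>\<in>C. linv H (E \<gamma> \<star> ti) x \<in> A (inv\<^bsub>\<Gamma>\<^esub> \<gamma>)"
proof (rule coideal_induct[OF pointed])
  show "\<forall>x\<in>{0}. \<forall>\<gamma>\<in>C. linv H (E \<gamma> \<star> ti) x \<in> A (inv\<^bsub>\<Gamma>\<^esub> \<gamma>)"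
    using linv_zero gf_0 GG.inv_closed by (metis singletonD)
next
  fix X v g
  assume X: "lcoideal X" and IH: "\<forall>x\<in>X. \<forall>\<gamma>\<in>C. linv H (E \<gamma> \<star> ti) x \<in> A (inv\<^bsub>\<Gamma>\<^esub> \<gamma>)"
    and v: "v \<in> V" "v \<notin> X" and g: "g \<in> GL" and d: "\<And>a. comulv H v a - scV (g a) v \<in> X"
  define r where "r a = comulv H v a - scV (g a) v" for a
  have r: "linv H (E \<gamma> \<star> ti) (r a) \<in> A (inv\<^bsub>\<Gamma>\<^esub> \<gamma>)" if "\<gamma> \<in> C" for \<gamma> a
    using IH d that unfolding r_def by blast
  have row: "linv H w (comulv H v a) = kc (g a) * linv H w v + linv H w (r a)" for w a
    unfolding r_def by (rule linv_row[OF d])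
  have conv_v: "linv H (w \<star> w') v = linv H w g * linv H w' v + (\<Sum>a<N. w a * linv H w' (r a))" for w w'
    unfolding linv_conv row by (simp add: linv_def[of H w] distrib_left sum.distrib sum_distrib_left sum_distrib_right ac_simps)
  have onv: "linv H (E \<gamma> \<star> ti) v \<in> A (inv\<^bsub>\<Gamma>\<^esub> \<gamma>)" if \<gamma>: "\<gamma> \<in> C" for \<gamma>
  proof (cases "\<gamma> = deg g")
    case False
    have "linv H (E \<gamma> \<star> ti) v = linv H (E \<gamma> \<star> (E \<gamma> \<star> ti)) v"
    proof (rule linv_cong)
      fix i assume i: "i < N"
      have "(E \<gamma> \<star> ti) i = ((E \<gamma> \<star> E \<gamma>) \<star> ti) i" by (rule CF.conv_cong) (simp_all add: E_conv \<gamma>)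
      then show "(E \<gamma> \<star> ti) i = (E \<gamma> \<star> (E \<gamma> \<star> ti)) i" using i by (simp add: CF.conv_assoc)
    qed
    also have "\<dots> = (\<Sum>a<N. E \<gamma> a * linv H (E \<gamma> \<star> ti) (r a))"
      unfolding conv_v linv_kc using deg(2)[OF g \<gamma>] False by simp
    also have "\<dots> \<in> A (inv\<^bsub>\<Gamma>\<^esub> \<gamma>)" using \<gamma> r by (intro gf_sum gf_scale) auto
    finally show ?thesis .
  next
    case True
    have tg: "linv H (tv \<star> E \<delta>) g = (if \<delta> = \<gamma> then linv H tv g else 0)" if "\<delta> \<in> C" for \<delta>
    proof -
      have "linv H (tv \<star> E \<delta>) g = (\<Sum>a<N. tv a * (kc (g a) * kc (dotp N (f \<delta>) g)))"
        unfolding linv_conv linv_kc by (intro sum.cong refl)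
          (simp add: dotp_def grouplikeD[OF g] sum_distrib_left kc_sum kc_mult ac_simps)
      then show ?thesis using deg(2)[OF g that] True by (simp add: linv_def mult.commute)
    qed
    have "kc (counitv H v) = linv H (tv \<star> ti) v"
      using linv_cong[of "tv \<star> ti" "\<lambda>i. kc (he H i)" v] tv_ti by (simp add: linv_kc counitv_dotp)
    also have "\<dots> = (\<Sum>\<delta>\<in>C. linv H ((tv \<star> E \<delta>) \<star> (E \<delta> \<star> ti)) v)"
      unfolding linv_def[of H "_ \<star> _" v] by (subst sum.swap) (simp add: conv_split[of _ tv ti] sum_distrib_left)
    also have "\<dots> = (\<Sum>\<delta>\<in>C. (if \<delta> = \<gamma> then linv H tv g * linv H (E \<gamma> \<star> ti) v else 0)
        + (\<Sum>a<N. (tv \<star> E \<delta>) a * linv H (E \<delta> \<star> ti) (r a)))"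
      unfolding conv_v by (intro sum.cong refl) (simp add: tg)
    also have "\<dots> = linv H tv g * linv H (E \<gamma> \<star> ti) v
        + (\<Sum>\<delta>\<in>C. \<Sum>a<N. (tv \<star> E \<delta>) a * linv H (E \<delta> \<star> ti) (r a))"
      using \<gamma> fin_\<Gamma> by (simp add: sum.distrib sum.delta)
    finally have fin: "linv H tv g * linv H (E \<gamma> \<star> ti) v
        = kc (counitv H v) - (\<Sum>\<delta>\<in>C. \<Sum>a<N. (tv \<star> E \<delta>) a * linv H (E \<delta> \<star> ti) (r a))"
      (is "_ = ?R") by simp
    have eq: "linv H (E \<gamma> \<star> ti) v = inverse (linv H tv g) * ?R"
      unfolding fin[symmetric] using t_grouplike_nonzero[OF g] by simp
    have "?R \<in> A \<one>\<^bsub>\<Gamma>\<^esub>"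
    proof (intro gf_minus gf_sum gf_kc GG.one_closed)
      fix \<delta> a assume "\<delta> \<in> C" "a \<in> {..<N}"
      then show "(tv \<star> E \<delta>) a * linv H (E \<delta> \<star> ti) (r a) \<in> A \<one>\<^bsub>\<Gamma>\<^esub>"
        by (intro gf_inv_mult[of \<delta>] gf_tv r) auto
    qed
    then have "inverse (linv H tv g) * ?R \<in> A (inv\<^bsub>\<Gamma>\<^esub> \<gamma> \<otimes>\<^bsub>\<Gamma>\<^esub> \<one>\<^bsub>\<Gamma>\<^esub>)"
      using gf_tinv[OF g] True \<gamma> by (intro gf_mult) auto
    then show ?thesis using eq \<gamma> by simp
  qed
  show "\<forall>x\<in>{x + scV c v |x c. x \<in> X}. \<forall>\<gamma>\<in>C. linv H (E \<gamma> \<star> ti) x \<in> A (inv\<^bsub>\<Gamma>\<^esub> \<gamma>)"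
  proof (intro ballI)
    fix y \<gamma> assume y: "y \<in> {x + scV c v |x c. x \<in> X}" and \<gamma>: "\<gamma> \<in> C"
    then obtain x c where *: "y = x + scV c v" "x \<in> X" by blast
    show "linv H (E \<gamma> \<star> ti) y \<in> A (inv\<^bsub>\<Gamma>\<^esub> \<gamma>)"
      unfolding *(1) linv_add linv_scale using \<gamma> IH *(2) onv[OF \<gamma>] by (intro gf_add gf_scale) auto
  qed
qed

lemma gf_ti: "\<gamma> \<in> C \<Longrightarrow> i < N \<Longrightarrow> (E \<gamma> \<star> ti) i \<in> A (inv\<^bsub>\<Gamma>\<^esub> \<gamma>)"
  using gf_ti_V linv_bas[of i "E \<gamma> \<star> ti"] by (metis bas_in_vecs)

lemma gf_conv2:
  assumes "\<gamma> \<in> C" "\<delta> \<in> C" "\<And>p. p \<in> {..<N} \<times> {..<N} \<Longrightarrow> w p \<in> A \<gamma>" "\<And>p. p \<in> {..<N} \<times> {..<N} \<Longrightarrow> w' p \<in> A \<delta>"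
  shows "(w \<star>\<star> w') p \<in> A (\<gamma> \<otimes>\<^bsub>\<Gamma>\<^esub> \<delta>)"
  unfolding CF2.conv_def scF_def using assms by (intro gf_sum gf_scale gf_mult GG.m_closed) auto

lemma gf_mus: "\<gamma> \<in> C \<Longrightarrow> (\<And>i. i < N \<Longrightarrow> w i \<in> A \<gamma>) \<Longrightarrow> mus w p \<in> A \<gamma>"
  unfolding mus_def by (rule gf_linv)

lemma gf_E2: "E2 \<alpha> \<beta> p \<in> A \<one>\<^bsub>\<Gamma>\<^esub>"
  using gf_kc[of "f \<alpha> (fst p) * f \<beta> (snd p)"] by (simp add: kc_mult)

text \<open>Insert the idempotents \<open>E2 \<alpha> \<beta>\<close>. On the left they cut out a
  part of t \<otimes> t of degree \<alpha>\<beta>. On the right they can be followed by the pullback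
  of \<open>E\<close> at \<alpha>\<beta>, which merges with the pullback of \<open>ti\<close> and
  leaves only its part of the inverse degree.\<close>

lemma gf_sg:
  assumes p: "p \<in> {..<N} \<times> {..<N}"
  shows "sg p \<in> A \<one>\<^bsub>\<Gamma>\<^esub>"
  unfolding sg_def conv2_split[OF p, of tt]
proof (rule gf_sum[OF GG.one_closed])
  fix q assume "q \<in> C \<times> C"
  then have q: "fst q \<in> C" "snd q \<in> C" "fst q \<otimes>\<^bsub>\<Gamma>\<^esub> snd q \<in> C" by auto
  let ?E = "E2 (fst q) (snd q)" and ?\<gamma> = "fst q \<otimes>\<^bsub>\<Gamma>\<^esub> snd q"
  have 1: "(tt \<star>\<star> ?E) p \<in> A ?\<gamma>" if "p \<in> {..<N} \<times> {..<N}" for p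
    using that q conv2_pure[of tv tv "E (fst q)" "E (snd q)" "fst p" "snd p"]
    by (auto intro!: gf_mult gf_tv)
  have 2: "(?E \<star>\<star> mus ti) p \<in> A (inv\<^bsub>\<Gamma>\<^esub> ?\<gamma>)" if p: "p \<in> {..<N} \<times> {..<N}" for p
  proof -
    have "(?E \<star>\<star> mus ti) p = ((?E \<star>\<star> mus (E ?\<gamma>)) \<star>\<star> mus ti) p"
      by (rule CF2.conv_cong) (simp_all only: E2_mus_E_l q)
    also have "\<dots> = (?E \<star>\<star> (mus (E ?\<gamma>) \<star>\<star> mus ti)) p" by (rule CF2.conv_assoc[OF p])
    also have "\<dots> = (?E \<star>\<star> mus (E ?\<gamma> \<star> ti)) p" by (rule CF2.conv_cong) (simp_all only: mus_conv)
    also have "\<dots> \<in> A (\<one>\<^bsub>\<Gamma>\<^esub> \<otimes>\<^bsub>\<Gamma>\<^esub> inv\<^bsub>\<Gamma>\<^esub> ?\<gamma>)"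
      using q by (intro gf_conv2 gf_E2 gf_mus gf_ti) auto
    finally show ?thesis using q by simp
  qed
  have "((tt \<star>\<star> ?E) \<star>\<star> (?E \<star>\<star> mus ti)) p \<in> A (?\<gamma> \<otimes>\<^bsub>\<Gamma>\<^esub> inv\<^bsub>\<Gamma>\<^esub> ?\<gamma>)"
    by (rule gf_conv2[OF q(3) GG.inv_closed[OF q(3)] 1 2])
  then show "((tt \<star>\<star> ?E) \<star>\<star> (?E \<star>\<star> mus ti)) p \<in> A \<one>\<^bsub>\<Gamma>\<^esub>" using q by simp
qed

lemma gf_sgi:
  assumes p: "p \<in> {..<N} \<times> {..<N}"
  shows "sgi p \<in> A \<one>\<^bsub>\<Gamma>\<^esub>"
  unfolding sgi_def conv2_split[OF p, of "mus tv"]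
proof (rule gf_sum[OF GG.one_closed])
  fix q assume "q \<in> C \<times> C"
  then have q: "fst q \<in> C" "snd q \<in> C" "fst q \<otimes>\<^bsub>\<Gamma>\<^esub> snd q \<in> C" by auto
  let ?E = "E2 (fst q) (snd q)" and ?\<gamma> = "fst q \<otimes>\<^bsub>\<Gamma>\<^esub> snd q"
  have 1: "(?E \<star>\<star> titi) p \<in> A (inv\<^bsub>\<Gamma>\<^esub> ?\<gamma>)" if "p \<in> {..<N} \<times> {..<N}" for p
    using that q conv2_pure[of "E (fst q)" "E (snd q)" ti ti "fst p" "snd p"]
    by (auto simp: GG.inv_mult intro!: gf_mult gf_ti)
  have 2: "(mus tv \<star>\<star> ?E) p \<in> A ?\<gamma>" if p: "p \<in> {..<N} \<times> {..<N}" for p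
  proof -
    have "(mus tv \<star>\<star> ?E) p = (mus tv \<star>\<star> (mus (E ?\<gamma>) \<star>\<star> ?E)) p"
      by (rule CF2.conv_cong) (simp_all only: E2_mus_E_l q)
    also have "\<dots> = ((mus tv \<star>\<star> mus (E ?\<gamma>)) \<star>\<star> ?E) p" by (rule CF2.conv_assoc[OF p, symmetric])
    also have "\<dots> = (mus (tv \<star> E ?\<gamma>) \<star>\<star> ?E) p" by (rule CF2.conv_cong) (simp_all only: mus_conv)
    also have "\<dots> \<in> A (?\<gamma> \<otimes>\<^bsub>\<Gamma>\<^esub> \<one>\<^bsub>\<Gamma>\<^esub>)"
      using q by (intro gf_conv2 gf_E2 gf_mus gf_tv) auto
    finally show ?thesis using q by simp
  qed
  have "((mus tv \<star>\<star> ?E) \<star>\<star> (?E \<star>\<star> titi)) p \<in> A (?\<gamma> \<otimes>\<^bsub>\<Gamma>\<^esub> inv\<^bsub>\<Gamma>\<^esub> ?\<gamma>)"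
    by (rule gf_conv2[OF q(3) GG.inv_closed[OF q(3)] 2 1])
  then show "((mus tv \<star>\<star> ?E) \<star>\<star> (?E \<star>\<star> titi)) p \<in> A \<one>\<^bsub>\<Gamma>\<^esub>" using q by simp
qed

lemma base_alg_subset_graded: "base_alg H \<subseteq> A \<one>\<^bsub>\<Gamma>\<^esub>"
proof
  fix z assume "z \<in> base_alg H"
  then have "z \<in> alg_gen ({sigma H x y | x y. x \<in> V \<and> y \<in> V} \<union> {sigma_inv H x y | x y. x \<in> V \<and> y \<in> V})"
    by (simp only: base_alg_def)
  then show "z \<in> A \<one>\<^bsub>\<Gamma>\<^esub>"
  proof (induction rule: alg_gen.induct)
    case (gen s)
    have "sigma H x y \<in> A \<one>\<^bsub>\<Gamma>\<^esub>" for x y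
      unfolding sigma_eq by (rule gf_sum[OF GG.one_closed], rule gf_sum[OF GG.one_closed],
          rule gf_scale[OF GG.one_closed], rule gf_sg, simp)
    moreover have "sigma_inv H x y \<in> A \<one>\<^bsub>\<Gamma>\<^esub>" for x y
      unfolding sigma_inv_eq by (rule gf_sum[OF GG.one_closed], rule gf_sum[OF GG.one_closed],
          rule gf_scale[OF GG.one_closed], rule gf_sgi, simp)
    ultimately have "\<And>x y. sigma H x y \<in> A \<one>\<^bsub>\<Gamma>\<^esub> \<and> sigma_inv H x y \<in> A \<one>\<^bsub>\<Gamma>\<^esub>" by blast
    then show ?case using gen by auto
  next
    case (mult a b)
    then show ?case using gf_mult[OF GG.one_closed GG.one_closed, of a b] by simp
  qed (simp_all add: gf_kc gf_add)
qed

end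

end

subsection \<open>Substitution of polynomials into polynomials\<close>

definition mono_subst :: "(nat \<Rightarrow> 'k::field mpoly) \<Rightarrow> (nat \<Rightarrow>\<^sub>0 nat) \<Rightarrow> 'k mpoly" where
  "mono_subst \<phi> m = (\<Prod>i\<in>Poly_Mapping.keys m. \<phi> i ^ Poly_Mapping.lookup m i)"

text \<open>It is applied to linear substitutions, in order to pass between the variables of the
  given basis of H and those of a homogeneous basis.\<close>

definition subst_poly :: "(nat \<Rightarrow> 'k::field mpoly) \<Rightarrow> 'k mpoly \<Rightarrow> 'k mpoly" where
  "subst_poly \<phi> p = (\<Sum>m\<in>Poly_Mapping.keys p. Poly_Mapping.single 0 (Poly_Mapping.lookup p m) * mono_subst \<phi> m)"

lemma mono_subst_superset:
  "finite S \<Longrightarrow> Poly_Mapping.keys m \<subseteq> S \<Longrightarrow> mono_subst \<phi> m = (\<Prod>i\<in>S. \<phi> i ^ Poly_Mapping.lookup m i)"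
  unfolding mono_subst_def by (rule prod.mono_neutral_left) (auto simp: in_keys_iff)

lemma mono_subst_add: "mono_subst \<phi> (m + m') = mono_subst \<phi> m * mono_subst \<phi> m'"
proof -
  let ?S = "Poly_Mapping.keys m \<union> Poly_Mapping.keys m'"
  have "mono_subst \<phi> (m + m') = (\<Prod>i\<in>?S. \<phi> i ^ Poly_Mapping.lookup (m + m') i)"
    by (rule mono_subst_superset) (auto simp: in_keys_iff lookup_add)
  also have "\<dots> = (\<Prod>i\<in>?S. \<phi> i ^ Poly_Mapping.lookup m i) * (\<Prod>i\<in>?S. \<phi> i ^ Poly_Mapping.lookup m' i)"
    by (simp add: lookup_add power_add prod.distrib)
  also have "\<dots> = mono_subst \<phi> m * mono_subst \<phi> m'"
    by (subst (1 2) mono_subst_superset[of ?S]) auto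
  finally show ?thesis .
qed

lemma mono_subst_0 [simp]: "mono_subst \<phi> 0 = 1"
  by (simp add: mono_subst_def)

lemma mono_subst_var [simp]: "mono_subst \<phi> (Poly_Mapping.single i (Suc 0)) = \<phi> i"
  by (simp add: mono_subst_def)

lemma subst_poly_superset:
  "finite S \<Longrightarrow> Poly_Mapping.keys p \<subseteq> S \<Longrightarrow>
    subst_poly \<phi> p = (\<Sum>m\<in>S. Poly_Mapping.single 0 (Poly_Mapping.lookup p m) * mono_subst \<phi> m)"
  unfolding subst_poly_def by (rule sum.mono_neutral_left) (auto simp: in_keys_iff)

lemma subst_poly_add: "subst_poly \<phi> (p + q) = subst_poly \<phi> p + subst_poly \<phi> q"
proof -
  let ?S = "Poly_Mapping.keys p \<union> Poly_Mapping.keys q"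
  have "subst_poly \<phi> (p + q) = (\<Sum>m\<in>?S. Poly_Mapping.single 0 (Poly_Mapping.lookup (p + q) m) * mono_subst \<phi> m)"
    by (rule subst_poly_superset) (use keys_add[of p q] in auto)
  also have "\<dots> = (\<Sum>m\<in>?S. Poly_Mapping.single 0 (Poly_Mapping.lookup p m) * mono_subst \<phi> m)
      + (\<Sum>m\<in>?S. Poly_Mapping.single 0 (Poly_Mapping.lookup q m) * mono_subst \<phi> m)"
    by (simp add: lookup_add single_add distrib_right sum.distrib)
  also have "\<dots> = subst_poly \<phi> p + subst_poly \<phi> q"
    by (subst (1 2) subst_poly_superset[of ?S]) auto
  finally show ?thesis .
qed

lemma subst_poly_0 [simp]: "subst_poly \<phi> 0 = 0"
  by (simp add: subst_poly_def)

lemma subst_poly_sum: "subst_poly \<phi> (\<Sum>i\<in>A. g i) = (\<Sum>i\<in>A. subst_poly \<phi> (g i))"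
  by (induction A rule: infinite_finite_induct) (auto simp: subst_poly_add)

lemma subst_poly_single: "subst_poly \<phi> (Poly_Mapping.single m c) = Poly_Mapping.single 0 c * mono_subst \<phi> m"
  by (subst subst_poly_superset[of "{m}"]) auto

lemma poly_expand: "p = (\<Sum>m\<in>Poly_Mapping.keys p. Poly_Mapping.single m (Poly_Mapping.lookup p m))"
proof (rule poly_mapping_eqI)
  fix k
  have "Poly_Mapping.lookup (\<Sum>m\<in>Poly_Mapping.keys p. Poly_Mapping.single m (Poly_Mapping.lookup p m)) k
      = (\<Sum>m\<in>Poly_Mapping.keys p. if m = k then Poly_Mapping.lookup p m else 0)"
    unfolding lookup_sum by (intro sum.cong refl) (auto simp: lookup_single when_def)
  then show "Poly_Mapping.lookup p k = Poly_Mapping.lookup (\<Sum>m\<in>Poly_Mapping.keys p. Poly_Mapping.single m (Poly_Mapping.lookup p m)) k"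
    by (simp add: in_keys_iff)
qed

lemma subst_poly_mult: "subst_poly \<phi> (p * q) = subst_poly \<phi> p * subst_poly \<phi> q"
proof -
  let ?s = "\<lambda>p m. Poly_Mapping.single m (Poly_Mapping.lookup p m)"
  have "p * q = (\<Sum>m\<in>Poly_Mapping.keys p. ?s p m) * (\<Sum>m'\<in>Poly_Mapping.keys q. ?s q m')"
    by (rule arg_cong2[where f = "(*)", OF poly_expand poly_expand])
  also have "\<dots> = (\<Sum>m\<in>Poly_Mapping.keys p. \<Sum>m'\<in>Poly_Mapping.keys q. ?s p m * ?s q m')"
    by (rule sum_product)
  finally have "subst_poly \<phi> (p * q) = (\<Sum>m\<in>Poly_Mapping.keys p. \<Sum>m'\<in>Poly_Mapping.keys q. subst_poly \<phi> (?s p m * ?s q m'))"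
    by (simp only: subst_poly_sum)
  also have "\<dots> = subst_poly \<phi> p * subst_poly \<phi> q"
    unfolding subst_poly_def[of \<phi> p] subst_poly_def[of \<phi> q] sum_product
    by (intro sum.cong refl) (simp add: mult_single subst_poly_single mono_subst_add flip: mult.assoc)
  finally show ?thesis .
qed

lemma subst_poly_const [simp]: "subst_poly \<phi> (Poly_Mapping.single 0 c) = Poly_Mapping.single 0 c"
  by (simp add: subst_poly_single)

lemma subst_poly_1 [simp]: "subst_poly \<phi> 1 = 1"
  using subst_poly_const[of \<phi> 1] by simp

lemma subst_poly_power: "subst_poly \<phi> (p ^ k) = subst_poly \<phi> p ^ k"
  by (induction k) (auto simp: subst_poly_mult)

lemma subst_poly_prod: "subst_poly \<phi> (\<Prod>i\<in>A. g i) = (\<Prod>i\<in>A. subst_poly \<phi> (g i))"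
  by (induction A rule: infinite_finite_induct) (auto simp: subst_poly_mult)

lemma subst_poly_comp: "subst_poly \<phi> (subst_poly \<psi> p) = subst_poly (\<lambda>i. subst_poly \<phi> (\<psi> i)) p"
  unfolding subst_poly_def[of \<psi>] subst_poly_def[of "\<lambda>i. subst_poly \<phi> (\<psi> i)"] mono_subst_def
  by (simp add: subst_poly_sum subst_poly_mult subst_poly_prod subst_poly_power)

lemma mono_subst_id: "mono_subst (\<lambda>i. Poly_Mapping.single (Poly_Mapping.single i 1) 1) m = Poly_Mapping.single m 1"
proof -
  have pw: "Poly_Mapping.single (Poly_Mapping.single i 1) 1 ^ k = Poly_Mapping.single (Poly_Mapping.single i k) (1::'a)" for i k
    by (induction k) (auto simp: mult_single simp flip: single_add)
  have pr: "(\<Prod>i\<in>A. Poly_Mapping.single (g i) (1::'a)) = Poly_Mapping.single (\<Sum>i\<in>A. g i) 1" for A and g :: "nat \<Rightarrow> (nat \<Rightarrow>\<^sub>0 nat)"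
    by (induction A rule: infinite_finite_induct) (auto simp: mult_single)
  have "(\<Sum>i\<in>Poly_Mapping.keys m. Poly_Mapping.single i (Poly_Mapping.lookup m i)) = m"
  proof (rule poly_mapping_eqI)
    fix k
    have "Poly_Mapping.lookup (\<Sum>i\<in>Poly_Mapping.keys m. Poly_Mapping.single i (Poly_Mapping.lookup m i)) k
        = (\<Sum>i\<in>Poly_Mapping.keys m. if i = k then Poly_Mapping.lookup m i else 0)"
      unfolding lookup_sum by (intro sum.cong refl) (auto simp: lookup_single when_def)
    then show "Poly_Mapping.lookup (\<Sum>i\<in>Poly_Mapping.keys m. Poly_Mapping.single i (Poly_Mapping.lookup m i)) k = Poly_Mapping.lookup m k"
      by (simp add: in_keys_iff)
  qed
  then show ?thesis unfolding mono_subst_def pw pr by simp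
qed

lemma subst_poly_id: "subst_poly (\<lambda>i. Poly_Mapping.single (Poly_Mapping.single i 1) 1) p = p"
  unfolding subst_poly_def mono_subst_id by (simp add: mult_single) (rule poly_expand[symmetric])

context graded_hopf
begin

subsection \<open>A homogeneous basis\<close>

text \<open>Written by slices, x_1 f_\<delta>(x_2) is x for \<delta> = \<gamma> and 0 otherwise;
  that is, x is coinvariant of degree \<gamma> for the projection of the second tensor
  factor.\<close>

definition homogeneous :: "'c \<Rightarrow> (nat \<Rightarrow> 'k) \<Rightarrow> bool" where
  "homogeneous \<gamma> x \<longleftrightarrow> x \<in> V \<and> (\<forall>\<delta>\<in>C. \<forall>a. dotp N (f \<delta>) (comulv H x a) = (if \<delta> = \<gamma> then x a else 0))"

definition proj :: "'c \<Rightarrow> (nat \<Rightarrow> 'k) \<Rightarrow> nat \<Rightarrow> 'k" where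
  "proj \<gamma> x = (\<lambda>a. dotp N (f \<gamma>) (comulv H x a))"

lemma comulv_dotp_rows:
  assumes "v \<in> V"
  shows "comulv H (\<lambda>a. dotp N \<phi> (comulv H v a)) a b = dotp N \<phi> (comulv H (comulv H v a) b)"
proof -
  have "comulv H (\<lambda>a. dotp N \<phi> (comulv H v a)) a b = (\<Sum>i<N. \<Sum>j<N. \<phi> j * (comulv H v i j * hc H i a b))"
    by (subst comulv_def) (simp add: dotp_def sum_distrib_left sum_distrib_right ac_simps)
  also have "\<dots> = (\<Sum>j<N. \<Sum>i<N. \<phi> j * (comulv H v i j * hc H i a b))" by (rule sum.swap)
  also have "\<dots> = dotp N \<phi> (comulv H (comulv H v a) b)"
    unfolding dotp_def comulv_row[OF assms] by (simp add: sum_distrib_left)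
  finally show ?thesis .
qed

lemma proj_V: "proj \<gamma> x \<in> V"
proof -
  have "proj \<gamma> x a = 0" if "N \<le> a" for a unfolding proj_def by (simp only: row_out[OF that] dotp_zero)
  then show ?thesis by (simp add: vecs_def)
qed

lemma homogeneous_proj:
  assumes "x \<in> V" "\<gamma> \<in> C" shows "homogeneous \<gamma> (proj \<gamma> x)"
  unfolding homogeneous_def
proof (intro conjI ballI allI proj_V)
  fix \<delta> a assume \<delta>: "\<delta> \<in> C"
  have "dotp N (f \<delta>) (comulv H (proj \<gamma> x) a) = dotp N (fconv (f \<delta>) (f \<gamma>)) (comulv H x a)"
    unfolding dotp_fconv proj_def dotp_def[of N "f \<delta>"] comulv_dotp_rows[OF assms(1)]
    by (simp add: dotp_def sum_distrib_left mult.assoc)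
  then show "dotp N (f \<delta>) (comulv H (proj \<gamma> x) a) = (if \<delta> = \<gamma> then proj \<gamma> x a else 0)"
    using f_orth[OF row_V \<delta> assms(2)] by (simp add: proj_def)
qed

lemma sum_proj: "x \<in> V \<Longrightarrow> (\<Sum>\<gamma>\<in>C. proj \<gamma> x) = x"
proof
  fix a assume x: "x \<in> V"
  have "(\<Sum>\<gamma>\<in>C. proj \<gamma> x) a = counitv H (comulv H x a)"
    unfolding sum_fun_apply proj_def by (rule f_counit[OF row_V])
  then show "(\<Sum>\<gamma>\<in>C. proj \<gamma> x) a = x a" using counit_right[OF x, of a] by (simp add: counitv_def)
qed

lemma linv_tv_E: "linv H (tv \<star> E \<gamma>) x = linv H tv (proj \<gamma> x)"
  unfolding linv_conv linv_kc linv_def[of H tv] proj_def by (simp add: mult.commute)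

lemma homogeneous_grouplike: "g \<in> GL \<Longrightarrow> homogeneous (deg g) g"
proof -
  assume g: "g \<in> GL"
  have "dotp N (f \<delta>) (comulv H g a) = g a * dotp N (f \<delta>) g" for \<delta> a
    by (simp add: dotp_def grouplikeD(3)[OF g] sum_distrib_left ac_simps)
  then show ?thesis unfolding homogeneous_def using grouplikeD(1)[OF g] deg(2)[OF g] by simp
qed

lemma proj_homogeneous:
  "homogeneous \<gamma> x \<Longrightarrow> \<delta> \<in> C \<Longrightarrow> proj \<delta> x = (if \<delta> = \<gamma> then x else 0)"
  by (rule ext) (simp add: homogeneous_def proj_def)

lemma homogeneous_unique:
  assumes "homogeneous \<gamma> x" "homogeneous \<delta> x" "\<gamma> \<in> C" "\<delta> \<in> C" "x \<noteq> 0" shows "\<gamma> = \<delta>"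
  using proj_homogeneous[OF assms(1,4)] proj_homogeneous[OF assms(2,4)] assms(5) by metis

text \<open>Group-likes are homogeneous and independent, and the homogeneous vectors span
  \<open>V\<close>, so a basis of homogeneous vectors extends them. The group-likes are enumerated
  first, to match the positions of the invertible generators.\<close>

lemma homogeneous_basis_exists:
  obtains w \<xi> \<beta> where "bij_betw w {..<card GL} GL" "card GL \<le> N"
    and "\<And>i. i < N \<Longrightarrow> \<beta> i \<in> C" "\<And>i. i < N \<Longrightarrow> homogeneous (\<beta> i) (w i)"
    and "\<And>i j. i < N \<Longrightarrow> j < N \<Longrightarrow> dotp N (\<xi> j) (w i) = (if i = j then 1 else 0)"
    and "\<And>x. x \<in> V \<Longrightarrow> x = (\<Sum>j<N. scV (dotp N (\<xi> j) x) (w j))"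
proof -
  let ?HS = "{x. \<exists>\<gamma>\<in>C. homogeneous \<gamma> x}"
  have "GL \<subseteq> ?HS" using homogeneous_grouplike deg(1) by blast
  then obtain B where B: "GL \<subseteq> B" "B \<subseteq> ?HS" "vs.independent B" "?HS \<subseteq> vs.span B"
    using vs.maximal_independent_subset_extend[OF _ grouplikes_independent] by blast
  have BV: "B \<subseteq> V" using B(2) by (auto simp: homogeneous_def)
  have VB: "V \<subseteq> vs.span B"
  proof
    fix x assume x: "x \<in> V"
    have "(\<Sum>\<gamma>\<in>C. proj \<gamma> x) \<in> vs.span B"
      using homogeneous_proj[OF x] B(4) by (intro vs.span_sum) blast
    then show "x \<in> vs.span B" by (simp only: sum_proj[OF x])
  qed
  have cB: "card B = N" "finite B" using basis_card[OF B(3) BV VB] independent_finite[OF B(3) BV] by auto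
  have cG: "card GL \<le> N" "finite GL" using B(1) cB card_mono finite_subset by metis+
  obtain e1 where e1: "bij_betw e1 {0..<card GL} GL" using ex_bij_betw_nat_finite[OF cG(2)] by blast
  obtain e2 where e2: "bij_betw e2 {0..<card (B - GL)} (B - GL)"
    using ex_bij_betw_nat_finite[of "B - GL"] cB by blast
  have cD: "card (B - GL) = N - card GL" using cB cG B(1) by (simp add: card_Diff_subset)
  define w where "w i = (if i < card GL then e1 i else e2 (i - card GL))" for i
  have w1: "bij_betw w {..<card GL} GL"
    using e1 by (subst bij_betw_cong[of _ _ e1]) (auto simp: w_def lessThan_atLeast0)
  have "bij_betw (\<lambda>i. i - card GL) {card GL..<N} {0..<card (B - GL)}"
    unfolding cD by (rule bij_betw_byWitness[where f' = "\<lambda>i. i + card GL"]) auto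
  from bij_betw_trans[OF this e2] have "bij_betw w {card GL..<N} (B - GL)"
    by (subst bij_betw_cong[of _ _ "e2 \<circ> (\<lambda>i. i - card GL)"]) (auto simp: w_def)
  from bij_betw_combine[OF w1 this] have w: "bij_betw w {..<N} B"
    using cG B(1) by (auto simp: Un_absorb1 ivl_disj_un)
  obtain \<psi> where \<psi>: "\<And>b b'. b \<in> B \<Longrightarrow> b' \<in> B \<Longrightarrow> dotp N (\<psi> b) b' = (if b' = b then 1 else 0)"
    and ex: "\<And>x. x \<in> vs.span B \<Longrightarrow> x = (\<Sum>b\<in>B. scV (dotp N (\<psi> b) x) b)"
    by (rule dual_basis[OF B(3) BV that])
  have wB: "w i \<in> B" if "i < N" for i using w that by (auto simp: bij_betw_def)
  have "\<forall>i. \<exists>\<gamma>. i < N \<longrightarrow> \<gamma> \<in> C \<and> homogeneous \<gamma> (w i)" using wB B(2) by blast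
  then obtain \<beta> where \<beta>: "\<And>i. i < N \<Longrightarrow> \<beta> i \<in> C \<and> homogeneous (\<beta> i) (w i)" by metis
  show ?thesis
  proof (rule that[of w \<beta> "\<lambda>j. \<psi> (w j)"])
    show "bij_betw w {..<card GL} GL" "card GL \<le> N" by (fact w1 cG(1))+
    show "\<beta> i \<in> C" "homogeneous (\<beta> i) (w i)" if "i < N" for i using \<beta>[OF that] by auto
    show "dotp N (\<psi> (w j)) (w i) = (if i = j then 1 else 0)" if "i < N" "j < N" for i j
      using \<psi>[OF wB[OF that(2)] wB[OF that(1)]] w that by (auto simp: bij_betw_def inj_on_def)
    show "x = (\<Sum>j<N. scV (dotp N (\<psi> (w j)) x) (w j))" if "x \<in> V" for x
    proof -
      have "x = (\<Sum>b\<in>B. scV (dotp N (\<psi> b) x) b)" using ex VB that by blast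
      also have "\<dots> = (\<Sum>j<N. scV (dotp N (\<psi> (w j)) x) (w j))"
        by (rule sum.reindex_bij_betw[OF w, symmetric])
      finally show ?thesis .
    qed
  qed
qed

end

locale graded_basis = graded_hopf H \<Gamma> f
  for H :: "'k::field hopf_data" and \<Gamma> :: "('c, 'd) monoid_scheme" and f :: "'c \<Rightarrow> nat \<Rightarrow> 'k" +
  fixes w \<xi> :: "nat \<Rightarrow> nat \<Rightarrow> 'k" and \<beta> :: "nat \<Rightarrow> 'c"
  assumes w_GL: "bij_betw w {..<card GL} GL" and card_GL: "card GL \<le> N"
    and \<beta>_C: "\<And>i. i < N \<Longrightarrow> \<beta> i \<in> C" and w_hom: "\<And>i. i < N \<Longrightarrow> homogeneous (\<beta> i) (w i)"
    and \<xi>_w: "\<And>i j. i < N \<Longrightarrow> j < N \<Longrightarrow> dotp N (\<xi> j) (w i) = (if i = j then 1 else 0)"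
    and w_expand: "\<And>x. x \<in> V \<Longrightarrow> x = (\<Sum>j<N. scV (dotp N (\<xi> j) x) (w j))"
begin

lemma w_V: "i < N \<Longrightarrow> w i \<in> V"
  using w_hom by (simp add: homogeneous_def)

lemma graded_familyI:
  assumes "\<And>\<gamma>. \<gamma> \<in> C \<Longrightarrow> 0 \<in> A \<gamma>" "\<And>\<gamma> z z'. \<gamma> \<in> C \<Longrightarrow> z \<in> A \<gamma> \<Longrightarrow> z' \<in> A \<gamma> \<Longrightarrow> z + z' \<in> A \<gamma>"
    and mult: "\<And>\<gamma> \<delta> z z'. \<gamma> \<in> C \<Longrightarrow> \<delta> \<in> C \<Longrightarrow> z \<in> A \<gamma> \<Longrightarrow> z' \<in> A \<delta> \<Longrightarrow> z * z' \<in> A (\<gamma> \<otimes>\<^bsub>\<Gamma>\<^esub> \<delta>)"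
    and kc: "\<And>c. kc c \<in> A \<one>\<^bsub>\<Gamma>\<^esub>" and tw: "\<And>i. i < N \<Longrightarrow> linv H tv (w i) \<in> A (\<beta> i)"
    and "\<And>g. g \<in> GL \<Longrightarrow> inverse (linv H tv g) \<in> A (inv\<^bsub>\<Gamma>\<^esub> (deg g))"
  shows "graded_family A"
  unfolding graded_family_def
proof (intro conjI ballI allI impI)
  fix \<gamma> i assume \<gamma>: "\<gamma> \<in> C" and i: "i < N"
  have sc: "kc c * z \<in> A \<gamma>" if "z \<in> A \<gamma>" for c z
    using mult[OF GG.one_closed \<gamma> kc[of c] that] \<gamma> by simp
  have sm: "(\<Sum>j\<in>S. F j) \<in> A \<gamma>" if "finite S" "\<And>j. j \<in> S \<Longrightarrow> F j \<in> A \<gamma>" for S :: "nat set" and F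
    using that by (induction S rule: finite_induct) (auto simp: assms(1,2) \<gamma>)
  have "(tv \<star> E \<gamma>) i = linv H (tv \<star> E \<gamma>) (bas i)" using i by (simp add: linv_bas)
  also have "\<dots> = linv H (tv \<star> E \<gamma>) (\<Sum>j<N. scV (dotp N (\<xi> j) (bas i)) (w j))"
    using w_expand[of "bas i"] i bas_in_vecs by metis
  also have "\<dots> = (\<Sum>j<N. kc (dotp N (\<xi> j) (bas i)) * linv H tv (proj \<gamma> (w j)))"
    by (simp only: linv_sum linv_scale linv_tv_E)
  also have "\<dots> \<in> A \<gamma>"
  proof (rule sm)
    fix j assume "j \<in> {..<N}"
    then have j: "j < N" by simp
    show "kc (dotp N (\<xi> j) (bas i)) * linv H tv (proj \<gamma> (w j)) \<in> A \<gamma>"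
    proof (cases "\<gamma> = \<beta> j")
      case True
      then show ?thesis using sc tw[OF j] proj_homogeneous[OF w_hom[OF j] \<gamma>] by simp
    next
      case False
      then have "proj \<gamma> (w j) = 0" using proj_homogeneous[OF w_hom[OF j] \<gamma>] by metis
      then show ?thesis using assms(1)[OF \<gamma>] linv_zero by (metis mult_zero_right)
    qed
  qed simp
  finally show "(tv \<star> E \<gamma>) i \<in> A \<gamma>" .
qed (use assms in auto)

lemma GL_index:
  assumes "g \<in> GL"
  obtains i where "i < card GL" "i < N" "w i = g" "\<beta> i = deg g"
proof -
  obtain i where i: "i < card GL" "w i = g" using bij_betw_imp_surj_on[OF w_GL] assms by (metis imageE lessThan_iff)
  have N: "i < N" using i card_GL by simp
  moreover have "\<beta> i = deg g"
    using homogeneous_unique[OF w_hom[OF N] _ \<beta>_C[OF N]] homogeneous_grouplike[OF assms] i(2)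
      deg(1)[OF assms] grouplikeD(2)[OF assms] by metis
  ultimately show ?thesis using that i by blast
qed

subsection \<open>Homogeneous fractions\<close>

text \<open>Rewrites a polynomial in the variables attached to the basis \<open>w\<close>:
  afterwards the variable of index j stands for t at \<open>w j\<close>. Indices beyond the
  dimension are left alone, so that \<open>\<Phi>\<close> inverts it on the whole polynomial
  type.\<close>

definition \<Psi> :: "'k mpoly \<Rightarrow> 'k mpoly" where
  "\<Psi> = subst_poly (\<lambda>i. if i < N then \<Sum>j<N. Poly_Mapping.single (Poly_Mapping.single j 1) (\<xi> j i)
     else Poly_Mapping.single (Poly_Mapping.single i 1) 1)"

definition \<Phi> :: "'k mpoly \<Rightarrow> 'k mpoly" where
  "\<Phi> = subst_poly (\<lambda>j. if j < N then tvar H (w j) else Poly_Mapping.single (Poly_Mapping.single j 1) 1)"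

lemma tvar_lincomb: "tvar H (\<Sum>j\<in>S. scV (c j) (x j)) = (\<Sum>j\<in>S. Poly_Mapping.single 0 (c j) * tvar H (x j))"
proof -
  have "emb (tvar H (\<Sum>j\<in>S. scV (c j) (x j))) = emb (\<Sum>j\<in>S. Poly_Mapping.single 0 (c j) * tvar H (x j))"
    unfolding emb_tvar emb_sum emb_mult kc_eq_emb[symmetric] linv_sum linv_scale ..
  then show ?thesis by simp
qed

lemma \<Phi>_\<Psi>: "\<Phi> (\<Psi> p) = p"
proof -
  have "subst_poly (\<lambda>j. if j < N then tvar H (w j) else Poly_Mapping.single (Poly_Mapping.single j 1) 1)
      (if i < N then \<Sum>j<N. Poly_Mapping.single (Poly_Mapping.single j 1) (\<xi> j i)
       else Poly_Mapping.single (Poly_Mapping.single i 1) 1) = Poly_Mapping.single (Poly_Mapping.single i 1) 1" for i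
  proof (cases "i < N")
    case True
    have "(\<Sum>j<N. Poly_Mapping.single 0 (\<xi> j i) * tvar H (w j)) = tvar H (\<Sum>j<N. scV (dotp N (\<xi> j) (bas i)) (w j))"
      using True by (simp add: tvar_lincomb dotp_bas)
    also have "\<dots> = tvar H (bas i)" using w_expand[of "bas i"] True bas_in_vecs by metis
    finally show ?thesis using True by (simp add: subst_poly_sum subst_poly_single tvar_bas)
  next
    case False
    then show ?thesis by (simp add: subst_poly_single)
  qed
  then show ?thesis unfolding \<Phi>_def \<Psi>_def subst_poly_comp by (simp only: subst_poly_id)
qed

text \<open>The degree of a monomial in the variables attached to \<open>w\<close>. The polynomial
  type also has variables of index \<ge> N; giving them the neutral degree keeps \<open>wt\<close>
  multiplicative on all monomials.\<close>

definition wt :: "(nat \<Rightarrow>\<^sub>0 nat) \<Rightarrow> 'c" where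
  "wt m = finprod \<Gamma> (\<lambda>i. (if i < N then \<beta> i else \<one>\<^bsub>\<Gamma>\<^esub>) [^]\<^bsub>\<Gamma>\<^esub> Poly_Mapping.lookup m i) (Poly_Mapping.keys m)"

lemma wt_superset:
  assumes "finite S" "Poly_Mapping.keys m \<subseteq> S"
  shows "wt m = finprod \<Gamma> (\<lambda>i. (if i < N then \<beta> i else \<one>\<^bsub>\<Gamma>\<^esub>) [^]\<^bsub>\<Gamma>\<^esub> Poly_Mapping.lookup m i) S"
  unfolding wt_def using assms \<beta>_C
  by (intro GG.finprod_mono_neutral_cong_left) (auto simp: in_keys_iff)

lemma wt_add: "wt (m + m') = wt m \<otimes>\<^bsub>\<Gamma>\<^esub> wt m'"
proof -
  let ?S = "Poly_Mapping.keys m \<union> Poly_Mapping.keys m'"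
  let ?b = "\<lambda>i. if i < N then \<beta> i else \<one>\<^bsub>\<Gamma>\<^esub>"
  have b: "?b i \<in> C" for i using \<beta>_C by simp
  have "wt (m + m') = finprod \<Gamma> (\<lambda>i. ?b i [^]\<^bsub>\<Gamma>\<^esub> Poly_Mapping.lookup (m + m') i) ?S"
    by (rule wt_superset) (auto simp: in_keys_iff lookup_add)
  also have "\<dots> = finprod \<Gamma> (\<lambda>i. ?b i [^]\<^bsub>\<Gamma>\<^esub> Poly_Mapping.lookup m i \<otimes>\<^bsub>\<Gamma>\<^esub> ?b i [^]\<^bsub>\<Gamma>\<^esub> Poly_Mapping.lookup m' i) ?S"
    using b by (simp only: lookup_add GG.nat_pow_mult)
  also have "\<dots> = finprod \<Gamma> (\<lambda>i. ?b i [^]\<^bsub>\<Gamma>\<^esub> Poly_Mapping.lookup m i) ?S \<otimes>\<^bsub>\<Gamma>\<^esub> finprod \<Gamma> (\<lambda>i. ?b i [^]\<^bsub>\<Gamma>\<^esub> Poly_Mapping.lookup m' i) ?S"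
    using b by (intro GG.finprod_multf) (auto simp del: if_split intro!: GG.nat_pow_closed)
  also have "\<dots> = wt m \<otimes>\<^bsub>\<Gamma>\<^esub> wt m'"
    by (subst (1 2) wt_superset[of ?S]) auto
  finally show ?thesis .
qed

lemma wt_0: "wt 0 = \<one>\<^bsub>\<Gamma>\<^esub>" by (simp add: wt_def)

lemma wt_var: "j < N \<Longrightarrow> wt (Poly_Mapping.single j 1) = \<beta> j"
  using \<beta>_C by (simp add: wt_def)

definition Sdeg :: "'c \<Rightarrow> 'k mpoly set" where
  "Sdeg \<gamma> = {p. \<forall>m\<in>Poly_Mapping.keys (\<Psi> p). wt m = \<gamma>}"

lemma \<Psi>_add: "\<Psi> (p + q) = \<Psi> p + \<Psi> q" and \<Psi>_mult: "\<Psi> (p * q) = \<Psi> p * \<Psi> q"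
  unfolding \<Psi>_def by (rule subst_poly_add, rule subst_poly_mult)

lemma Sdeg_0: "0 \<in> Sdeg \<gamma>"
  by (simp add: Sdeg_def \<Psi>_def)

lemma Sdeg_add: "p \<in> Sdeg \<gamma> \<Longrightarrow> q \<in> Sdeg \<gamma> \<Longrightarrow> p + q \<in> Sdeg \<gamma>"
  using keys_add[of "\<Psi> p" "\<Psi> q"] by (auto simp: Sdeg_def \<Psi>_add)

lemma Sdeg_mult: "p \<in> Sdeg \<gamma> \<Longrightarrow> q \<in> Sdeg \<delta> \<Longrightarrow> p * q \<in> Sdeg (\<gamma> \<otimes>\<^bsub>\<Gamma>\<^esub> \<delta>)"
  using keys_mult[of "\<Psi> p" "\<Psi> q"] by (fastforce simp: Sdeg_def \<Psi>_mult wt_add)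

lemma Sdeg_const: "Poly_Mapping.single 0 c \<in> Sdeg \<one>\<^bsub>\<Gamma>\<^esub>"
  unfolding Sdeg_def \<Psi>_def by (simp add: wt_0)

lemma Sdeg_tvar: "j < N \<Longrightarrow> tvar H (w j) \<in> Sdeg (\<beta> j)"
proof -
  assume j: "j < N"
  have "\<Psi> (tvar H (w j)) = (\<Sum>i<N. \<Sum>k<N. Poly_Mapping.single (Poly_Mapping.single k (1::nat)) (w j i * \<xi> k i))"
    unfolding \<Psi>_def tvar_def subst_poly_sum
    by (intro sum.cong refl) (simp add: subst_poly_single sum_distrib_left mult_single)
  also have "\<dots> = (\<Sum>k<N. \<Sum>i<N. Poly_Mapping.single (Poly_Mapping.single k (1::nat)) (w j i * \<xi> k i))"
    by (rule sum.swap)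
  also have "\<dots> = (\<Sum>k<N. Poly_Mapping.single (Poly_Mapping.single k (1::nat)) (dotp N (\<xi> k) (w j)))"
  proof (intro sum.cong refl)
    have s: "(\<Sum>i\<in>A. Poly_Mapping.single m (h i)) = Poly_Mapping.single m (\<Sum>i\<in>A. h i)"
      for A :: "nat set" and m :: "nat \<Rightarrow>\<^sub>0 nat" and h :: "nat \<Rightarrow> 'k"
      by (induction A rule: infinite_finite_induct) (auto simp: single_add)
    show "(\<Sum>i<N. Poly_Mapping.single (Poly_Mapping.single k (1::nat)) (w j i * \<xi> k i))
        = Poly_Mapping.single (Poly_Mapping.single k (1::nat)) (dotp N (\<xi> k) (w j))" for k
    proof -
      have "(\<Sum>i<N. Poly_Mapping.single (Poly_Mapping.single k (1::nat)) (w j i * \<xi> k i))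
          = Poly_Mapping.single (Poly_Mapping.single k (1::nat)) (\<Sum>i<N. w j i * \<xi> k i)"
        by (rule s)
      also have "(\<Sum>i<N. w j i * \<xi> k i) = dotp N (\<xi> k) (w j)" by (simp add: dotp_def mult.commute)
      finally show ?thesis .
    qed
  qed
  also have "\<dots> = (\<Sum>k<N. if k = j then Poly_Mapping.single (Poly_Mapping.single j (1::nat)) 1 else 0)"
    using j by (intro sum.cong refl) (auto simp: \<xi>_w)
  also have "\<dots> = Poly_Mapping.single (Poly_Mapping.single j (1::nat)) 1" using j by simp
  finally show ?thesis unfolding Sdeg_def using wt_var[OF j] by simp
qed

text \<open>After the change of variables, polynomials of different degrees have no monomial in
  common, so nothing can cancel in the sum.\<close>

lemma Sdeg_direct:
  assumes S: "finite S" "inj_on d S" and p: "\<And>s. s \<in> S \<Longrightarrow> p s \<in> Sdeg (d s)"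
    and sum: "(\<Sum>s\<in>S. p s) = 0" and s: "s \<in> S"
  shows "p s = 0"
proof -
  have "\<Psi> (p s) = 0"
  proof (rule poly_mapping_eqI, rule ccontr)
    fix m assume "Poly_Mapping.lookup (\<Psi> (p s)) m \<noteq> Poly_Mapping.lookup 0 m"
    then have m: "m \<in> Poly_Mapping.keys (\<Psi> (p s))" by (simp add: in_keys_iff)
    then have wm: "wt m = d s" using p[OF s] by (simp add: Sdeg_def)
    have "(\<Sum>r\<in>S. Poly_Mapping.lookup (\<Psi> (p r)) m) = Poly_Mapping.lookup (\<Psi> (\<Sum>r\<in>S. p r)) m"
      by (simp add: \<Psi>_def subst_poly_sum lookup_sum)
    then have "(\<Sum>r\<in>S. Poly_Mapping.lookup (\<Psi> (p r)) m) = 0" by (simp add: sum \<Psi>_def)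
    moreover have "(\<Sum>r\<in>S. Poly_Mapping.lookup (\<Psi> (p r)) m) = (\<Sum>r\<in>S. if r = s then Poly_Mapping.lookup (\<Psi> (p s)) m else 0)"
    proof (intro sum.cong refl)
      fix r assume r: "r \<in> S"
      show "Poly_Mapping.lookup (\<Psi> (p r)) m = (if r = s then Poly_Mapping.lookup (\<Psi> (p s)) m else 0)"
      proof (cases "r = s")
        case False
        then have "wt m \<noteq> d r" using S(2) r s wm by (metis inj_onD)
        then have "m \<notin> Poly_Mapping.keys (\<Psi> (p r))" using p[OF r] by (auto simp: Sdeg_def)
        then show ?thesis using False by (simp add: in_keys_iff)
      qed simp
    qed
    ultimately show False using m S(1) s by (simp add: in_keys_iff)
  qed
  then show ?thesis using \<Phi>_\<Psi>[of "p s"] by (simp add: \<Phi>_def)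
qed

text \<open>Fractions with a homogeneous denominator m. Restricting the denominators in this way is
  what makes the sum of the different degrees direct.\<close>

definition FA :: "'c \<Rightarrow> 'k mpoly fract set" where
  "FA \<gamma> = {z. \<exists>\<delta>\<in>C. \<exists>m\<in>Sdeg \<delta>. m \<noteq> 0 \<and> (\<exists>p\<in>Sdeg (\<gamma> \<otimes>\<^bsub>\<Gamma>\<^esub> \<delta>). z * emb m = emb p)}"

lemma FA_I: "\<delta> \<in> C \<Longrightarrow> m \<in> Sdeg \<delta> \<Longrightarrow> m \<noteq> 0 \<Longrightarrow> p \<in> Sdeg (\<gamma> \<otimes>\<^bsub>\<Gamma>\<^esub> \<delta>) \<Longrightarrow> z * emb m = emb p \<Longrightarrow> z \<in> FA \<gamma>"
  unfolding FA_def by blast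

lemma FA_poly: "p \<in> Sdeg \<gamma> \<Longrightarrow> \<gamma> \<in> C \<Longrightarrow> emb p \<in> FA \<gamma>"
  using Sdeg_const[of 1] by (intro FA_I[of "\<one>\<^bsub>\<Gamma>\<^esub>" 1 p]) auto

lemma graded_family_FA: "graded_family FA"
proof (rule graded_familyI)
  show "0 \<in> FA \<gamma>" if "\<gamma> \<in> C" for \<gamma> using FA_poly[OF Sdeg_0 that] by simp
  show "kc c \<in> FA \<one>\<^bsub>\<Gamma>\<^esub>" for c using FA_poly[OF Sdeg_const] by (simp add: kc_eq_emb)
  show "linv H tv (w i) \<in> FA (\<beta> i)" if "i < N" for i
    using FA_poly[OF Sdeg_tvar[OF that] \<beta>_C[OF that]] by (simp add: emb_tvar)
next
  fix \<gamma> z z' assume \<gamma>: "\<gamma> \<in> C" and "z \<in> FA \<gamma>" "z' \<in> FA \<gamma>"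
  then obtain \<delta> m p \<delta>' m' p' where *: "\<delta> \<in> C" "m \<in> Sdeg \<delta>" "m \<noteq> 0" "p \<in> Sdeg (\<gamma> \<otimes>\<^bsub>\<Gamma>\<^esub> \<delta>)" "z * emb m = emb p"
    "\<delta>' \<in> C" "m' \<in> Sdeg \<delta>'" "m' \<noteq> 0" "p' \<in> Sdeg (\<gamma> \<otimes>\<^bsub>\<Gamma>\<^esub> \<delta>')" "z' * emb m' = emb p'"
    unfolding FA_def by blast
  have "p * m' + p' * m \<in> Sdeg (\<gamma> \<otimes>\<^bsub>\<Gamma>\<^esub> (\<delta> \<otimes>\<^bsub>\<Gamma>\<^esub> \<delta>'))"
    using Sdeg_mult[OF *(4,7)] Sdeg_mult[OF *(9,2)] * \<gamma> by (intro Sdeg_add) (simp_all add: GG.m_ac)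
  moreover have "(z + z') * emb (m * m') = emb (p * m' + p' * m)"
    using *(5,10) by (simp add: emb_mult emb_add algebra_simps)
  ultimately show "z + z' \<in> FA \<gamma>"
    using * Sdeg_mult[OF *(2,7)] by (intro FA_I[of "\<delta> \<otimes>\<^bsub>\<Gamma>\<^esub> \<delta>'" "m * m'"]) auto
next
  fix \<gamma> \<gamma>' z z' assume \<gamma>: "\<gamma> \<in> C" "\<gamma>' \<in> C" and "z \<in> FA \<gamma>" "z' \<in> FA \<gamma>'"
  then obtain \<delta> m p \<delta>' m' p' where *: "\<delta> \<in> C" "m \<in> Sdeg \<delta>" "m \<noteq> 0" "p \<in> Sdeg (\<gamma> \<otimes>\<^bsub>\<Gamma>\<^esub> \<delta>)" "z * emb m = emb p"
    "\<delta>' \<in> C" "m' \<in> Sdeg \<delta>'" "m' \<noteq> 0" "p' \<in> Sdeg (\<gamma>' \<otimes>\<^bsub>\<Gamma>\<^esub> \<delta>')" "z' * emb m' = emb p'"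
    unfolding FA_def by blast
  have "p * p' \<in> Sdeg ((\<gamma> \<otimes>\<^bsub>\<Gamma>\<^esub> \<gamma>') \<otimes>\<^bsub>\<Gamma>\<^esub> (\<delta> \<otimes>\<^bsub>\<Gamma>\<^esub> \<delta>'))"
    using Sdeg_mult[OF *(4,9)] * \<gamma> by (simp add: GG.m_ac)
  moreover have "(z * z') * emb (m * m') = emb (p * p')"
    by (simp add: emb_mult *(5,10)[symmetric] ac_simps)
  ultimately show "z * z' \<in> FA (\<gamma> \<otimes>\<^bsub>\<Gamma>\<^esub> \<gamma>')"
    using * Sdeg_mult[OF *(2,7)] by (intro FA_I[of "\<delta> \<otimes>\<^bsub>\<Gamma>\<^esub> \<delta>'" "m * m'"]) auto
next
  fix g assume g: "g \<in> GL"
  obtain i where i: "i < N" "w i = g" "\<beta> i = deg g" using GL_index[OF g] by metis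
  have "tvar H g \<in> Sdeg (deg g)" using Sdeg_tvar[OF i(1)] i by simp
  moreover have "tvar H g \<noteq> 0" using t_grouplike_nonzero[OF g] by (auto simp flip: emb_tvar)
  moreover have "1 \<in> Sdeg (inv\<^bsub>\<Gamma>\<^esub> deg g \<otimes>\<^bsub>\<Gamma>\<^esub> deg g)" using Sdeg_const[of 1] deg(1)[OF g] by simp
  ultimately show "inverse (linv H tv g) \<in> FA (inv\<^bsub>\<Gamma>\<^esub> (deg g))"
    using t_grouplike_nonzero[OF g] deg(1)[OF g] by (intro FA_I[of "deg g" "tvar H g" 1]) (auto simp: emb_tvar)
qed

lemma FA_common_denominator:
  assumes "finite S" "S \<subseteq> C" "\<And>\<gamma>. \<gamma> \<in> S \<Longrightarrow> z \<gamma> \<in> FA \<gamma>"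
  shows "\<exists>\<delta>\<in>C. \<exists>m\<in>Sdeg \<delta>. m \<noteq> 0 \<and> (\<forall>\<gamma>\<in>S. \<exists>p\<in>Sdeg (\<gamma> \<otimes>\<^bsub>\<Gamma>\<^esub> \<delta>). z \<gamma> * emb m = emb p)"
  using assms
proof (induction S rule: finite_induct)
  case empty
  show ?case using Sdeg_const[of 1] by (intro bexI[of _ "\<one>\<^bsub>\<Gamma>\<^esub>"] bexI[of _ 1]) auto
next
  case (insert \<alpha> S)
  obtain \<delta> m where m: "\<delta> \<in> C" "m \<in> Sdeg \<delta>" "m \<noteq> 0" "\<And>\<gamma>. \<gamma> \<in> S \<Longrightarrow> \<exists>p\<in>Sdeg (\<gamma> \<otimes>\<^bsub>\<Gamma>\<^esub> \<delta>). z \<gamma> * emb m = emb p"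
    using insert by auto
  obtain \<delta>' m' q where m': "\<delta>' \<in> C" "m' \<in> Sdeg \<delta>'" "m' \<noteq> 0" "q \<in> Sdeg (\<alpha> \<otimes>\<^bsub>\<Gamma>\<^esub> \<delta>')" "z \<alpha> * emb m' = emb q"
    using insert.prems(2)[of \<alpha>] unfolding FA_def by blast
  have "\<exists>p\<in>Sdeg (\<gamma> \<otimes>\<^bsub>\<Gamma>\<^esub> (\<delta> \<otimes>\<^bsub>\<Gamma>\<^esub> \<delta>')). z \<gamma> * emb (m * m') = emb p" if \<gamma>: "\<gamma> \<in> insert \<alpha> S" for \<gamma>
  proof (cases "\<gamma> = \<alpha>")
    case True
    have "m * q \<in> Sdeg (\<gamma> \<otimes>\<^bsub>\<Gamma>\<^esub> (\<delta> \<otimes>\<^bsub>\<Gamma>\<^esub> \<delta>'))"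
      using Sdeg_mult[OF m(2) m'(4)] m(1) m'(1) True insert.prems(1) by (simp add: GG.m_ac)
    moreover have "z \<gamma> * emb (m * m') = emb (m * q)" using True m'(5) by (simp add: emb_mult ac_simps)
    ultimately show ?thesis by blast
  next
    case False
    then obtain p where p: "p \<in> Sdeg (\<gamma> \<otimes>\<^bsub>\<Gamma>\<^esub> \<delta>)" "z \<gamma> * emb m = emb p" using m(4) \<gamma> by blast
    have "p * m' \<in> Sdeg (\<gamma> \<otimes>\<^bsub>\<Gamma>\<^esub> (\<delta> \<otimes>\<^bsub>\<Gamma>\<^esub> \<delta>'))"
      using Sdeg_mult[OF p(1) m'(2)] m(1) m'(1) subsetD[OF insert.prems(1) \<gamma>] by (simp add: GG.m_assoc)
    moreover have "z \<gamma> * emb (m * m') = emb (p * m')" using p(2) by (simp add: emb_mult flip: mult.assoc)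
    ultimately show ?thesis by blast
  qed
  then show ?case using m m' Sdeg_mult[OF m(2) m'(2)]
    by (intro bexI[of _ "\<delta> \<otimes>\<^bsub>\<Gamma>\<^esub> \<delta>'"] bexI[of _ "m * m'"]) auto
qed

text \<open>A common homogeneous denominator shifts all degrees by the same \<delta>, and
  translation in the group is injective; the claim becomes one about polynomials.\<close>

lemma FA_direct:
  assumes z: "\<And>\<gamma>. \<gamma> \<in> C \<Longrightarrow> z \<gamma> \<in> FA \<gamma>" and sum: "(\<Sum>\<gamma>\<in>C. z \<gamma>) = 0" and \<gamma>: "\<gamma> \<in> C"
  shows "z \<gamma> = 0"
proof -
  obtain \<delta> m where m: "\<delta> \<in> C" "m \<in> Sdeg \<delta>" "m \<noteq> 0" "\<forall>\<gamma>\<in>C. \<exists>p\<in>Sdeg (\<gamma> \<otimes>\<^bsub>\<Gamma>\<^esub> \<delta>). z \<gamma> * emb m = emb p"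
    using FA_common_denominator[OF fin_\<Gamma> subset_refl z] by blast
  then obtain p where p: "\<And>\<gamma>. \<gamma> \<in> C \<Longrightarrow> p \<gamma> \<in> Sdeg (\<gamma> \<otimes>\<^bsub>\<Gamma>\<^esub> \<delta>)" "\<And>\<gamma>. \<gamma> \<in> C \<Longrightarrow> z \<gamma> * emb m = emb (p \<gamma>)" by metis
  have "emb (\<Sum>\<gamma>\<in>C. p \<gamma>) = (\<Sum>\<gamma>\<in>C. z \<gamma>) * emb m"
    unfolding emb_sum sum_distrib_right by (intro sum.cong refl) (simp add: p(2))
  then have "(\<Sum>\<gamma>\<in>C. p \<gamma>) = 0" by (simp add: sum)
  moreover have "inj_on (\<lambda>\<gamma>. \<gamma> \<otimes>\<^bsub>\<Gamma>\<^esub> \<delta>) C" using m(1) by (auto simp: inj_on_def)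
  ultimately have "p \<gamma> = 0"
    using Sdeg_direct[where S = C and d = "\<lambda>\<gamma>. \<gamma> \<otimes>\<^bsub>\<Gamma>\<^esub> \<delta>" and p = p and s = \<gamma>] fin_\<Gamma> p(1) \<gamma> by blast
  then show ?thesis using p(2)[OF \<gamma>] m(3) by simp
qed

end

text \<open>Nakayama's lemma by elimination of one generator at a time, without determinants.\<close>

lemma nakayama:
  fixes a :: "nat \<Rightarrow> 'f::field" and B I :: "'f set"
  assumes IB: "I \<subseteq> B" and I0: "0 \<in> I" and Iadd: "\<And>x y. x \<in> I \<Longrightarrow> y \<in> I \<Longrightarrow> x + y \<in> I"
    and Imult: "\<And>b x. b \<in> B \<Longrightarrow> x \<in> I \<Longrightarrow> b * x \<in> I"
    and B1: "1 \<in> B" and Bm: "\<And>x y. x \<in> B \<Longrightarrow> y \<in> B \<Longrightarrow> x - y \<in> B"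
    and "\<And>i. i < n \<Longrightarrow> \<exists>\<iota>. (\<forall>j. \<iota> j \<in> I) \<and> a i = (\<Sum>j<n. \<iota> j * a j)"
    and "\<exists>i<n. a i \<noteq> 0"
  shows "1 \<in> I"
  using assms(7,8)
proof (induction n)
  case 0
  then show ?case by simp
next
  case (Suc n)
  obtain \<nu> where \<nu>: "\<And>j. \<nu> j \<in> I" "a n = (\<Sum>j<Suc n. \<nu> j * a j)" using Suc.prems(1)[of n] by blast
  \<comment> \<open>Elimination of a_n without dividing by \<delta>, which might be zero: \<delta>
    a_n is a combination of the earlier generators with coefficients in I.\<close>
  define \<delta> where "\<delta> = 1 - \<nu> n"
  have \<delta>: "\<delta> \<in> B" unfolding \<delta>_def by (rule Bm[OF B1 subsetD[OF IB \<nu>(1)]])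
  have an: "\<delta> * a n = (\<Sum>j<n. \<nu> j * a j)"
    using \<nu>(2) unfolding \<delta>_def by (simp add: left_diff_distrib) (metis add_diff_cancel_right')
  show ?case
  proof (cases "\<exists>i<n. a i \<noteq> 0")
    case True
    show ?thesis
    proof (rule Suc.IH[OF _ True])
      fix i assume i: "i < n"
      obtain \<iota> where \<iota>: "\<And>j. \<iota> j \<in> I" "a i = (\<Sum>j<Suc n. \<iota> j * a j)"
        using Suc.prems(1)[of i] i by auto
      \<comment> \<open>Write a_i = \<nu>_n a_i + \<delta> a_i, expand the second a_i by its
        relation, and replace \<delta> a_n by the relation \<open>an\<close>. All resulting
        coefficients lie in I.\<close>
      define \<kappa> where "\<kappa> j = (if j = i then \<nu> n else 0) + (\<delta> * \<iota> j + \<iota> n * \<nu> j)" for j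
      have "\<kappa> j \<in> I" for j
        unfolding \<kappa>_def using \<nu>(1) I0 Imult[OF \<delta> \<iota>(1)] Imult[OF subsetD[OF IB \<iota>(1)] \<nu>(1)]
        by (intro Iadd) auto
      moreover have "a i = (\<Sum>j<n. \<kappa> j * a j)"
      proof -
        have "(\<Sum>j<n. \<kappa> j * a j) = (\<Sum>j<n. if j = i then \<nu> n * a i else 0)
            + (\<delta> * (\<Sum>j<n. \<iota> j * a j) + \<iota> n * (\<Sum>j<n. \<nu> j * a j))"
          unfolding \<kappa>_def sum_distrib_left sum.distrib[symmetric]
          by (intro sum.cong refl) (auto simp: algebra_simps)
        also have "(\<Sum>j<n. \<iota> j * a j) = a i - \<iota> n * a n" using \<iota>(2) by simp
        also have "(\<Sum>j<n. if j = i then \<nu> n * a i else 0) = \<nu> n * a i" using i by simp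
        finally have "(\<Sum>j<n. \<kappa> j * a j) = \<nu> n * a i + (\<delta> * (a i - \<iota> n * a n) + \<iota> n * (\<delta> * a n))"
          by (simp only: an)
        then show ?thesis by (simp add: \<delta>_def algebra_simps)
      qed
      ultimately show "\<exists>\<iota>. (\<forall>j. \<iota> j \<in> I) \<and> a i = (\<Sum>j<n. \<iota> j * a j)" by blast
    qed
  next
    case False
    then have "a n \<noteq> 0" using Suc.prems(2) by (metis less_Suc_eq)
    moreover have "\<delta> * a n = 0" unfolding an using False by simp
    \<comment> \<open>Here a_n is the only nonzero generator, so \<delta> a_n = 0 in a field gives
      \<nu>_n = 1.\<close>
    ultimately have "\<delta> = 0" by simp
    then show ?thesis using \<nu>(1)[of n] by (simp add: \<delta>_def)
  qed
qed

context pointed_hopf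
begin

subsection \<open>The group of group-like elements\<close>

lemma grouplikeI: "x \<in> V \<Longrightarrow> counitv H x = 1 \<Longrightarrow> comulv H x = tensor x x \<Longrightarrow> x \<in> GL"
  unfolding grouplikes_def using counitv_zero by (auto simp: zero_fun_def)

lemma unitv_GL: "unitv H \<in> GL"
  by (rule grouplikeI[OF unitv_V counitv_unit comulv_unit])

lemma comulv_GL: "g \<in> GL \<Longrightarrow> comulv H g = tensor g g"
  by (simp add: grouplikes_def)

lemma mulv_GL: "g \<in> GL \<Longrightarrow> h \<in> GL \<Longrightarrow> mulv H g h \<in> GL"
  by (rule grouplikeI) (simp_all add: mulv_V counitv_mulv grouplikeD(1,4) comulv_mulv comulv_GL tmul_tensor)

lemma finite_GL: "finite GL"
  using independent_finite(1)[OF grouplikes_independent, of N] grouplikeD(1) by blast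

text \<open>The antipode gives a left inverse of g in H, so left multiplication by g is injective on
  the finite set \<open>GL\<close> and therefore reaches the unit.\<close>

lemma GL_inverse:
  assumes g: "g \<in> GL"
  obtains h where "h \<in> GL" "mulv H g h = unitv H"
proof -
  have "mulv H (antipv H g) g = unitv H"
  proof
    fix p
    have "mulv H (antipv H g) g = mulv H (\<Sum>a<N. scV (g a) (hs H a)) (\<Sum>b<N. scV (g b) (bas b))"
      unfolding antipv_eq_sum using vecs_expand[OF grouplikeD(1)[OF g]] by (rule arg_cong)
    also have "\<dots> = (\<Sum>b<N. \<Sum>a<N. scV (g b * g a) (mulv H (hs H a) (bas b)))"
      by (simp only: mul.m_sum_l mul.m_sum_r mul.m_sc_l mul.m_sc_r vs.scale_sum_right vs.scale_scale)
    finally have "mulv H (antipv H g) g p = (\<Sum>b<N. \<Sum>a<N. g b * g a * mulv H (hs H a) (bas b) p)"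
      by (simp add: sum_fun_apply)
    also have "\<dots> = (\<Sum>a<N. \<Sum>b<N. comulv H g a b * mulv H (antipv H (bas a)) (bas b) p)"
      by (subst sum.swap) (simp add: grouplikeD(3)[OF g] antipv_bas ac_simps)
    also have "\<dots> = unitv H p" using antip_V1[rule_format, OF grouplikeD(1)[OF g], of p] grouplikeD(4)[OF g] by (simp only: mult_1_left)
    finally show "mulv H (antipv H g) g p = unitv H p" .
  qed
  then have "h = h'" if "h \<in> GL" "h' \<in> GL" "mulv H g h = mulv H g h'" for h h'
    using that by (metis mul.m_assoc mulv_unit_l grouplikeD(1))
  then have "inj_on (mulv H g) GL" by (auto simp: inj_on_def)
  moreover have "mulv H g ` GL \<subseteq> GL" using mulv_GL[OF g] by blast
  ultimately have "mulv H g ` GL = GL" using endo_inj_surj[OF finite_GL] by blast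
  then show ?thesis using that unitv_GL by (metis imageE)
qed

subsection \<open>The module spanned by the variables over the base algebra\<close>

abbreviation BA :: "'k mpoly fract set" where "BA \<equiv> base_alg H"

lemma BA_kc: "kc c \<in> BA" and BA_add: "a \<in> BA \<Longrightarrow> b \<in> BA \<Longrightarrow> a + b \<in> BA"
  and BA_mult: "a \<in> BA \<Longrightarrow> b \<in> BA \<Longrightarrow> a * b \<in> BA"
  unfolding base_alg_def by (rule alg_gen.scal, rule alg_gen.add, assumption+, rule alg_gen.mult, assumption+)

lemma BA_0: "0 \<in> BA" and BA_1: "1 \<in> BA"
  using BA_kc[of 0] BA_kc[of 1] by simp_all

lemma BA_sum: "(\<And>i. i \<in> S \<Longrightarrow> F i \<in> BA) \<Longrightarrow> sum F S \<in> BA"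
  by (induction S rule: infinite_finite_induct) (auto simp: BA_0 BA_add)

lemma BA_minus: "a \<in> BA \<Longrightarrow> b \<in> BA \<Longrightarrow> a - b \<in> BA"
  using BA_add[OF _ BA_mult[OF BA_kc[of "-1"]], of a b] by (simp add: kc_uminus)

definition lin2 :: "(nat \<times> nat \<Rightarrow> 'k mpoly fract) \<Rightarrow> (nat \<Rightarrow> 'k) \<Rightarrow> (nat \<Rightarrow> 'k) \<Rightarrow> 'k mpoly fract" where
  "lin2 w x y = (\<Sum>i<N. \<Sum>j<N. kc (x i * y j) * w (i, j))"

lemma lin2_BA: "x \<in> V \<Longrightarrow> y \<in> V \<Longrightarrow> lin2 sg x y \<in> BA" "x \<in> V \<Longrightarrow> y \<in> V \<Longrightarrow> lin2 sgi x y \<in> BA"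
  unfolding lin2_def sigma_eq[symmetric] sigma_inv_eq[symmetric] base_alg_def
  by (rule alg_gen.gen, blast)+

lemma lin2_bas: "i < N \<Longrightarrow> j < N \<Longrightarrow> lin2 w (bas i) (bas j) = w (i, j)"
proof -
  assume "i < N" "j < N"
  moreover have "lin2 w x y = linv H (\<lambda>i. linv H (\<lambda>j. w (i, j)) y) x" for x y
    unfolding lin2_def linv_def by (simp add: sum_distrib_left kc_mult mult.assoc)
  ultimately show ?thesis by (simp add: linv_bas)
qed

lemma sg_BA: "p \<in> {..<N} \<times> {..<N} \<Longrightarrow> sg p \<in> BA"
  using lin2_BA(1)[of "bas (fst p)" "bas (snd p)"] lin2_bas[of "fst p" "snd p" sg] by auto

lemma lin2_conv2: "lin2 (F \<star>\<star> G) x y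
    = (\<Sum>a<N. \<Sum>b<N. \<Sum>a'<N. \<Sum>b'<N. kc (comulv H x a b * comulv H y a' b') * (F (a, a') * G (b, b')))"
  unfolding comulv_pair_expand lin2_def CF2.conv_def sum_pairs2 scF_def by simp

lemma lin2_conv2_GL:
  assumes "g \<in> GL" "h \<in> GL"
  shows "lin2 (F \<star>\<star> G) g h = lin2 F g h * lin2 G g h"
proof -
  have "lin2 (F \<star>\<star> G) g h = (\<Sum>a<N. \<Sum>b<N. \<Sum>a'<N. \<Sum>b'<N. kc (g a * h a') * F (a, a') * (kc (g b * h b') * G (b, b')))"
    unfolding lin2_conv2 by (intro sum.cong refl) (simp add: grouplikeD(3) assms kc_mult ac_simps)
  also have "\<dots> = (\<Sum>a<N. \<Sum>a'<N. \<Sum>b<N. \<Sum>b'<N. kc (g a * h a') * F (a, a') * (kc (g b * h b') * G (b, b')))"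
    by (rule sum.cong[OF refl], rule sum.swap)
  also have "\<dots> = lin2 F g h * lin2 G g h"
    unfolding lin2_def by (simp only: sum_distrib_right) (simp only: sum_distrib_left)
  finally show ?thesis .
qed

lemma lin2_cong: "(\<And>p. p \<in> {..<N} \<times> {..<N} \<Longrightarrow> F p = G p) \<Longrightarrow> lin2 F x y = lin2 G x y"
  unfolding lin2_def by (intro sum.cong refl) simp

lemma lin2_mus: "lin2 (mus w) x y = linv H w (mulv H x y)"
  by (simp add: lin2_def linv_mulv)

lemma lin2_pure: "lin2 (\<lambda>p. w (fst p) * w' (snd p)) x y = linv H w x * linv H w' y"
  unfolding lin2_def linv_def sum_product by (intro sum.cong refl) (simp add: kc_mult ac_simps)

lemma conv2_unit_r: "p \<in> {..<N} \<times> {..<N} \<Longrightarrow> (w \<star>\<star> (\<lambda>p. kc (he2 p))) p = w p"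
  using CF2.conv_unit_r[of p w 1] by (simp add: scF_def)

lemma conv2_unit_l: "p \<in> {..<N} \<times> {..<N} \<Longrightarrow> ((\<lambda>p. kc (he2 p)) \<star>\<star> w) p = w p"
  using CF2.conv_unit_l[of p 1 w] by (simp add: scF_def)

lemma mus_unit: "p \<in> {..<N} \<times> {..<N} \<Longrightarrow> mus (\<lambda>i. kc (he H i)) p = kc (he2 p)"
proof -
  assume "p \<in> {..<N} \<times> {..<N}"
  then show ?thesis using hm_he[of "fst p" "snd p"]
    by (simp add: mus_def linv_kc dotp_def mem_Times_iff mult.commute)
qed

lemma mus_ti_tv: "p \<in> {..<N} \<times> {..<N} \<Longrightarrow> (mus ti \<star>\<star> mus tv) p = kc (he2 p)"
proof -
  assume p: "p \<in> {..<N} \<times> {..<N}"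
  have "(mus ti \<star>\<star> mus tv) p = mus (ti \<star> tv) p" by (rule mus_conv[OF p, symmetric])
  also have "\<dots> = mus (\<lambda>i. kc (he H i)) p" unfolding mus_def by (rule linv_cong) (rule ti_tv)
  finally show ?thesis by (simp only: mus_unit[OF p])
qed

lemma titi_tt: "p \<in> {..<N} \<times> {..<N} \<Longrightarrow> (titi \<star>\<star> tt) p = kc (he2 p)"
  using conv2_pure[of ti ti tv tv "fst p" "snd p"] by (auto simp: ti_tv kc_mult mem_Times_iff)

lemma sg_mus_tv: "p \<in> {..<N} \<times> {..<N} \<Longrightarrow> (sg \<star>\<star> mus tv) p = tt p"
proof -
  assume p: "p \<in> {..<N} \<times> {..<N}"
  have "(sg \<star>\<star> mus tv) p = (tt \<star>\<star> (mus ti \<star>\<star> mus tv)) p" unfolding sg_def by (rule CF2.conv_assoc[OF p])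
  also have "\<dots> = (tt \<star>\<star> (\<lambda>p. kc (he2 p))) p" by (rule CF2.conv_cong[OF refl mus_ti_tv])
  finally show ?thesis by (simp only: conv2_unit_r[OF p])
qed

lemma sgi_tt: "p \<in> {..<N} \<times> {..<N} \<Longrightarrow> (sgi \<star>\<star> tt) p = mus tv p"
proof -
  assume p: "p \<in> {..<N} \<times> {..<N}"
  have "(sgi \<star>\<star> tt) p = (mus tv \<star>\<star> (titi \<star>\<star> tt)) p" unfolding sgi_def by (rule CF2.conv_assoc[OF p])
  also have "\<dots> = (mus tv \<star>\<star> (\<lambda>p. kc (he2 p))) p" by (rule CF2.conv_cong[OF refl titi_tt])
  finally show ?thesis by (simp only: conv2_unit_r[OF p])
qed

lemma titi_sg: "p \<in> {..<N} \<times> {..<N} \<Longrightarrow> (titi \<star>\<star> sg) p = mus ti p"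
proof -
  assume p: "p \<in> {..<N} \<times> {..<N}"
  have "(titi \<star>\<star> sg) p = ((titi \<star>\<star> tt) \<star>\<star> mus ti) p" unfolding sg_def by (rule CF2.conv_assoc[OF p, symmetric])
  also have "\<dots> = ((\<lambda>p. kc (he2 p)) \<star>\<star> mus ti) p" by (rule CF2.conv_cong[OF titi_tt refl])
  finally show ?thesis by (simp only: conv2_unit_l[OF p])
qed

abbreviation T :: "(nat \<Rightarrow> 'k) \<Rightarrow> 'k mpoly fract" where "T x \<equiv> linv H tv x"

text \<open>At group-likes a convolution is an ordinary product, so the cocycle relations read t_g
  t_h = \<sigma>(g,h) t_gh and \<sigma>^-1(g,h) t_g t_h = t_gh. Cancelling in the field shows that
  both cocycle values are units of the base algebra.\<close>

lemma T_mult_GL: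
  assumes "g \<in> GL" "h \<in> GL"
  obtains s s' where "s \<in> BA" "s' \<in> BA" "s * s' = 1" "T g * T h = s * T (mulv H g h)"
proof -
  let ?s = "lin2 sg g h" and ?s' = "lin2 sgi g h"
  have V: "g \<in> V" "h \<in> V" using assms grouplikeD by auto
  have nz: "T g \<noteq> 0" "T h \<noteq> 0" "T (mulv H g h) \<noteq> 0" using assms mulv_GL t_grouplike_nonzero by auto
  have 1: "?s * T (mulv H g h) = T g * T h"
  proof -
    have "?s * T (mulv H g h) = lin2 (sg \<star>\<star> mus tv) g h" by (simp add: lin2_conv2_GL assms lin2_mus)
    also have "\<dots> = lin2 tt g h" by (rule lin2_cong[OF sg_mus_tv])
    finally show ?thesis by (simp only: lin2_pure)
  qed
  have 2: "?s' * (T g * T h) = T (mulv H g h)"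
  proof -
    have "?s' * (T g * T h) = lin2 (sgi \<star>\<star> tt) g h" by (simp add: lin2_conv2_GL assms lin2_pure)
    also have "\<dots> = lin2 (mus tv) g h" by (rule lin2_cong[OF sgi_tt])
    finally show ?thesis by (simp only: lin2_mus)
  qed
  have "(?s * ?s') * (T g * T h) = 1 * (T g * T h)" using 1 2 by (simp add: mult.assoc)
  then have "?s * ?s' = 1" using nz mult_right_cancel[of "T g * T h"] by (metis mult_eq_0_iff)
  then show ?thesis using that[of ?s ?s'] lin2_BA[OF V] 1 by simp
qed

text \<open>With g = h = 1 the relation becomes t_1 t_1 = \<sigma>(1,1) t_1, hence t_1 =
  \<sigma>(1,1).\<close>

lemma T_unit: "T (unitv H) \<in> BA" "inverse (T (unitv H)) \<in> BA" "T (unitv H) \<noteq> 0"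
proof -
  show nz: "T (unitv H) \<noteq> 0" by (rule t_grouplike_nonzero[OF unitv_GL])
  obtain s s' where s: "s \<in> BA" "s' \<in> BA" "s * s' = 1"
    "T (unitv H) * T (unitv H) = s * T (mulv H (unitv H) (unitv H))"
    by (rule T_mult_GL[OF unitv_GL unitv_GL])
  then have eq: "s = T (unitv H)" using nz mulv_unit_l[OF unitv_V] by simp
  then show "T (unitv H) \<in> BA" using s(1) by simp
  have "inverse (T (unitv H)) = s'" using s(3) nz eq by (metis inverse_unique)
  then show "inverse (T (unitv H)) \<in> BA" using s(2) by simp
qed

text \<open>For the base algebra itself this is the module A spanned by the variables; for an ideal
  I it is IA.\<close>

definition MM :: "'k mpoly fract set \<Rightarrow> 'k mpoly fract set" where
  "MM I = {z. \<exists>b. (\<forall>i. b i \<in> I) \<and> z = (\<Sum>i<N. b i * tv i)}"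

lemma MM_I: "(\<And>i. b i \<in> I) \<Longrightarrow> z = (\<Sum>i<N. b i * tv i) \<Longrightarrow> z \<in> MM I"
  unfolding MM_def by blast

definition BA_ideal :: "'k mpoly fract set \<Rightarrow> bool" where
  "BA_ideal I \<longleftrightarrow> I \<subseteq> BA \<and> 0 \<in> I \<and> (\<forall>a\<in>I. \<forall>b\<in>I. a + b \<in> I) \<and> (\<forall>b\<in>BA. \<forall>a\<in>I. b * a \<in> I)"

lemma BA_ideal_BA: "BA_ideal BA"
  by (simp add: BA_ideal_def BA_0 BA_add BA_mult)

context
  fixes I assumes I: "BA_ideal I"
begin

lemma id_BA: "a \<in> I \<Longrightarrow> a \<in> BA" and id_0: "0 \<in> I" and id_add: "a \<in> I \<Longrightarrow> b \<in> I \<Longrightarrow> a + b \<in> I"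
  and id_mult: "b \<in> BA \<Longrightarrow> a \<in> I \<Longrightarrow> b * a \<in> I"
  using I unfolding BA_ideal_def by blast+

lemma id_mult_r: "a \<in> I \<Longrightarrow> b \<in> BA \<Longrightarrow> a * b \<in> I"
  using id_mult[of b a] by (simp add: mult.commute)

lemma id_minus: "a \<in> I \<Longrightarrow> b \<in> I \<Longrightarrow> a - b \<in> I"
  using id_add[OF _ id_mult[OF BA_kc[of "-1"]], of a b] by (simp add: kc_uminus)

lemma MM_add: "z \<in> MM I \<Longrightarrow> z' \<in> MM I \<Longrightarrow> z + z' \<in> MM I"
proof -
  assume "z \<in> MM I" "z' \<in> MM I"
  then obtain b b' where *: "\<forall>i. b i \<in> I" "z = (\<Sum>i<N. b i * tv i)" "\<forall>i. b' i \<in> I" "z' = (\<Sum>i<N. b' i * tv i)"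
    unfolding MM_def by blast
  have "z + z' = (\<Sum>i<N. (b i + b' i) * tv i)" unfolding * by (simp add: distrib_right sum.distrib)
  then show ?thesis by (rule MM_I[rotated]) (use *(1,3) id_add in blast)
qed

lemma MM_0: "0 \<in> MM I"
  unfolding MM_def using id_0 by (auto intro!: exI[of _ "\<lambda>_. 0"])

lemma MM_sum: "(\<And>i. i \<in> S \<Longrightarrow> F i \<in> MM I) \<Longrightarrow> sum F S \<in> MM I"
  by (induction S rule: infinite_finite_induct) (auto simp: MM_0 MM_add)

lemma MM_scale: "b \<in> BA \<Longrightarrow> z \<in> MM I \<Longrightarrow> b * z \<in> MM I"
proof -
  assume b: "b \<in> BA" and "z \<in> MM I"
  then obtain c where *: "\<forall>i. c i \<in> I" "z = (\<Sum>i<N. c i * tv i)" unfolding MM_def by blast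
  have "b * z = (\<Sum>i<N. (b * c i) * tv i)" unfolding * by (simp add: sum_distrib_left mult.assoc)
  then show ?thesis by (rule MM_I[rotated]) (use *(1) id_mult[OF b] in blast)
qed

lemma MM_minus: "z \<in> MM I \<Longrightarrow> z' \<in> MM I \<Longrightarrow> z - z' \<in> MM I"
  using MM_add[OF _ MM_scale[OF BA_kc[of "-1"]], of z z'] by (simp add: kc_uminus)

lemma MM_T: "c \<in> I \<Longrightarrow> c * T x \<in> MM I"
proof -
  assume c: "c \<in> I"
  have "c * T x = (\<Sum>i<N. (c * kc (x i)) * tv i)" unfolding linv_def by (simp add: sum_distrib_left mult.assoc)
  then show ?thesis by (rule MM_I[rotated]) (rule id_mult_r[OF c BA_kc])
qed

lemma MM_base: "c \<in> I \<Longrightarrow> c \<in> MM I"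
  using MM_T[OF id_mult_r[OF _ T_unit(2)], of c "unitv H"] T_unit(3) by (simp add: mult.assoc)

text \<open>The relation t_x t_y = \<sigma>(x_1,y_1) t_{x_2 y_2} turns a product of variables into a
  combination of variables over the base algebra. So A is a ring, finite over the base algebra, and
  IA is an ideal of it.\<close>

lemma MM_mult: "z \<in> MM I \<Longrightarrow> y \<in> MM BA \<Longrightarrow> z * y \<in> MM I"
proof -
  assume "z \<in> MM I" "y \<in> MM BA"
  then obtain b c where *: "\<And>i. b i \<in> I" "z = (\<Sum>i<N. b i * tv i)" "\<And>i. c i \<in> BA" "y = (\<Sum>i<N. c i * tv i)"
    unfolding MM_def by blast
  have "tv i * tv j = (\<Sum>p\<in>{..<N} \<times> {..<N}. \<Sum>q\<in>{..<N} \<times> {..<N}. kc (hc2 (i, j) p q) * sg p * T (hm H (fst q) (snd q)))"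
    if "i < N" "j < N" for i j
    using sg_mus_tv[of "(i, j)"] that unfolding CF2.conv_def scF_def mus_def by (simp add: mult.assoc)
  then have "z * y = (\<Sum>i<N. \<Sum>j<N. \<Sum>p\<in>{..<N} \<times> {..<N}. \<Sum>q\<in>{..<N} \<times> {..<N}.
      (b i * (c j * (kc (hc2 (i, j) p q) * sg p))) * T (hm H (fst q) (snd q)))"
    unfolding *(2,4) sum_product
    by (intro sum.cong refl) (simp add: mult.assoc mult.left_commute[of "tv _"] sum_distrib_left)
  also have "\<dots> \<in> MM I"
  proof (rule MM_sum, rule MM_sum, rule MM_sum, rule MM_sum, rule MM_T, rule id_mult_r[OF *(1)])
    fix i j p q assume "p \<in> {..<N} \<times> {..<N}"
    then show "c j * (kc (hc2 (i, j) p q) * sg p) \<in> BA" by (intro BA_mult *(3) BA_kc sg_BA)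
  qed
  finally show ?thesis .
qed

end

lemmas AM_add = MM_add[OF BA_ideal_BA] and AM_sum = MM_sum[OF BA_ideal_BA]
  and AM_scale = MM_scale[OF BA_ideal_BA] and AM_minus = MM_minus[OF BA_ideal_BA]
  and AM_T = MM_T[OF BA_ideal_BA] and AM_base = MM_base[OF BA_ideal_BA]
  and AM_mult = MM_mult[OF BA_ideal_BA] and AM_0 = MM_0[OF BA_ideal_BA]

lemma AM_T': "T x \<in> MM BA"
  using AM_T[OF BA_1, of x] by simp

lemma AM_tv: "i < N \<Longrightarrow> tv i \<in> MM BA"
  using AM_T'[of "bas i"] by (simp add: linv_bas)

text \<open>For the inverse h of g, the product t_g t_h is a unit of the base algebra times t_1,
  itself a unit; hence the inverse of \<open>t_g\<close> is a unit times t_h.\<close>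

lemma AM_inverse_T:
  assumes g: "g \<in> GL" shows "inverse (T g) \<in> MM BA"
proof -
  obtain h where h: "h \<in> GL" "mulv H g h = unitv H" by (rule GL_inverse[OF g])
  obtain s s' where s: "s \<in> BA" "s' \<in> BA" "s * s' = 1" "T g * T h = s * T (mulv H g h)"
    by (rule T_mult_GL[OF g h(1)])
  have "T g * ((s' * inverse (T (unitv H))) * T h) = (T g * T h) * (s' * inverse (T (unitv H)))"
    by (simp only: ac_simps)
  also have "\<dots> = (s * s') * (T (unitv H) * inverse (T (unitv H)))"
    unfolding s(4) h(2) by (simp only: ac_simps)
  also have "\<dots> = 1" using s(3) T_unit(3) by simp
  finally have "inverse (T g) = (s' * inverse (T (unitv H))) * T h" by (rule inverse_unique)
  then show ?thesis using AM_T[OF BA_mult[OF s(2) T_unit(2)]] by simp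
qed

text \<open>In the coideal induction, (t \<star> t^-1)(v) = \<epsilon>(v) is solved for the value at
  v. The solution uses the inverse of \<open>t_g\<close>, which lies in the ring A, and values
  already known to lie in A.\<close>

lemma AM_ti: "i < N \<Longrightarrow> ti i \<in> MM BA"
proof -
  assume i: "i < N"
  have "\<forall>x\<in>V. linv H ti x \<in> MM BA"
  proof (rule coideal_induct[OF pointed])
    show "\<forall>x\<in>{0}. linv H ti x \<in> MM BA" using linv_zero AM_0 by (metis singletonD)
  next
    fix X v g
    assume IH: "\<forall>x\<in>X. linv H ti x \<in> MM BA" and g: "g \<in> GL" and d: "\<And>a. comulv H v a - scV (g a) v \<in> X"
    define r where "r a = comulv H v a - scV (g a) v" for a
    have r: "linv H ti (r a) \<in> MM BA" for a using IH d unfolding r_def by blast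
    have row: "linv H ti (comulv H v a) = kc (g a) * linv H ti v + linv H ti (r a)" for a
      unfolding r_def by (rule linv_row[OF d])
    have "kc (counitv H v) = linv H (tv \<star> ti) v"
      using linv_cong[of "tv \<star> ti" "\<lambda>i. kc (he H i)" v] tv_ti by (simp add: linv_kc counitv_dotp)
    also have "\<dots> = T g * linv H ti v + (\<Sum>a<N. tv a * linv H ti (r a))"
      unfolding linv_conv row
      by (simp add: linv_def[of H tv] distrib_left sum.distrib sum_distrib_left sum_distrib_right ac_simps)
    finally have fin: "T g * linv H ti v = kc (counitv H v) - (\<Sum>a<N. tv a * linv H ti (r a))" (is "_ = ?R") by simp
    have eq: "linv H ti v = inverse (T g) * ?R" unfolding fin[symmetric] using t_grouplike_nonzero[OF g] by simp
    have "?R \<in> MM BA"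
      by (rule AM_minus[OF AM_base[OF BA_kc]], rule AM_sum, rule AM_mult[OF AM_tv r]) simp
    then have onv: "linv H ti v \<in> MM BA" unfolding eq by (rule AM_mult[OF AM_inverse_T[OF g]])
    show "\<forall>x\<in>{x + scV c v |x c. x \<in> X}. linv H ti x \<in> MM BA"
    proof
      fix y assume "y \<in> {x + scV c v |x c. x \<in> X}"
      then obtain x c where y: "y = x + scV c v" "x \<in> X" by blast
      show "linv H ti y \<in> MM BA"
        unfolding y(1) linv_add linv_scale using IH y(2) AM_add AM_scale[OF BA_kc onv] by blast
    qed
  qed
  then show ?thesis using i linv_bas[OF i, of ti] by (metis bas_in_vecs)
qed

end

context pointed_hopf
begin

subsection \<open>Maps that are linear over the base algebra modulo an ideal\<close>

text \<open>phi F c at x is F(c t^-1_{x_1}) t_{x_2}: the image of (c \<otimes> 1) times the sum of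
  t^-1_{x_1} \<otimes> t_{x_2} under F \<otimes> id. For F linear modulo I this makes sense modulo
  IA. The factor c is carried along so that multiplication in the first tensor factor can be
  expressed.\<close>

definition phi :: "('k mpoly fract \<Rightarrow> 'k mpoly fract) \<Rightarrow> 'k mpoly fract \<Rightarrow> nat \<Rightarrow> 'k mpoly fract" where
  "phi F c = (\<lambda>i. F (c * ti i)) \<star> tv"

lemma conv2_diff_l: "(w \<star>\<star> u) p - (w' \<star>\<star> u) p = ((\<lambda>p. w p - w' p) \<star>\<star> u) p"
  unfolding CF2.conv_def scF_def by (simp add: left_diff_distrib right_diff_distrib sum_subtractf)

context
  fixes I F
  assumes I: "BA_ideal I"
    and F_add: "\<And>a a'. a \<in> MM BA \<Longrightarrow> a' \<in> MM BA \<Longrightarrow> F (a + a') - (F a + F a') \<in> I"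
    and F_scale: "\<And>b a. b \<in> BA \<Longrightarrow> a \<in> MM BA \<Longrightarrow> F (b * a) - b * F a \<in> I"
begin

lemma F_sum:
  assumes "finite S" "\<And>s. s \<in> S \<Longrightarrow> b s \<in> BA" "\<And>s. s \<in> S \<Longrightarrow> a s \<in> MM BA"
  shows "F (\<Sum>s\<in>S. b s * a s) - (\<Sum>s\<in>S. b s * F (a s)) \<in> I"
  using assms
proof (induction S rule: finite_induct)
  case empty
  show ?case using F_scale[OF BA_0 AM_0] by simp
next
  case (insert s S)
  let ?R = "\<Sum>s\<in>S. b s * a s" and ?Q = "\<Sum>s\<in>S. b s * F (a s)"
  have R: "?R \<in> MM BA" by (rule AM_sum, rule AM_scale) (use insert in auto)
  have sa: "b s * a s \<in> MM BA" by (rule AM_scale) (use insert in auto)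
  have "(F (b s * a s + ?R) - (F (b s * a s) + F ?R)) + (F (b s * a s) - b s * F (a s)) + (F ?R - ?Q) \<in> I"
    by (intro id_add[OF I] F_add[OF sa R] F_scale insert.IH) (use insert in auto)
  moreover have "(F (b s * a s + ?R) - (F (b s * a s) + F ?R)) + (F (b s * a s) - b s * F (a s)) + (F ?R - ?Q)
      = F (b s * a s + ?R) - (b s * F (a s) + ?Q)"
    by (simp only: algebra_simps)
  ultimately show ?case by (simp only: sum.insert[OF insert.hyps])
qed

text \<open>This is the multiplicativity of x \<mapsto> t^-1_{x_1} \<otimes> t_{x_2}. By
  \<open>titi_sg\<close> the first leg at a product is a product of two inverses times a value of
  \<sigma>; that value lies in the base algebra, passes to the second leg, and there converts t at a
  product into a product of two t by \<open>sg_mus_tv\<close>.\<close>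

lemma phi_mus:
  assumes c: "c \<in> MM BA" and p: "p \<in> {..<N} \<times> {..<N}"
  shows "mus (phi F c) p - ((\<lambda>q. F (c * titi q)) \<star>\<star> tt) p \<in> MM I"
proof -
  let ?P = "{..<N} \<times> {..<N}"
  let ?W = "\<lambda>q. F (c * titi q)"
  define Fc where "Fc = (\<lambda>i. F (c * ti i))"
  have cti: "c * ti i \<in> MM BA" if "i < N" for i by (rule AM_mult[OF c AM_ti[OF that]])
  have ctiti: "c * titi q \<in> MM BA" if "q \<in> ?P" for q
    using that by (intro AM_mult[OF c] AM_mult AM_ti) auto
  have D: "mus Fc r - (?W \<star>\<star> sg) r \<in> I" if r: "r \<in> ?P" for r
  proof -
    have "F (\<Sum>l<N. kc (hm H (fst r) (snd r) l) * (c * ti l)) - (\<Sum>l<N. kc (hm H (fst r) (snd r) l) * F (c * ti l)) \<in> I"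
      by (rule F_sum) (auto intro: BA_kc cti)
    then have 1: "F (c * mus ti r) - mus Fc r \<in> I"
      unfolding mus_def linv_def Fc_def by (simp add: sum_distrib_left mult.left_commute)
    have "F (\<Sum>x\<in>?P \<times> ?P. (kc (hc2 r (fst x) (snd x)) * sg (snd x)) * (c * titi (fst x)))
        - (\<Sum>x\<in>?P \<times> ?P. (kc (hc2 r (fst x) (snd x)) * sg (snd x)) * ?W (fst x)) \<in> I"
    proof (rule F_sum)
      fix x assume "x \<in> ?P \<times> ?P"
      then have x: "fst x \<in> ?P" "snd x \<in> ?P" by (simp_all only: mem_Times_iff)
      show "kc (hc2 r (fst x) (snd x)) * sg (snd x) \<in> BA" by (intro BA_mult BA_kc sg_BA x)
      show "c * titi (fst x) \<in> MM BA" by (rule ctiti[OF x(1)])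
    qed simp
    moreover have "(\<Sum>x\<in>?P \<times> ?P. (kc (hc2 r (fst x) (snd x)) * sg (snd x)) * (c * titi (fst x))) = c * (titi \<star>\<star> sg) r"
    proof -
      have "c * (titi \<star>\<star> sg) r = (\<Sum>q\<in>?P. \<Sum>s\<in>?P. (kc (hc2 r q s) * sg s) * (c * titi q))"
        unfolding CF2.conv_def scF_def sum_distrib_left by (intro sum.cong refl) (simp only: ac_simps)
      also have "\<dots> = (\<Sum>x\<in>?P \<times> ?P. (kc (hc2 r (fst x) (snd x)) * sg (snd x)) * (c * titi (fst x)))"
        unfolding sum.cartesian_product[of _ ?P ?P] by (simp only: case_prod_unfold)
      finally show ?thesis by simp
    qed
    moreover have "(\<Sum>x\<in>?P \<times> ?P. (kc (hc2 r (fst x) (snd x)) * sg (snd x)) * ?W (fst x)) = (?W \<star>\<star> sg) r"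
    proof -
      have "(?W \<star>\<star> sg) r = (\<Sum>q\<in>?P. \<Sum>s\<in>?P. (kc (hc2 r q s) * sg s) * ?W q)"
        unfolding CF2.conv_def scF_def by (intro sum.cong refl) (simp only: ac_simps)
      also have "\<dots> = (\<Sum>x\<in>?P \<times> ?P. (kc (hc2 r (fst x) (snd x)) * sg (snd x)) * ?W (fst x))"
        unfolding sum.cartesian_product[of _ ?P ?P] by (simp only: case_prod_unfold)
      finally show ?thesis by simp
    qed
    ultimately have 2: "F (c * mus ti r) - (?W \<star>\<star> sg) r \<in> I" by (simp only: titi_sg[OF r])
    have "(F (c * mus ti r) - (?W \<star>\<star> sg) r) - (F (c * mus ti r) - mus Fc r) \<in> I" by (rule id_minus[OF I 2 1])
    then show ?thesis by simp
  qed
  have "(?W \<star>\<star> tt) p = (?W \<star>\<star> (sg \<star>\<star> mus tv)) p"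
    by (rule CF2.conv_cong[OF refl]) (simp only: sg_mus_tv)
  also have "\<dots> = ((?W \<star>\<star> sg) \<star>\<star> mus tv) p" by (rule CF2.conv_assoc[OF p, symmetric])
  finally have "mus (phi F c) p - (?W \<star>\<star> tt) p = ((\<lambda>r. mus Fc r - (?W \<star>\<star> sg) r) \<star>\<star> mus tv) p"
    unfolding phi_def Fc_def[symmetric] mus_conv[OF p] by (simp only: conv2_diff_l)
  also have "\<dots> = (\<Sum>q\<in>?P. \<Sum>r\<in>?P. (kc (hc2 p q r) * (mus Fc q - (?W \<star>\<star> sg) q)) * T (hm H (fst r) (snd r)))"
    unfolding CF2.conv_def[of "\<lambda>r. mus Fc r - (?W \<star>\<star> sg) r"] scF_def mus_def[of tv] by (simp only: mult.assoc)
  also have "\<dots> \<in> MM I"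
    by (rule MM_sum[OF I], rule MM_sum[OF I], rule MM_T[OF I], rule id_mult[OF I BA_kc D])
  finally show ?thesis .
qed

lemma phi_mulv:
  assumes c: "c \<in> MM BA"
  shows "linv H (phi F c) (mulv H x y) - lin2 ((\<lambda>q. F (c * titi q)) \<star>\<star> tt) x y \<in> MM I"
proof -
  have "linv H (phi F c) (mulv H x y) - lin2 ((\<lambda>q. F (c * titi q)) \<star>\<star> tt) x y
      = (\<Sum>i<N. \<Sum>j<N. kc (x i * y j) * (mus (phi F c) (i, j) - ((\<lambda>q. F (c * titi q)) \<star>\<star> tt) (i, j)))"
    unfolding linv_mulv lin2_def by (simp only: sum_subtractf right_diff_distrib)
  also have "\<dots> \<in> MM I"
    by (rule MM_sum[OF I], rule MM_sum[OF I], rule MM_scale[OF I BA_kc], rule phi_mus[OF c]) simp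
  finally show ?thesis .
qed

lemma lin2_W_commute:
  "lin2 ((\<lambda>q. F (c * titi q)) \<star>\<star> tt) x y = lin2 ((\<lambda>q. F (c * titi q)) \<star>\<star> tt) y x"
  unfolding lin2_conv2 by (subst sum_swap4) (simp add: mult.commute)

lemma lin2_W:
  "lin2 ((\<lambda>q. F (c * titi q)) \<star>\<star> tt) x y
    = (\<Sum>a<N. \<Sum>b<N. kc (comulv H x a b) * (linv H (phi F (c * ti a)) y * tv b))"
  unfolding lin2_conv2 phi_def linv_conv[of _ _ y] linv_def[of H tv]
  by (intro sum.cong refl) (simp add: sum_distrib_left sum_distrib_right kc_mult ac_simps)

text \<open>An algebra map into a commutative algebra kills commutators. The set \<open>K\<close>
  asks for all c at once: at a product xy, the first legs coming from x are absorbed into c, so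
  membership of y is used with the modified c.\<close>

lemma CI_phi:
  assumes x: "x \<in> CI" and c: "c \<in> MM BA"
  shows "linv H (phi F c) x \<in> MM I"
proof -
  define K where "K = {x \<in> V. \<forall>c\<in>MM BA. linv H (phi F c) x \<in> MM I}"
  have lin: "lin2 ((\<lambda>q. F (c * titi q)) \<star>\<star> tt) x y \<in> MM I" if "y \<in> K" "c \<in> MM BA" for x y c
    unfolding lin2_W
  proof (rule MM_sum[OF I], rule MM_sum[OF I], rule MM_scale[OF I BA_kc], rule MM_mult[OF I])
    fix a b assume "a \<in> {..<N}" "b \<in> {..<N}"
    then show "tv b \<in> MM BA" "linv H (phi F (c * ti a)) y \<in> MM I"
      using that AM_tv AM_mult[OF that(2) AM_ti] by (auto simp: K_def)
  qed
  have m1: "linv H (phi F c) (mulv H x y) \<in> MM I" if "y \<in> K" "c \<in> MM BA" for x y c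
    using MM_add[OF I phi_mulv[OF that(2), of x y] lin[OF that, of x]] by simp
  have m2: "linv H (phi F c) (mulv H y x) \<in> MM I" if "y \<in> K" "c \<in> MM BA" for x y c
    using MM_add[OF I phi_mulv[OF that(2), of y x] lin[OF that, of x]] lin2_W_commute[of c x y] by simp
  have "two_sided_ideal H K"
  proof (rule two_sidedI)
    have "linv H (phi F c) 0 \<in> MM I" for c by (simp only: linv_zero MM_0[OF I])
    then show "0 \<in> K" unfolding K_def using zero_in_vecs by blast
    show "x + y \<in> K" if "x \<in> K" "y \<in> K" for x y
      using that MM_add[OF I] add_in_vecs unfolding K_def by (auto simp only: linv_add mem_Collect_eq)
    show "scV a x \<in> K" if "x \<in> K" for a x
      using that MM_scale[OF I BA_kc] scV_in_vecs unfolding K_def by (auto simp only: linv_scale mem_Collect_eq)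
    show "mulv H x y \<in> K" if "y \<in> K" for x y using m1[OF that] mulv_V unfolding K_def by blast
    show "mulv H y x \<in> K" if "y \<in> K" for x y using m2[OF that] mulv_V unfolding K_def by blast
  qed (auto simp: K_def)
  moreover have "comm_quotient H K"
    unfolding comm_quotient_iff
  proof (intro ballI)
    fix x y :: "nat \<Rightarrow> 'k"
    have "linv H (phi F c) (mulv H x y - mulv H y x) \<in> MM I" if "c \<in> MM BA" for c
      using MM_minus[OF I phi_mulv[OF that, of x y] phi_mulv[OF that, of y x]] lin2_W_commute[of c x y]
      unfolding linv_diff by simp
    then show "mulv H x y - mulv H y x \<in> K" using diff_in_vecs[OF mulv_V mulv_V] unfolding K_def by blast
  qed
  ultimately have "CI \<subseteq> K" by (rule CI_least)
  then show ?thesis using assms unfolding K_def by blast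
qed

lemma linv_ti_unit: "linv H ti (unitv H) = inverse (T (unitv H))"
proof -
  have "comulv H (unitv H) a = scV (unitv H a) (unitv H)" for a
    unfolding comulv_unit by (rule ext) (simp add: tensor_def)
  then have "linv H (tv \<star> ti) (unitv H) = T (unitv H) * linv H ti (unitv H)"
    unfolding linv_conv by (simp only: linv_scale) (simp add: linv_def[of H tv] sum_distrib_left sum_distrib_right ac_simps)
  moreover have "linv H (tv \<star> ti) (unitv H) = 1"
    using linv_cong[of "tv \<star> ti" "\<lambda>i. kc (he H i)" "unitv H"] tv_ti counitv_unit by (simp add: linv_kc counitv_dotp)
  ultimately show ?thesis by (metis inverse_unique)
qed

text \<open>For x coinvariant under the projection to the abelianization, the elements \<open>1 \<otimes> t\<^sub>x\<close> and
  \<open>t\<^sub>x \<otimes> 1\<close> agree in the tensor square over the base algebra; this is the image of that identity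
  under a linear map F on the first factor.\<close>

lemma coinvariant_congruence:
  assumes x: "x \<in> V" and rows: "\<And>a. comulv H x a - scV (x a) (unitv H) \<in> CI"
  shows "F (T x) - F 1 * T x \<in> MM I"
proof -
  \<comment> \<open>S is the sum of F(t_{x_1} t^-1_{x_2}) t_{x_3}. Contracting the first two factors
    gives F(1) t_x; replacing the slices of x by multiples of the unit modulo \<open>CI\<close>
    gives F(t_x).\<close>
  define S where "S = (\<Sum>a<N. linv H (phi F (tv a)) (comulv H x a))"
  have "S - F 1 * T x \<in> MM I"
  proof -
    define G where "G l = (\<Sum>a<N. \<Sum>a'<N. kc (hc H l a a') * F (tv a * ti a'))" for l
    have "comulv H (comulv H x a) a' = (\<Sum>l<N. scV (hc H l a a') (comulv H x l))" for a a'
      by (rule ext) (simp add: comulv_row[OF x] sum_fun_apply mult.commute)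
    then have "S = (\<Sum>a<N. \<Sum>a'<N. \<Sum>l<N. kc (hc H l a a') * F (tv a * ti a') * T (comulv H x l))"
      unfolding S_def phi_def linv_conv
      by (simp only: linv_sum linv_scale sum_distrib_left) (simp only: ac_simps)
    also have "\<dots> = (\<Sum>a<N. \<Sum>l<N. \<Sum>a'<N. kc (hc H l a a') * F (tv a * ti a') * T (comulv H x l))"
      by (rule sum.cong[OF refl], rule sum.swap)
    also have "\<dots> = (\<Sum>l<N. \<Sum>a<N. \<Sum>a'<N. kc (hc H l a a') * F (tv a * ti a') * T (comulv H x l))"
      by (rule sum.swap)
    also have "\<dots> = (\<Sum>l<N. G l * T (comulv H x l))" unfolding G_def by (simp only: sum_distrib_right)
    finally have S: "S = (\<Sum>l<N. G l * T (comulv H x l))" .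
    have "T x = T (act (he H) x)" by (simp only: act_he[OF x])
    also have "\<dots> = (\<Sum>l<N. kc (he H l) * T (comulv H x l))" unfolding act_def by (simp only: linv_sum linv_scale)
    finally have Tx: "F 1 * T x = (\<Sum>l<N. (kc (he H l) * F 1) * T (comulv H x l))"
      by (simp only: sum_distrib_left) (simp only: ac_simps)
    have G: "G l - kc (he H l) * F 1 \<in> I" if l: "l < N" for l
    proof -
      let ?P = "{..<N} \<times> {..<N}"
      have "F (\<Sum>q\<in>?P. kc (hc H l (fst q) (snd q)) * (tv (fst q) * ti (snd q)))
          - (\<Sum>q\<in>?P. kc (hc H l (fst q) (snd q)) * F (tv (fst q) * ti (snd q))) \<in> I"
        by (rule F_sum) (auto intro!: BA_kc AM_mult[OF AM_tv AM_ti])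
      moreover have "(\<Sum>q\<in>?P. kc (hc H l (fst q) (snd q)) * F (tv (fst q) * ti (snd q))) = G l"
        unfolding G_def sum.cartesian_product by (simp only: case_prod_unfold)
      moreover have "(\<Sum>q\<in>?P. kc (hc H l (fst q) (snd q)) * (tv (fst q) * ti (snd q))) = kc (he H l)"
        using tv_ti[OF l] unfolding conv1_eq sum.cartesian_product by (simp only: case_prod_unfold)
      ultimately have 1: "F (kc (he H l)) - G l \<in> I" by simp
      have 2: "F (kc (he H l)) - kc (he H l) * F 1 \<in> I" using F_scale[OF BA_kc AM_base[OF BA_1], of "he H l"] by simp
      show ?thesis using id_minus[OF I 2 1] by simp
    qed
    have "S - F 1 * T x = (\<Sum>l<N. (G l - kc (he H l) * F 1) * T (comulv H x l))"
      unfolding S Tx by (simp only: sum_subtractf left_diff_distrib)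
    also have "\<dots> \<in> MM I" by (rule MM_sum[OF I], rule MM_T[OF I], rule G) simp
    finally show ?thesis .
  qed
  moreover have "S - F (T x) \<in> MM I"
  proof -
    \<comment> \<open>At the unit the value is F(c t_1^-1) t_1. Since t_1^-1 lies in the base
      algebra it comes out of F modulo I and cancels against t_1.\<close>
    have unit: "linv H (phi F c) (unitv H) - F c \<in> MM I" if c: "c \<in> MM BA" for c
    proof -
      let ?u = "unitv H" and ?t = "inverse (T (unitv H))"
      have row: "comulv H ?u a = scV (?u a) ?u" for a
        unfolding comulv_unit by (rule ext) (simp add: tensor_def)
      have "F (\<Sum>a<N. kc (?u a) * (c * ti a)) - (\<Sum>a<N. kc (?u a) * F (c * ti a)) \<in> I"
        by (rule F_sum) (auto intro: BA_kc AM_mult[OF c AM_ti])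
      moreover have "(\<Sum>a<N. kc (?u a) * (c * ti a)) = linv H ti ?u * c"
        unfolding linv_def by (simp add: sum_distrib_left sum_distrib_right ac_simps)
      ultimately have 1: "F (?t * c) - (\<Sum>a<N. kc (?u a) * F (c * ti a)) \<in> I" by (simp only: linv_ti_unit)
      have 2: "F (?t * c) - ?t * F c \<in> I" by (rule F_scale[OF T_unit(2) c])
      have 3: "(\<Sum>a<N. kc (?u a) * F (c * ti a)) - ?t * F c \<in> I" using id_minus[OF I 2 1] by simp
      have "linv H (phi F c) ?u = (\<Sum>a<N. kc (?u a) * F (c * ti a)) * T ?u"
        unfolding phi_def linv_conv row linv_scale by (simp add: sum_distrib_left sum_distrib_right ac_simps)
      then have "linv H (phi F c) ?u - F c = ((\<Sum>a<N. kc (?u a) * F (c * ti a)) - ?t * F c) * T ?u"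
        using T_unit(3) by (simp add: left_diff_distrib)
      then show ?thesis using MM_T[OF I 3, of ?u] by simp
    qed
    \<comment> \<open>The part of each slice lying in the commutator ideal, to which
      \<open>CI_phi\<close> applies with c the a-th variable.\<close>
    define r where "r a = comulv H x a - scV (x a) (unitv H)" for a
    have e: "linv H w (comulv H x a) = kc (x a) * linv H w (unitv H) + linv H w (r a)" for w a
      unfolding r_def linv_diff linv_scale by simp
    have r: "linv H (phi F (tv a)) (r a) \<in> MM I" if "a < N" for a
      unfolding r_def by (rule CI_phi[OF rows AM_tv[OF that]])
    have "F (\<Sum>a<N. kc (x a) * tv a) - (\<Sum>a<N. kc (x a) * F (tv a)) \<in> I"
      by (rule F_sum) (auto intro: BA_kc AM_tv)
    then have 1: "F (T x) - (\<Sum>a<N. kc (x a) * F (tv a)) \<in> MM I"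
      unfolding linv_def by (rule MM_base[OF I])
    have "S - (\<Sum>a<N. kc (x a) * F (tv a))
        = (\<Sum>a<N. kc (x a) * (linv H (phi F (tv a)) (unitv H) - F (tv a)) + linv H (phi F (tv a)) (r a))"
      unfolding S_def e by (simp add: right_diff_distrib sum.distrib sum_subtractf)
    also have "\<dots> \<in> MM I"
      by (rule MM_sum[OF I], rule MM_add[OF I MM_scale[OF I BA_kc unit[OF AM_tv]] r]) simp_all
    finally have "(S - (\<Sum>a<N. kc (x a) * F (tv a))) - (F (T x) - (\<Sum>a<N. kc (x a) * F (tv a))) \<in> MM I"
      by (rule MM_minus[OF I _ 1])
    then show ?thesis by simp
  qed
  ultimately have "(S - F 1 * T x) - (S - F (T x)) \<in> MM I" by (rule MM_minus[OF I])
  then show ?thesis by simp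
qed

end

end

context graded_hopf
begin

lemma deg_mulv:
  assumes "g \<in> GL" "h \<in> GL"
  shows "deg (mulv H g h) = deg g \<otimes>\<^bsub>\<Gamma>\<^esub> deg h"
proof (rule deg_eqI[OF mulv_GL[OF assms]])
  have C: "deg g \<in> C" "deg h \<in> C" using deg(1) assms by auto
  then show "deg g \<otimes>\<^bsub>\<Gamma>\<^esub> deg h \<in> C" by simp
  have "dotp N (f (deg g \<otimes>\<^bsub>\<Gamma>\<^esub> deg h)) (mulv H g h) = (\<Sum>\<alpha>\<in>C. \<Sum>\<beta>\<in>C. if \<alpha> = deg g then if \<beta> = deg h then 1 else 0 else 0)"
    using C by (subst f_mulv) (auto simp: grouplikeD(1) assms deg(2) intro!: sum.cong)
  also have "\<dots> = (\<Sum>\<alpha>\<in>C. if \<alpha> = deg g then 1 else 0)"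
    using C fin_\<Gamma> by (intro sum.cong refl) auto
  also have "\<dots> = 1" using C fin_\<Gamma> by simp
  finally show "dotp N (f (deg g \<otimes>\<^bsub>\<Gamma>\<^esub> deg h)) (mulv H g h) \<noteq> 0" by simp
qed

lemma deg_unitv: "deg (unitv H) = \<one>\<^bsub>\<Gamma>\<^esub>"
  using deg_mulv[OF unitv_GL unitv_GL] mulv_unit_l[OF unitv_V] deg(1)[OF unitv_GL] by simp

text \<open>Both terms have the same value under every \<open>f \<gamma>\<close>, by the degree of x
  on one side and that of the unit on the other, and the common kernel of these functionals lies in
  \<open>CI\<close>.\<close>

lemma homogeneous_one_rows:
  assumes "homogeneous \<one>\<^bsub>\<Gamma>\<^esub> x"
  shows "comulv H x a - scV (x a) (unitv H) \<in> CI"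
proof (rule f_kernel)
  show "comulv H x a - scV (x a) (unitv H) \<in> V" by (intro diff_in_vecs row_V scV_in_vecs unitv_V)
  show "\<forall>\<gamma>\<in>C. dotp N (f \<gamma>) (comulv H x a - scV (x a) (unitv H)) = 0"
  proof
    fix \<gamma> assume \<gamma>: "\<gamma> \<in> C"
    show "dotp N (f \<gamma>) (comulv H x a - scV (x a) (unitv H)) = 0"
      unfolding dotp_diff dotp_scale deg(2)[OF unitv_GL \<gamma>] deg_unitv using assms \<gamma> by (simp add: homogeneous_def)
  qed
qed

end

context graded_basis
begin

subsection \<open>Elements of degree one\<close>

lemma BA_FA: "b \<in> BA \<Longrightarrow> b \<in> FA \<one>\<^bsub>\<Gamma>\<^esub>"
  using base_alg_subset_graded[OF graded_family_FA] by blast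

definition comp1 :: "nat \<Rightarrow> 'k mpoly fract" where
  "comp1 i = (tv \<star> E \<one>\<^bsub>\<Gamma>\<^esub>) i"

text \<open>The component of neutral degree of a sum of homogeneous fractions, unique by
  \<open>FA_direct\<close>. On A it is linear over the base algebra, whose elements have neutral
  degree themselves.\<close>

definition P :: "'k mpoly fract \<Rightarrow> 'k mpoly fract" where
  "P z = (THE y. \<exists>\<zeta>. \<zeta> \<one>\<^bsub>\<Gamma>\<^esub> = y \<and> (\<forall>\<gamma>\<in>C. \<zeta> \<gamma> \<in> FA \<gamma>) \<and> z = (\<Sum>\<gamma>\<in>C. \<zeta> \<gamma>))"

lemma P_eqI:
  assumes "\<And>\<gamma>. \<gamma> \<in> C \<Longrightarrow> \<zeta> \<gamma> \<in> FA \<gamma>" "z = (\<Sum>\<gamma>\<in>C. \<zeta> \<gamma>)"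
  shows "P z = \<zeta> \<one>\<^bsub>\<Gamma>\<^esub>"
  unfolding P_def
proof (rule the_equality)
  show "\<exists>\<zeta>'. \<zeta>' \<one>\<^bsub>\<Gamma>\<^esub> = \<zeta> \<one>\<^bsub>\<Gamma>\<^esub> \<and> (\<forall>\<gamma>\<in>C. \<zeta>' \<gamma> \<in> FA \<gamma>) \<and> z = (\<Sum>\<gamma>\<in>C. \<zeta>' \<gamma>)" using assms by blast
next
  fix y assume "\<exists>\<zeta>'. \<zeta>' \<one>\<^bsub>\<Gamma>\<^esub> = y \<and> (\<forall>\<gamma>\<in>C. \<zeta>' \<gamma> \<in> FA \<gamma>) \<and> z = (\<Sum>\<gamma>\<in>C. \<zeta>' \<gamma>)"
  then obtain \<zeta>' where *: "\<zeta>' \<one>\<^bsub>\<Gamma>\<^esub> = y" "\<And>\<gamma>. \<gamma> \<in> C \<Longrightarrow> \<zeta>' \<gamma> \<in> FA \<gamma>" "z = (\<Sum>\<gamma>\<in>C. \<zeta>' \<gamma>)" by blast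
  have "\<zeta>' \<one>\<^bsub>\<Gamma>\<^esub> - \<zeta> \<one>\<^bsub>\<Gamma>\<^esub> = 0"
  proof (rule FA_direct[of "\<lambda>\<gamma>. \<zeta>' \<gamma> - \<zeta> \<gamma>"])
    show "\<zeta>' \<gamma> - \<zeta> \<gamma> \<in> FA \<gamma>" if "\<gamma> \<in> C" for \<gamma>
      by (rule gf_minus[OF graded_family_FA that *(2)[OF that] assms(1)[OF that]])
    show "(\<Sum>\<gamma>\<in>C. \<zeta>' \<gamma> - \<zeta> \<gamma>) = 0" using *(3) assms(2) by (simp add: sum_subtractf)
  qed simp
  then show "y = \<zeta> \<one>\<^bsub>\<Gamma>\<^esub>" using *(1) by simp
qed

lemma tv_sum_E: "i < N \<Longrightarrow> tv i = (\<Sum>\<gamma>\<in>C. (tv \<star> E \<gamma>) i)"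
proof -
  assume i: "i < N"
  have "(\<Sum>\<gamma>\<in>C. (tv \<star> E \<gamma>) i) = (\<Sum>\<gamma>\<in>C. T (proj \<gamma> (bas i)))"
    unfolding linv_tv_E[symmetric] using i by (simp add: linv_bas)
  also have "\<dots> = T (\<Sum>\<gamma>\<in>C. proj \<gamma> (bas i))" by (simp only: linv_sum)
  also have "\<dots> = tv i" using sum_proj[OF bas_in_vecs[OF i]] linv_bas[OF i, of tv] by simp
  finally show ?thesis by simp
qed

lemma P_lincomb:
  assumes "\<And>i. b i \<in> BA"
  shows "P (\<Sum>i<N. b i * tv i) = (\<Sum>i<N. b i * comp1 i)"
proof -
  have "P (\<Sum>i<N. b i * tv i) = (\<lambda>\<gamma>. \<Sum>i<N. b i * (tv \<star> E \<gamma>) i) \<one>\<^bsub>\<Gamma>\<^esub>"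
  proof (rule P_eqI)
    fix \<gamma> assume \<gamma>: "\<gamma> \<in> C"
    show "(\<Sum>i<N. b i * (tv \<star> E \<gamma>) i) \<in> FA \<gamma>"
    proof (rule gf_sum[OF graded_family_FA \<gamma>])
      fix i assume "i \<in> {..<N}"
      then have "b i * (tv \<star> E \<gamma>) i \<in> FA (\<one>\<^bsub>\<Gamma>\<^esub> \<otimes>\<^bsub>\<Gamma>\<^esub> \<gamma>)"
        using gf_mult[OF graded_family_FA GG.one_closed \<gamma> BA_FA[OF assms] gf_tv[OF graded_family_FA \<gamma>]] by simp
      then show "b i * (tv \<star> E \<gamma>) i \<in> FA \<gamma>" using \<gamma> by simp
    qed
  next
    have "(\<Sum>i<N. b i * tv i) = (\<Sum>i<N. \<Sum>\<gamma>\<in>C. b i * (tv \<star> E \<gamma>) i)"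
      by (intro sum.cong refl) (simp add: tv_sum_E flip: sum_distrib_left)
    then show "(\<Sum>i<N. b i * tv i) = (\<Sum>\<gamma>\<in>C. \<Sum>i<N. b i * (tv \<star> E \<gamma>) i)"
      by (simp only: sum.swap[of _ C])
  qed
  then show ?thesis by (simp add: comp1_def)
qed

lemma P_add: "z \<in> MM BA \<Longrightarrow> z' \<in> MM BA \<Longrightarrow> P (z + z') = P z + P z'"
proof -
  assume "z \<in> MM BA" "z' \<in> MM BA"
  then obtain b b' where *: "\<And>i. b i \<in> BA" "z = (\<Sum>i<N. b i * tv i)" "\<And>i. b' i \<in> BA" "z' = (\<Sum>i<N. b' i * tv i)"
    unfolding MM_def by blast
  have "z + z' = (\<Sum>i<N. (b i + b' i) * tv i)" unfolding *(2,4) by (simp add: distrib_right sum.distrib)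
  then have "P (z + z') = (\<Sum>i<N. (b i + b' i) * comp1 i)" using P_lincomb[of "\<lambda>i. b i + b' i"] BA_add *(1,3) by simp
  then show ?thesis unfolding *(2,4) P_lincomb[OF *(1)] P_lincomb[OF *(3)] by (simp add: distrib_right sum.distrib)
qed

lemma P_scale: "c \<in> BA \<Longrightarrow> z \<in> MM BA \<Longrightarrow> P (c * z) = c * P z"
proof -
  assume c: "c \<in> BA" and "z \<in> MM BA"
  then obtain b where *: "\<And>i. b i \<in> BA" "z = (\<Sum>i<N. b i * tv i)" unfolding MM_def by blast
  have "c * z = (\<Sum>i<N. (c * b i) * tv i)" unfolding *(2) by (simp add: sum_distrib_left mult.assoc)
  then have "P (c * z) = (\<Sum>i<N. (c * b i) * comp1 i)" using P_lincomb[of "\<lambda>i. c * b i"] BA_mult[OF c *(1)] by simp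
  then show ?thesis unfolding *(2) P_lincomb[OF *(1)] by (simp add: sum_distrib_left mult.assoc)
qed

lemma P_FA: "z \<in> FA \<one>\<^bsub>\<Gamma>\<^esub> \<Longrightarrow> P z = z"
  using P_eqI[of "\<lambda>\<gamma>. if \<gamma> = \<one>\<^bsub>\<Gamma>\<^esub> then z else 0" z] gf_0[OF graded_family_FA] fin_\<Gamma> by (simp add: sum.delta)

text \<open>A filtration between the base algebra, at j = 0, and its module generated by 1 and all
  degree-one components of the variables, at j = N. It is collapsed from the top.\<close>

definition XX :: "nat \<Rightarrow> 'k mpoly fract set" where
  "XX j = {z. \<exists>c b. c \<in> BA \<and> (\<forall>i. b i \<in> BA) \<and> z = c + (\<Sum>i<j. b i * comp1 i)}"

lemma XX_I: "c \<in> BA \<Longrightarrow> (\<And>i. b i \<in> BA) \<Longrightarrow> z = c + (\<Sum>i<j. b i * comp1 i) \<Longrightarrow> z \<in> XX j"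
  unfolding XX_def by blast

lemma XX_add: "z \<in> XX j \<Longrightarrow> z' \<in> XX j \<Longrightarrow> z + z' \<in> XX j"
proof -
  assume "z \<in> XX j" "z' \<in> XX j"
  then obtain c b c' b' where *: "c \<in> BA" "\<forall>i. b i \<in> BA" "z = c + (\<Sum>i<j. b i * comp1 i)"
    "c' \<in> BA" "\<forall>i. b' i \<in> BA" "z' = c' + (\<Sum>i<j. b' i * comp1 i)" unfolding XX_def by blast
  have "z + z' = (c + c') + (\<Sum>i<j. (b i + b' i) * comp1 i)" unfolding * by (simp add: distrib_right sum.distrib)
  then show ?thesis by (rule XX_I[rotated 2]) (use * BA_add in blast)+
qed

lemma XX_scale: "a \<in> BA \<Longrightarrow> z \<in> XX j \<Longrightarrow> a * z \<in> XX j"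
proof -
  assume a: "a \<in> BA" and "z \<in> XX j"
  then obtain c b where *: "c \<in> BA" "\<forall>i. b i \<in> BA" "z = c + (\<Sum>i<j. b i * comp1 i)" unfolding XX_def by blast
  have "a * z = a * c + (\<Sum>i<j. (a * b i) * comp1 i)" unfolding * by (simp add: distrib_left sum_distrib_left mult.assoc)
  then show ?thesis by (rule XX_I[rotated 2]) (use * BA_mult[OF a] in blast)+
qed

lemma XX_minus: "z \<in> XX j \<Longrightarrow> z' \<in> XX j \<Longrightarrow> z - z' \<in> XX j"
  using XX_add[OF _ XX_scale[OF BA_kc[of "-1"]], of z j z'] by (simp add: kc_uminus)

lemma XX_base: "c \<in> BA \<Longrightarrow> c \<in> XX j"
  by (rule XX_I[of c "\<lambda>_. 0"]) (simp_all add: BA_0)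

lemma XX_Suc: "z \<in> XX (Suc j) \<Longrightarrow> \<exists>b\<in>BA. z - b * comp1 j \<in> XX j"
proof -
  assume "z \<in> XX (Suc j)"
  then obtain c b where *: "c \<in> BA" "\<forall>i. b i \<in> BA" "z = c + (\<Sum>i<Suc j. b i * comp1 i)" unfolding XX_def by blast
  then have "z - b j * comp1 j \<in> XX j" by (intro XX_I[of c b]) simp_all
  then show ?thesis using * by blast
qed

lemma comp1_XX: "j < n \<Longrightarrow> comp1 j \<in> XX n"
proof -
  assume j: "j < n"
  have "comp1 j = 0 + (\<Sum>i<n. (if i = j then 1 else 0) * comp1 i)"
    using j by (simp add: if_distrib[of "\<lambda>z. z * _"] cong: if_cong)
  then show ?thesis by (rule XX_I[rotated 2]) (auto simp: BA_0 BA_1)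
qed

lemma comp1_eq_T: "i < N \<Longrightarrow> comp1 i = T (proj \<one>\<^bsub>\<Gamma>\<^esub> (bas i))"
  unfolding comp1_def linv_tv_E[symmetric] by (simp add: linv_bas)

text \<open>The quotient of \<open>XX (Suc j)\<close> by \<open>XX j\<close> is cyclic, generated by
  \<open>comp1 j\<close>, with annihilator \<open>I\<close>. Projecting A to it by \<open>P\<close>
  gives a map to B / I with 1 \<mapsto> 0 and \<open>comp1 j\<close> \<mapsto> 1. As
  \<open>comp1 j\<close> is t at a vector of neutral degree, \<open>coinvariant_congruence\<close>
  yields 1 \<in> IA, and Nakayama's lemma yields 1 \<in> I, which says that \<open>comp1 j\<close>
  lies in \<open>XX j\<close>.\<close>

lemma XX_step:
  assumes j: "j < N" and le: "XX N \<subseteq> XX (Suc j)"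
  shows "comp1 j \<in> XX j"
proof -
  define I where "I = {b \<in> BA. b * comp1 j \<in> XX j}"
  have I: "BA_ideal I"
    unfolding BA_ideal_def I_def using BA_0 XX_base[OF BA_0] BA_add XX_add BA_mult XX_scale
    by (auto simp: distrib_right mult.assoc)
  have PX: "P z \<in> XX (Suc j)" if "z \<in> MM BA" for z
  proof -
    obtain b where *: "\<And>i. b i \<in> BA" "z = (\<Sum>i<N. b i * tv i)" using \<open>z \<in> MM BA\<close> unfolding MM_def by blast
    have "P z \<in> XX N" unfolding *(2) P_lincomb[OF *(1)] by (rule XX_I[OF BA_0 *(1)]) simp
    then show ?thesis using le by blast
  qed
  \<comment> \<open>A chosen coefficient of \<open>comp1 j\<close> in the projection of z. It is
    determined modulo \<open>I\<close> only, which is why additivity and linearity hold only up to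
    \<open>I\<close>.\<close>
  define F where "F z = (SOME b. b \<in> BA \<and> P z - b * comp1 j \<in> XX j)" for z
  have F: "F z \<in> BA \<and> P z - F z * comp1 j \<in> XX j" if "z \<in> MM BA" for z
    unfolding F_def by (rule someI_ex) (use XX_Suc[OF PX[OF that]] in blast)
  have FI: "b - F z \<in> I" if z: "z \<in> MM BA" and b: "b \<in> BA" "P z - b * comp1 j \<in> XX j" for z b
  proof -
    have "(P z - F z * comp1 j) - (P z - b * comp1 j) \<in> XX j" using XX_minus F[OF z] b(2) by blast
    then have "(b - F z) * comp1 j \<in> XX j" by (simp add: left_diff_distrib)
    then show ?thesis unfolding I_def using BA_minus[OF b(1)] F[OF z] by blast
  qed
  have F_add: "F (a + a') - (F a + F a') \<in> I" if a: "a \<in> MM BA" "a' \<in> MM BA" for a a'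
  proof -
    have "(P a - F a * comp1 j) + (P a' - F a' * comp1 j) \<in> XX j" using XX_add F a by blast
    then have "P (a + a') - (F a + F a') * comp1 j \<in> XX j"
      unfolding P_add[OF a] by (simp add: algebra_simps)
    then have "(F a + F a') - F (a + a') \<in> I" using FI[OF AM_add[OF a]] BA_add F a by blast
    then have "0 - ((F a + F a') - F (a + a')) \<in> I" by (rule id_minus[OF I id_0[OF I]])
    then show ?thesis by simp
  qed
  have F_scale: "F (b * a) - b * F a \<in> I" if b: "b \<in> BA" and a: "a \<in> MM BA" for b a
  proof -
    have "b * (P a - F a * comp1 j) \<in> XX j" using XX_scale[OF b] F[OF a] by blast
    then have "P (b * a) - (b * F a) * comp1 j \<in> XX j"
      unfolding P_scale[OF b a] by (simp add: algebra_simps)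
    then have "b * F a - F (b * a) \<in> I" using FI[OF AM_scale[OF b a]] BA_mult[OF b] F[OF a] by blast
    then have "0 - (b * F a - F (b * a)) \<in> I" by (rule id_minus[OF I id_0[OF I]])
    then show ?thesis by simp
  qed
  define x where "x = proj \<one>\<^bsub>\<Gamma>\<^esub> (bas j)"
  have hx: "homogeneous \<one>\<^bsub>\<Gamma>\<^esub> x" unfolding x_def by (rule homogeneous_proj[OF bas_in_vecs[OF j] GG.one_closed])
  have Tx: "T x = comp1 j" unfolding x_def comp1_eq_T[OF j] ..
  have key: "F (T x) - F 1 * T x \<in> MM I"
    by (rule coinvariant_congruence[OF I F_add F_scale])
      (use hx homogeneous_one_rows in \<open>auto simp: homogeneous_def\<close>)
  have "P 1 - 0 * comp1 j \<in> XX j" using P_FA[OF BA_FA[OF BA_1]] XX_base[OF BA_1] by simp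
  then have "0 - F 1 \<in> I" by (rule FI[OF AM_base[OF BA_1] BA_0])
  then have F1: "F 1 \<in> I" using id_minus[OF I id_0[OF I]] by force
  have "comp1 j \<in> FA \<one>\<^bsub>\<Gamma>\<^esub>" unfolding comp1_def by (rule gf_tv[OF graded_family_FA GG.one_closed j])
  then have "P (T x) - 1 * comp1 j \<in> XX j" unfolding Tx using P_FA XX_base[OF BA_0] by simp
  then have "1 - F (T x) \<in> I" by (rule FI[OF AM_T' BA_1])
  then have "(1 - F (T x)) + ((F (T x) - F 1 * T x) + F 1 * T x) \<in> MM I"
    by (intro MM_add[OF I] MM_base[OF I] key MM_T[OF I F1])
  then have one: "1 \<in> MM I" by simp
  \<comment> \<open>From 1 \<in> IA every variable lies in IA, which is the hypothesis of Nakayama's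
    lemma for the generators of A.\<close>
  have "1 \<in> I"
  proof (rule nakayama[of I BA N tv])
    show "\<exists>\<iota>. (\<forall>k. \<iota> k \<in> I) \<and> tv i = (\<Sum>k<N. \<iota> k * tv k)" if "i < N" for i
      using MM_mult[OF I one AM_tv[OF that]] unfolding MM_def by simp
    show "\<exists>i<N. tv i \<noteq> 0"
    proof (rule ccontr)
      assume "\<not> ?thesis"
      then have "T (unitv H) = 0" unfolding linv_def by simp
      then show False using T_unit(3) by simp
    qed
  qed (use I BA_1 BA_minus in \<open>auto simp: BA_ideal_def\<close>)
  then show ?thesis by (simp add: I_def)
qed

text \<open>Removing one generator at a time leads from \<open>XX N\<close>, which contains all the
  components, down to \<open>XX 0\<close>, the base algebra.\<close>

lemma comp1_BA: "i < N \<Longrightarrow> comp1 i \<in> BA"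
proof -
  assume i: "i < N"
  have "k \<le> N \<Longrightarrow> XX N \<subseteq> XX (N - k)" for k
  proof (induction k)
    case (Suc k)
    define j where "j = N - Suc k"
    have j: "j < N" "Suc j = N - k" using Suc.prems by (auto simp: j_def)
    have c: "comp1 j \<in> XX j" using XX_step[OF j(1)] Suc j(2) by simp
    have "XX (Suc j) \<subseteq> XX j"
    proof
      fix z assume "z \<in> XX (Suc j)"
      then obtain b where "b \<in> BA" "z - b * comp1 j \<in> XX j" using XX_Suc by blast
      then have "(z - b * comp1 j) + b * comp1 j \<in> XX j" using XX_add XX_scale c by blast
      then show "z \<in> XX j" by simp
    qed
    then show ?case using Suc j by (auto simp: j_def)
  qed simp
  from this[of N] have "comp1 i \<in> XX 0" using comp1_XX[OF i] by auto
  then show ?thesis by (auto simp: XX_def)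
qed

theorem T_homogeneous_one_BA:
  assumes "homogeneous \<one>\<^bsub>\<Gamma>\<^esub> x" shows "T x \<in> BA"
proof -
  have "T x = linv H (tv \<star> E \<one>\<^bsub>\<Gamma>\<^esub>) x"
    unfolding linv_tv_E using proj_homogeneous[OF assms GG.one_closed] by simp
  also have "\<dots> = (\<Sum>i<N. kc (x i) * comp1 i)" unfolding linv_def comp1_def ..
  also have "\<dots> \<in> BA" by (rule BA_sum, rule BA_mult[OF BA_kc comp1_BA]) simp
  finally show ?thesis .
qed

end

subsection \<open>Monomials in the variables of group-like elements\<close>

lemma alg_gen_0_1:
  "0 \<in> alg_gen S" "1 \<in> alg_gen S"
  using alg_gen.scal[of 0 S] alg_gen.scal[of 1 S] by simp_all

lemma alg_gen_prod: "(\<And>i. i \<in> A \<Longrightarrow> F i \<in> alg_gen S) \<Longrightarrow> prod F A \<in> alg_gen S"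
  by (induction A rule: infinite_finite_induct) (auto intro: alg_gen.mult alg_gen_0_1)

lemma alg_gen_power: "z \<in> alg_gen S \<Longrightarrow> z ^ k \<in> alg_gen S"
  by (induction k) (auto intro: alg_gen.mult alg_gen_0_1)

context pointed_hopf
begin

lemma grouplike_monomial_mono: "grouplike_monomial H D p \<Longrightarrow> D \<le> E \<Longrightarrow> grouplike_monomial H E p"
  unfolding grouplike_monomial_def using le_trans by blast

lemma grouplike_monomial_one: "grouplike_monomial H 0 1"
  unfolding grouplike_monomial_def by (rule exI[of _ "\<lambda>_. 0"]) simp

lemma grouplike_monomial_tvar: "g \<in> GL \<Longrightarrow> grouplike_monomial H 1 (tvar H g)"
  unfolding grouplike_monomial_def
  by (rule exI[of _ "\<lambda>h. if h = g then 1 else 0"])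
    (simp add: finite_GL if_distrib[of "\<lambda>k. tvar H _ ^ k"] cong: if_cong)

lemma grouplike_monomial_mult:
  assumes "grouplike_monomial H D p" "grouplike_monomial H E q"
  shows "grouplike_monomial H (D + E) (p * q)"
proof -
  obtain d e where "sum d GL \<le> D" "p = (\<Prod>g\<in>GL. tvar H g ^ d g)"
    and "sum e GL \<le> E" "q = (\<Prod>g\<in>GL. tvar H g ^ e g)"
    using assms unfolding grouplike_monomial_def by blast
  then show ?thesis unfolding grouplike_monomial_def
    by (intro exI[of _ "\<lambda>g. d g + e g"]) (simp add: sum.distrib prod.distrib power_add)
qed

lemma grouplike_monomial_power: "grouplike_monomial H D p \<Longrightarrow> grouplike_monomial H (k * D) (p ^ k)"
  by (induction k) (simp_all add: grouplike_monomial_one grouplike_monomial_mult)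

lemma grouplike_monomial_prod:
  assumes "finite S" "\<And>i. i \<in> S \<Longrightarrow> grouplike_monomial H (D i) (p i)"
  shows "grouplike_monomial H (\<Sum>i\<in>S. D i) (\<Prod>i\<in>S. p i)"
  using assms by (induction S) (simp_all add: grouplike_monomial_one grouplike_monomial_mult)

end

context graded_hopf
begin

text \<open>The degree is read off the rightmost tensor factor, and slicing removes the leftmost
  one; coassociativity makes the two operations commute.\<close>

lemma homogeneous_row:
  assumes "homogeneous \<gamma> x" shows "homogeneous \<gamma> (comulv H x a)"
  unfolding homogeneous_def
proof (intro conjI ballI allI row_V)
  fix \<delta> b assume \<delta>: "\<delta> \<in> C"
  have x: "x \<in> V" using assms by (simp add: homogeneous_def)
  have "dotp N (f \<delta>) (comulv H (comulv H x a) b) = comulv H (\<lambda>a. dotp N (f \<delta>) (comulv H x a)) a b"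
    by (simp only: comulv_dotp_rows[OF x])
  also have "(\<lambda>a. dotp N (f \<delta>) (comulv H x a)) = (if \<delta> = \<gamma> then x else 0)"
    using assms \<delta> by (auto simp: homogeneous_def fun_eq_iff)
  also have "comulv H \<dots> a b = (if \<delta> = \<gamma> then comulv H x a b else 0)"
    using comulv_zero by (cases "\<delta> = \<gamma>") (simp_all only: if_True if_False simp_thms)
  finally show "dotp N (f \<delta>) (comulv H (comulv H x a) b) = (if \<delta> = \<gamma> then comulv H x a b else 0)" .
qed

lemma dotp_f_mulv_GL:
  assumes x: "x \<in> V" and g: "g \<in> GL" and \<gamma>: "\<gamma> \<in> C"
  shows "dotp N (f (\<gamma> \<otimes>\<^bsub>\<Gamma>\<^esub> deg g)) (mulv H x g) = dotp N (f \<gamma>) x"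
proof -
  have C: "deg g \<in> C" using deg(1) g by auto
  have "dotp N (f (\<gamma> \<otimes>\<^bsub>\<Gamma>\<^esub> deg g)) (mulv H x g)
      = (\<Sum>\<alpha>\<in>C. \<Sum>\<beta>\<in>C. if \<beta> = deg g then if \<alpha> = \<gamma> then dotp N (f \<alpha>) x else 0 else 0)"
    using C \<gamma> by (subst f_mulv) (auto simp: grouplikeD(1) g x deg(2) intro!: sum.cong)
  also have "\<dots> = (\<Sum>\<alpha>\<in>C. if \<alpha> = \<gamma> then dotp N (f \<alpha>) x else 0)"
    using C fin_\<Gamma> by (intro sum.cong refl) auto
  also have "\<dots> = dotp N (f \<gamma>) x" using \<gamma> fin_\<Gamma> by simp
  finally show ?thesis .
qed

lemma homogeneous_mulv_GL:
  assumes x: "homogeneous \<gamma> x" and g: "g \<in> GL" and \<gamma>: "\<gamma> \<in> C"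
  shows "homogeneous (\<gamma> \<otimes>\<^bsub>\<Gamma>\<^esub> deg g) (mulv H x g)"
  unfolding homogeneous_def
proof (intro conjI ballI allI)
  have V: "x \<in> V" "g \<in> V" using x g grouplikeD by (auto simp: homogeneous_def)
  show "mulv H x g \<in> V" using mulv_V V by blast
  fix \<delta> a assume \<delta>: "\<delta> \<in> C"
  have dC: "deg g \<in> C" using deg(1) g by auto
  define \<delta>' where "\<delta>' = \<delta> \<otimes>\<^bsub>\<Gamma>\<^esub> inv\<^bsub>\<Gamma>\<^esub> (deg g)"
  have \<delta>': "\<delta>' \<in> C" "\<delta> = \<delta>' \<otimes>\<^bsub>\<Gamma>\<^esub> deg g" using \<delta> dC by (simp_all add: \<delta>'_def GG.m_assoc)
  have eq: "\<delta> = \<gamma> \<otimes>\<^bsub>\<Gamma>\<^esub> deg g \<longleftrightarrow> \<delta>' = \<gamma>" using \<delta>' \<gamma> dC by simp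
  have mg: "(\<Sum>b<N. f \<delta> b * (\<Sum>b1<N. \<Sum>b2<N. comulv H x a1 b1 * g b2 * hm H b1 b2 b))
      = dotp N (f \<delta>) (mulv H (comulv H x a1) g)" for a1
    unfolding dotp_def mulv_def ..
  have "dotp N (f \<delta>) (comulv H (mulv H x g) a)
      = (\<Sum>b<N. \<Sum>a1<N. \<Sum>a2<N. (g a2 * hm H a1 a2 a) * (f \<delta> b * (\<Sum>b1<N. \<Sum>b2<N. comulv H x a1 b1 * g b2 * hm H b1 b2 b)))"
    unfolding dotp_def comulv_mulv[OF V] tmul_def sum_distrib_left grouplikeD(3)[OF g]
    by (rule sum.cong[OF refl], rule sum.cong[OF refl], subst sum.swap) (simp add: ac_simps)
  also have "\<dots> = (\<Sum>a1<N. \<Sum>a2<N. \<Sum>b<N. (g a2 * hm H a1 a2 a) * (f \<delta> b * (\<Sum>b1<N. \<Sum>b2<N. comulv H x a1 b1 * g b2 * hm H b1 b2 b)))"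
    by (subst sum.swap, rule sum.cong[OF refl], rule sum.swap)
  also have "\<dots> = (\<Sum>a1<N. \<Sum>a2<N. (g a2 * hm H a1 a2 a) * dotp N (f \<delta>) (mulv H (comulv H x a1) g))"
    by (simp only: mg sum_distrib_left[symmetric])
  also have "\<dots> = (\<Sum>a1<N. \<Sum>a2<N. (g a2 * hm H a1 a2 a) * (if \<delta>' = \<gamma> then x a1 else 0))"
    unfolding \<delta>'(2) dotp_f_mulv_GL[OF row_V g \<delta>'(1)] using x \<delta>'(1) by (simp add: homogeneous_def)
  also have "\<dots> = (if \<delta>' = \<gamma> then mulv H x g a else 0)" by (simp add: mulv_def ac_simps)
  finally show "dotp N (f \<delta>) (comulv H (mulv H x g) a) = (if \<delta> = \<gamma> \<otimes>\<^bsub>\<Gamma>\<^esub> deg g then mulv H x g a else 0)"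
    by (simp only: eq)
qed

end

context graded_basis
begin

subsection \<open>Generators of the base algebra\<close>

text \<open>t_x t_g = \<sigma>(x_1,g) t_{x_2 g}. The slices x_2 keep the degree \<gamma> of x, so
  x_2 g has neutral degree and its t lies in the base algebra.\<close>

lemma T_mult_homogeneous_BA:
  assumes x: "homogeneous \<gamma> x" and \<gamma>: "\<gamma> \<in> C" and g: "g \<in> GL" "deg g = inv\<^bsub>\<Gamma>\<^esub> \<gamma>"
  shows "T x * T g \<in> BA"
proof -
  have TB: "T (mulv H (comulv H x a) g) \<in> BA" for a
    using homogeneous_mulv_GL[OF homogeneous_row[OF x] g(1) \<gamma>, of a] T_homogeneous_one_BA \<gamma> g(2) by simp
  have "T x * T g = lin2 (\<lambda>p. tv (fst p) * tv (snd p)) x g" by (simp only: lin2_pure)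
  also have "\<dots> = lin2 (sg \<star>\<star> mus tv) x g" by (rule lin2_cong) (simp only: sg_mus_tv)
  also have "\<dots> = (\<Sum>a<N. \<Sum>a'<N. \<Sum>b<N. \<Sum>b'<N. (kc (g a') * sg (a, a')) * (kc (comulv H x a b * g b') * mus tv (b, b')))"
    unfolding lin2_conv2 grouplikeD(3)[OF g(1)]
    by (rule sum.cong[OF refl], subst sum.swap) (simp add: kc_mult ac_simps)
  also have "\<dots> = (\<Sum>a<N. \<Sum>a'<N. (kc (g a') * sg (a, a')) * T (mulv H (comulv H x a) g))"
    unfolding lin2_mus[symmetric] lin2_def by (simp only: sum_distrib_left)
  also have "\<dots> \<in> BA"
    by (intro BA_sum BA_mult BA_kc TB) (auto intro: sg_BA)
  finally show ?thesis .
qed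

text \<open>Units of the base algebra times a single variable at a group-like of degree \<gamma>. By
  \<open>T_mult_GL\<close> such elements are closed under products, so a whole monomial can be
  replaced by one group-like variable.\<close>

definition unit_multiple :: "'c \<Rightarrow> 'k mpoly fract \<Rightarrow> bool" where
  "unit_multiple \<gamma> z \<longleftrightarrow> (\<exists>s\<in>BA. \<exists>s'\<in>BA. \<exists>g\<in>GL. s * s' = 1 \<and> deg g = \<gamma> \<and> z = s * T g)"

lemma unit_multiple_T: "g \<in> GL \<Longrightarrow> unit_multiple (deg g) (T g)"
  unfolding unit_multiple_def using BA_1 by force

lemma unit_multiple_one: "unit_multiple \<one>\<^bsub>\<Gamma>\<^esub> 1"
  unfolding unit_multiple_def
  using T_unit unitv_GL deg_unitv by (metis left_inverse)

lemma unit_multiple_mult: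
  assumes "unit_multiple \<gamma> z" "unit_multiple \<delta> z'" shows "unit_multiple (\<gamma> \<otimes>\<^bsub>\<Gamma>\<^esub> \<delta>) (z * z')"
proof -
  obtain s s' g where 1: "s \<in> BA" "s' \<in> BA" "g \<in> GL" "s * s' = 1" "deg g = \<gamma>" "z = s * T g"
    using assms(1) unfolding unit_multiple_def by blast
  obtain t t' h where 2: "t \<in> BA" "t' \<in> BA" "h \<in> GL" "t * t' = 1" "deg h = \<delta>" "z' = t * T h"
    using assms(2) unfolding unit_multiple_def by blast
  obtain r r' where 3: "r \<in> BA" "r' \<in> BA" "r * r' = 1" "T g * T h = r * T (mulv H g h)"
    by (rule T_mult_GL[OF 1(3) 2(3)])
  have "z * z' = (s * t) * (T g * T h)" by (simp add: 1 2 ac_simps)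
  then have "z * z' = (s * t * r) * T (mulv H g h)" by (simp add: 3 ac_simps)
  moreover have "(s * t * r) * (s' * t' * r') = (s * s') * (t * t') * (r * r')" by (simp add: ac_simps)
  then have "(s * t * r) * (s' * t' * r') = 1" by (simp add: 1 2 3)
  moreover have "deg (mulv H g h) = \<gamma> \<otimes>\<^bsub>\<Gamma>\<^esub> \<delta>" using deg_mulv 1 2 by blast
  ultimately show ?thesis unfolding unit_multiple_def
    using BA_mult[OF BA_mult[OF 1(1) 2(1)] 3(1)] BA_mult[OF BA_mult[OF 1(2) 2(2)] 3(2)] mulv_GL[OF 1(3) 2(3)] by blast
qed

text \<open>A group-like g of neutral degree has an inverse of neutral degree, so \<open>t_g\<close>
  and t at the inverse both lie in the base algebra; their product is a unit of it.\<close>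

lemma unit_multiple_degree_one:
  assumes "unit_multiple \<one>\<^bsub>\<Gamma>\<^esub> z" shows "z \<in> BA" "inverse z \<in> BA"
proof -
  obtain s s' g where 1: "s \<in> BA" "s' \<in> BA" "g \<in> GL" "s * s' = 1" "deg g = \<one>\<^bsub>\<Gamma>\<^esub>" "z = s * T g"
    using assms unfolding unit_multiple_def by blast
  have one: "T g \<in> BA" if "g \<in> GL" "deg g = \<one>\<^bsub>\<Gamma>\<^esub>" for g
    using T_homogeneous_one_BA homogeneous_grouplike that by metis
  then show "z \<in> BA" using 1 BA_mult by simp
  obtain h where h: "h \<in> GL" "mulv H g h = unitv H" by (rule GL_inverse[OF 1(3)])
  have "deg h = \<one>\<^bsub>\<Gamma>\<^esub>" using deg_mulv[OF 1(3) h(1)] h deg_unitv 1(5) deg(1)[OF h(1)] by simp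
  then have hB: "T h \<in> BA" using one h by blast
  obtain t t' where 3: "t \<in> BA" "t' \<in> BA" "t * t' = 1" "T g * T h = t * T (unitv H)"
    by (rule T_mult_GL[OF 1(3) h(1)]) (simp add: h)
  have "z * (s' * T h * t' * inverse (T (unitv H))) = (s * s') * t' * inverse (T (unitv H)) * (T g * T h)"
    by (simp add: 1(6) ac_simps)
  also have "\<dots> = (t * t') * (T (unitv H) * inverse (T (unitv H)))" unfolding 1(4) 3(4) by (simp add: ac_simps)
  also have "\<dots> = 1" using 3 T_unit(3) by simp
  finally have "inverse z = s' * T h * t' * inverse (T (unitv H))" by (rule inverse_unique)
  then show "inverse z \<in> BA" using 1 3 hB T_unit BA_mult by simp
qed

end

section \<open>Explicit generators from the primary decomposition\<close>

locale primary_basis = graded_basis H \<Gamma> f w \<xi> \<beta>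
  for H :: "'k::field hopf_data" and \<Gamma> :: "(nat \<Rightarrow> int) monoid" and f :: "(nat \<Rightarrow> int) \<Rightarrow> nat \<Rightarrow> 'k"
    and w \<xi> and \<beta> :: "nat \<Rightarrow> nat \<Rightarrow> int" +
  fixes qs :: "nat list"
  assumes \<Gamma>_eq: "\<Gamma> = product_group {..<length qs} (\<lambda>i. integer_mod_group (qs ! i))"
    and qs_ge: "\<And>q. q \<in> set qs \<Longrightarrow> 2 \<le> q"
begin

abbreviation "r \<equiv> length qs"
abbreviation "q j \<equiv> qs ! j"

lemma q_ge: "j < r \<Longrightarrow> 2 \<le> q j"
  using qs_ge by simp

lemma carrier_iff: "c \<in> C \<longleftrightarrow> c \<in> extensional {..<r} \<and> (\<forall>i<r. 0 \<le> c i \<and> c i < int (q i))"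
proof -
  have "carrier (integer_mod_group (q i)) = {0..<int (q i)}" if "i < r" for i
    using q_ge[OF that] by (auto simp: carrier_integer_mod_group)
  then show ?thesis unfolding \<Gamma>_eq by (auto simp: PiE_iff)
qed

lemma mult_eq: "c \<otimes>\<^bsub>\<Gamma>\<^esub> d = (\<lambda>i\<in>{..<r}. (c i + d i) mod int (q i))"
  unfolding \<Gamma>_eq by (simp add: mult_integer_mod_group)

lemma one_eq: "\<one>\<^bsub>\<Gamma>\<^esub> = (\<lambda>i\<in>{..<r}. 0)"
  unfolding \<Gamma>_eq by (simp add: one_integer_mod_group)

definition sec :: "(nat \<Rightarrow> int) \<Rightarrow> nat \<Rightarrow> 'k" where
  "sec c = (SOME g. g \<in> GL \<and> deg g = c)"

lemma sec: "c \<in> C \<Longrightarrow> sec c \<in> GL" "c \<in> C \<Longrightarrow> deg (sec c) = c"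
  using someI_ex[of "\<lambda>g. g \<in> GL \<and> deg g = c"] deg_surj[of c] unfolding sec_def by blast+

text \<open>The k-th power of the j-th standard generator of \<Gamma>. The reduction modulo q_j
  makes it neutral for k = q_j.\<close>

definition gen_deg :: "nat \<Rightarrow> nat \<Rightarrow> nat \<Rightarrow> int" where
  "gen_deg j k = (\<lambda>i\<in>{..<r}. if i = j then int k mod int (q j) else 0)"

definition gg :: "nat \<Rightarrow> nat \<Rightarrow> 'k" where
  "gg j = sec (gen_deg j 1)"

lemma gen_deg_C: "j < r \<Longrightarrow> gen_deg j k \<in> C"
  using q_ge unfolding carrier_iff gen_deg_def by force

lemma gg: "j < r \<Longrightarrow> gg j \<in> GL" "j < r \<Longrightarrow> deg (gg j) = gen_deg j 1"
  unfolding gg_def using sec gen_deg_C by auto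

lemma gg_inj: "i < r \<Longrightarrow> j < r \<Longrightarrow> gg i = gg j \<Longrightarrow> i = j"
proof (rule ccontr)
  assume a: "i < r" "j < r" "gg i = gg j" "i \<noteq> j"
  then have "gen_deg i 1 i = gen_deg j 1 i" using gg by metis
  then show False using a q_ge[of i] by (simp add: gen_deg_def)
qed

definition mono :: "(nat \<Rightarrow> int) \<Rightarrow> 'k mpoly" where
  "mono c = (\<Prod>j<r. tvar H (gg j) ^ nat (c j))"

definition M :: "(nat \<Rightarrow> int) \<Rightarrow> 'k mpoly fract" where
  "M c = (\<Prod>j<r. T (gg j) ^ nat (c j))"

lemma emb_mono: "emb (mono c) = M c"
  by (simp add: mono_def M_def emb_prod emb_power emb_tvar)

lemma M_nonzero: "M c \<noteq> 0"
  unfolding M_def using gg(1) t_grouplike_nonzero by simp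

lemma unit_multiple_gg_power: "j < r \<Longrightarrow> unit_multiple (gen_deg j k) (T (gg j) ^ k)"
proof (induction k)
  case 0
  have "gen_deg j 0 = \<one>\<^bsub>\<Gamma>\<^esub>" by (auto simp: gen_deg_def one_eq restrict_def fun_eq_iff)
  then show ?case using unit_multiple_one by simp
next
  case (Suc k)
  have "unit_multiple (gen_deg j 1 \<otimes>\<^bsub>\<Gamma>\<^esub> gen_deg j k) (T (gg j) * T (gg j) ^ k)"
    using unit_multiple_mult[OF unit_multiple_T[OF gg(1)[OF Suc.prems]] Suc.IH[OF Suc.prems]] gg(2)[OF Suc.prems] by simp
  moreover have "gen_deg j 1 \<otimes>\<^bsub>\<Gamma>\<^esub> gen_deg j k = gen_deg j (Suc k)"
    unfolding mult_eq gen_deg_def by (rule restrict_ext) (simp add: mod_simps ac_simps)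
  ultimately show ?case by simp
qed

lemma unit_multiple_M:
  assumes c: "c \<in> C" shows "unit_multiple c (M c)"
proof -
  \<comment> \<open>Factor by factor: the product of the first k powers has the degree that agrees
    with c in the first k coordinates and is 0 in the others.\<close>
  have "k \<le> r \<Longrightarrow> unit_multiple (\<lambda>i\<in>{..<r}. if i < k then c i else 0) (\<Prod>j<k. T (gg j) ^ nat (c j))" for k
  proof (induction k)
    case 0
    then show ?case using unit_multiple_one by (simp add: one_eq restrict_def)
  next
    case (Suc k)
    let ?a = "\<lambda>i\<in>{..<r}. if i < k then c i else 0"
    have "unit_multiple (?a \<otimes>\<^bsub>\<Gamma>\<^esub> gen_deg k (nat (c k))) (\<Prod>j<Suc k. T (gg j) ^ nat (c j))"
      unfolding prod.lessThan_Suc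
      by (rule unit_multiple_mult[OF Suc.IH unit_multiple_gg_power]) (use Suc.prems in auto)
    moreover have "?a \<otimes>\<^bsub>\<Gamma>\<^esub> gen_deg k (nat (c k)) = (\<lambda>i\<in>{..<r}. if i < Suc k then c i else 0)"
      unfolding mult_eq gen_deg_def
      by (rule restrict_ext) (use c in \<open>auto simp: carrier_iff less_Suc_eq\<close>)
    ultimately show ?case by (simp only:)
  qed
  from this[OF order_refl] have "unit_multiple (\<lambda>i\<in>{..<r}. if i < r then c i else 0) (M c)" unfolding M_def .
  moreover have "(\<lambda>i\<in>{..<r}. if i < r then c i else 0) = c"
    using c by (auto simp: carrier_iff extensional_def restrict_def fun_eq_iff)
  ultimately show ?thesis by (simp only:)
qed

text \<open>The powers \<open>t\<^sub>g ^ q\<^sub>j\<close> of the chosen lifts of the standard generators make the monomials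
  M multiplicative up to units; the remaining u compensate the degree of a basis vector by a monomial M
  or, where a bound by two factors is needed, by a single group-like element.\<close>

definition u :: "nat \<Rightarrow> 'k mpoly" where
  "u i = (if i < card GL
    then if \<exists>j<r. w i = gg j then tvar H (w i) ^ q (SOME j. j < r \<and> w i = gg j)
         else tvar H (w i) * mono (inv\<^bsub>\<Gamma>\<^esub> (\<beta> i))
    else tvar H (w i) * tvar H (sec (inv\<^bsub>\<Gamma>\<^esub> (\<beta> i))))"

lemma u_gg:
  assumes "i < card GL" "j < r" "w i = gg j" shows "u i = tvar H (gg j) ^ q j"
proof -
  have "(SOME j. j < r \<and> w i = gg j) = j"
    by (rule some_equality) (use assms gg_inj in auto)
  then show ?thesis using assms by (auto simp: u_def)
qed

lemma u_grouplike:
  "i < card GL \<Longrightarrow> \<not> (\<exists>j<r. w i = gg j) \<Longrightarrow> u i = tvar H (w i) * mono (inv\<^bsub>\<Gamma>\<^esub> (\<beta> i))"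
  by (auto simp: u_def)

lemma u_other: "card GL \<le> i \<Longrightarrow> u i = tvar H (w i) * tvar H (sec (inv\<^bsub>\<Gamma>\<^esub> (\<beta> i)))"
  by (simp add: u_def)

lemma wGL: "i < card GL \<Longrightarrow> w i \<in> GL \<and> i < N \<and> \<beta> i = deg (w i)"
proof -
  assume i: "i < card GL"
  then have w: "w i \<in> GL" using w_GL by (auto simp: bij_betw_def)
  obtain i' where i': "i' < card GL" "w i' = w i" "\<beta> i' = deg (w i)" using GL_index[OF w] by metis
  then have "i' = i" using w_GL i by (auto simp: bij_betw_def inj_on_def)
  then show ?thesis using w i' i card_GL by auto
qed

lemma inv_\<beta>_C: "i < N \<Longrightarrow> inv\<^bsub>\<Gamma>\<^esub> (\<beta> i) \<in> C"
  using \<beta>_C by simp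

text \<open>The truncated subtraction is exact because each q_j is at least 2. The right side is the
  maximal total of the reduced exponents 0 \<le> c_j < q_j, hence the bound for the monomials
  \<open>mono c\<close>.\<close>

lemma degree_bound: "sum_list qs - r = (\<Sum>j<r. q j - 1)"
proof -
  have "(\<Sum>j<r. q j - 1) + r = (\<Sum>j<r. (q j - 1) + 1)" by (simp add: sum.distrib del: One_nat_def)
  also have "\<dots> = (\<Sum>j<r. q j)" using q_ge by (intro sum.cong refl) force
  also have "\<dots> = sum_list qs" by (simp add: sum_list_sum_nth atLeast0LessThan)
  finally show ?thesis by simp
qed

lemma mono_monomial:
  assumes c: "c \<in> C" shows "grouplike_monomial H (sum_list qs - r) (mono c)"
proof -
  have "grouplike_monomial H (\<Sum>j<r. nat (c j) * 1) (mono c)"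
    unfolding mono_def
    by (rule grouplike_monomial_prod, simp) ( rule grouplike_monomial_power, rule grouplike_monomial_tvar, rule gg, simp)
  moreover have "(\<Sum>j<r. nat (c j) * 1) \<le> sum_list qs - r"
    unfolding degree_bound using c by (intro sum_mono) (force simp: carrier_iff)
  ultimately show ?thesis by (rule grouplike_monomial_mono)
qed

text \<open>A power with exponent q_j has degree (q_j - 1) + 1, at most d - r + 1. In the other case
  one variable is multiplied by a compensating monomial of degree at most d - r.\<close>

lemma u_monomial:
  assumes i: "i < card GL" shows "grouplike_monomial H (sum_list qs - r + 1) (u i)"
proof (cases "\<exists>j<r. w i = gg j")
  case True
  then obtain j where j: "j < r" "w i = gg j" by blast
  have "q j - 1 \<le> sum_list qs - r" unfolding degree_bound using j(1) by (intro member_le_sum) auto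
  then have "q j * 1 \<le> sum_list qs - r + 1" using q_ge[OF j(1)] by simp
  then show ?thesis unfolding u_gg[OF i j]
    using grouplike_monomial_mono grouplike_monomial_power[OF grouplike_monomial_tvar[OF gg(1)[OF j(1)]]] by blast
next
  case False
  have "grouplike_monomial H (1 + (sum_list qs - r)) (tvar H (w i) * mono (inv\<^bsub>\<Gamma>\<^esub> (\<beta> i)))"
    using wGL[OF i] inv_\<beta>_C[of i] by (intro grouplike_monomial_mult grouplike_monomial_tvar mono_monomial) auto
  then show ?thesis unfolding u_grouplike[OF i False] by (simp add: add.commute)
qed

lemma u_prod_le_two: "card GL \<le> i \<Longrightarrow> i < N \<Longrightarrow> prod_le_two H (u i)"
  unfolding prod_le_two_def u_other
  by (rule exI[of _ "[w i, sec (inv\<^bsub>\<Gamma>\<^esub> (\<beta> i))]"]) (use w_V sec inv_\<beta>_C grouplikeD in auto)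

lemma u_nonzero: "i < card GL \<Longrightarrow> emb (u i) \<noteq> 0"
proof (cases "\<exists>j<r. w i = gg j")
  case True
  then show "i < card GL \<Longrightarrow> ?thesis" using u_gg gg(1) t_grouplike_nonzero by (auto simp: emb_power emb_tvar simp del: emb_eq_0_iff)
next
  case False
  then show "i < card GL \<Longrightarrow> ?thesis"
    using wGL[of i] by (simp add: u_grouplike emb_mult emb_mono emb_tvar M_nonzero t_grouplike_nonzero del: emb_eq_0_iff)
qed

definition U :: "'k mpoly fract set" where
  "U = alg_gen ({emb (u i) | i. i < card GL} \<union> {inverse (emb (u i)) | i. i < card GL}
     \<union> {emb (u i) | i. card GL \<le> i \<and> i < N})"

lemma unit_multiple_u:
  assumes i: "i < card GL" shows "unit_multiple \<one>\<^bsub>\<Gamma>\<^esub> (emb (u i))"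
proof (cases "\<exists>j<r. w i = gg j")
  case True
  then obtain j where j: "j < r" "w i = gg j" by blast
  have "gen_deg j (q j) = \<one>\<^bsub>\<Gamma>\<^esub>" by (auto simp: gen_deg_def one_eq restrict_def fun_eq_iff)
  then show ?thesis unfolding u_gg[OF i j] emb_power emb_tvar using unit_multiple_gg_power[OF j(1), of "q j"] by simp
next
  case False
  have "unit_multiple (\<beta> i \<otimes>\<^bsub>\<Gamma>\<^esub> inv\<^bsub>\<Gamma>\<^esub> (\<beta> i)) (T (w i) * M (inv\<^bsub>\<Gamma>\<^esub> (\<beta> i)))"
    using wGL[OF i] unit_multiple_T[of "w i"] inv_\<beta>_C[of i] by (intro unit_multiple_mult unit_multiple_M) auto
  moreover have "\<beta> i \<otimes>\<^bsub>\<Gamma>\<^esub> inv\<^bsub>\<Gamma>\<^esub> (\<beta> i) = \<one>\<^bsub>\<Gamma>\<^esub>" using wGL[OF i] \<beta>_C[of i] by simp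
  ultimately show ?thesis by (simp only: u_grouplike[OF i False] emb_mult emb_mono emb_tvar)
qed

lemma U_subset: "U \<subseteq> BA"
proof
  fix z assume "z \<in> U"
  then show "z \<in> BA" unfolding U_def
  proof (induction rule: alg_gen.induct)
    case (gen s)
    then consider i where "i < card GL" "s = emb (u i)" | i where "i < card GL" "s = inverse (emb (u i))"
      | i where "card GL \<le> i" "i < N" "s = emb (u i)" by blast
    then show ?case
    proof cases
      case (3 i)
      have "T (w i) * T (sec (inv\<^bsub>\<Gamma>\<^esub> (\<beta> i))) \<in> BA"
        using T_mult_homogeneous_BA[OF w_hom \<beta>_C] sec inv_\<beta>_C 3(2) by blast
      then show ?thesis by (simp only: 3 u_other[OF 3(1)] emb_mult emb_tvar)
    qed (use unit_multiple_degree_one[OF unit_multiple_u] in blast)+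
  qed (rule BA_kc BA_add BA_mult; assumption)+
qed

lemma U_add: "a \<in> U \<Longrightarrow> b \<in> U \<Longrightarrow> a + b \<in> U" and U_mult: "a \<in> U \<Longrightarrow> b \<in> U \<Longrightarrow> a * b \<in> U"
  and U_kc: "kc c \<in> U" and U_0: "0 \<in> U" and U_1: "1 \<in> U"
  unfolding U_def by (auto intro: alg_gen.add alg_gen.mult alg_gen.scal alg_gen_0_1)

lemma U_gen: "i < N \<Longrightarrow> emb (u i) \<in> U" and U_gen_inv: "i < card GL \<Longrightarrow> inverse (emb (u i)) \<in> U"
  unfolding U_def by (rule alg_gen.gen; cases "i < card GL"; force)+

lemma gg_power_U: "j < r \<Longrightarrow> T (gg j) ^ q j \<in> U \<and> inverse (T (gg j) ^ q j) \<in> U"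
proof -
  assume j: "j < r"
  obtain i where i: "i < card GL" "i < N" "w i = gg j" using GL_index[OF gg(1)[OF j]] by metis
  have "emb (u i) = T (gg j) ^ q j" using u_gg[OF i(1) j i(3)] by (simp only: emb_power emb_tvar)
  then show ?thesis using U_gen[OF i(2)] U_gen_inv[OF i(1)] by simp
qed

text \<open>Adding exponents coordinatewise produces carries \<open>\<epsilon> j\<close> when c_j +
  d_j exceeds q_j - 1. Each carry contributes t at \<open>gg j\<close> to the power q_j, which is
  invertible in \<open>U\<close> because it is one of the generators.\<close>

lemma M_mult:
  assumes c: "c \<in> C" and d: "d \<in> C"
  obtains \<kappa> where "\<kappa> \<in> U" "inverse \<kappa> \<in> U" "\<kappa> \<noteq> 0" "M c * M d = M (c \<otimes>\<^bsub>\<Gamma>\<^esub> d) * \<kappa>"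
proof
  define \<epsilon> where "\<epsilon> j = nat ((c j + d j) div int (q j))" for j
  let ?\<kappa> = "\<Prod>j<r. (T (gg j) ^ q j) ^ \<epsilon> j"
  show "?\<kappa> \<in> U" unfolding U_def
    by (rule alg_gen_prod, rule alg_gen_power) (use gg_power_U in \<open>simp add: U_def\<close>)
  have "inverse ?\<kappa> = (\<Prod>j<r. inverse (T (gg j) ^ q j) ^ \<epsilon> j)" by (simp add: prod_inversef[symmetric] o_def power_inverse)
  also have "\<dots> \<in> U" unfolding U_def
    by (rule alg_gen_prod, rule alg_gen_power) (use gg_power_U in \<open>simp add: U_def\<close>)
  finally show "inverse ?\<kappa> \<in> U" .
  show "?\<kappa> \<noteq> 0" using gg(1) t_grouplike_nonzero by simp
  have "nat (c j) + nat (d j) = nat ((c \<otimes>\<^bsub>\<Gamma>\<^esub> d) j) + q j * \<epsilon> j" if j: "j < r" for j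
  proof -
    have nn: "0 \<le> c j" "0 \<le> d j" using c d j by (auto simp: carrier_iff)
    have "0 \<le> (c j + d j) div int (q j)" "0 \<le> (c j + d j) mod int (q j)"
      using nn q_ge[OF j] by (auto simp: pos_imp_zdiv_nonneg_iff)
    then have "int (nat (c j) + nat (d j)) = int (nat ((c \<otimes>\<^bsub>\<Gamma>\<^esub> d) j) + q j * \<epsilon> j)"
      using nn j by (simp add: \<epsilon>_def mult_eq)
    then show ?thesis by (simp only: of_nat_eq_iff)
  qed
  then have "T (gg j) ^ nat (c j) * T (gg j) ^ nat (d j) = T (gg j) ^ nat ((c \<otimes>\<^bsub>\<Gamma>\<^esub> d) j) * (T (gg j) ^ q j) ^ \<epsilon> j"
    if "j < r" for j
    using that by (simp only: power_add[symmetric] power_mult[symmetric])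
  then show "M c * M d = M (c \<otimes>\<^bsub>\<Gamma>\<^esub> d) * ?\<kappa>"
    unfolding M_def prod.distrib[symmetric] by (intro prod.cong refl) simp
qed

lemma M_one: "M \<one>\<^bsub>\<Gamma>\<^esub> = 1"
  by (simp add: M_def one_eq)

lemma M_gen: "j < r \<Longrightarrow> M (gen_deg j 1) = T (gg j)"
proof -
  assume j: "j < r"
  have "M (gen_deg j 1) = (\<Prod>i<r. if i = j then T (gg i) else 1)"
    unfolding M_def by (intro prod.cong refl) (use q_ge[OF j] in \<open>auto simp: gen_deg_def\<close>)
  then show ?thesis using j by simp
qed

text \<open>The candidate for the component of degree c: the multiples of one invertible monomial by
  the algebra of the proposed generators. Its neutral component is \<open>U\<close>.\<close>

definition A :: "(nat \<Rightarrow> int) \<Rightarrow> 'k mpoly fract set" where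
  "A c = {M c * y | y. y \<in> U}"

lemma A_mult:
  assumes "c \<in> C" "d \<in> C" "z \<in> A c" "z' \<in> A d" shows "z * z' \<in> A (c \<otimes>\<^bsub>\<Gamma>\<^esub> d)"
proof -
  obtain y y' where y: "y \<in> U" "z = M c * y" "y' \<in> U" "z' = M d * y'" using assms by (auto simp: A_def)
  obtain \<kappa> where \<kappa>: "\<kappa> \<in> U" "M c * M d = M (c \<otimes>\<^bsub>\<Gamma>\<^esub> d) * \<kappa>" using M_mult[OF assms(1,2)] by metis
  have "z * z' = (M c * M d) * (y * y')" by (simp add: y ac_simps)
  then have "z * z' = M (c \<otimes>\<^bsub>\<Gamma>\<^esub> d) * (\<kappa> * (y * y'))" by (simp only: \<kappa> mult.assoc)
  then show ?thesis unfolding A_def using U_mult \<kappa> y by blast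
qed

lemma A_one: "A \<one>\<^bsub>\<Gamma>\<^esub> = U"
  by (simp add: A_def M_one)

lemma inverse_M: "c \<in> C \<Longrightarrow> inverse (M c) \<in> A (inv\<^bsub>\<Gamma>\<^esub> c)"
proof -
  assume c: "c \<in> C"
  obtain \<kappa> where \<kappa>: "inverse \<kappa> \<in> U" "\<kappa> \<noteq> 0" "M c * M (inv\<^bsub>\<Gamma>\<^esub> c) = M (c \<otimes>\<^bsub>\<Gamma>\<^esub> inv\<^bsub>\<Gamma>\<^esub> c) * \<kappa>"
    using M_mult[OF c GG.inv_closed[OF c]] by metis
  have "M c * (M (inv\<^bsub>\<Gamma>\<^esub> c) * inverse \<kappa>) = \<kappa> * inverse \<kappa>"
    using \<kappa>(3) c by (simp add: M_one mult.assoc[symmetric])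
  then have "inverse (M c) = M (inv\<^bsub>\<Gamma>\<^esub> c) * inverse \<kappa>" using \<kappa>(2) by (intro inverse_unique) simp
  then show ?thesis unfolding A_def using \<kappa>(1) by blast
qed

text \<open>Either g is one of the \<open>gg j\<close>, whose variable is itself a monomial
  \<open>M\<close>, or the generator u belonging to g is \<open>t_g\<close> times a monomial of
  inverse degree and can be solved for \<open>t_g\<close>.\<close>

lemma A_T:
  assumes g: "g \<in> GL" shows "T g \<in> A (deg g)" "inverse (T g) \<in> A (inv\<^bsub>\<Gamma>\<^esub> (deg g))"
proof -
  obtain i where i: "i < card GL" "i < N" "w i = g" "\<beta> i = deg g" by (rule GL_index[OF g])
  have dC: "deg g \<in> C" "inv\<^bsub>\<Gamma>\<^esub> (deg g) \<in> C" using deg(1)[OF g] by auto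
  have *: "T g \<in> A (deg g) \<and> inverse (T g) \<in> A (inv\<^bsub>\<Gamma>\<^esub> (deg g))"
  proof (cases "\<exists>j<r. w i = gg j")
    case True
    then obtain j where "j < r" "g = gg j" using i by auto
    then have "T g = M (deg g)" using M_gen gg(2) by simp
    moreover have "M (deg g) * 1 \<in> A (deg g)" unfolding A_def using U_1 by blast
    ultimately show ?thesis using inverse_M[OF dC(1)] by simp
  next
    case False
    have e: "emb (u i) = T g * M (inv\<^bsub>\<Gamma>\<^esub> (deg g))"
      using u_grouplike[OF i(1) False] by (simp only: i emb_mult emb_mono emb_tvar)
    have "T g = emb (u i) * inverse (M (inv\<^bsub>\<Gamma>\<^esub> (deg g)))" unfolding e using M_nonzero by simp
    moreover have "emb (u i) \<in> A \<one>\<^bsub>\<Gamma>\<^esub>" unfolding A_one by (rule U_gen[OF i(2)])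
    ultimately have 1: "T g \<in> A (deg g)" using A_mult[OF GG.one_closed _ _ inverse_M[OF dC(2)]] dC by simp
    have "inverse (T g) = M (inv\<^bsub>\<Gamma>\<^esub> (deg g)) * inverse (emb (u i))"
      unfolding e using M_nonzero t_grouplike_nonzero[OF g] by (simp add: field_simps)
    then show ?thesis using 1 U_gen_inv[OF i(1)] unfolding A_def by blast
  qed
  then show "T g \<in> A (deg g)" "inverse (T g) \<in> A (inv\<^bsub>\<Gamma>\<^esub> (deg g))" by auto
qed

text \<open>For a basis vector that is not group-like, u is its variable times a single group-like
  variable, whose inverse is already known to lie in the family.\<close>

lemma A_w: "i < N \<Longrightarrow> T (w i) \<in> A (\<beta> i)"
proof (cases "i < card GL")
  case True
  then show ?thesis using A_T(1) wGL[OF True] by auto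
next
  assume i: "i < N"
  case False
  let ?g = "sec (inv\<^bsub>\<Gamma>\<^esub> (\<beta> i))"
  have g: "?g \<in> GL" "deg ?g = inv\<^bsub>\<Gamma>\<^esub> (\<beta> i)" using sec inv_\<beta>_C[OF i] by auto
  have "emb (u i) = T (w i) * T ?g" using u_other[of i] False by (simp add: emb_mult emb_tvar)
  then have "T (w i) = emb (u i) * inverse (T ?g)" using t_grouplike_nonzero[OF g(1)] by simp
  moreover have "emb (u i) * inverse (T ?g) \<in> A (\<one>\<^bsub>\<Gamma>\<^esub> \<otimes>\<^bsub>\<Gamma>\<^esub> \<beta> i)"
    using U_gen[OF i] A_T(2)[OF g(1)] \<beta>_C[OF i] unfolding g(2) by (intro A_mult) (auto simp: A_one)
  ultimately show ?thesis using \<beta>_C[OF i] by simp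
qed

text \<open>The family \<open>A\<close> satisfies the closure conditions, so the base algebra lies
  in its neutral component \<open>U\<close>; the other inclusion is membership of the generators and
  their inverses.\<close>

lemma base_alg_eq_U: "BA = U"
proof
  have "graded_family A"
  proof (rule graded_familyI)
    show "0 \<in> A c" for c unfolding A_def using U_0 by force
    show "z + z' \<in> A c" if "z \<in> A c" "z' \<in> A c" for c z z'
      using that U_add unfolding A_def by (force simp: distrib_left[symmetric])
    show "kc c \<in> A \<one>\<^bsub>\<Gamma>\<^esub>" for c unfolding A_one by (rule U_kc)
  qed (use A_mult A_w A_T(2) in auto)
  then show "BA \<subseteq> U" using base_alg_subset_graded A_one by metis
qed (rule U_subset)

end

text \<open>For trivial \<open>Gbar H\<close> the list \<open>qs\<close> is empty and the degree
  bound becomes 0 - 0 + 1, as for d = r = 0. In general the subtraction of natural numbers is exact,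
  since each prime power is at least 2.\<close>

theorem theorem4p6:
  fixes H :: "'k::field hopf_data" and qs :: "nat list"
  assumes "hopf_algebra H"
    and "pointed H"
    and "ab_is_group_algebra H"
    and "\<forall>q\<in>set qs. \<exists>p e. prime p \<and> e \<ge> 1 \<and> q = p ^ e"
    and "Gbar H \<cong> product_group {..<length qs} (\<lambda>i. integer_mod_group (qs ! i))"
  shows "\<exists>u :: nat \<Rightarrow> 'k mpoly.
     (\<forall>i<card (grouplikes H). grouplike_monomial H (sum_list qs - length qs + 1) (u i)) \<and>
     (\<forall>i. card (grouplikes H) \<le> i \<and> i < hdim H \<longrightarrow> prod_le_two H (u i)) \<and>
     (\<forall>i<card (grouplikes H). emb (u i) \<noteq> 0) \<and>
     base_alg H = alg_gen ({emb (u i) | i. i < card (grouplikes H)}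
                        \<union> {inverse (emb (u i)) | i. i < card (grouplikes H)}
                        \<union> {emb (u i) | i. card (grouplikes H) \<le> i \<and> i < hdim H})"
proof -
  have ph: "pointed_hopf H" by unfold_locales (use assms in auto)
  interpret pointed_hopf H by (rule ph)
  define \<Gamma> where "\<Gamma> = product_group {..<length qs} (\<lambda>i. integer_mod_group (qs ! i))"
  have grp: "group \<Gamma>" unfolding \<Gamma>_def by (simp add: product_group)
  have comm: "comm_group \<Gamma>"
    by (rule group.group_comm_groupI[OF grp])
      (auto simp: \<Gamma>_def mult_integer_mod_group add.commute intro!: restrict_ext)
  have qs: "2 \<le> q" if q: "q \<in> set qs" for q
  proof -
    obtain p e where pe: "prime p" "e \<ge> 1" "q = p ^ e" using assms(4) q by blast
    have "p ^ 1 \<le> p ^ e" using pe prime_ge_1_nat by (intro power_increasing) auto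
    then show ?thesis using prime_ge_2_nat[OF pe(1)] pe(3) by simp
  qed
  obtain f where f: "finite (carrier \<Gamma>)"
    "\<And>x. x \<in> V \<Longrightarrow> (\<Sum>\<gamma>\<in>carrier \<Gamma>. dotp N (f \<gamma>) x) = counitv H x"
    "\<And>x \<gamma> \<delta>. x \<in> V \<Longrightarrow> \<gamma> \<in> carrier \<Gamma> \<Longrightarrow> \<delta> \<in> carrier \<Gamma> \<Longrightarrow>
      dotp N (fconv (f \<gamma>) (f \<delta>)) x = (if \<gamma> = \<delta> then dotp N (f \<gamma>) x else 0)"
    "\<And>x y \<gamma>. x \<in> V \<Longrightarrow> y \<in> V \<Longrightarrow> \<gamma> \<in> carrier \<Gamma> \<Longrightarrow> dotp N (f \<gamma>) (mulv H x y)
      = (\<Sum>\<alpha>\<in>carrier \<Gamma>. \<Sum>\<beta>\<in>carrier \<Gamma>. if \<alpha> \<otimes>\<^bsub>\<Gamma>\<^esub> \<beta> = \<gamma> then dotp N (f \<alpha>) x * dotp N (f \<beta>) y else 0)"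
    "\<And>x. x \<in> V \<Longrightarrow> \<forall>\<gamma>\<in>carrier \<Gamma>. dotp N (f \<gamma>) x = 0 \<Longrightarrow> x \<in> CI"
    "\<And>\<gamma>. \<gamma> \<in> carrier \<Gamma> \<Longrightarrow> \<exists>x\<in>V. dotp N (f \<gamma>) x \<noteq> 0"
    by (rule grading_exists[OF assms(3) assms(5)[folded \<Gamma>_def] grp that])
  have gh: "graded_hopf H \<Gamma> f"
    by (intro graded_hopf.intro ph graded_hopf_axioms.intro comm f)
  interpret graded_hopf H \<Gamma> f by (rule gh)
  obtain w \<xi> \<beta> where w: "bij_betw w {..<card GL} GL" "card GL \<le> N"
    "\<And>i. i < N \<Longrightarrow> \<beta> i \<in> carrier \<Gamma>" "\<And>i. i < N \<Longrightarrow> homogeneous (\<beta> i) (w i)"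
    "\<And>i j. i < N \<Longrightarrow> j < N \<Longrightarrow> dotp N (\<xi> j) (w i) = (if i = j then 1 else 0)"
    "\<And>x. x \<in> V \<Longrightarrow> x = (\<Sum>j<N. scV (dotp N (\<xi> j) x) (w j))"
    by (rule homogeneous_basis_exists[OF that])
  interpret primary_basis H \<Gamma> f w \<xi> \<beta> qs
    by (intro primary_basis.intro graded_basis.intro gh graded_basis_axioms.intro
        primary_basis_axioms.intro w \<Gamma>_def qs)
  show ?thesis
    by (rule exI[of _ u]) (use u_monomial u_prod_le_two u_nonzero base_alg_eq_U in \<open>auto simp: U_def\<close>)
qed

end
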